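(* Let $G$, $a>0$, $\rho_a$, $Q$, $B$, $\mathcal P_k$ and $\mathcal P$ be as in the context. Then: (a) $\mathcal P$ is dense in $\mathcal H\cap L^p(\rho_a)$ for $1\le p<\infty$. (b) $\mathcal P\subset\mathcal D(Q)$, and $\mathcal P$ is a core for the restricted form $Q|_{\mathcal H}$ (i.e. dense in $\mathcal D(Q)\cap\mathcal H$ in the energy norm $(\|f\|^2_{L^2(\rho_a)}+Q(f))^{1/2}$); in particular $Q|_{\mathcal H}$ is densely defined in $\mathcal H\cap L^2(\rho_a)$. (c) If $j\ne k$ then $\mathcal P_j\perp\mathcal P_k$ both in $L^2(\rho_a)$ and in the energy inner product $(f,g)_{L^2(\rho_a)}+Q(f,g)$. (d) $\mathcal H\cap L^2(\rho_a)=\bigoplus_{k=0}^\infty\mathcal P_k$ (orthogonal Hilbert direct sum in $L^2(\rho_a)$). (e) $\mathcal H\cap\mathcal D(Q)=\bigoplus_{k=0}^\infty\mathcal P_k$ (orthogonal Hilbert direct sum, convergence in energy norm). (f) $\mathcal P\subset\mathcal D(B)$, and $\mathcal P$ is a core for $B$.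
   Context: Let $\mathfrak g$ be a finite-dimensional complex Lie algebra which is stratified of step $m$: $\mathfrak g=V_1\oplus\cdots\oplus V_m$ (complex subspaces) with $[V_1,V_j]=V_{j+1}$ for $1\le j<m$, $[V_1,V_m]=0$, $V_m\neq 0$. Let $G$ be the connected, simply connected complex Lie group with Lie algebra $\mathfrak g$, identified with $\mathfrak g$ as a set (exponential map = identity, identity $e=0$), with Haar measure $m$ = a Lebesgue measure on $\mathfrak g$. For $\xi\in\mathfrak g$, $\tilde\xi$ is the left-invariant vector field with $\tilde\xi(e)=\xi$. Dilations: $\delta_\lambda(v_1+\cdots+v_m)=\sum_k\lambda^kv_k$ ($v_k\in V_k$, $\lambda\in\mathbb C$). $\mathcal H$ = holomorphic functions on $G$; for an integer $k\ge0$, $\mathcal P_k$ is the set of $f\in\mathcal H$ with $f(\delta_\lambda z)=\lambda^kf(z)$ for all $z\in G$ and $\lambda\in\mathbb C\setminus\{0\}$; $\mathcal P$ is the linear span (finite sums) of $\bigcup_k\mathcal P_k$. Let $J$ be the complex structure of $\mathfrak g$ and $h$ a symmetric positive semidefinite real bilinear form on the real dual $\mathfrak g^*$ with $h(J^*\alpha,J^*\beta)=h(\alpha,\beta)$ whose horizontal space $\{v:\alpha(v)=0\text{ whenever }h(\alpha,\alpha)=0\}$ equals $V_1$; it induces a positive definite $J$-Hermitian inner product $g$ on $V_1$. Choose $x_1,\dots,x_k\in V_1$ with $x_1,Jx_1,\dots,x_k,Jx_k$ a $g$-orthonormal real basis of $V_1$; $X_j=\widetilde{x_j}$, $Y_j=\widetilde{Jx_j}$;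 $\Delta=\sum_j(X_j^2+Y_j^2)$; heat kernel $\rho_s$: smooth positive probability density with $e^{s\Delta/4}f(x)=\int_G f(xy^{-1})\rho_s(y)\,dm(y)$. Fix $a>0$; $L^p(\rho_a)=L^p(G,\rho_a\,dm)$. $Q$ is the closure in $L^2(\rho_a)$ of $Q_0(f_1,f_2)=\int_G\sum_j(X_jf_1\,X_j\bar f_2+Y_jf_1\,Y_j\bar f_2)\rho_a\,dm$ on $C_c^\infty(G)$, with domain $\mathcal D(Q)$, $Q(f)=Q(f,f)$. $B$ is the self-adjoint operator on $\mathcal H\cap L^2(\rho_a)$ associated with the closed form $Q|_{\mathcal H}$ ($Q$ restricted to $\mathcal D(Q)\cap\mathcal H$). *)

theory Defs
  imports "HOL-Analysis.Analysis"
begin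

text \<open>The complex Lie algebra g is modelled as a finite-dimensional real vector space
  (type 'g of class euclidean_space) with a complex structure J.\<close>

definition complex_structure :: "('g::euclidean_space \<Rightarrow> 'g) \<Rightarrow> bool" where
  "complex_structure J \<longleftrightarrow> linear J \<and> (\<forall>v. J (J v) = - v)"

definition cscale :: "('g::real_vector \<Rightarrow> 'g) \<Rightarrow> complex \<Rightarrow> 'g \<Rightarrow> 'g" where
  "cscale J c v = Re c *\<^sub>R v + Im c *\<^sub>R J v"

definition complex_subspace :: "('g::real_vector \<Rightarrow> 'g) \<Rightarrow> 'g set \<Rightarrow> bool" where
  "complex_subspace J S \<longleftrightarrow> subspace S \<and> (\<forall>v\<in>S. J v \<in> S)"

definition complex_lie_algebra ::
  "('g::euclidean_space \<Rightarrow> 'g) \<Rightarrow> ('g \<Rightarrow> 'g \<Rightarrow> 'g) \<Rightarrow> bool" where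
  "complex_lie_algebra J br \<longleftrightarrow> complex_structure J \<and> bilinear br
     \<and> (\<forall>x y. br x y = - br y x)
     \<and> (\<forall>x y z. br x (br y z) + br y (br z x) + br z (br x y) = 0)
     \<and> (\<forall>x y. br (J x) y = J (br x y))"

definition strat_decomp :: "(nat \<Rightarrow> 'g::real_vector set) \<Rightarrow> nat \<Rightarrow> 'g \<Rightarrow> (nat \<Rightarrow> 'g) \<Rightarrow> bool" where
  "strat_decomp V m v c \<longleftrightarrow> (\<forall>k\<in>{1..m}. c k \<in> V k) \<and> (\<forall>k. k \<notin> {1..m} \<longrightarrow> c k = 0)
     \<and> v = (\<Sum>k=1..m. c k)"

definition stratified ::
  "('g::euclidean_space \<Rightarrow> 'g) \<Rightarrow> ('g \<Rightarrow> 'g \<Rightarrow> 'g) \<Rightarrow> (nat \<Rightarrow> 'g set) \<Rightarrow> nat \<Rightarrow> bool" where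
  "stratified J br V m \<longleftrightarrow> complex_lie_algebra J br \<and> m \<ge> 1
     \<and> (\<forall>k\<in>{1..m}. complex_subspace J (V k))
     \<and> (\<forall>v. \<exists>!c. strat_decomp V m v c)
     \<and> (\<forall>j. 1 \<le> j \<and> j < m \<longrightarrow> V (Suc j) = span {br x y | x y. x \<in> V 1 \<and> y \<in> V j})
     \<and> (\<forall>x\<in>V 1. \<forall>y\<in>V m. br x y = 0)
     \<and> V m \<noteq> {0}"

definition strat_comp :: "(nat \<Rightarrow> 'g::real_vector set) \<Rightarrow> nat \<Rightarrow> 'g \<Rightarrow> nat \<Rightarrow> 'g" where
  "strat_comp V m v = (THE c. strat_decomp V m v c)"

definition dil :: "('g::real_vector \<Rightarrow> 'g) \<Rightarrow> (nat \<Rightarrow> 'g set) \<Rightarrow> nat \<Rightarrow> complex \<Rightarrow> 'g \<Rightarrow> 'g" where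
  "dil J V m l v = (\<Sum>k=1..m. cscale J (l ^ k) (strat_comp V m v k))"

fun Ck :: "nat \<Rightarrow> ('a::real_normed_vector \<Rightarrow> 'b::real_normed_vector) \<Rightarrow> bool" where
  "Ck 0 f = continuous_on UNIV f"
| "Ck (Suc n) f = ((\<forall>x. f differentiable (at x)) \<and> continuous_on UNIV f
      \<and> (\<forall>v. Ck n (\<lambda>x. frechet_derivative f (at x) v)))"

definition smooth_fun :: "('a::real_normed_vector \<Rightarrow> 'b::real_normed_vector) \<Rightarrow> bool" where
  "smooth_fun f \<longleftrightarrow> (\<forall>n. Ck n f)"

definition test_fun :: "('a::real_normed_vector \<Rightarrow> complex) \<Rightarrow> bool" where
  "test_fun f \<longleftrightarrow> smooth_fun f \<and> compact (closure {z. f z \<noteq> 0})"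

text \<open>gmul is a smooth group law on g with identity 0, exp = identity (one-parameter
  subgroups are the lines t x, so inverses are -x), and Lie algebra (computed as
  d/dt d/ds (tx)(sy)(tx)^-1 at 0) equal to br.  This determines the connected, simply
  connected Lie group of g identified with g via exp.\<close>
definition exp_identified_group :: "('g::euclidean_space \<Rightarrow> 'g \<Rightarrow> 'g) \<Rightarrow> ('g \<Rightarrow> 'g \<Rightarrow> 'g) \<Rightarrow> bool" where
  "exp_identified_group br gmul \<longleftrightarrow>
     smooth_fun (\<lambda>p::'g \<times> 'g. gmul (fst p) (snd p))
     \<and> (\<forall>x y z. gmul (gmul x y) z = gmul x (gmul y z))
     \<and> (\<forall>x. gmul 0 x = x \<and> gmul x 0 = x)
     \<and> (\<forall>x. \<forall>s t::real. gmul (s *\<^sub>R x) (t *\<^sub>R x) = (s + t) *\<^sub>R x)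
     \<and> (\<forall>x y. \<exists>A. (\<forall>t. ((\<lambda>s. gmul (gmul (t *\<^sub>R x) (s *\<^sub>R y)) (- (t *\<^sub>R x)))
                          has_vector_derivative A t) (at 0))
                 \<and> (A has_vector_derivative br x y) (at 0))"

definition lvf :: "('g::real_normed_vector \<Rightarrow> 'g \<Rightarrow> 'g) \<Rightarrow> 'g \<Rightarrow> ('g \<Rightarrow> complex) \<Rightarrow> 'g \<Rightarrow> complex" where
  "lvf gmul x f z = vector_derivative (\<lambda>t::real. f (gmul z (t *\<^sub>R x))) (at 0)"

definition holo :: "('g::real_normed_vector \<Rightarrow> 'g) \<Rightarrow> ('g \<Rightarrow> complex) \<Rightarrow> bool" where
  "holo J f \<longleftrightarrow> (\<forall>z. \<exists>D. (f has_derivative D) (at z) \<and> (\<forall>v. D (J v) = \<i> * D v))"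

definition hom_poly :: "('g::real_normed_vector \<Rightarrow> 'g) \<Rightarrow> (nat \<Rightarrow> 'g set) \<Rightarrow> nat \<Rightarrow> nat \<Rightarrow> ('g \<Rightarrow> complex) set" where
  "hom_poly J V m k = {f. holo J f \<and> (\<forall>z l. l \<noteq> 0 \<longrightarrow> f (dil J V m l z) = l ^ k * f z)}"

text \<open>Linear span of the union of the P_k (each P_k being a complex vector space,
  this is the set of finite sums of elements of the P_k).\<close>
definition poly_span :: "('g::real_normed_vector \<Rightarrow> 'g) \<Rightarrow> (nat \<Rightarrow> 'g set) \<Rightarrow> nat \<Rightarrow> ('g \<Rightarrow> complex) set" where
  "poly_span J V m = {f. \<exists>n c. (\<forall>k<n. c k \<in> hom_poly J V m k) \<and> f = (\<lambda>z. \<Sum>k<n. c k z)}"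

text \<open>h: symmetric positive semidefinite real bilinear form on the real dual of g,
  J-invariant, with horizontal space V_1.  Dual vectors = real-linear functionals.\<close>
definition cometric :: "('g::euclidean_space \<Rightarrow> 'g) \<Rightarrow> 'g set \<Rightarrow> (('g \<Rightarrow> real) \<Rightarrow> ('g \<Rightarrow> real) \<Rightarrow> real) \<Rightarrow> bool" where
  "cometric J V1 h \<longleftrightarrow>
     (\<forall>\<alpha> \<beta> \<gamma> c. linear \<alpha> \<and> linear \<beta> \<and> linear \<gamma> \<longrightarrow>
        h \<alpha> \<beta> = h \<beta> \<alpha> \<and> h (\<lambda>v. \<alpha> v + c * \<beta> v) \<gamma> = h \<alpha> \<gamma> + c * h \<beta> \<gamma>)
     \<and> (\<forall>\<alpha>. linear \<alpha> \<longrightarrow> h \<alpha> \<alpha> \<ge> 0)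
     \<and> (\<forall>\<alpha> \<beta>. linear \<alpha> \<and> linear \<beta> \<longrightarrow> h (\<alpha> \<circ> J) (\<beta> \<circ> J) = h \<alpha> \<beta>)
     \<and> {v. \<forall>\<alpha>. linear \<alpha> \<and> h \<alpha> \<alpha> = 0 \<longrightarrow> \<alpha> v = 0} = V1"

definition represents :: "(('g::euclidean_space \<Rightarrow> real) \<Rightarrow> ('g \<Rightarrow> real) \<Rightarrow> real) \<Rightarrow> ('g \<Rightarrow> real) \<Rightarrow> 'g \<Rightarrow> bool" where
  "represents h \<alpha> u \<longleftrightarrow> linear \<alpha> \<and> (\<forall>\<gamma>. linear \<gamma> \<longrightarrow> \<gamma> u = h \<alpha> \<gamma>)"

definition induced_metric :: "(('g::euclidean_space \<Rightarrow> real) \<Rightarrow> ('g \<Rightarrow> real) \<Rightarrow> real) \<Rightarrow> 'g \<Rightarrow> 'g \<Rightarrow> real" where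
  "induced_metric h u v = h (SOME \<alpha>. represents h \<alpha> u) (SOME \<beta>. represents h \<beta> v)"

definition horizontal_onb :: "('g::euclidean_space \<Rightarrow> 'g) \<Rightarrow> 'g set \<Rightarrow> (('g \<Rightarrow> real) \<Rightarrow> ('g \<Rightarrow> real) \<Rightarrow> real)
     \<Rightarrow> (nat \<Rightarrow> 'g) \<Rightarrow> nat \<Rightarrow> bool" where
  "horizontal_onb J V1 h x n \<longleftrightarrow>
     (\<forall>j<n. x j \<in> V1)
     \<and> (\<forall>i<n. \<forall>j<n. induced_metric h (x i) (x j) = (if i = j then 1 else 0)
                   \<and> induced_metric h (J (x i)) (J (x j)) = (if i = j then 1 else 0)
                   \<and> induced_metric h (x i) (J (x j)) = 0)
     \<and> span (x ` {..<n} \<union> (J \<circ> x) ` {..<n}) = V1"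

definition sublap :: "('g::real_normed_vector \<Rightarrow> 'g \<Rightarrow> 'g) \<Rightarrow> ('g \<Rightarrow> 'g) \<Rightarrow> (nat \<Rightarrow> 'g) \<Rightarrow> nat
    \<Rightarrow> ('g \<Rightarrow> complex) \<Rightarrow> 'g \<Rightarrow> complex" where
  "sublap gmul J x n f z = (\<Sum>j<n. lvf gmul (x j) (lvf gmul (x j) f) z
                                   + lvf gmul (J (x j)) (lvf gmul (J (x j)) f) z)"

text \<open>rho_s (s>0) is a smooth positive probability density (w.r.t. Lebesgue measure) and
  e^{s Delta/4} f(x) = int f(x y^-1) rho_s(y) dy, characterised by: for every test function f,
  u(s,x) = int f(x y^-1) rho_s(y) dy is smooth in x, solves du/ds = (1/4) Delta u for s>0 and
  u(s,.) -> f uniformly as s -> 0+.\<close>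
definition heat_kernel :: "('g::euclidean_space \<Rightarrow> 'g \<Rightarrow> 'g) \<Rightarrow> ('g \<Rightarrow> 'g) \<Rightarrow> (nat \<Rightarrow> 'g) \<Rightarrow> nat
    \<Rightarrow> (real \<Rightarrow> 'g \<Rightarrow> real) \<Rightarrow> bool" where
  "heat_kernel gmul J x n \<rho> \<longleftrightarrow>
     (\<forall>s>0. smooth_fun (\<rho> s) \<and> (\<forall>y. \<rho> s y > 0) \<and> integrable lborel (\<rho> s)
            \<and> integral\<^sup>L lborel (\<rho> s) = 1)
     \<and> (\<forall>f. test_fun f \<longrightarrow>
          (let u = (\<lambda>s z. \<integral>y. f (gmul z (- y)) * complex_of_real (\<rho> s y) \<partial>lborel) in
            (\<forall>s>0. smooth_fun (u s))
            \<and> (\<forall>s>0. \<forall>z. ((\<lambda>r. u r z) has_vector_derivative (sublap gmul J x n (u s) z / 4)) (at s))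
            \<and> uniform_limit UNIV u f (at_right 0)))"

definition inLp :: "'g measure \<Rightarrow> real \<Rightarrow> ('g \<Rightarrow> complex) \<Rightarrow> bool" where
  "inLp M p f \<longleftrightarrow> f \<in> borel_measurable M \<and> integrable M (\<lambda>z. cmod (f z) powr p)"

definition Lp_dist :: "'g measure \<Rightarrow> real \<Rightarrow> ('g \<Rightarrow> complex) \<Rightarrow> ('g \<Rightarrow> complex) \<Rightarrow> real" where
  "Lp_dist M p f g = (\<integral>z. cmod (f z - g z) powr p \<partial>M) powr (1 / p)"

definition L2ip :: "'g measure \<Rightarrow> ('g \<Rightarrow> complex) \<Rightarrow> ('g \<Rightarrow> complex) \<Rightarrow> complex" where
  "L2ip M f g = (\<integral>z. f z * cnj (g z) \<partial>M)"

definition L2norm :: "'g measure \<Rightarrow> ('g \<Rightarrow> complex) \<Rightarrow> real" where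
  "L2norm M f = sqrt (\<integral>z. (cmod (f z))\<^sup>2 \<partial>M)"

definition Q0 :: "('g::real_normed_vector \<Rightarrow> 'g \<Rightarrow> 'g) \<Rightarrow> ('g \<Rightarrow> 'g) \<Rightarrow> (nat \<Rightarrow> 'g) \<Rightarrow> nat \<Rightarrow> 'g measure
    \<Rightarrow> ('g \<Rightarrow> complex) \<Rightarrow> ('g \<Rightarrow> complex) \<Rightarrow> complex" where
  "Q0 gmul J x n M f1 f2 = (\<integral>z. (\<Sum>j<n.
        lvf gmul (x j) f1 z * lvf gmul (x j) (\<lambda>w. cnj (f2 w)) z
      + lvf gmul (J (x j)) f1 z * lvf gmul (J (x j)) (\<lambda>w. cnj (f2 w)) z) \<partial>M)"

definition form_approx :: "'g measure \<Rightarrow> (('g::real_normed_vector \<Rightarrow> complex) \<Rightarrow> ('g \<Rightarrow> complex) \<Rightarrow> complex)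
    \<Rightarrow> (nat \<Rightarrow> 'g \<Rightarrow> complex) \<Rightarrow> ('g \<Rightarrow> complex) \<Rightarrow> bool" where
  "form_approx M q0 \<phi> f \<longleftrightarrow> (\<forall>k. test_fun (\<phi> k))
     \<and> (\<lambda>k. L2norm M (\<lambda>z. \<phi> k z - f z)) \<longlonglongrightarrow> 0
     \<and> (\<forall>e>0. \<exists>N. \<forall>i\<ge>N. \<forall>j\<ge>N. Re (q0 (\<lambda>z. \<phi> i z - \<phi> j z) (\<lambda>z. \<phi> i z - \<phi> j z)) < e)"

definition form_dom :: "'g measure \<Rightarrow> (('g::real_normed_vector \<Rightarrow> complex) \<Rightarrow> ('g \<Rightarrow> complex) \<Rightarrow> complex)
    \<Rightarrow> ('g \<Rightarrow> complex) set" where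
  "form_dom M q0 = {f. inLp M 2 f \<and> (\<exists>\<phi>. form_approx M q0 \<phi> f)}"

definition form_closure :: "'g measure \<Rightarrow> (('g::real_normed_vector \<Rightarrow> complex) \<Rightarrow> ('g \<Rightarrow> complex) \<Rightarrow> complex)
    \<Rightarrow> ('g \<Rightarrow> complex) \<Rightarrow> ('g \<Rightarrow> complex) \<Rightarrow> complex" where
  "form_closure M q0 f g = lim (\<lambda>k. q0 ((SOME \<phi>. form_approx M q0 \<phi> f) k) ((SOME \<psi>. form_approx M q0 \<psi> g) k))"

definition energy_norm :: "'g measure \<Rightarrow> (('g \<Rightarrow> complex) \<Rightarrow> ('g \<Rightarrow> complex) \<Rightarrow> complex)
    \<Rightarrow> ('g \<Rightarrow> complex) \<Rightarrow> real" where
  "energy_norm M Q f = sqrt ((L2norm M f)\<^sup>2 + Re (Q f f))"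

text \<open>Self-adjoint operator associated with the closed form Q restricted to the form domain
  D (here D(Q) intersected with H) in the Hilbert space S (here H intersected with L^2):
  f in dom B iff f in D and there is g in S with Q(f,h) = <g,h> for all h in D; B f = g.\<close>
definition assoc_dom :: "'g measure \<Rightarrow> (('g \<Rightarrow> complex) \<Rightarrow> ('g \<Rightarrow> complex) \<Rightarrow> complex)
    \<Rightarrow> ('g \<Rightarrow> complex) set \<Rightarrow> ('g \<Rightarrow> complex) set \<Rightarrow> ('g \<Rightarrow> complex) set" where
  "assoc_dom M Q D S = {f\<in>D. \<exists>g\<in>S. \<forall>h\<in>D. Q f h = L2ip M g h}"

definition assoc_op :: "'g measure \<Rightarrow> (('g \<Rightarrow> complex) \<Rightarrow> ('g \<Rightarrow> complex) \<Rightarrow> complex)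
    \<Rightarrow> ('g \<Rightarrow> complex) set \<Rightarrow> ('g \<Rightarrow> complex) set \<Rightarrow> ('g \<Rightarrow> complex) \<Rightarrow> ('g \<Rightarrow> complex)" where
  "assoc_op M Q D S f = (SOME g. g \<in> S \<and> (\<forall>h\<in>D. Q f h = L2ip M g h))"


definition heat_meas :: "(real \<Rightarrow> 'g \<Rightarrow> real) \<Rightarrow> real \<Rightarrow> 'g::euclidean_space measure" where
  "heat_meas \<rho> a = density lborel (\<lambda>z. ennreal (\<rho> a z))"

definition Qdom where
  "Qdom gmul J x n \<rho> a = form_dom (heat_meas \<rho> a) (Q0 gmul J x n (heat_meas \<rho> a))"

definition Qform where
  "Qform gmul J x n \<rho> a = form_closure (heat_meas \<rho> a) (Q0 gmul J x n (heat_meas \<rho> a))"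

definition HL2 where
  "HL2 J \<rho> a = {f. holo J f \<and> inLp (heat_meas \<rho> a) 2 f}"

definition HDQ where
  "HDQ gmul J x n \<rho> a = Qdom gmul J x n \<rho> a \<inter> {f. holo J f}"

end

theory Submission
  imports Defs "HOL-Complex_Analysis.Complex_Analysis" "HOL-Probability.Probability" "HOL-Real_Asymp.Real_Asymp"
begin

text \<open>
  The group law is never computed. Along a ray the Maurer-Cartan form \<open>\<omega>\<close> solves the linear equation
  \<open>W' = v - [z, W]\<close>, so a linear map that intertwines brackets intertwines \<open>\<omega>\<close>; hence dilations are
  group automorphisms and translations are holomorphic.

  The heat kernel enters only through a maximum principle with barrier \<open>e^(C s) \<Psi>\<close>, where \<open>\<Psi>\<close> is proper,
  homogeneous up to a constant and satisfies \<open>\<Delta>\<Psi> \<le> C \<Psi>\<close>. It shows that all moments of \<open>\<rho>\<^sub>a\<close> are finite and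
  that bounded solutions of the heat equation are unique. Since the sub-Laplacian commutes with the
  dilations of modulus one, uniqueness makes the measure \<open>\<rho>\<^sub>a dm\<close> invariant under them.

  The homogeneous components of a holomorphic \<open>f\<close> are the Taylor coefficients of \<open>\<lambda> \<mapsto> f (\<delta>\<^sub>\<lambda> z)\<close>, that is,
  its Fourier coefficients under the isometric circle action. Components of different degrees are
  therefore orthogonal, the Fejer means converge in \<open>L\<^sup>p\<close>, and partial sums are best approximations in
  \<open>L\<^sup>2\<close>. Horizontal left-invariant fields lower the degree by one and commute with taking components, so
  the \<open>L\<^sup>2\<close> statements for \<open>X\<^sub>j f\<close> give those in the energy norm. The operator \<open>B\<close> preserves each degree;
  on polynomials of one degree the form is bounded in \<open>L\<^sup>2\<close>, because point evaluations are.
\<close>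

section \<open>Calculus of the classes Ck\<close>

text \<open>Rotations, not real dilations, carry the argument: a real dilation changes the time
  parameter of the kernel, whereas one with \<open>cmod l = 1\<close> fixes the sub-Laplacian. The
  kernel comes without decay estimates, so moments are bounded through test functions below
  \<open>Psi\<close>, uniformly in the cutoff; positivity and continuity of the density on compact
  sets replace Harnack-type estimates in the bound for point evaluations. The closed form is given
  by unspecified approximating sequences and has to be recognised on smooth functions as the
  gradient form: closability gives one direction, cutoffs composed with dilations, whose horizontal
  derivatives are O(1/k), give the other. The polynomials of one degree are treated as a complete
  subspace and not by dimension: Riesz representation there produces \<open>B\<close>, and
  projection onto that degree extends the representation to the whole form domain. Elements are
  functions rather than classes; the evaluation bound turns a vanishing norm into vanishing
  values.\<close>

lemma Ck_SucI:
  assumes "\<And>x. (f has_derivative D x) (at x)" "\<And>v. Ck n (\<lambda>x. D x v)"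
  shows "Ck (Suc n) f"
proof -
  have "frechet_derivative f (at x) = D x" for x
    using assms(1) frechet_derivative_at by metis
  moreover have "f differentiable (at x)" for x
    using assms(1) differentiableI by blast
  ultimately show ?thesis
    using assms(2) by (simp add: continuous_on_eq_continuous_at differentiable_imp_continuous_within)
qed

lemma Ck_SucD:
  assumes "Ck (Suc n) f"
  shows "(f has_derivative frechet_derivative f (at x)) (at x)"
    and "Ck n (\<lambda>x. frechet_derivative f (at x) v)"
  using assms frechet_derivative_works by auto

lemma Ck_Suc: "Ck (Suc n) f \<Longrightarrow> Ck n f"
proof (induction n arbitrary: f)
  case (Suc n)
  then show ?case by (intro Ck_SucI[OF Ck_SucD(1)[OF Suc.prems]]) (auto intro: Ck_SucD)
qed simp

lemma Ck_cont: "Ck n f \<Longrightarrow> continuous_on UNIV f"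
  by (cases n) auto

lemma Ck_const: "Ck n (\<lambda>x. c)"
proof (induction n arbitrary: c)
  case (Suc n)
  show ?case by (rule Ck_SucI[where D="\<lambda>x v. 0"]) (auto intro: Suc)
qed simp

lemma Ck_add: "Ck n f \<Longrightarrow> Ck n g \<Longrightarrow> Ck n (\<lambda>x. f x + g x)"
proof (induction n arbitrary: f g)
  case (Suc n)
  show ?case
    by (rule Ck_SucI, rule has_derivative_add[OF Ck_SucD(1)[OF Suc.prems(1)] Ck_SucD(1)[OF Suc.prems(2)]])
       (auto intro!: Suc.IH Ck_SucD(2) Suc.prems)
qed (auto intro: continuous_intros)

lemma Ck_bounded_bilinear:
  assumes "bounded_bilinear p"
  shows "Ck n f \<Longrightarrow> Ck n g \<Longrightarrow> Ck n (\<lambda>x. p (f x) (g x))"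
proof (induction n arbitrary: f g)
  case 0
  then show ?case using bounded_bilinear.continuous_on[OF assms] by simp
next
  case (Suc n)
  show ?case
    by (rule Ck_SucI, rule bounded_bilinear.FDERIV[OF assms Ck_SucD(1)[OF Suc.prems(1)] Ck_SucD(1)[OF Suc.prems(2)]])
       (rule Ck_add; rule Suc.IH; use Suc.prems in \<open>blast intro: Ck_SucD(2) Ck_Suc\<close>)
qed

lemma Ck_bounded_linear:
  assumes "bounded_linear p"
  shows "Ck n f \<Longrightarrow> Ck n (\<lambda>x. p (f x))"
proof (induction n arbitrary: f)
  case 0
  then show ?case using bounded_linear.continuous_on[OF assms] by simp
next
  case (Suc n)
  show ?case
    by (rule Ck_SucI, rule bounded_linear.has_derivative[OF assms Ck_SucD(1)[OF Suc.prems]])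
       (rule Suc.IH[OF Ck_SucD(2)[OF Suc.prems]])
qed

lemma Ck_id: "Ck n (\<lambda>x. x)"
proof (cases n)
  case (Suc k)
  then show ?thesis by (auto intro!: Ck_SucI[where D="\<lambda>x v. v"] Ck_const)
qed simp

lemma Ck_sum: "(\<And>i. i \<in> I \<Longrightarrow> Ck n (f i)) \<Longrightarrow> Ck n (\<lambda>x. \<Sum>i\<in>I. f i x)"
  by (induction I rule: infinite_finite_induct) (auto intro: Ck_const Ck_add)

lemma Ck_prod:
  fixes f :: "'i \<Rightarrow> 'a::real_normed_vector \<Rightarrow> 'b::{real_normed_algebra,comm_ring_1}"
  shows "(\<And>i. i \<in> I \<Longrightarrow> Ck n (f i)) \<Longrightarrow> Ck n (\<lambda>x. \<Prod>i\<in>I. f i x)"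
  by (induction I rule: infinite_finite_induct)
     (auto intro: Ck_const Ck_bounded_bilinear[OF bounded_bilinear_mult])

lemma Ck_power:
  fixes f :: "'a::real_normed_vector \<Rightarrow> 'b::{real_normed_algebra,comm_ring_1}"
  shows "Ck n f \<Longrightarrow> Ck n (\<lambda>x. f x ^ k)"
  by (induction k) (auto intro: Ck_const Ck_bounded_bilinear[OF bounded_bilinear_mult])

lemma linear_expand:
  fixes L :: "'b::euclidean_space \<Rightarrow> 'c::real_vector"
  assumes "linear L"
  shows "L v = (\<Sum>b\<in>Basis. (v \<bullet> b) *\<^sub>R L b)"
proof -
  have "L v = L (\<Sum>b\<in>Basis. (v \<bullet> b) *\<^sub>R b)" by (simp add: euclidean_representation)
  also have "\<dots> = (\<Sum>b\<in>Basis. (v \<bullet> b) *\<^sub>R L b)"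
    by (simp add: linear_sum[OF assms] linear_scale[OF assms])
  finally show ?thesis .
qed

text \<open>The inner derivative enters the chain rule linearly and is expanded in a basis, so the
  derivative of the composite is a finite sum of products. The induction varies only
  \<open>f\<close>, which is replaced by its directional derivatives while \<open>g\<close>
  stays.\<close>

lemma Ck_compose:
  fixes f :: "'b::euclidean_space \<Rightarrow> 'c::real_normed_vector"
  shows "Ck n f \<Longrightarrow> Ck n g \<Longrightarrow> Ck n (\<lambda>x. f (g x))"
proof (induction n arbitrary: f)
  case 0
  then show ?case using continuous_on_compose2[of UNIV f UNIV g] by auto
next
  case (Suc n)
  let ?f = "\<lambda>y. frechet_derivative f (at y)" and ?g = "\<lambda>y. frechet_derivative g (at y)"
  have lin: "linear (?f y)" for y
    using Ck_SucD(1)[OF Suc.prems(1)] has_derivative_linear by blast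
  have Dfg: "((\<lambda>x. f (g x)) has_derivative (\<lambda>v. \<Sum>b\<in>Basis. (?g x v \<bullet> b) *\<^sub>R ?f (g x) b)) (at x)" for x
    by (rule has_derivative_eq_rhs[OF has_derivative_compose[OF Ck_SucD(1)[OF Suc.prems(2)] Ck_SucD(1)[OF Suc.prems(1)], of x]])
       (rule ext, rule linear_expand[OF lin])
  show ?case
  proof (rule Ck_SucI[OF Dfg])
    fix v
    have "Ck n (\<lambda>x. (?g x v \<bullet> b))" for b
      by (rule Ck_bounded_linear[OF bounded_linear_inner_left Ck_SucD(2)[OF Suc.prems(2)]])
    moreover have "Ck n (\<lambda>x. ?f (g x) b)" for b
      by (rule Suc.IH[OF Ck_SucD(2)[OF Suc.prems(1)] Ck_Suc[OF Suc.prems(2)]])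
    ultimately show "Ck n (\<lambda>x. \<Sum>b\<in>Basis. (?g x v \<bullet> b) *\<^sub>R ?f (g x) b)"
      by (intro Ck_sum Ck_bounded_bilinear[OF bounded_bilinear_scaleR])
  qed
qed

text \<open>Point and direction may both move; the left-invariant frame and the derivatives along it
  are of this form.\<close>

lemma Ck_frechet_apply:
  fixes f :: "'a::euclidean_space \<Rightarrow> 'c::real_normed_vector" and g h :: "'b::real_normed_vector \<Rightarrow> 'a"
  assumes "Ck (Suc n) f" "Ck n g" "Ck n h"
  shows "Ck n (\<lambda>x. frechet_derivative f (at (g x)) (h x))"
proof -
  have lin: "linear (frechet_derivative f (at y))" for y
    using Ck_SucD(1)[OF assms(1)] has_derivative_linear by blast
  have "(\<lambda>x. frechet_derivative f (at (g x)) (h x)) =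
      (\<lambda>x. \<Sum>b\<in>Basis. (h x \<bullet> b) *\<^sub>R frechet_derivative f (at (g x)) b)"
    by (rule ext, rule linear_expand[OF lin])
  moreover have "Ck n (\<lambda>x. \<Sum>b\<in>Basis. (h x \<bullet> b) *\<^sub>R frechet_derivative f (at (g x)) b)"
    by (intro Ck_sum Ck_bounded_bilinear[OF bounded_bilinear_scaleR]
        Ck_bounded_linear[OF bounded_linear_inner_left assms(3)]
        Ck_compose[OF Ck_SucD(2)[OF assms(1)] assms(2)])
  ultimately show ?thesis by simp
qed

lemma Ck_Pair:
  fixes f :: "'a::real_normed_vector \<Rightarrow> 'b::real_normed_vector" and g :: "'a \<Rightarrow> 'c::real_normed_vector"
  assumes "Ck n f" "Ck n g" shows "Ck n (\<lambda>x. (f x, g x))"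
proof -
  have "bounded_linear (\<lambda>x::'b. (x, 0::'c))" "bounded_linear (\<lambda>x::'c. (0::'b, x))"
    by (auto intro!: bounded_linear_Pair bounded_linear_ident bounded_linear_zero)
  from Ck_add[OF Ck_bounded_linear[OF this(1) assms(1)] Ck_bounded_linear[OF this(2) assms(2)]]
  show ?thesis by simp
qed

text \<open>The functions below are, up to constants, all derivatives of the flat function exp(-1/x).\<close>

definition flat_exp :: "nat \<Rightarrow> real \<Rightarrow> real" where
  "flat_exp k x = (if x > 0 then exp (- (1 / x)) / x ^ k else 0)"

lemma flat_exp_tendsto_0: "(flat_exp k \<longlongrightarrow> 0) (at 0)"
proof -
  have "((\<lambda>x::real. exp (- (1 / x)) / x ^ k) \<longlongrightarrow> 0) (at_right 0)" by real_asymp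
  then have "(flat_exp k \<longlongrightarrow> 0) (at_right 0)"
    by (rule Lim_transform_eventually) (auto simp: flat_exp_def eventually_at_filter)
  moreover have "((\<lambda>x::real. 0::real) \<longlongrightarrow> 0) (at_left 0)" by simp
  then have "(flat_exp k \<longlongrightarrow> 0) (at_left 0)"
    by (rule Lim_transform_eventually) (auto simp: flat_exp_def eventually_at_filter)
  ultimately show ?thesis by (simp add: filterlim_at_split)
qed

text \<open>At 0 the difference quotient of \<open>flat_exp k\<close> is
  \<open>flat_exp (Suc k)\<close>, which tends to 0; elsewhere one branch holds on a neighbourhood.
  The shift to \<open>k + 2\<close> is the inner derivative \<open>1 / x^2\<close>, the shift to
  \<open>Suc k\<close> the derivative of the denominator.\<close>

lemma flat_exp_has_derivative:
  "(flat_exp k has_real_derivative (flat_exp (k + 2) x - real k * flat_exp (Suc k) x)) (at x)"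
proof -
  consider "x > 0" | "x = 0" | "x < 0" by linarith
  then show ?thesis
  proof cases
    case 1
    have "((\<lambda>x. exp (- (1 / x)) / x ^ k) has_real_derivative (flat_exp (k + 2) x - real k * flat_exp (Suc k) x)) (at x)"
    proof -
      have k: "real k * x ^ (k - Suc 0) = real k * x ^ k / x" using 1 by (cases k) auto
      have "((\<lambda>x. exp (- (1 / x)) / x ^ k) has_real_derivative
          ((exp (- (1 / x)) * (1 / x\<^sup>2)) * x ^ k - exp (- (1 / x)) * (real k * x ^ (k - Suc 0))) / (x ^ k * x ^ k)) (at x)"
        using 1 by (intro DERIV_divide DERIV_pow DERIV_chain2[OF DERIV_exp])
          (auto intro!: derivative_eq_intros simp: power2_eq_square)
      also have "((exp (- (1 / x)) * (1 / x\<^sup>2)) * x ^ k - exp (- (1 / x)) * (real k * x ^ (k - Suc 0))) / (x ^ k * x ^ k)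
          = flat_exp (k + 2) x - real k * flat_exp (Suc k) x"
        unfolding k using 1 by (simp add: flat_exp_def field_simps power2_eq_square)
      finally show ?thesis .
    qed
    then have d: ?thesis if "\<forall>\<^sub>F y in nhds x. flat_exp k y = exp (- (1 / y)) / y ^ k"
      by (rule DERIV_cong_ev[OF refl that refl, THEN iffD2])
    have "\<forall>\<^sub>F y in nhds x. flat_exp k y = exp (- (1 / y)) / y ^ k"
      using eventually_nhds_in_open[of "{0<..}" x] 1
      by (auto elim!: eventually_mono simp: flat_exp_def)
    then show ?thesis by (rule d)
  next
    case 2
    have "((\<lambda>y. (flat_exp k y - flat_exp k 0) / (y - 0)) \<longlongrightarrow> 0) (at 0)"
      by (rule Lim_transform_eventually[OF flat_exp_tendsto_0[of "Suc k"]])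
         (auto simp: flat_exp_def eventually_at_filter)
    then show ?thesis using 2 by (simp add: has_field_derivative_iff flat_exp_def)
  next
    case 3
    have "((\<lambda>x. 0) has_real_derivative (flat_exp (k + 2) x - real k * flat_exp (Suc k) x)) (at x)"
      using 3 by (auto simp: flat_exp_def)
    then have d: ?thesis if "\<forall>\<^sub>F y in nhds x. flat_exp k y = 0"
      by (rule DERIV_cong_ev[OF refl that refl, THEN iffD2])
    have "\<forall>\<^sub>F y in nhds x. flat_exp k y = 0"
      using eventually_nhds_in_open[of "{..<0}" x] 3
      by (auto elim!: eventually_mono simp: flat_exp_def)
    then show ?thesis by (rule d)
  qed
qed

lemma Ck_flat_exp: "Ck n (flat_exp k)"
proof (induction n arbitrary: k)
  case 0
  have "isCont (flat_exp k) x" for x by (rule DERIV_isCont[OF flat_exp_has_derivative])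
  then show ?case by (simp add: continuous_on_eq_continuous_at)
next
  case (Suc n)
  have "Ck n (\<lambda>x. (flat_exp (k + 2) x + (- real k) * flat_exp (Suc k) x) * v)" for v
    by (intro Ck_bounded_bilinear[OF bounded_bilinear_mult] Ck_add Ck_const Suc)
  then show ?case
    by (intro Ck_SucI[OF flat_exp_has_derivative[unfolded has_field_derivative_def]]) simp
qed

lemma flat_exp_0_nonneg: "0 \<le> flat_exp 0 x" and flat_exp_0_le_1: "flat_exp 0 x \<le> 1" and flat_exp_0_pos_iff: "0 < flat_exp 0 x \<longleftrightarrow> 0 < x"
  by (auto simp: flat_exp_def)

section \<open>Smooth functions and test functions\<close>

lemma smooth_funI: "(\<And>n. Ck n f) \<Longrightarrow> smooth_fun f"
  by (simp add: smooth_fun_def)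

lemma smooth_funD: "smooth_fun f \<Longrightarrow> Ck n f"
  by (simp add: smooth_fun_def)

lemma smooth_has_derivative: "smooth_fun f \<Longrightarrow> (f has_derivative frechet_derivative f (at x)) (at x)"
  using Ck_SucD(1)[OF smooth_funD] .

lemma smooth_frechet: "smooth_fun f \<Longrightarrow> smooth_fun (\<lambda>x. frechet_derivative f (at x) v)"
  using Ck_SucD(2)[OF smooth_funD] by (intro smooth_funI)

lemma smooth_continuous: "smooth_fun f \<Longrightarrow> continuous_on UNIV f"
  using Ck_cont smooth_funD by blast

lemma smooth_of_real: "smooth_fun f \<Longrightarrow> smooth_fun (\<lambda>x. complex_of_real (f x))"
  by (auto intro!: smooth_funI Ck_bounded_linear[OF bounded_linear_of_real] dest: smooth_funD)

lemma smooth_linear_compose: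
  fixes f :: "'b::euclidean_space \<Rightarrow> 'c::real_normed_vector" and T :: "'a::real_normed_vector \<Rightarrow> 'b"
  shows "smooth_fun f \<Longrightarrow> bounded_linear T \<Longrightarrow> smooth_fun (\<lambda>x. f (T x))"
  by (auto intro!: smooth_funI Ck_compose[of _ f T] Ck_bounded_linear[of T] Ck_id dest: smooth_funD)

lemma smooth_scaleC: "smooth_fun f \<Longrightarrow> smooth_fun (\<lambda>x. (c::complex) * f x)"
  by (auto intro!: smooth_funI Ck_bounded_linear[OF bounded_linear_mult_right] dest: smooth_funD)

lemma smooth_add: "smooth_fun f \<Longrightarrow> smooth_fun g \<Longrightarrow> smooth_fun (\<lambda>x. f x + g x)"
  by (auto intro!: smooth_funI Ck_add dest: smooth_funD)

lemma smooth_diff: "smooth_fun f \<Longrightarrow> smooth_fun g \<Longrightarrow> smooth_fun (\<lambda>x. f x - g x)"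
  using smooth_add[of f "\<lambda>x. - g x"]
  by (auto intro!: smooth_funI Ck_bounded_linear[OF bounded_linear_minus[OF bounded_linear_ident]] dest: smooth_funD)

lemma smooth_mult:
  fixes f g :: "'a::real_normed_vector \<Rightarrow> 'b::real_normed_algebra"
  shows "smooth_fun f \<Longrightarrow> smooth_fun g \<Longrightarrow> smooth_fun (\<lambda>x. f x * g x)"
  by (auto intro!: smooth_funI Ck_bounded_bilinear[OF bounded_bilinear_mult] dest: smooth_funD)

lemma test_fun_support:
  assumes "smooth_fun f" "compact K" "\<And>z. z \<notin> K \<Longrightarrow> f z = 0"
  shows "test_fun f"
  unfolding test_fun_def
proof
  have "closure {z. f z \<noteq> 0} \<subseteq> K"
    using assms by (intro closure_minimal) (auto simp: compact_imp_closed)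
  then show "compact (closure {z. f z \<noteq> 0})"
    using compact_Int_closed[OF assms(2) closed_closure[of "{z. f z \<noteq> 0}"]]
    by (simp add: inf.absorb2)
qed fact

lemma test_fun_smooth: "test_fun f \<Longrightarrow> smooth_fun f"
  by (simp add: test_fun_def)

lemma test_fun_compact:
  assumes "test_fun f" obtains K where "compact K" "\<And>z. z \<notin> K \<Longrightarrow> f z = 0"
  using assms closure_subset[of "{z. f z \<noteq> 0}"] unfolding test_fun_def by blast

lemma test_fun_diff:
  assumes "test_fun f" "test_fun g" shows "test_fun (\<lambda>z. f z - g z)"
proof -
  obtain K where K: "compact K" "\<And>z. z \<notin> K \<Longrightarrow> f z = 0" using test_fun_compact assms(1) by blast
  obtain L where L: "compact L" "\<And>z. z \<notin> L \<Longrightarrow> g z = 0" using test_fun_compact assms(2) by blast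
  show ?thesis
    using assms K L by (intro test_fun_support[of _ "K \<union> L"] smooth_diff) (auto simp: test_fun_smooth)
qed

section \<open>Bump functions and measures determined by test functions\<close>

definition bump :: "'g::euclidean_space \<Rightarrow> real" where
  "bump z = exp 1 * flat_exp 0 (1 - z \<bullet> z)"

lemma bump_smooth: "smooth_fun (bump :: 'g::euclidean_space \<Rightarrow> real)"
proof (rule smooth_funI)
  fix n
  have "Ck n (\<lambda>z::'g. 1 + (-1) * (z \<bullet> z))"
    by (intro Ck_add Ck_const Ck_bounded_bilinear[OF bounded_bilinear_mult]
        Ck_bounded_bilinear[OF bounded_bilinear_inner] Ck_id)
  then have "Ck n (\<lambda>z::'g. exp 1 * flat_exp 0 (1 + (-1) * (z \<bullet> z)))"
    by (intro Ck_bounded_bilinear[OF bounded_bilinear_mult] Ck_const Ck_compose[OF Ck_flat_exp])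
  then show "Ck n (bump :: 'g \<Rightarrow> real)" by (simp add: bump_def[abs_def])
qed

text \<open>The factor \<open>exp 1\<close> in \<open>bump\<close> serves this normalisation, which
  makes the dilated bumps converge to 1.\<close>

lemma bump_0: "bump 0 = 1" by (simp add: bump_def flat_exp_def exp_minus)

lemma bump_nonneg: "0 \<le> bump z" by (simp add: bump_def flat_exp_0_nonneg)

lemma bump_le_1: "bump z \<le> 1"
proof -
  have "flat_exp 0 (1 - z \<bullet> z) \<le> exp (- 1)"
    using inner_ge_zero[of z] by (auto simp: flat_exp_def)
  then show ?thesis by (simp add: bump_def exp_minus field_simps)
qed

lemma bump_support: "z \<notin> cball 0 1 \<Longrightarrow> bump z = 0"
  using one_less_power[of "norm z" 2] power_le_one_iff[of "norm z" 2]
  by (auto simp: bump_def flat_exp_def dot_square_norm)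

definition box_bump :: "'g::euclidean_space \<Rightarrow> 'g \<Rightarrow> 'g \<Rightarrow> real" where
  "box_bump l u z = (\<Prod>i\<in>Basis. flat_exp 0 (z \<bullet> i - l \<bullet> i) * flat_exp 0 (u \<bullet> i - z \<bullet> i))"

lemma box_bump_smooth: "smooth_fun (box_bump l u)"
proof (rule smooth_funI)
  fix n
  have "Ck n (\<lambda>z. flat_exp 0 (z \<bullet> i + (- (l \<bullet> i))))" "Ck n (\<lambda>z. flat_exp 0 (u \<bullet> i + (-1) * (z \<bullet> i)))" for i
    by (intro Ck_compose[OF Ck_flat_exp] Ck_add Ck_const Ck_bounded_linear[OF bounded_linear_inner_left]
        Ck_id Ck_bounded_bilinear[OF bounded_bilinear_mult])+
  then show "Ck n (box_bump l u)"
    unfolding box_bump_def[abs_def]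
    by (intro Ck_prod Ck_bounded_bilinear[OF bounded_bilinear_mult]) auto
qed

lemma box_bump_range: "0 \<le> box_bump l u z" "box_bump l u z \<le> 1"
  unfolding box_bump_def by (auto intro!: prod_nonneg prod_le_1 mult_le_one simp: flat_exp_0_nonneg flat_exp_0_le_1)

lemma box_bump_pos_iff: "0 < box_bump l u z \<longleftrightarrow> z \<in> box l u"
proof
  assume "0 < box_bump l u z"
  then have "box_bump l u z \<noteq> 0" by simp
  then have "\<forall>i\<in>Basis. flat_exp 0 (z \<bullet> i - l \<bullet> i) \<noteq> 0 \<and> flat_exp 0 (u \<bullet> i - z \<bullet> i) \<noteq> 0"
    unfolding box_bump_def prod_zero_iff[OF finite_Basis] by simp
  moreover have "t > 0" if "flat_exp 0 t \<noteq> 0" for t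
    using that by (simp add: flat_exp_def split: if_splits)
  ultimately have "\<forall>i\<in>Basis. 0 < z \<bullet> i - l \<bullet> i \<and> 0 < u \<bullet> i - z \<bullet> i"
    by blast
  then show "z \<in> box l u" by (simp add: mem_box)
next
  assume "z \<in> box l u"
  then show "0 < box_bump l u z"
    unfolding box_bump_def by (intro prod_pos) (simp add: mem_box flat_exp_0_pos_iff)
qed

text \<open>The indicator of a box is the limit of \<open>1 - (1 - b)^k\<close>, where \<open>b\<close> is its bump function.\<close>

lemma measure_eq_test_fun:
  fixes M N :: "'g::euclidean_space measure"
  assumes fin: "finite_measure M" "finite_measure N" and sets: "sets M = sets borel" "sets N = sets borel"
    and eq: "\<And>f. test_fun f \<Longrightarrow> (\<integral>z. f z \<partial>M) = (\<integral>z. f z \<partial>N)"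
  shows "M = N"
proof -
  have box: "emeasure M (box l u) = emeasure N (box l u)" for l u :: 'g
  proof -
    define s where "s k z = complex_of_real (1 - (1 - box_bump l u z) ^ k)" for k z
    have tst: "test_fun (s k)" for k
    proof (rule test_fun_support[of _ "cbox l u"])
      have "Ck n (\<lambda>z. 1 + (-1) * (1 + (-1) * box_bump l u z) ^ k)" for n
        by (intro Ck_add Ck_const Ck_bounded_bilinear[OF bounded_bilinear_mult] Ck_power smooth_funD[OF box_bump_smooth])
      then have "smooth_fun (\<lambda>z. 1 - (1 - box_bump l u z) ^ k)" by (intro smooth_funI) simp
      then show "smooth_fun (s k)" unfolding s_def by (rule smooth_of_real)
      fix z assume "z \<notin> cbox l u"
      then have "z \<notin> box l u" using box_subset_cbox by blast
      then have "box_bump l u z = 0"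
        using box_bump_pos_iff box_bump_range(1) by (metis less_eq_real_def)
      then show "s k z = 0" by (simp add: s_def)
    qed simp
    have lim: "(\<lambda>k. \<integral>z. s k z \<partial>K) \<longlonglongrightarrow> (\<integral>z. indicator (box l u) z \<partial>K)"
      if "finite_measure K" "sets K = sets borel" for K :: "'g measure"
    proof (rule integral_dominated_convergence[where w="\<lambda>_. 1"])
      show "s k \<in> borel_measurable K" for k
        using borel_measurable_continuous_onI[OF smooth_continuous[OF test_fun_smooth[OF tst]]]
        by (simp add: measurable_cong_sets[OF that(2) refl])
      show "(indicator (box l u) :: 'g \<Rightarrow> complex) \<in> borel_measurable K"
        using that(2) by (intro borel_measurable_indicator) auto
      show "integrable K (\<lambda>_. 1::real)" using that by (simp add: finite_measure.integrable_const)
      show "AE z in K. norm (s k z) \<le> 1" for k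
      proof (rule AE_I2)
        fix z
        have "0 \<le> (1 - box_bump l u z) ^ k" "(1 - box_bump l u z) ^ k \<le> 1"
          using box_bump_range[of l u z] by (auto intro: power_le_one)
        then show "norm (s k z) \<le> 1" unfolding s_def norm_of_real by simp
      qed
      show "AE z in K. (\<lambda>k. s k z) \<longlonglongrightarrow> indicator (box l u) z"
      proof (rule AE_I2)
        fix z
        show "(\<lambda>k. s k z) \<longlonglongrightarrow> indicator (box l u) z"
        proof (cases "z \<in> box l u")
          case True
          then have "(\<lambda>k. (1 - box_bump l u z) ^ k) \<longlonglongrightarrow> 0"
            using box_bump_pos_iff[of l u z] box_bump_range[of l u z] by (intro LIMSEQ_realpow_zero) auto
          then have "(\<lambda>k. complex_of_real (1 - (1 - box_bump l u z) ^ k)) \<longlonglongrightarrow> of_real (1 - 0)"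
            by (intro tendsto_of_real tendsto_diff) auto
          then show ?thesis using True by (simp add: s_def)
        next
          case False
          then have "box_bump l u z = 0"
            using box_bump_pos_iff box_bump_range(1) by (metis less_eq_real_def)
          then show ?thesis using False by (simp add: s_def)
        qed
      qed
    qed
    have int: "(\<integral>z. (indicator (box l u) z :: complex) \<partial>K) = of_real (measure K (box l u))"
      if "finite_measure K" "sets K = sets borel" for K :: "'g measure"
    proof -
      have "space K = UNIV" using that(2) sets_eq_imp_space_eq by fastforce
      have "(\<integral>z. (indicator (box l u) z :: complex) \<partial>K) = (\<integral>z. of_real (indicator (box l u) z) \<partial>K)"
        by (intro Bochner_Integration.integral_cong) (auto simp: indicator_def)
      also have "\<dots> = of_real (\<integral>z. indicator (box l u) z \<partial>K)" by (rule integral_complex_of_real)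
      also have "\<dots> = of_real (measure K (box l u))"
        using \<open>space K = UNIV\<close> by simp
      finally show ?thesis .
    qed
    have "(\<integral>z. (indicator (box l u) z :: complex) \<partial>M) = (\<integral>z. indicator (box l u) z \<partial>N)"
      using lim[OF fin(1) sets(1)] lim[OF fin(2) sets(2)] LIMSEQ_unique eq[OF tst] by auto
    then have "measure M (box l u) = measure N (box l u)"
      using int fin sets by (metis of_real_eq_iff)
    then show ?thesis
      using fin by (simp add: finite_measure.emeasure_eq_measure)
  qed
  show ?thesis
  proof (rule measure_eqI_generator_eq[where \<Omega>=UNIV and E="range (\<lambda>(a, b). box a b :: 'g set)"
        and A="\<lambda>n. box (- (real n *\<^sub>R One)) (real n *\<^sub>R One)"])
    show "Int_stable (range (\<lambda>(a, b). box a b :: 'g set))"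
      by (auto simp: Int_stable_def box_Int_box)
    show "(\<Union>i. box (- (real i *\<^sub>R One)) (real i *\<^sub>R One)) = (UNIV :: 'g set)"
      using UN_box_eq_UNIV by simp
    show "sets M = sigma_sets UNIV (range (\<lambda>(a, b). box a b))"
      "sets N = sigma_sets UNIV (range (\<lambda>(a, b). box a b))"
      unfolding sets by (subst borel_eq_box, simp add: sets_measure_of)+
    show "emeasure M (box (- (real i *\<^sub>R One)) (real i *\<^sub>R One)) \<noteq> \<infinity>" for i
      using fin(1) by (simp add: finite_measure.emeasure_eq_measure)
  qed (use box in auto)
qed

section \<open>The group law in exponential coordinates\<close>

text \<open>Gronwall: if \<open>K\<close> bounds \<open>L\<close>, then
  \<open>exp (- 2 * K * t)\<close> times the squared norm of \<open>D t\<close> is nonincreasing, so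
  it cannot rise from its initial value 0.\<close>

lemma linear_ode_unique:
  fixes D :: "real \<Rightarrow> 'g::real_inner"
  assumes D: "\<And>t. (D has_vector_derivative L (D t)) (at t)" and L: "bounded_linear L" and "D 0 = 0"
  shows "D 1 = 0"
proof -
  obtain K where K: "\<And>x. norm (L x) \<le> norm x * K" using bounded_linear.bounded[OF L] by blast
  define \<phi> where "\<phi> t = exp (- 2 * K * t) * (D t \<bullet> D t)" for t
  have "\<exists>y. (\<phi> has_real_derivative y) (at t) \<and> y \<le> 0" for t
  proof (intro exI conjI)
    have "((\<lambda>t. D t \<bullet> D t) has_real_derivative (2 * (D t \<bullet> L (D t)))) (at t)"
      using has_derivative_inner[OF D[unfolded has_vector_derivative_def] D[unfolded has_vector_derivative_def], of t]
      by (simp add: has_field_derivative_def inner_commute algebra_simps fun_eq_iff mult_commute_abs)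
    then show "(\<phi> has_real_derivative (- 2 * K * exp (- 2 * K * t) * (D t \<bullet> D t)
        + exp (- 2 * K * t) * (2 * (D t \<bullet> L (D t))))) (at t)"
      unfolding \<phi>_def by (auto intro!: derivative_eq_intros)
    have "D t \<bullet> L (D t) \<le> norm (D t) * norm (L (D t))" by (rule norm_cauchy_schwarz)
    also have "\<dots> \<le> norm (D t) * (norm (D t) * K)" by (intro mult_left_mono K) simp
    also have "\<dots> = K * (D t \<bullet> D t)" by (simp add: dot_square_norm power2_eq_square)
    finally have "exp (- 2 * K * t) * (2 * (D t \<bullet> L (D t))) \<le> exp (- 2 * K * t) * (2 * (K * (D t \<bullet> D t)))"
      by (intro mult_left_mono) auto
    then show "- 2 * K * exp (- 2 * K * t) * (D t \<bullet> D t) + exp (- 2 * K * t) * (2 * (D t \<bullet> L (D t))) \<le> 0"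
      by (simp add: algebra_simps)
  qed
  then have "\<phi> 1 \<le> \<phi> 0" by (rule DERIV_nonpos_imp_nonincreasing[of 0 1, OF zero_le_one])
  moreover have "\<phi> 0 = 0" unfolding \<phi>_def assms(3) by simp
  moreover have "\<phi> 1 > 0" if "D 1 \<noteq> 0"
    unfolding \<phi>_def using that by (intro mult_pos_pos) (simp_all add: inner_gt_zero_iff)
  ultimately show ?thesis by linarith
qed

text \<open>Reduces derivatives along one-parameter curves to the parameter 0, where the group law
  supplies them.\<close>

lemma has_vector_derivative_shift:
  assumes "((\<lambda>h. f (t + h)) has_vector_derivative f') (at (0::real))"
  shows "(f has_vector_derivative f') (at t)"
proof -
  have "((\<lambda>s. s - t) has_vector_derivative 1) (at t)"
    by (auto intro!: derivative_eq_intros)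
  from vector_diff_chain_at[OF this, of "\<lambda>h. f (t + h)" f'] assms show ?thesis
    by (simp add: o_def)
qed

locale exp_group =
  fixes br gmul :: "'g::euclidean_space \<Rightarrow> 'g \<Rightarrow> 'g"
  assumes grp: "exp_identified_group br gmul" and bil: "bilinear br"
begin

lemma gmul_smooth: "smooth_fun (\<lambda>p. gmul (fst p) (snd p))"
  and gmul_assoc: "gmul (gmul x y) z = gmul x (gmul y z)"
  and gmul_0_left [simp]: "gmul 0 x = x"
  and gmul_0_right [simp]: "gmul x 0 = x"
  and gmul_scale: "gmul (s *\<^sub>R x) (t *\<^sub>R x) = (s + t) *\<^sub>R x"
  using grp unfolding exp_identified_group_def by auto

lemma gmul_minus_right [simp]: "gmul x (- x) = 0"
  using gmul_scale[of 1 x "-1"] by simp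

lemma gmul_minus_left [simp]: "gmul (- x) x = 0"
  using gmul_scale[of "-1" x 1] by simp

lemma gmul_cancel_left [simp]: "gmul (- x) (gmul x y) = y" "gmul x (gmul (- x) y) = y"
  by (simp_all flip: gmul_assoc)

lemma minus_gmul: "- gmul x y = gmul (- y) (- x)"
proof -
  have "gmul (gmul x y) (gmul (- y) (- x)) = gmul x (gmul y (gmul (- y) (- x)))"
    by (rule gmul_assoc)
  also have "\<dots> = 0" by simp
  finally have "gmul (gmul x y) (gmul (- y) (- x)) = 0" .
  then have "gmul (- gmul x y) (gmul (gmul x y) (gmul (- y) (- x))) = - gmul x y" by simp
  then show ?thesis by (simp only: gmul_cancel_left)
qed

section \<open>The differential of the group law and the Maurer-Cartan form\<close>

definition DG :: "'g \<Rightarrow> 'g \<Rightarrow> 'g \<times> 'g \<Rightarrow> 'g" where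
  "DG x y = frechet_derivative (\<lambda>p. gmul (fst p) (snd p)) (at (x, y))"

lemma DG_has_derivative: "((\<lambda>p. gmul (fst p) (snd p)) has_derivative DG x y) (at (x, y))"
  unfolding DG_def by (rule smooth_has_derivative[OF gmul_smooth])

lemma DG_linear: "linear (DG x y)"
  using DG_has_derivative has_derivative_linear by blast

lemma DG_split: "DG x y (u, v) = DG x y (u, 0) + DG x y (0, v)"
  using linear_add[OF DG_linear, of x y "(u, 0)" "(0, v)"] by simp

lemma gmul_has_derivative:
  assumes "(f has_derivative f') (at t)" "(g has_derivative g') (at t)"
  shows "((\<lambda>t. gmul (f t) (g t)) has_derivative (\<lambda>v. DG (f t) (g t) (f' v, g' v))) (at t)"
  using has_derivative_compose[OF has_derivative_Pair[OF assms] DG_has_derivative] by simp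

lemma gmul_has_vector_derivative:
  assumes "(f has_vector_derivative f') (at t)" "(g has_vector_derivative g') (at t)"
  shows "((\<lambda>t. gmul (f t) (g t)) has_vector_derivative DG (f t) (g t) (f', g')) (at t)"
proof -
  have "DG (f t) (g t) (s *\<^sub>R f', s *\<^sub>R g') = s *\<^sub>R DG (f t) (g t) (f', g')" for s
    using linear_scale[OF DG_linear, of "f t" "g t" s "(f', g')"] by simp
  then show ?thesis
    using gmul_has_derivative[OF assms[unfolded has_vector_derivative_def]]
    by (simp add: has_vector_derivative_def)
qed

lemma gmul_continuous:
  assumes "continuous_on S f" "continuous_on S g"
  shows "continuous_on S (\<lambda>t. gmul (f t) (g t))"
  using continuous_on_compose2[OF smooth_continuous[OF gmul_smooth] continuous_on_Pair[OF assms]] by simp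

text \<open>Differential of left translation by \<open>z\<close> at the identity:
  \<open>E z v\<close> is the value at \<open>z\<close> of the left-invariant field of
  \<open>v\<close>. Its inverse \<open>om z\<close>, the Maurer-Cartan form, brings tangent vectors
  at \<open>z\<close> back to the identity.\<close>

definition E :: "'g \<Rightarrow> 'g \<Rightarrow> 'g" where "E z v = DG z 0 (0, v)"
definition om :: "'g \<Rightarrow> 'g \<Rightarrow> 'g" where "om z v = DG (- z) z (0, v)"

lemma left_has_derivative: "(gmul w has_derivative (\<lambda>v. DG w z (0, v))) (at z)"
  using gmul_has_derivative[OF has_derivative_const has_derivative_ident, of w z] by simp

lemma right_has_derivative: "((\<lambda>y. gmul y w) has_derivative (\<lambda>v. DG z w (v, 0))) (at z)"
  using gmul_has_derivative[OF has_derivative_ident has_derivative_const, of w z] by simp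

text \<open>Associativity differentiated in the last factor. That \<open>E\<close> and
  \<open>om\<close> are mutually inverse and that \<open>E\<close> is left-invariant are special
  cases.\<close>

lemma left_chain: "DG w (gmul z y) (0, DG z y (0, v)) = DG (gmul w z) y (0, v)"
proof -
  have "((\<lambda>y. gmul w (gmul z y)) has_derivative (\<lambda>v. DG w (gmul z y) (0, DG z y (0, v)))) (at y)"
    by (rule has_derivative_compose[OF left_has_derivative left_has_derivative])
  moreover have "(\<lambda>y. gmul w (gmul z y)) = gmul (gmul w z)" by (simp add: gmul_assoc fun_eq_iff)
  ultimately have "(gmul (gmul w z) has_derivative (\<lambda>v. DG w (gmul z y) (0, DG z y (0, v)))) (at y)" by simp
  from has_derivative_unique[OF this left_has_derivative, THEN fun_cong] show ?thesis .
qed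

lemma DG_0_left: "DG 0 y (0, v) = v"
proof -
  have "gmul 0 = (\<lambda>v. v)" by (simp add: fun_eq_iff)
  then have "(gmul 0 has_derivative (\<lambda>v. v)) (at y)" by (simp add: has_derivative_ident)
  from has_derivative_unique[OF left_has_derivative this, THEN fun_cong] show ?thesis .
qed

lemma E_om [simp]: "E z (om z v) = v" and om_E [simp]: "om z (E z v) = v"
  using left_chain[of z "- z" z v] left_chain[of "- z" z 0 v] by (simp_all add: E_def om_def DG_0_left)

lemma E_left: "DG w z (0, E z v) = E (gmul w z) v"
  using left_chain[of w z 0 v] by (simp add: E_def)

lemma E_linear: "linear (E z)"
  using linear_compose[OF _ DG_linear, of "\<lambda>v. (0, v)"] by (simp add: E_def[abs_def] o_def linear_iff)

lemma E_smooth: "smooth_fun (\<lambda>z. E z v)"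
  unfolding E_def DG_def
  by (intro smooth_funI Ck_frechet_apply Ck_Pair Ck_id Ck_const smooth_funD[OF gmul_smooth])

text \<open>The adjoint representation: differential at the identity of conjugation by
  \<open>p\<close>, written as left translation followed by right translation with the inverse
  \<open>- p\<close>.\<close>

definition Ad :: "'g \<Rightarrow> 'g \<Rightarrow> 'g" where "Ad p v = DG p (- p) (E p v, 0)"

lemma Ad_has_derivative: "((\<lambda>y. gmul (gmul p y) (- p)) has_derivative Ad p) (at 0)"
  using has_derivative_compose[OF left_has_derivative[of p 0] right_has_derivative]
  by (simp add: Ad_def[abs_def] E_def)

text \<open>The group axioms provide the iterated derivative through an unnamed function
  \<open>A\<close>; uniqueness of derivatives identifies \<open>A t\<close> with
  \<open>Ad (t *\<^sub>R x) y\<close>, so the bracket is the derivative of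
  \<open>Ad\<close>.\<close>

lemma Ad_deriv: "((\<lambda>t. Ad (t *\<^sub>R x) y) has_vector_derivative br x y) (at 0)"
proof -
  obtain A where A: "\<And>t. ((\<lambda>s. gmul (gmul (t *\<^sub>R x) (s *\<^sub>R y)) (- (t *\<^sub>R x))) has_vector_derivative A t) (at 0)"
    "(A has_vector_derivative br x y) (at 0)"
    using grp unfolding exp_identified_group_def by blast
  have "A t = Ad (t *\<^sub>R x) y" for t
  proof -
    have d0: "(\<lambda>s. s *\<^sub>R y) (0::real) = 0" by simp
    have "((\<lambda>s::real. s *\<^sub>R y) has_derivative (\<lambda>s. s *\<^sub>R y)) (at 0)" by (auto intro!: derivative_eq_intros)
    from has_derivative_compose[OF this, unfolded d0, OF Ad_has_derivative[of "t *\<^sub>R x"]]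
    have "((\<lambda>s. gmul (gmul (t *\<^sub>R x) (s *\<^sub>R y)) (- (t *\<^sub>R x))) has_derivative (\<lambda>s. Ad (t *\<^sub>R x) (s *\<^sub>R y))) (at 0)" .
    moreover have "Ad (t *\<^sub>R x) (s *\<^sub>R y) = s *\<^sub>R Ad (t *\<^sub>R x) y" for s
      using linear_scale[OF has_derivative_linear[OF Ad_has_derivative]] .
    ultimately have "((\<lambda>s. gmul (gmul (t *\<^sub>R x) (s *\<^sub>R y)) (- (t *\<^sub>R x))) has_vector_derivative Ad (t *\<^sub>R x) y) (at 0)"
      by (simp add: has_vector_derivative_def)
    then show ?thesis using vector_derivative_unique_at[OF A(1)] by blast
  qed
  then have "A = (\<lambda>t. Ad (t *\<^sub>R x) y)" by auto
  then show ?thesis using A(2) by simp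
qed

lemma om_curve: "((\<lambda>s. gmul (- (t *\<^sub>R z)) (t *\<^sub>R (z + s *\<^sub>R v))) has_vector_derivative om (t *\<^sub>R z) (t *\<^sub>R v)) (at 0)"
proof -
  have "((\<lambda>s. t *\<^sub>R (z + s *\<^sub>R v)) has_vector_derivative t *\<^sub>R v) (at 0)"
    by (auto intro!: derivative_eq_intros simp: has_vector_derivative_def)
  from gmul_has_vector_derivative[OF has_vector_derivative_const this, of "- (t *\<^sub>R z)"]
  show ?thesis by (simp add: om_def)
qed

text \<open>Cocycle rule. Multiples of one vector multiply by adding their coefficients, so the
  product for \<open>t + h\<close> is \<open>q s\<close> enclosed between the two factors for
  \<open>h\<close>. Differentiating in \<open>s\<close>, the inner part \<open>q s\<close>
  contributes a conjugation by \<open>- (h *\<^sub>R z)\<close> and the right factor contributes the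
  form at time \<open>h\<close>.\<close>

lemma om_shift: "om ((t + h) *\<^sub>R z) ((t + h) *\<^sub>R v) = Ad (- (h *\<^sub>R z)) (om (t *\<^sub>R z) (t *\<^sub>R v)) + om (h *\<^sub>R z) (h *\<^sub>R v)"
proof -
  define q where "q s = gmul (- (t *\<^sub>R z)) (t *\<^sub>R (z + s *\<^sub>R v))" for s
  have q0: "q 0 = 0" by (simp add: q_def)
  have dq: "(q has_vector_derivative om (t *\<^sub>R z) (t *\<^sub>R v)) (at 0)" unfolding q_def by (rule om_curve)
  have dl: "((\<lambda>s. h *\<^sub>R (z + s *\<^sub>R v)) has_vector_derivative h *\<^sub>R v) (at 0)"
    by (auto intro!: derivative_eq_intros simp: has_vector_derivative_def)
  have "((\<lambda>s. gmul (- (h *\<^sub>R z)) (gmul (q s) (h *\<^sub>R (z + s *\<^sub>R v)))) has_vector_derivative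
      DG (- (h *\<^sub>R z)) (h *\<^sub>R z) (0, DG 0 (h *\<^sub>R z) (om (t *\<^sub>R z) (t *\<^sub>R v), h *\<^sub>R v))) (at 0)"
    using gmul_has_vector_derivative[OF has_vector_derivative_const gmul_has_vector_derivative[OF dq dl], of "- (h *\<^sub>R z)"]
    by (simp add: q0)
  moreover have "gmul (- (h *\<^sub>R z)) (gmul (q s) (h *\<^sub>R (z + s *\<^sub>R v))) = gmul (- ((t + h) *\<^sub>R z)) ((t + h) *\<^sub>R (z + s *\<^sub>R v))" for s
  proof -
    have "gmul (- (h *\<^sub>R z)) (gmul (q s) (h *\<^sub>R (z + s *\<^sub>R v)))
      = gmul (gmul ((- h) *\<^sub>R z) ((- t) *\<^sub>R z)) (gmul (t *\<^sub>R (z + s *\<^sub>R v)) (h *\<^sub>R (z + s *\<^sub>R v)))"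
      by (simp add: q_def gmul_assoc)
    also have "\<dots> = gmul (- ((t + h) *\<^sub>R z)) ((t + h) *\<^sub>R (z + s *\<^sub>R v))"
      unfolding gmul_scale by (simp add: algebra_simps)
    finally show ?thesis .
  qed
  ultimately have "((\<lambda>s. gmul (- ((t + h) *\<^sub>R z)) ((t + h) *\<^sub>R (z + s *\<^sub>R v))) has_vector_derivative
      DG (- (h *\<^sub>R z)) (h *\<^sub>R z) (0, DG 0 (h *\<^sub>R z) (om (t *\<^sub>R z) (t *\<^sub>R v), h *\<^sub>R v))) (at 0)" by simp
  from vector_derivative_unique_at[OF om_curve this]
  have 1: "om ((t + h) *\<^sub>R z) ((t + h) *\<^sub>R v)
    = DG (- (h *\<^sub>R z)) (h *\<^sub>R z) (0, DG 0 (h *\<^sub>R z) (om (t *\<^sub>R z) (t *\<^sub>R v), 0) + h *\<^sub>R v)"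
    using DG_split[of 0 "h *\<^sub>R z" _ "h *\<^sub>R v"] by (simp add: DG_0_left)
  have 2: "DG (- (h *\<^sub>R z)) (h *\<^sub>R z) (0, DG 0 (h *\<^sub>R z) (u, 0)) = Ad (- (h *\<^sub>R z)) u" for u
  proof -
    have "((\<lambda>y. gmul (- (h *\<^sub>R z)) (gmul y (h *\<^sub>R z))) has_derivative
        (\<lambda>u. DG (- (h *\<^sub>R z)) (h *\<^sub>R z) (0, DG 0 (h *\<^sub>R z) (u, 0)))) (at 0)"
      using has_derivative_compose[OF right_has_derivative[of "h *\<^sub>R z" 0] left_has_derivative] by simp
    then have "((\<lambda>y. gmul (gmul (- (h *\<^sub>R z)) y) (- (- (h *\<^sub>R z)))) has_derivative
        (\<lambda>u. DG (- (h *\<^sub>R z)) (h *\<^sub>R z) (0, DG 0 (h *\<^sub>R z) (u, 0)))) (at 0)"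
      by (simp add: gmul_assoc)
    from has_derivative_unique[OF this Ad_has_derivative, THEN fun_cong] show ?thesis .
  qed
  have 3: "DG (- (h *\<^sub>R z)) (h *\<^sub>R z) (0, a + b) = DG (- (h *\<^sub>R z)) (h *\<^sub>R z) (0, a) + DG (- (h *\<^sub>R z)) (h *\<^sub>R z) (0, b)" for a b
    using linear_add[OF DG_linear, of _ _ "(0, a)" "(0, b)"] by simp
  show ?thesis unfolding 1 3 2 by (simp add: om_def)
qed

text \<open>The cocycle rule differentiated in \<open>h\<close> at 0: the conjugation contributes
  \<open>- br z\<close> of the current value, and the second summand, \<open>h\<close> times a
  differentiable function with value \<open>v\<close> at 0, contributes \<open>v\<close>. The
  equation takes the place of the power series for the differential of the exponential map.\<close>

lemma om_ode: "((\<lambda>t. om (t *\<^sub>R z) (t *\<^sub>R v)) has_vector_derivative (v - br z (om (t *\<^sub>R z) (t *\<^sub>R v)))) (at t)"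
proof (rule has_vector_derivative_shift)
  define W where "W t = om (t *\<^sub>R z) (t *\<^sub>R v)" for t
  have scl: "W h = h *\<^sub>R om (h *\<^sub>R z) v" for h
    using linear_scale[OF DG_linear, of _ _ h "(0, v)"] by (simp add: W_def om_def)
  have "Ck (Suc 0) (\<lambda>h. om (h *\<^sub>R z) v)"
    unfolding om_def DG_def
    by (intro Ck_frechet_apply Ck_Pair Ck_const smooth_funD[OF gmul_smooth] Ck_bounded_bilinear[OF bounded_bilinear_scaleR]
      Ck_bounded_linear[OF bounded_linear_minus[OF bounded_linear_ident]] Ck_id)
  from Ck_SucD(1)[OF this, of 0]
  have "((\<lambda>h. h *\<^sub>R om (h *\<^sub>R z) v) has_derivative (\<lambda>h. h *\<^sub>R v)) (at 0)"
    by (auto intro!: derivative_eq_intros simp: om_def DG_0_left)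
  then have dW: "(W has_vector_derivative v) (at 0)"
    by (simp add: scl[abs_def] has_vector_derivative_def)
  have "((\<lambda>h::real. - h) has_vector_derivative (- 1)) (at 0)"
    by (auto intro!: derivative_eq_intros)
  from vector_diff_chain_at[OF this, of "\<lambda>t. Ad (t *\<^sub>R z) (W t')" "br z (W t')" for t'] Ad_deriv
  have "((\<lambda>h. Ad (- (h *\<^sub>R z)) (W t)) has_vector_derivative - br z (W t)) (at 0)"
    by (simp add: o_def)
  from has_vector_derivative_add[OF this dW]
  show "((\<lambda>h. om ((t + h) *\<^sub>R z) ((t + h) *\<^sub>R v)) has_vector_derivative v - br z (om (t *\<^sub>R z) (t *\<^sub>R v))) (at 0)"
    unfolding om_shift by (simp add: W_def)
qed

text \<open>The difference \<open>D\<close> of the two sides along the rays satisfies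
  \<open>D' = - br p D\<close> with \<open>D 0 = 0\<close>. The points \<open>p\<close> and
  \<open>z\<close> are independent: automorphisms use \<open>p = T z\<close>, the complex structure
  uses \<open>p = z\<close>.\<close>

lemma om_intertwine:
  assumes T: "linear T" and br: "\<And>u. br p (T u) = T (br z u)"
  shows "om p (T v) = T (om z v)"
proof -
  define D where "D t = om (t *\<^sub>R p) (t *\<^sub>R T v) - T (om (t *\<^sub>R z) (t *\<^sub>R v))" for t
  have lin: "linear (br p)" using bil by (simp add: bilinear_def)
  have "D 1 = 0"
  proof (rule linear_ode_unique)
    show "bounded_linear (\<lambda>u. - br p u)"
      using lin by (intro bounded_linear_minus) (simp add: linear_conv_bounded_linear)
    show "D 0 = 0"
      using linear_0[OF T] linear_0[OF DG_linear] by (simp add: D_def om_def flip: zero_prod_def)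
    have bT: "bounded_linear T" using T by (simp add: linear_conv_bounded_linear)
    show "(D has_vector_derivative - br p (D t)) (at t)" for t
      using has_vector_derivative_diff[OF om_ode[of p "T v" t]
          bounded_linear.has_vector_derivative[OF bT om_ode[of z v t]]]
      by (simp add: D_def[abs_def] linear_diff[OF T] linear_diff[OF lin] br)
  qed
  then show ?thesis by (simp add: D_def)
qed

lemma E_intertwine:
  assumes "linear T" "\<And>u. br p (T u) = T (br z u)"
  shows "E p (T v) = T (E z v)"
  using arg_cong[OF om_intertwine[OF assms, of "E z v"], of "E p"] by simp

lemma curve_deriv: "((\<lambda>t. gmul z (t *\<^sub>R y)) has_vector_derivative E (gmul z (t *\<^sub>R y)) y) (at t)"
proof (rule has_vector_derivative_shift)
  have "((\<lambda>h::real. h *\<^sub>R y) has_vector_derivative y) (at 0)"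
    by (auto intro!: derivative_eq_intros simp: has_vector_derivative_def)
  from gmul_has_vector_derivative[OF has_vector_derivative_const this]
  have "((\<lambda>h. gmul (gmul z (t *\<^sub>R y)) (h *\<^sub>R y)) has_vector_derivative E (gmul z (t *\<^sub>R y)) y) (at 0)"
    by (simp add: E_def)
  then show "((\<lambda>h. gmul z ((t + h) *\<^sub>R y)) has_vector_derivative E (gmul z (t *\<^sub>R y)) y) (at 0)"
    by (simp add: gmul_assoc gmul_scale)
qed

text \<open>By the intertwining property of \<open>E\<close>, the image under \<open>T\<close> of
  \<open>gmul x (t *\<^sub>R y)\<close> is an integral curve of the left-invariant field of
  \<open>T y\<close>. Multiplying from the right by \<open>- (t *\<^sub>R T y)\<close> therefore
  gives a constant curve, and its values at 0 and 1 are compared.\<close>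

lemma automorphism_gmul:
  assumes T: "linear T" and br: "\<And>x y. br (T x) (T y) = T (br x y)"
  shows "T (gmul x y) = gmul (T x) (T y)"
proof -
  define \<gamma> where "\<gamma> t = gmul x (t *\<^sub>R y)" for t
  define \<kappa> where "\<kappa> t = gmul (T (\<gamma> t)) (- (t *\<^sub>R T y))" for t
  have bT: "bounded_linear T" using T by (simp add: linear_conv_bounded_linear)
  have "(\<kappa> has_vector_derivative 0) (at t)" for t
  proof -
    have 1: "((\<lambda>t. T (\<gamma> t)) has_vector_derivative E (T (\<gamma> t)) (T y)) (at t)"
      using bounded_linear.has_vector_derivative[OF bT curve_deriv[of x y t]]
      by (simp add: \<gamma>_def E_intertwine[OF T br])
    have 2: "((\<lambda>t. - (t *\<^sub>R T y)) has_vector_derivative - T y) (at t)" for t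
      by (auto intro!: derivative_eq_intros simp: has_vector_derivative_def)
    have 3: "(\<kappa> has_vector_derivative DG (T (\<gamma> t)) (- (t *\<^sub>R T y)) (E (T (\<gamma> t)) (T y), - T y)) (at t)"
      unfolding \<kappa>_def by (rule gmul_has_vector_derivative[OF 1 2])
    \<comment> \<open>The velocity of \<open>\<kappa>\<close> at \<open>t\<close> equals that of the
      curve in which \<open>T (\<gamma> (t + h))\<close> is replaced by
      \<open>gmul (T (\<gamma> t)) (h *\<^sub>R T y)\<close>, tangent to it at \<open>h = 0\<close>.
      There the two multiples of \<open>T y\<close> combine and \<open>h\<close> disappears.\<close>
    have 4: "((\<lambda>h. - ((t + h) *\<^sub>R T y)) has_vector_derivative - T y) (at 0)"
      by (auto intro!: derivative_eq_intros simp: has_vector_derivative_def)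
    have "((\<lambda>h. gmul (gmul (T (\<gamma> t)) (h *\<^sub>R T y)) (- ((t + h) *\<^sub>R T y))) has_vector_derivative
        DG (T (\<gamma> t)) (- (t *\<^sub>R T y)) (E (T (\<gamma> t)) (T y), - T y)) (at 0)"
      using gmul_has_vector_derivative[OF curve_deriv[of "T (\<gamma> t)" "T y" 0] 4] by simp
    moreover have "gmul (gmul (T (\<gamma> t)) (h *\<^sub>R T y)) (- ((t + h) *\<^sub>R T y)) = \<kappa> t" for h
    proof -
      have "gmul (h *\<^sub>R T y) (- ((t + h) *\<^sub>R T y)) = - (t *\<^sub>R T y)"
        using gmul_scale[of h "T y" "- (t + h)"] by (simp add: algebra_simps)
      then show ?thesis by (simp add: \<kappa>_def gmul_assoc)
    qed
    ultimately have "((\<lambda>h. \<kappa> t) has_vector_derivative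
        DG (T (\<gamma> t)) (- (t *\<^sub>R T y)) (E (T (\<gamma> t)) (T y), - T y)) (at 0)" by simp
    from vector_derivative_unique_at[OF this has_vector_derivative_const]
    show ?thesis using 3 by simp
  qed
  then have "\<kappa> constant_on UNIV"
    by (intro has_derivative_zero_connected_constant_on[of UNIV "{}"])
       (auto simp: has_vector_derivative_def intro!: continuous_at_imp_continuous_on has_derivative_continuous)
  then have "\<kappa> 1 = \<kappa> 0" unfolding constant_on_def by auto
  then have "gmul (gmul (T (gmul x y)) (- T y)) (T y) = gmul (T x) (T y)"
    by (simp add: \<kappa>_def \<gamma>_def)
  then show ?thesis by (simp add: gmul_assoc)
qed

section \<open>Left-invariant fields as derivations\<close>

lemma lvf_curve:
  assumes "(f has_derivative D) (at z)"
  shows "((\<lambda>t. f (gmul z (t *\<^sub>R x))) has_vector_derivative D (E z x)) (at 0)"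
proof -
  have "((\<lambda>t. gmul z (t *\<^sub>R x)) has_derivative (\<lambda>t. t *\<^sub>R E z x)) (at 0)"
    using curve_deriv[of z x 0] by (simp add: has_vector_derivative_def)
  moreover have "(f has_derivative D) (at (gmul z (0 *\<^sub>R x)))" using assms by simp
  ultimately have "((\<lambda>t. f (gmul z (t *\<^sub>R x))) has_derivative (\<lambda>t. D (t *\<^sub>R E z x))) (at 0)"
    by (rule has_derivative_compose)
  then show ?thesis
    using linear_scale[OF has_derivative_linear[OF assms]] by (simp add: has_vector_derivative_def)
qed

lemma lvf_eq: "(f has_derivative D) (at z) \<Longrightarrow> lvf gmul x f z = D (E z x)"
  unfolding lvf_def by (rule vector_derivative_at[OF lvf_curve])

lemma lvf_along:
  assumes "f differentiable (at (gmul z (t *\<^sub>R x)))"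
  shows "((\<lambda>t. f (gmul z (t *\<^sub>R x))) has_vector_derivative lvf gmul x f (gmul z (t *\<^sub>R x))) (at t)"
proof (rule has_vector_derivative_shift)
  obtain D where D: "(f has_derivative D) (at (gmul z (t *\<^sub>R x)))"
    using assms differentiable_def by blast
  have "((\<lambda>h. f (gmul (gmul z (t *\<^sub>R x)) (h *\<^sub>R x))) has_vector_derivative lvf gmul x f (gmul z (t *\<^sub>R x))) (at 0)"
    unfolding lvf_eq[OF D] by (rule lvf_curve[OF D])
  then show "((\<lambda>h. f (gmul z ((t + h) *\<^sub>R x))) has_vector_derivative lvf gmul x f (gmul z (t *\<^sub>R x))) (at 0)"
    by (simp add: gmul_assoc gmul_scale)
qed

lemma smooth_differentiable: "smooth_fun f \<Longrightarrow> f differentiable (at x)"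
  using smooth_has_derivative differentiableI by blast

lemma lvf_smooth_eq: "smooth_fun f \<Longrightarrow> lvf gmul x f z = frechet_derivative f (at z) (E z x)"
  by (rule lvf_eq[OF smooth_has_derivative])

lemma lvf_smooth: "smooth_fun f \<Longrightarrow> smooth_fun (lvf gmul x f)"
proof (rule smooth_funI)
  fix n assume f: "smooth_fun f"
  have "Ck n (\<lambda>z. frechet_derivative f (at z) (E z x))"
    by (intro Ck_frechet_apply smooth_funD[OF f] Ck_id smooth_funD[OF E_smooth])
  moreover have "lvf gmul x f = (\<lambda>z. frechet_derivative f (at z) (E z x))"
    by (rule ext) (rule lvf_smooth_eq[OF f])
  ultimately show "Ck n (lvf gmul x f)" by simp
qed

lemma lvf_add:
  "f differentiable (at z) \<Longrightarrow> g differentiable (at z) \<Longrightarrow>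
    lvf gmul x (\<lambda>z. f z + g z) z = lvf gmul x f z + lvf gmul x g z"
  unfolding differentiable_def by (auto simp: lvf_eq lvf_eq[OF has_derivative_add])

lemma lvf_diff:
  "f differentiable (at z) \<Longrightarrow> g differentiable (at z) \<Longrightarrow>
    lvf gmul x (\<lambda>z. f z - g z) z = lvf gmul x f z - lvf gmul x g z"
  unfolding differentiable_def by (auto simp: lvf_eq lvf_eq[OF has_derivative_diff])

lemma lvf_cmult: "f differentiable (at z) \<Longrightarrow> lvf gmul x (\<lambda>z. c * f z) z = c * lvf gmul x f z"
  unfolding differentiable_def by (auto simp: lvf_eq lvf_eq[OF has_derivative_mult_right])

lemma lvf_mult:
  "f differentiable (at z) \<Longrightarrow> g differentiable (at z) \<Longrightarrow>
    lvf gmul x (\<lambda>z. f z * g z) z = f z * lvf gmul x g z + lvf gmul x f z * g z"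
  unfolding differentiable_def by (auto simp: lvf_eq lvf_eq[OF has_derivative_mult])

lemma lvf_cnj: "f differentiable (at z) \<Longrightarrow> lvf gmul x (\<lambda>z. cnj (f z)) z = cnj (lvf gmul x f z)"
  unfolding differentiable_def
  by (auto simp: lvf_eq lvf_eq[OF bounded_linear.has_derivative[OF bounded_linear_cnj]])

lemma lvf_sum:
  "(\<And>i. i \<in> I \<Longrightarrow> f i differentiable (at z)) \<Longrightarrow>
    lvf gmul x (\<lambda>z. \<Sum>i\<in>I. f i z) z = (\<Sum>i\<in>I. lvf gmul x (f i) z)"
proof (induction I rule: infinite_finite_induct)
  case (insert i I)
  then show ?case by (simp add: lvf_add)
qed (auto simp: lvf_def)

lemma lvf_direction:
  assumes "f differentiable (at z)"
  shows "lvf gmul (r *\<^sub>R x + s *\<^sub>R y) f z = r *\<^sub>R lvf gmul x f z + s *\<^sub>R lvf gmul y f z"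
proof -
  obtain D where D: "(f has_derivative D) (at z)" using assms differentiable_def by blast
  have "linear (\<lambda>v. D (E z v))"
    using linear_compose[OF E_linear has_derivative_linear[OF D]] by (simp add: o_def)
  then show ?thesis
    by (simp add: lvf_eq[OF D] linear_add[of "\<lambda>v. D (E z v)"] linear_scale[of "\<lambda>v. D (E z v)"])
qed

lemma lvf_automorphism:
  assumes "linear T" "\<And>x y. br (T x) (T y) = T (br x y)"
  shows "lvf gmul x (\<lambda>z. f (T z)) z = lvf gmul (T x) f (T z)"
  unfolding lvf_def automorphism_gmul[OF assms] linear_scale[OF assms(1)] ..

end

section \<open>Stratification and dilations\<close>

locale strat_group =
  fixes J :: "'g::euclidean_space \<Rightarrow> 'g" and br :: "'g \<Rightarrow> 'g \<Rightarrow> 'g" and V :: "nat \<Rightarrow> 'g set" and m :: nat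
    and gmul :: "'g \<Rightarrow> 'g \<Rightarrow> 'g"
  assumes strat: "stratified J br V m" and grp': "exp_identified_group br gmul"
begin

lemma cla: "complex_lie_algebra J br" and m_ge_1: "m \<ge> 1"
  and V_sub: "k \<in> {1..m} \<Longrightarrow> complex_subspace J (V k)"
  and V_ex1: "\<exists>!c. strat_decomp V m v c"
  and V_Suc: "1 \<le> j \<Longrightarrow> j < m \<Longrightarrow> V (Suc j) = span {br x y | x y. x \<in> V 1 \<and> y \<in> V j}"
  and V_top: "x \<in> V 1 \<Longrightarrow> y \<in> V m \<Longrightarrow> br x y = 0"
  using strat unfolding stratified_def by blast+

lemma J_linear: "linear J" and J_J [simp]: "J (J v) = - v" and br_bilinear: "bilinear br"
  and br_anti: "br x y = - br y x"
  and br_jacobi: "br x (br y z) + br y (br z x) + br z (br x y) = 0"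
  and br_J_left: "br (J x) y = J (br x y)"
  using cla unfolding complex_lie_algebra_def complex_structure_def by blast+

sublocale exp_group br gmul
  by unfold_locales (rule grp', rule br_bilinear)

lemma J_bounded_linear: "bounded_linear J"
  using J_linear by (simp add: linear_conv_bounded_linear)

lemma br_J_right: "br x (J y) = J (br x y)"
  using br_anti[of x "J y"] br_anti[of y x] by (simp add: br_J_left linear_neg[OF J_linear])

lemma E_J: "E z (J v) = J (E z v)"
  by (rule E_intertwine[OF J_linear br_J_right])

text \<open>Every tangent vector at \<open>z\<close> has the form \<open>E z u\<close>, and left
  translation carries it to \<open>E (gmul w z) u\<close>. Complex linearity of the frame thus
  passes to all left translations.\<close>

lemma left_J: "DG w z (0, J v) = J (DG w z (0, v))"
  using E_left[of w z "J (om z v)"] E_left[of w z "om z v"] by (simp add: E_J)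

text \<open>Inversion is \<open>y \<mapsto> - y\<close> and conjugates right translation by
  \<open>w\<close> into left translation by \<open>- w\<close>.\<close>

lemma right_J: "DG z w (J v, 0) = J (DG z w (v, 0))"
proof -
  have eq: "DG z w (u, 0) = DG (- w) (- z) (0, u)" for u
  proof -
    have "((\<lambda>y. - y) has_derivative (\<lambda>v. - v)) (at z)" by (auto intro!: derivative_eq_intros)
    from has_derivative_minus[OF has_derivative_compose[OF this left_has_derivative[of "- w" "- z"]]]
    have "((\<lambda>y. - gmul (- w) (- y)) has_derivative (\<lambda>v. - DG (- w) (- z) (0, - v))) (at z)" .
    then have "((\<lambda>y. gmul y w) has_derivative (\<lambda>v. - DG (- w) (- z) (0, - v))) (at z)"
      by (simp add: minus_gmul)
    from fun_cong[OF has_derivative_unique[OF right_has_derivative this], of u]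
    show ?thesis using linear_neg[OF DG_linear, of "- w" "- z" "(0, u)"] by simp
  qed
  show ?thesis unfolding eq by (rule left_J)
qed

lemma cscale_linear: "linear (cscale J c)"
  unfolding cscale_def[abs_def]
  by (intro linear_compose_add linear_compose_scale_right linear_id[unfolded id_def] J_linear)

lemma cscale_cscale: "cscale J c (cscale J d v) = cscale J (c * d) v"
  by (simp add: cscale_def linear_add[OF J_linear] linear_scale[OF J_linear] algebra_simps)

lemma cscale_of_real: "cscale J (of_real r) v = r *\<^sub>R v"
  by (simp add: cscale_def)

lemma cscale_1 [simp]: "cscale J 1 v = v" and cscale_0 [simp]: "cscale J 0 v = 0" and cscale_i: "cscale J \<i> v = J v"
  by (simp_all add: cscale_def)

lemma cscale_J: "cscale J c (J v) = J (cscale J c v)"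
  using cscale_cscale[of c \<i> v] cscale_cscale[of \<i> c v] by (simp add: cscale_i mult.commute)

lemma cscale_V: "k \<in> {1..m} \<Longrightarrow> v \<in> V k \<Longrightarrow> cscale J c v \<in> V k"
  using V_sub[of k] unfolding cscale_def complex_subspace_def
  by (simp add: subspace_add subspace_scale)

lemma br_cscale: "br (cscale J c x) (cscale J d y) = cscale J (c * d) (br x y)"
proof -
  have l: "br (cscale J c x) y = cscale J c (br x y)" for c x y
    unfolding cscale_def by (simp add: bilinear_ladd[OF br_bilinear] bilinear_lmul[OF br_bilinear] br_J_left)
  have "br x (cscale J d y) = cscale J d (br x y)" for x
    unfolding cscale_def by (simp add: bilinear_radd[OF br_bilinear] bilinear_rmul[OF br_bilinear] br_J_right)
  then show ?thesis by (simp add: l cscale_cscale mult.commute)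
qed

lemma cscale_bounded: obtains C where "C > 0" "\<And>c v. norm (cscale J c v) \<le> C * (norm c * norm v)"
proof -
  obtain K where K: "K > 0" "\<And>v. norm (J v) \<le> norm v * K"
    using bounded_linear.pos_bounded[of J] J_linear by (auto simp: linear_conv_bounded_linear)
  have "norm (cscale J c v) \<le> (1 + K) * (norm c * norm v)" for c v
  proof -
    have "norm (cscale J c v) \<le> \<bar>Re c\<bar> * norm v + \<bar>Im c\<bar> * norm (J v)"
      unfolding cscale_def by (rule order_trans[OF norm_triangle_ineq]) simp
    also have "\<dots> \<le> norm c * norm v + norm c * (norm v * K)"
      by (intro add_mono mult_mono K abs_Re_le_cmod abs_Im_le_cmod) auto
    finally show ?thesis by (simp add: algebra_simps)
  qed
  then show ?thesis using that[of "1 + K"] K(1) by auto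
qed

lemma cscale_continuous:
  assumes "continuous_on S f" "continuous_on S g" shows "continuous_on S (\<lambda>t. cscale J (f t) (g t))"
  unfolding cscale_def
  using assms by (intro continuous_intros bounded_linear.continuous_on[OF J_bounded_linear])

lemma cscale_has_derivative:
  assumes "(f has_derivative f') (at t)"
  shows "((\<lambda>t. cscale J (f t) v) has_derivative (\<lambda>h. cscale J (f' h) v)) (at t)"
  unfolding cscale_def using assms
  by (intro has_derivative_add has_derivative_scaleR_left has_derivative_Re has_derivative_Im)

section \<open>Components, dilations and the grading of the bracket\<close>

abbreviation comp :: "'g \<Rightarrow> nat \<Rightarrow> 'g" where "comp v k \<equiv> strat_comp V m v k"

lemma comp_decomp: "strat_decomp V m v (strat_comp V m v)"
  unfolding strat_comp_def by (rule theI'[OF V_ex1])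

lemma comp_unique: "strat_decomp V m v c \<Longrightarrow> strat_comp V m v = c"
  unfolding strat_comp_def by (rule the1_equality[OF V_ex1])

lemma comp_in: "k \<in> {1..m} \<Longrightarrow> comp v k \<in> V k" and comp_out: "k \<notin> {1..m} \<Longrightarrow> comp v k = 0"
  and comp_sum: "(\<Sum>k=1..m. comp v k) = v"
  using comp_decomp[of v] unfolding strat_decomp_def by auto

lemma comp_sum' [simp]: "(\<Sum>k=Suc 0..m. comp v k) = v"
  using comp_sum[of v] by simp

lemma V_subspace: "k \<in> {1..m} \<Longrightarrow> subspace (V k)"
  using V_sub unfolding complex_subspace_def by blast

lemma comp_linear: "linear (\<lambda>v. comp v k)"
proof (rule linearI)
  fix u v c
  have "strat_decomp V m (u + v) (\<lambda>k. comp u k + comp v k)"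
    unfolding strat_decomp_def
    by (auto simp: sum.distrib comp_sum comp_out intro!: subspace_add V_subspace comp_in)
  then show "comp (u + v) k = comp u k + comp v k" by (rule comp_unique[THEN fun_cong])
  have "strat_decomp V m (c *\<^sub>R v) (\<lambda>k. c *\<^sub>R comp v k)"
    unfolding strat_decomp_def
    by (auto simp: scaleR_sum_right[symmetric] comp_sum comp_out intro!: subspace_scale V_subspace comp_in)
  then show "comp (c *\<^sub>R v) k = c *\<^sub>R comp v k" by (rule comp_unique[THEN fun_cong])
qed

lemma comp_bounded_linear: "bounded_linear (\<lambda>v. comp v k)"
  using comp_linear by (simp add: linear_conv_bounded_linear)

lemma comp_in_V:
  assumes "j \<in> {1..m}" "v \<in> V j" shows "comp v k = (if k = j then v else 0)"
proof -
  have "strat_decomp V m v (\<lambda>k. if k = j then v else 0)"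
    unfolding strat_decomp_def using assms by (auto simp: subspace_0[OF V_subspace])
  then show ?thesis by (rule comp_unique[THEN fun_cong])
qed

lemma dil_linear: "linear (dil J V m l)"
  unfolding dil_def[abs_def]
  by (intro linear_compose_sum ballI) (rule linear_compose[OF comp_linear cscale_linear, unfolded o_def])

lemma comp_dil: "comp (dil J V m l v) k = (if k \<in> {1..m} then cscale J (l ^ k) (comp v k) else 0)"
proof -
  have "strat_decomp V m (dil J V m l v) (\<lambda>k. if k \<in> {1..m} then cscale J (l ^ k) (comp v k) else 0)"
    unfolding strat_decomp_def by (auto simp: dil_def intro!: cscale_V comp_in)
  then show ?thesis by (rule comp_unique[THEN fun_cong])
qed

lemma dil_dil: "dil J V m a (dil J V m b v) = dil J V m (a * b) v"
  by (simp add: dil_def[of _ _ _ a] dil_def[of _ _ _ "a * b"] comp_dil cscale_cscale power_mult_distrib)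

lemma dil_1 [simp]: "dil J V m 1 v = v"
  by (simp add: dil_def)

lemma dil_0 [simp]: "dil J V m 0 v = 0"
  unfolding dil_def by (intro sum.neutral ballI) (simp add: power_0_left)

lemma dil_zero [simp]: "dil J V m l 0 = 0"
  by (rule linear_0[OF dil_linear])

lemma dil_V:
  assumes "j \<in> {1..m}" "v \<in> V j" shows "dil J V m l v = cscale J (l ^ j) v"
proof -
  have "dil J V m l v = (\<Sum>k=1..m. if k = j then cscale J (l ^ j) v else 0)"
    unfolding dil_def comp_in_V[OF assms] by (intro sum.cong) (auto simp: linear_0[OF cscale_linear])
  also have "\<dots> = cscale J (l ^ j) v" using assms(1) by simp
  finally show ?thesis .
qed

lemma dil_V1: "x \<in> V 1 \<Longrightarrow> dil J V m l x = cscale J l x"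
  using dil_V[of 1 x l] m_ge_1 by simp

lemma V1_J: "x \<in> V 1 \<Longrightarrow> J x \<in> V 1"
  using V_sub[of 1] m_ge_1 unfolding complex_subspace_def by auto

lemma comp_J: "comp (J v) k = J (comp v k)"
proof -
  have "strat_decomp V m (J v) (\<lambda>k. J (comp v k))"
    unfolding strat_decomp_def using V_sub comp_in
    by (auto simp: linear_sum[OF J_linear, symmetric] comp_sum comp_out linear_0[OF J_linear] complex_subspace_def)
  then show ?thesis by (rule comp_unique[THEN fun_cong])
qed

lemma dil_J: "dil J V m l (J v) = J (dil J V m l v)"
  by (simp add: dil_def comp_J cscale_J linear_sum[OF J_linear])

text \<open>The layers extended by zero outside \<open>{1..m}\<close>, so that degrees can be added
  without asking whether the sum still lies in the range.\<close>

definition Vx :: "nat \<Rightarrow> 'g set" where "Vx k = (if k \<in> {1..m} then V k else {0})"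

lemma Vx_subspace: "subspace (Vx k)"
  unfolding Vx_def using V_subspace by simp

lemma br_V1: assumes "x \<in> V 1" "u \<in> Vx k" "k \<ge> 1" shows "br x u \<in> Vx (Suc k)"
proof -
  consider "k < m" | "k = m" | "k > m" by linarith
  then show ?thesis
  proof cases
    case 1
    then have "br x u \<in> V (Suc k)"
      using assms V_Suc[of k] by (auto simp: Vx_def intro!: span_base)
    then show ?thesis using 1 by (simp add: Vx_def)
  next
    case 2
    then have "br x u = 0" using assms V_top m_ge_1 by (simp add: Vx_def)
    then show ?thesis by (simp add: subspace_0[OF Vx_subspace])
  next
    case 3
    then have "br x u = 0" using assms bilinear_rzero[OF br_bilinear] by (simp add: Vx_def)
    then show ?thesis by (simp add: subspace_0[OF Vx_subspace])
  qed
qed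

text \<open>The stratification prescribes brackets with \<open>V 1\<close> only. The layer of degree
  \<open>Suc i\<close> is spanned by brackets \<open>br a b\<close> with \<open>a\<close> in
  \<open>V 1\<close>, and the Jacobi identity turns \<open>br (br a b) y\<close> into
  \<open>br a (br b y) - br b (br a y)\<close>, where \<open>b\<close> has the lower degree
  \<open>i\<close>.\<close>

lemma br_grade: "i \<ge> 1 \<Longrightarrow> j \<ge> 1 \<Longrightarrow> x \<in> Vx i \<Longrightarrow> y \<in> Vx j \<Longrightarrow> br x y \<in> Vx (i + j)"
proof (induction i arbitrary: j x y rule: nat_induct_at_least[where m=1])
  case base
  then show ?case using br_V1[of x y j] m_ge_1 by (simp add: Vx_def)
next
  case (Suc i)
  show ?case
  proof (cases "Suc i \<le> m")
    case False
    then have "br x y = 0" using Suc.prems bilinear_lzero[OF br_bilinear] by (simp add: Vx_def)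
    then show ?thesis by (simp add: subspace_0[OF Vx_subspace])
  next
    case True
    then have iV: "Vx i = V i" using Suc.hyps by (simp add: Vx_def)
    have "x \<in> span {br x y | x y. x \<in> V 1 \<and> y \<in> V i}"
      using Suc.prems True V_Suc[of i] Suc.hyps by (simp add: Vx_def)
    then show ?thesis
    proof (rule span_induct)
      show "subspace {x. br x y \<in> Vx (Suc i + j)}"
        unfolding subspace_def
        using Vx_subspace[of "Suc i + j"] bilinear_lzero[OF br_bilinear]
        by (simp add: bilinear_ladd[OF br_bilinear] bilinear_lmul[OF br_bilinear] subspace_0 subspace_add subspace_scale)
      fix u assume "u \<in> {br x y | x y. x \<in> V 1 \<and> y \<in> V i}"
      then obtain a b where u: "u = br a b" "a \<in> V 1" "b \<in> V i" by blast
      have "br u y = br a (br b y) - br b (br a y)"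
      proof -
        have "br u y = - br y (br a b)" using br_anti[of "br a b" y] by (simp add: u)
        also have "\<dots> = br a (br b y) + br b (br y a)"
          using br_jacobi[of a b y] by (simp add: add_eq_0_iff2)
        also have "br b (br y a) = - br b (br a y)"
          using br_anti[of y a] bilinear_rneg[OF br_bilinear] by simp
        finally show ?thesis by simp
      qed
      moreover have "br a (br b y) \<in> Vx (Suc (i + j))"
        using Suc.IH[OF Suc.prems(1), of b y] u iV Suc.prems Suc.hyps by (intro br_V1) auto
      moreover have "br b (br a y) \<in> Vx (i + Suc j)"
        using u iV Suc.prems by (intro Suc.IH br_V1) auto
      ultimately show "br u y \<in> Vx (Suc i + j)"
        using subspace_diff[OF Vx_subspace] by simp
    qed
  qed
qed

lemma dil_Vx: "u \<in> Vx k \<Longrightarrow> dil J V m l u = cscale J (l ^ k) u"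
  using dil_V[of k u l] by (cases "k \<in> {1..m}") (auto simp: Vx_def linear_0[OF cscale_linear])

lemma dil_br: "br (dil J V m l x) (dil J V m l y) = dil J V m l (br x y)"
proof -
  have dbl: "br (\<Sum>i=1..m. a i) (\<Sum>j=1..m. b j) = (\<Sum>i=1..m. \<Sum>j=1..m. br (a i) (b j))" for a b
    using bilinear_sum[OF br_bilinear, of a "{1..m}" b "{1..m}"] by (simp add: sum.cartesian_product)
  have "br (dil J V m l x) (dil J V m l y) = (\<Sum>i=1..m. \<Sum>j=1..m. cscale J (l ^ (i + j)) (br (comp x i) (comp y j)))"
    unfolding dil_def dbl by (simp add: br_cscale power_add)
  also have "\<dots> = (\<Sum>i=1..m. \<Sum>j=1..m. dil J V m l (br (comp x i) (comp y j)))"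
    by (intro sum.cong refl dil_Vx[symmetric] br_grade) (auto simp: Vx_def comp_in[simplified])
  also have "\<dots> = dil J V m l (br (\<Sum>i=1..m. comp x i) (\<Sum>i=1..m. comp y i))"
    unfolding dbl by (simp add: linear_sum[OF dil_linear])
  finally show ?thesis by (simp add: comp_sum)
qed

lemma lvf_dil: "lvf gmul x (\<lambda>z. f (dil J V m l z)) z = lvf gmul (dil J V m l x) f (dil J V m l z)"
  by (rule lvf_automorphism[OF dil_linear dil_br])

lemma dil_continuous:
  assumes "continuous_on S f" "continuous_on S g" shows "continuous_on S (\<lambda>t. dil J V m (f t) (g t))"
  unfolding dil_def
  using assms
  by (intro continuous_intros cscale_continuous bounded_linear.continuous_on[OF comp_bounded_linear])

lemma dil_bounded_linear: "bounded_linear (dil J V m l)"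
  using dil_linear by (simp add: linear_conv_bounded_linear)

lemma dil_has_derivative:
  "((\<lambda>l. dil J V m l z) has_derivative (\<lambda>h. \<Sum>k=1..m. cscale J (of_nat k * h * l ^ (k - 1)) (comp z k))) (at l)"
  unfolding dil_def by (intro has_derivative_sum cscale_has_derivative has_derivative_power) (rule has_derivative_ident)

text \<open>A field from \<open>V 1\<close> is multiplied by \<open>r\<close> under the dilation, so
  differentiating along it divides the factor \<open>b\<close> by \<open>r\<close>. The affine term
  \<open>a\<close> is allowed because \<open>Psi\<close> is homogeneous only after subtracting
  1.\<close>

lemma lvf_scaling:
  fixes f :: "'g \<Rightarrow> complex"
  assumes f: "\<And>z. f differentiable (at z)" and x: "x \<in> V 1" and r: "r > 0"
    and hom: "\<And>z. f (dil J V m (of_real r) z) = a + b * f z"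
  shows "lvf gmul x f (dil J V m (of_real r) z) = (b / of_real r) * lvf gmul x f z"
proof -
  have "b * lvf gmul x f z = lvf gmul x (\<lambda>z. a + b * f z) z"
  proof -
    have "lvf gmul x (\<lambda>z. a + b * f z) z = lvf gmul x (\<lambda>z. a) z + lvf gmul x (\<lambda>z. b * f z) z"
      using f by (intro lvf_add differentiable_const differentiable_mult)
    moreover have "lvf gmul x (\<lambda>z. a) z = 0" by (simp add: lvf_def)
    ultimately show ?thesis using lvf_cmult[OF f] by simp
  qed
  also have "\<dots> = lvf gmul (dil J V m (of_real r) x) f (dil J V m (of_real r) z)"
    unfolding hom[symmetric] by (rule lvf_dil)
  also have "dil J V m (of_real r) x = r *\<^sub>R x + 0 *\<^sub>R x"
    by (simp add: dil_V1[OF x] cscale_of_real)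
  finally show ?thesis using r by (simp add: lvf_direction[OF f] scaleR_conv_of_real field_simps del: scaleR_zero_left add_0_right)
qed

subsection \<open>Homogeneous gauge functions\<close>

text \<open>A smooth power of a homogeneous gauge. The squared norm of the component of degree
  \<open>k\<close> scales with \<open>r ^ (2 * k)\<close>; the exponent
  \<open>q * (fact m div k)\<close> gives all summands the common degree
  \<open>2 * q * fact m\<close> and is an integer because \<open>k\<close> divides
  \<open>fact m\<close>. Raising \<open>q\<close> lets \<open>Psi\<close> dominate any polynomial
  growth.\<close>

definition Psi :: "nat \<Rightarrow> 'g \<Rightarrow> real" where
  "Psi q z = 1 + (\<Sum>k=1..m. (comp z k \<bullet> comp z k) ^ (q * (fact m div k)))"

lemma Psi_smooth: "smooth_fun (Psi q)"
proof (rule smooth_funI)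
  fix n
  have "Ck n (\<lambda>z. comp z k)" for k
    using comp_linear by (intro Ck_bounded_linear[of "\<lambda>z. comp z k", OF _ Ck_id]) (simp add: linear_conv_bounded_linear)
  then show "Ck n (Psi q)"
    unfolding Psi_def[abs_def]
    by (intro Ck_add Ck_const Ck_sum Ck_power Ck_bounded_bilinear[OF bounded_bilinear_inner])
qed

lemma Psi_ge_1: "1 \<le> Psi q z"
  unfolding Psi_def by (simp add: sum_nonneg)

lemma Psi_dil:
  assumes "r \<ge> 0"
  shows "Psi q (dil J V m (of_real r) z) - 1 = r ^ (2 * q * fact m) * (Psi q z - 1)"
proof -
  have "(comp (dil J V m (of_real r) z) k \<bullet> comp (dil J V m (of_real r) z) k) ^ (q * (fact m div k))
      = r ^ (2 * q * fact m) * (comp z k \<bullet> comp z k) ^ (q * (fact m div k))" if k: "k \<in> {1..m}" for k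
  proof -
    have "k dvd fact m" using k by (intro dvd_fact) auto
    then have km: "k * (fact m div k) = fact m" by simp
    have "comp (dil J V m (of_real r) z) k = r ^ k *\<^sub>R comp z k"
      using k cscale_of_real[of "r ^ k"] by (simp add: comp_dil)
    then have "comp (dil J V m (of_real r) z) k \<bullet> comp (dil J V m (of_real r) z) k = r ^ (2 * k) * (comp z k \<bullet> comp z k)"
      by (simp add: mult_2 power_add)
    moreover have "(r ^ (2 * k)) ^ (q * (fact m div k)) = r ^ (2 * q * (k * (fact m div k)))"
      by (simp add: power_mult[symmetric] ac_simps)
    ultimately show ?thesis by (simp add: power_mult_distrib km)
  qed
  then show ?thesis unfolding Psi_def by (simp add: sum_distrib_left)
qed

lemma Psi_compact:
  assumes q: "q \<ge> 1" shows "compact {z. Psi q z \<le> c}"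
proof -
  have "norm z \<le> real m * (1 + \<bar>c\<bar>)" if z: "Psi q z \<le> c" for z
  proof -
    have "norm (comp z k) \<le> 1 + \<bar>c\<bar>" if k: "k \<in> {1..m}" for k
    proof (rule ccontr)
      assume "\<not> ?thesis"
      then have n: "norm (comp z k) > 1 + \<bar>c\<bar>" by simp
      have "fact m div k \<ge> 1"
        using k dvd_imp_le[OF dvd_fact[of k m]] by (simp add: Suc_le_eq div_greater_zero_iff)
      then have e: "q * (fact m div k) \<ge> 1" using q by (metis mult_le_mono nat_mult_1)
      have 1: "norm (comp z k) \<le> comp z k \<bullet> comp z k"
        using n abs_ge_zero[of c] by (auto simp: dot_square_norm power2_eq_square mult_le_cancel_left1)
      have "(comp z k \<bullet> comp z k) ^ 1 \<le> (comp z k \<bullet> comp z k) ^ (q * (fact m div k))"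
        using 1 n e by (intro power_increasing) auto
      also have "\<dots> \<le> (\<Sum>k=1..m. (comp z k \<bullet> comp z k) ^ (q * (fact m div k)))"
        using k by (intro member_le_sum) auto
      also have "\<dots> \<le> c" using z unfolding Psi_def by simp
      finally show False using 1 n by simp
    qed
    then have "(\<Sum>k=1..m. norm (comp z k)) \<le> (\<Sum>k=1..m. 1 + \<bar>c\<bar>)" by (intro sum_mono)
    moreover have "norm z \<le> (\<Sum>k=1..m. norm (comp z k))"
      using norm_sum[of "comp z" "{1..m}"] by (simp add: comp_sum)
    ultimately show ?thesis by simp
  qed
  then have "bounded {z. Psi q z \<le> c}" unfolding bounded_iff by blast
  moreover have "closed {z. Psi q z \<le> c}"
    using smooth_continuous[OF Psi_smooth] by (intro closed_Collect_le) auto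
  ultimately show ?thesis by (simp add: compact_eq_bounded_closed)
qed

text \<open>A point far out is the expansion, by some \<open>R \<ge> 1\<close>, of a point in the
  compact set where \<open>C\<close> is known, and along this expansion \<open>norm (F z)\<close>
  grows at most as fast as \<open>Psi\<close>. This is how every global bound by \<open>Psi\<close>
  arises.\<close>

lemma hom_bound:
  fixes F :: "'g \<Rightarrow> 'b::real_normed_vector"
  assumes F: "continuous_on UNIV F" and q: "q \<ge> 1" and d: "d \<le> 2 * q * fact m"
    and hom: "\<And>r z. r \<ge> 1 \<Longrightarrow> norm (F (dil J V m (of_real r) z)) \<le> r ^ d * norm (F z)"
    and C: "\<And>z. Psi q z \<le> 2 \<Longrightarrow> norm (F z) \<le> C"
  shows "norm (F z) \<le> C * Psi q z"
proof -
  \<comment> \<open>The origin lies in the set on which \<open>C\<close> is a bound, since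
    \<open>Psi q 0 = 1\<close>.\<close>
  have C0: "C \<ge> 0"
  proof -
    have "Psi q 0 - 1 = 0 ^ (2 * q * fact m) * (Psi q 0 - 1)" using Psi_dil[of 0 q 0] by simp
    then have "Psi q 0 = 1" using q by (simp add: power_0_left)
    then show ?thesis using C[of 0] norm_ge_zero[of "F 0"] by linarith
  qed
  show ?thesis
  proof (cases "Psi q z \<le> 2")
    case True
    then have "norm (F z) \<le> C * 1" using C by simp
    also have "\<dots> \<le> C * Psi q z" using Psi_ge_1 C0 by (intro mult_left_mono)
    finally show ?thesis .
  next
    case False
    define N where "N = (2 * q * fact m :: nat)"
    have N: "N > 0" using q by (simp add: N_def)
    \<comment> \<open>Chosen so that the contracted point \<open>w\<close> satisfies
      \<open>Psi q w = 2\<close>, the border of the set where \<open>C\<close> applies.\<close>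
    define R where "R = root N (Psi q z - 1)"
    have RN: "R ^ N = Psi q z - 1" using N False by (simp add: R_def)
    have R1: "R \<ge> 1" using N False by (simp add: R_def)
    define w where "w = dil J V m (of_real (1 / R)) z"
    have zw: "z = dil J V m (of_real R) w"
      using R1 by (simp add: w_def dil_dil flip: of_real_mult)
    have "Psi q w - 1 = (1 / R) ^ N * R ^ N"
      unfolding RN unfolding w_def N_def using R1 by (intro Psi_dil) simp
    also have "\<dots> = 1" using R1 by (simp flip: power_mult_distrib)
    finally have "norm (F w) \<le> C" by (intro C) simp
    have "norm (F z) \<le> R ^ d * norm (F w)" unfolding zw by (rule hom[OF R1])
    also have "\<dots> \<le> R ^ N * C"
      using R1 d \<open>norm (F w) \<le> C\<close> by (intro mult_mono power_increasing) (auto simp: N_def)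
    also have "\<dots> \<le> C * Psi q z" unfolding RN using C0 by (simp add: algebra_simps)
    finally show ?thesis .
  qed
qed

lemma hom_bound_ex:
  fixes F :: "'g \<Rightarrow> 'b::real_normed_vector"
  assumes F: "continuous_on UNIV F" and q: "q \<ge> 1" and d: "d \<le> 2 * q * fact m"
    and hom: "\<And>r z. r \<ge> 1 \<Longrightarrow> norm (F (dil J V m (of_real r) z)) \<le> r ^ d * norm (F z)"
  shows "\<exists>C. \<forall>z. norm (F z) \<le> C * Psi q z"
proof -
  have "bounded (F ` {z. Psi q z \<le> 2})"
    by (intro compact_imp_bounded compact_continuous_image continuous_on_subset[OF F] Psi_compact[OF q] subset_UNIV)
  then obtain C where "\<And>z. Psi q z \<le> 2 \<Longrightarrow> norm (F z) \<le> C" unfolding bounded_iff by auto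
  then show ?thesis using hom_bound[OF F q d hom] by blast
qed

end

section \<open>Holomorphic functions\<close>

text \<open>Cauchy's formula with the unit circle parametrised by its angle. The case
  \<open>k = 1\<close> recovers derivatives from values, general \<open>k\<close> yields homogeneous
  components.\<close>

lemma circle_coefficient:
  fixes h :: "complex \<Rightarrow> complex"
  assumes "h holomorphic_on UNIV"
  shows "((\<lambda>t. h (cis t) * cis (- (real k * t))) has_integral (2 * pi * ((deriv ^^ k) h 0 / fact k))) {0..2 * pi}"
proof -
  have "((\<lambda>u. h u / (u - 0) ^ (Suc k)) has_contour_integral ((2 * pi * \<i>) / (fact k) * (deriv ^^ k) h 0)) (circlepath 0 1)"
    using assms holomorphic_on_subset holomorphic_on_imp_continuous_on
    by (intro Cauchy_has_contour_integral_higher_derivative_circlepath) (blast, blast, simp)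
  then have "((\<lambda>t. h (0 + of_real 1 * cis t) / (0 + of_real 1 * cis t - 0) ^ (Suc k) * of_real 1 * \<i> * cis t)
      has_integral ((2 * pi * \<i>) / (fact k) * (deriv ^^ k) h 0)) {0..2 * pi}"
    unfolding circlepath_def by (subst (asm) has_contour_integral_part_circlepath_iff) auto
  from has_integral_mult_right[OF this, of "- \<i>"]
  have "((\<lambda>t. - \<i> * (h (0 + of_real 1 * cis t) / (0 + of_real 1 * cis t - 0) ^ (Suc k) * of_real 1 * \<i> * cis t))
      has_integral (- \<i> * ((2 * pi * \<i>) / (fact k) * (deriv ^^ k) h 0))) {0..2 * pi}" .
  moreover have "- \<i> * (h (0 + of_real 1 * cis t) / (0 + of_real 1 * cis t - 0) ^ (Suc k) * of_real 1 * \<i> * cis t)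
      = h (cis t) * cis (- (real k * t))" for t
  proof -
    have "cis (- (real k * t)) = inverse (cis t ^ k)" by (simp only: Complex.DeMoivre cis_inverse)
    moreover have "- \<i> * (H / (0 + of_real 1 * c - 0) ^ (Suc k) * of_real 1 * \<i> * c) = H * inverse (c ^ k)"
      if "c \<noteq> 0" for H c :: complex
      using that by (simp add: field_simps)
    ultimately show ?thesis by simp
  qed
  moreover have "- \<i> * ((2 * pi * \<i>) / (fact k) * (deriv ^^ k) h 0) = 2 * pi * ((deriv ^^ k) h 0 / fact k)"
    by (simp add: field_simps)
  ultimately show ?thesis by simp
qed

context strat_group
begin

abbreviation fd :: "('g \<Rightarrow> complex) \<Rightarrow> 'g \<Rightarrow> 'g \<Rightarrow> complex" where
  "fd f z \<equiv> frechet_derivative f (at z)"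

lemma holoI:
  "(\<And>z. (f has_derivative D z) (at z)) \<Longrightarrow> (\<And>z v. D z (J v) = \<i> * D z v) \<Longrightarrow> holo J f"
  unfolding holo_def by blast

lemma holo_has_derivative: "holo J f \<Longrightarrow> (f has_derivative fd f z) (at z)"
  unfolding holo_def using frechet_derivative_works differentiableI by blast

lemma holo_fd_J:
  assumes "holo J f" shows "fd f z (J v) = \<i> * fd f z v"
proof -
  obtain D where D: "(f has_derivative D) (at z)" "\<And>v. D (J v) = \<i> * D v"
    using assms unfolding holo_def by blast
  then show ?thesis using frechet_derivative_at[OF D(1)] by simp
qed

lemma holo_differentiable: "holo J f \<Longrightarrow> f differentiable (at z)"
  using holo_has_derivative differentiableI by blast

lemma holo_continuous: "holo J f \<Longrightarrow> continuous_on UNIV f"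
  using holo_has_derivative has_derivative_continuous by (intro continuous_at_imp_continuous_on) blast

lemma holo_const: "holo J (\<lambda>z. c)"
  by (rule holoI[where D="\<lambda>z v. 0"]) auto

lemma holo_add: assumes "holo J f" "holo J g" shows "holo J (\<lambda>z. f z + g z)"
  by (rule holoI[OF has_derivative_add[OF holo_has_derivative[OF assms(1)] holo_has_derivative[OF assms(2)]]])
     (simp add: assms holo_fd_J algebra_simps)

lemma holo_cmult: assumes "holo J f" shows "holo J (\<lambda>z. c * f z)"
  by (rule holoI[OF has_derivative_mult_right[OF holo_has_derivative[OF assms]]])
     (simp add: assms holo_fd_J algebra_simps)

lemma holo_diff: assumes "holo J f" "holo J g" shows "holo J (\<lambda>z. f z - g z)"
  using holo_add[OF assms(1) holo_cmult[OF assms(2), of "- 1"]] by simp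

lemma holo_sum: "(\<And>i. i \<in> I \<Longrightarrow> holo J (f i)) \<Longrightarrow> holo J (\<lambda>z. \<Sum>i\<in>I. f i z)"
  by (induction I rule: infinite_finite_induct) (auto intro: holo_const holo_add)

lemma holo_compose:
  assumes f: "holo J f" and \<phi>: "\<And>z. (\<phi> has_derivative \<phi>' z) (at z)" and J: "\<And>z v. \<phi>' z (J v) = J (\<phi>' z v)"
  shows "holo J (\<lambda>z. f (\<phi> z))"
  by (rule holoI[OF has_derivative_compose[OF \<phi> holo_has_derivative[OF f]]]) (simp add: J holo_fd_J[OF f])

lemma holo_translate: "holo J f \<Longrightarrow> holo J (\<lambda>z. f (z + w))"
  by (rule holo_compose[where \<phi>'="\<lambda>z v. v"]) (auto intro!: derivative_eq_intros)

lemma holo_right: "holo J f \<Longrightarrow> holo J (\<lambda>z. f (gmul z w))"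
  by (rule holo_compose[OF _ right_has_derivative]) (auto simp: right_J)

lemma holo_dil: "holo J f \<Longrightarrow> holo J (\<lambda>z. f (dil J V m l z))"
  by (rule holo_compose[where \<phi>'="\<lambda>z. dil J V m l"])
     (auto simp: dil_J intro: bounded_linear_imp_has_derivative dil_bounded_linear)

text \<open>One rule for affine complex lines, left translates of complex lines and dilation orbits:
  the derivative of the curve intertwines \<open>\<i>\<close> with \<open>J\<close>, so it is
  determined by its value at 1.\<close>

lemma holo_curve:
  assumes f: "holo J f" and \<phi>: "(\<phi> has_derivative \<phi>') (at c)" and J: "\<And>h. \<phi>' (\<i> * h) = J (\<phi>' h)"
  shows "((\<lambda>c. f (\<phi> c)) has_field_derivative fd f (\<phi> c) (\<phi>' 1)) (at c)"
  unfolding has_field_derivative_def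
proof (rule has_derivative_eq_rhs[OF has_derivative_compose[OF \<phi> holo_has_derivative[OF f]]], rule ext)
  fix h :: complex
  have l: "linear \<phi>'" by (rule has_derivative_linear[OF \<phi>])
  have D: "linear (fd f (\<phi> c))" by (rule has_derivative_linear[OF holo_has_derivative[OF f]])
  have "\<phi>' h = \<phi>' (Re h *\<^sub>R 1 + Im h *\<^sub>R (\<i> * 1))"
    by (simp add: scaleR_conv_of_real mult.commute[of _ \<i>] flip: complex_eq)
  also have "\<dots> = Re h *\<^sub>R \<phi>' 1 + Im h *\<^sub>R J (\<phi>' 1)"
    by (simp only: linear_add[OF l] linear_scale[OF l] J)
  finally have "fd f (\<phi> c) (\<phi>' h) = Re h *\<^sub>R fd f (\<phi> c) (\<phi>' 1) + Im h *\<^sub>R (\<i> * fd f (\<phi> c) (\<phi>' 1))"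
    by (simp add: linear_add[OF D] linear_scale[OF D] holo_fd_J[OF f])
  also have "\<dots> = (of_real (Re h) + \<i> * of_real (Im h)) * fd f (\<phi> c) (\<phi>' 1)"
    by (simp add: scaleR_conv_of_real algebra_simps)
  also have "\<dots> = fd f (\<phi> c) (\<phi>' 1) * h" by (simp flip: complex_eq add: mult.commute)
  finally show "fd f (\<phi> c) (\<phi>' h) = fd f (\<phi> c) (\<phi>' 1) * h" .
qed

lemma cscale_mult_i: "cscale J (\<i> * h) v = J (cscale J h v)"
  using cscale_cscale[of \<i> h v] by (simp add: cscale_i)

lemma holo_slice:
  assumes "holo J f"
  shows "((\<lambda>c. f (z + cscale J c v)) has_field_derivative fd f (z + cscale J c v) v) (at c)"
proof -
  have "((\<lambda>c. z + cscale J c v) has_derivative (\<lambda>h. cscale J h v)) (at c)"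
    using has_derivative_add[OF has_derivative_const cscale_has_derivative[OF has_derivative_ident]] by simp
  from holo_curve[OF assms this] show ?thesis by (simp add: cscale_mult_i)
qed

lemma holo_left_slice:
  assumes "holo J f"
  shows "((\<lambda>c. f (gmul z (cscale J c x))) has_field_derivative fd f (gmul z (cscale J c x)) (DG z (cscale J c x) (0, x))) (at c)"
proof -
  have "((\<lambda>c. gmul z (cscale J c x)) has_derivative (\<lambda>h. DG z (cscale J c x) (0, cscale J h x))) (at c)"
    by (rule has_derivative_compose[OF cscale_has_derivative[OF has_derivative_ident] left_has_derivative])
  from holo_curve[OF assms this] show ?thesis by (simp add: cscale_mult_i left_J)
qed

lemma holo_dil_slice:
  assumes "holo J f" shows "(\<lambda>l. f (dil J V m l z)) holomorphic_on UNIV"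
proof -
  have "(\<Sum>k=1..m. cscale J (of_nat k * (\<i> * h) * l ^ (k - 1)) (comp z k))
      = J (\<Sum>k=1..m. cscale J (of_nat k * h * l ^ (k - 1)) (comp z k))" for h l
    using cscale_mult_i by (simp add: linear_sum[OF J_linear] mult.left_commute mult.assoc)
  from holo_curve[OF assms dil_has_derivative this]
  show ?thesis unfolding holomorphic_on_def field_differentiable_def by blast
qed

section \<open>Cauchy integrals, regularity and locally uniform limits\<close>

lemma Cauchy_direction:
  assumes "holo J f"
  shows "((\<lambda>t. f (z + cscale J (cis t) v) * cis (- t)) has_integral (2 * pi * fd f z v)) {0..2 * pi}"
proof -
  have "(\<lambda>c. f (z + cscale J c v)) holomorphic_on UNIV"
    using holo_slice[OF assms] unfolding holomorphic_on_def field_differentiable_def by blast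
  from circle_coefficient[OF this, of 1] show ?thesis
    using DERIV_imp_deriv[OF holo_slice[OF assms, of z v 0]] by simp
qed

text \<open>The circle lies in the left translate of a complex line, so the left-invariant
  derivative itself is an average of values of \<open>f\<close>. Hence it is holomorphic again, and
  it is controlled by \<open>f\<close> on a compact set.\<close>

lemma Cauchy_lvf:
  assumes "holo J f"
  shows "((\<lambda>t. f (gmul z (cscale J (cis t) x)) * cis (- t)) has_integral (2 * pi * lvf gmul x f z)) {0..2 * pi}"
proof -
  have "(\<lambda>c. f (gmul z (cscale J c x))) holomorphic_on UNIV"
    using holo_left_slice[OF assms] unfolding holomorphic_on_def field_differentiable_def by blast
  from circle_coefficient[OF this, of 1] show ?thesis
    using DERIV_imp_deriv[OF holo_left_slice[OF assms, of z x 0]]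
    by (simp add: lvf_eq[OF holo_has_derivative[OF assms]] E_def)
qed

lemma holo_param_fd_continuous:
  assumes F: "continuous_on (UNIV \<times> {0..2 * pi}) (\<lambda>(z, t). F z t)"
    and hol: "\<And>t. t \<in> {0..2 * pi} \<Longrightarrow> holo J (\<lambda>z. F z t)"
  shows "continuous_on (UNIV \<times> {0..2 * pi}) (\<lambda>(z, t). fd (\<lambda>z. F z t) z v)"
proof -
  have "continuous_on ((UNIV \<times> {0..2 * pi}) \<times> cbox 0 (2 * pi))
      (\<lambda>(p, s). F (fst p + cscale J (cis s) v) (snd p) * cis (- s))"
    unfolding split_beta
    by (intro continuous_on_mult continuous_on_compose2[OF F, where f="\<lambda>x. (fst (fst x) + cscale J (cis (snd x)) v, snd (fst x))", simplified split_beta fst_conv snd_conv]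
       continuous_intros cscale_continuous) auto
  from integral_continuous_on_param[OF this]
  have "continuous_on (UNIV \<times> {0..2 * pi})
      (\<lambda>p. integral (cbox 0 (2 * pi)) (\<lambda>s. F (fst p + cscale J (cis s) v) (snd p) * cis (- s)) / (2 * pi))"
    by (intro continuous_intros) auto
  then show ?thesis
  proof (rule continuous_on_eq)
    fix p :: "'g \<times> real" assume "p \<in> UNIV \<times> {0..2 * pi}"
    then have "holo J (\<lambda>z. F z (snd p))" by (auto intro: hol)
    from integral_unique[OF Cauchy_direction[OF this, of "fst p" v]]
    show "integral (cbox 0 (2 * pi)) (\<lambda>s. F (fst p + cscale J (cis s) v) (snd p) * cis (- s)) / (2 * pi)
      = (case p of (z, t) \<Rightarrow> fd (\<lambda>z. F z t) z v)" by (simp add: split_beta)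
  qed
qed

text \<open>Differentiation under the integral is justified by Cauchy's formula, which makes the
  derivatives jointly continuous.\<close>

lemma holo_param_has_derivative:
  assumes F: "continuous_on (UNIV \<times> {0..2 * pi}) (\<lambda>(z, t). F z t)"
    and hol: "\<And>t. t \<in> {0..2 * pi} \<Longrightarrow> holo J (\<lambda>z. F z t)"
  shows "((\<lambda>z. integral {0..2 * pi} (F z)) has_derivative
    (\<lambda>v. integral {0..2 * pi} (\<lambda>t. fd (\<lambda>z. F z t) z v))) (at z)"
proof -
  define fx where "fx z t = Blinfun (fd (\<lambda>z. F z t) z)" for z t
  have fx: "blinfun_apply (fx z t) = fd (\<lambda>z. F z t) z" if "t \<in> {0..2 * pi}" for z t
    unfolding fx_def using has_derivative_bounded_linear[OF holo_has_derivative[OF hol[OF that]]]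
    by (rule bounded_linear_Blinfun_apply)
  have cfx: "continuous_on (UNIV \<times> {0..2 * pi}) (\<lambda>(z, t). fx z t)"
  proof (rule continuous_on_blinfun_componentwise)
    fix v :: 'g
    show "continuous_on (UNIV \<times> {0..2 * pi}) (\<lambda>p. blinfun_apply (case p of (z, t) \<Rightarrow> fx z t) v)"
      by (rule continuous_on_eq[OF holo_param_fd_continuous[OF assms]]) (auto simp: fx)
  qed
  have cF: "continuous_on {0..2 * pi} (F z)" for z
    using continuous_on_compose2[OF F, of "{0..2 * pi}" "\<lambda>t. (z, t)"]
    by (force intro!: continuous_on_Pair continuous_on_const continuous_on_id)
  have "((\<lambda>z. integral (cbox 0 (2 * pi)) (F z)) has_derivative integral (cbox 0 (2 * pi)) (fx z)) (at z within UNIV)"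
  proof (rule leibniz_rule)
    show "((\<lambda>z. F z t) has_derivative blinfun_apply (fx z t)) (at z)" if "t \<in> cbox 0 (2 * pi)" for z t
      using that fx[of t] holo_has_derivative[OF hol[of t]] by simp
    show "F z integrable_on cbox 0 (2 * pi)" for z
      using cF by (intro integrable_continuous) simp
  qed (use cfx in auto)
  moreover have "blinfun_apply (integral {0..2 * pi} (fx z)) v = integral {0..2 * pi} (\<lambda>t. fd (\<lambda>z. F z t) z v)" for v
  proof -
    have "continuous_on {0..2 * pi} (fx z)"
      using continuous_on_compose2[OF cfx, of "{0..2 * pi}" "\<lambda>t. (z, t)"]
      by (force intro!: continuous_on_Pair continuous_on_const continuous_on_id)
    then have "fx z integrable_on {0..2 * pi}" by (rule integrable_continuous_real)
    then have "blinfun_apply (integral {0..2 * pi} (fx z)) v = integral {0..2 * pi} (\<lambda>t. blinfun_apply (fx z t) v)"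
      by (rule blinfun_apply_integral)
    also have "\<dots> = integral {0..2 * pi} (\<lambda>t. fd (\<lambda>z. F z t) z v)"
      by (intro integral_cong) (simp add: fx)
    finally show ?thesis .
  qed
  then have "blinfun_apply (integral {0..2 * pi} (fx z)) = (\<lambda>v. integral {0..2 * pi} (\<lambda>t. fd (\<lambda>z. F z t) z v))"
    by (rule ext)
  ultimately show ?thesis by simp
qed

lemma holo_param:
  assumes F: "continuous_on (UNIV \<times> {0..2 * pi}) (\<lambda>(z, t). F z t)"
    and hol: "\<And>t. t \<in> {0..2 * pi} \<Longrightarrow> holo J (\<lambda>z. F z t)"
  shows "holo J (\<lambda>z. integral {0..2 * pi} (F z))"
proof (rule holoI[OF holo_param_has_derivative[OF assms]])
  fix z v
  have "integral {0..2 * pi} (\<lambda>t. fd (\<lambda>z. F z t) z (J v)) = integral {0..2 * pi} (\<lambda>t. \<i> * fd (\<lambda>z. F z t) z v)"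
    by (intro integral_cong) (simp add: holo_fd_J[OF hol])
  then show "integral {0..2 * pi} (\<lambda>t. fd (\<lambda>z. F z t) z (J v)) = \<i> * integral {0..2 * pi} (\<lambda>t. fd (\<lambda>z. F z t) z v)"
    by simp
qed

lemma lvf_param:
  assumes F: "continuous_on (UNIV \<times> {0..2 * pi}) (\<lambda>(z, t). F z t)"
    and hol: "\<And>t. t \<in> {0..2 * pi} \<Longrightarrow> holo J (\<lambda>z. F z t)"
  shows "lvf gmul x (\<lambda>z. integral {0..2 * pi} (F z)) z = integral {0..2 * pi} (\<lambda>t. lvf gmul x (\<lambda>z. F z t) z)"
  by (subst lvf_eq[OF holo_param_has_derivative[OF F hol]])
     (auto intro!: Henstock_Kurzweil_Integration.integral_cong simp: lvf_eq[OF holo_has_derivative[OF hol]])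

text \<open>Cauchy's formula writes the directional derivative as an average of translates of
  \<open>f\<close>; smoothness follows by iterating.\<close>

lemma holo_fd:
  assumes f: "holo J f" shows "holo J (\<lambda>z. fd f z v)"
proof -
  have "holo J (\<lambda>z. (1 / (2 * pi)) * integral {0..2 * pi} (\<lambda>t. cis (- t) * f (z + cscale J (cis t) v)))"
  proof (rule holo_cmult, rule holo_param)
    show "continuous_on (UNIV \<times> {0..2 * pi}) (\<lambda>(z, t). cis (- t) * f (z + cscale J (cis t) v))"
      unfolding split_beta
      by (intro continuous_intros continuous_on_compose2[OF holo_continuous[OF f]] cscale_continuous) auto
    show "holo J (\<lambda>z. cis (- t) * f (z + cscale J (cis t) v))" for t
      by (intro holo_cmult holo_translate f)
  qed
  then show ?thesis
    using integral_unique[OF Cauchy_direction[OF f, of _ v]] by (simp add: mult.commute)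
qed

lemma holo_smooth:
  assumes "holo J f" shows "smooth_fun f"
proof (rule smooth_funI)
  fix n show "Ck n f" using assms
  proof (induction n arbitrary: f)
    case 0
    then show ?case using holo_continuous by simp
  next
    case (Suc n)
    show ?case by (rule Ck_SucI[OF holo_has_derivative[OF Suc.prems]]) (rule Suc.IH[OF holo_fd[OF Suc.prems]])
  qed
qed

lemma holo_lvf:
  assumes f: "holo J f" shows "holo J (lvf gmul x f)"
proof -
  have "holo J (\<lambda>z. (1 / (2 * pi)) * integral {0..2 * pi} (\<lambda>t. cis (- t) * f (gmul z (cscale J (cis t) x))))"
  proof (rule holo_cmult, rule holo_param)
    show "continuous_on (UNIV \<times> {0..2 * pi}) (\<lambda>(z, t). cis (- t) * f (gmul z (cscale J (cis t) x)))"
      unfolding split_beta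
      by (intro continuous_intros continuous_on_compose2[OF holo_continuous[OF f]] cscale_continuous gmul_continuous) auto
    show "holo J (\<lambda>z. cis (- t) * f (gmul z (cscale J (cis t) x)))" for t
      by (intro holo_cmult holo_right f)
  qed
  moreover have "lvf gmul x f = (\<lambda>z. (1 / (2 * pi)) * integral {0..2 * pi} (\<lambda>t. cis (- t) * f (gmul z (cscale J (cis t) x))))"
    by (rule ext) (use integral_unique[OF Cauchy_lvf[OF f, of _ x]] in \<open>simp add: mult.commute\<close>)
  ultimately show ?thesis by simp
qed

lemma lvf_J:
  assumes "holo J f" shows "lvf gmul (J x) f z = \<i> * lvf gmul x f z"
  by (simp add: lvf_eq[OF holo_has_derivative[OF assms]] E_J holo_fd_J[OF assms])

lemma lvf_cscale:
  assumes "holo J f" shows "lvf gmul (cscale J c x) f z = c * lvf gmul x f z"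
proof -
  have "lvf gmul (cscale J c x) f z = Re c *\<^sub>R lvf gmul x f z + Im c *\<^sub>R (\<i> * lvf gmul x f z)"
    unfolding cscale_def by (simp add: lvf_direction[OF holo_differentiable[OF assms]] lvf_J[OF assms])
  also have "\<dots> = (of_real (Re c) + \<i> * of_real (Im c)) * lvf gmul x f z"
    by (simp add: scaleR_conv_of_real algebra_simps)
  finally show ?thesis by (simp flip: complex_eq)
qed

lemma lvf_dil_holo:
  assumes "holo J f" "x \<in> V 1"
  shows "lvf gmul x (\<lambda>z. f (dil J V m l z)) z = l * lvf gmul x f (dil J V m l z)"
  unfolding lvf_dil dil_V1[OF assms(2)] by (rule lvf_cscale[OF assms(1)])

text \<open>Weierstrass' theorem. Cauchy's formula at points of norm at most \<open>R\<close>
  samples only the ball of radius \<open>R + C\<close>, so uniform closeness of the functions there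
  gives uniform closeness of the derivatives.\<close>

lemma holo_uniform_limit:
  assumes f: "\<And>n. holo J (f n)" and lim: "\<And>R. uniform_limit (cball 0 R) f g sequentially"
  shows "holo J g"
proof -
  obtain C where C: "C > 0" "\<And>c v. norm (cscale J c v) \<le> C * (norm c * norm v)" using cscale_bounded by blast
  have cg: "continuous_on (cball 0 R) g" for R
    by (rule uniform_limit_theorem[OF _ lim])
       (auto intro!: always_eventually continuous_on_subset[OF holo_continuous[OF f]])
  have "isCont g z" for z
    using cg[of "norm z + 1"] by (rule continuous_on_interior) (simp add: interior_cball)
  then have cont: "continuous_on UNIV g" by (simp add: continuous_on_eq_continuous_at)
  define g' where "g' z v = (1 / (2 * pi)) * integral {0..2 * pi} (\<lambda>t. g (z + cscale J (cis t) v) * cis (- t))" for z v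
  have int: "(\<lambda>t. h (z + cscale J (cis t) v) * cis (- t)) integrable_on {0..2 * pi}"
    if "continuous_on UNIV h" for h :: "'g \<Rightarrow> complex" and z v
    by (intro integrable_continuous_real continuous_intros continuous_on_compose2[OF that] cscale_continuous) auto
  have est: "norm (fd (f n) z v - g' z v) \<le> e"
    if e: "\<And>w. w \<in> cball 0 (R + C) \<Longrightarrow> norm (f n w - g w) \<le> e" and z: "norm z \<le> R" and v: "norm v \<le> 1" for n z v e R
  proof -
    define If where "If = integral {0..2 * pi} (\<lambda>t. f n (z + cscale J (cis t) v) * cis (- t))"
    define Ig where "Ig = integral {0..2 * pi} (\<lambda>t. g (z + cscale J (cis t) v) * cis (- t))"
    have "integral {0..2 * pi} (\<lambda>t. (f n (z + cscale J (cis t) v) - g (z + cscale J (cis t) v)) * cis (- t)) = If - Ig"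
      unfolding If_def Ig_def left_diff_distrib
      by (rule Henstock_Kurzweil_Integration.integral_diff[OF int[OF holo_continuous[OF f]] int[OF cont]])
    moreover have "If = 2 * pi * fd (f n) z v"
      unfolding If_def by (rule integral_unique[OF Cauchy_direction[OF f]])
    moreover have "g' z v = (1 / (2 * pi)) * Ig" by (simp add: g'_def Ig_def)
    ultimately have "fd (f n) z v - g' z v = (1 / (2 * pi)) * integral {0..2 * pi}
      (\<lambda>t. (f n (z + cscale J (cis t) v) - g (z + cscale J (cis t) v)) * cis (- t))"
      by (simp add: field_simps)
    moreover have "norm (integral {0..2 * pi} (\<lambda>t. (f n (z + cscale J (cis t) v) - g (z + cscale J (cis t) v)) * cis (- t)))
      \<le> e * (2 * pi - 0)"
    proof (rule integral_bound)
      show "continuous_on {0..2 * pi} (\<lambda>t. (f n (z + cscale J (cis t) v) - g (z + cscale J (cis t) v)) * cis (- t))"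
        by (intro continuous_intros continuous_on_compose2[OF cont] continuous_on_compose2[OF holo_continuous[OF f]]
          cscale_continuous) auto
      fix t
      have "norm (z + cscale J (cis t) v) \<le> R + C"
      proof -
        have "norm (cscale J (cis t) v) \<le> C * norm v" using C(2)[of "cis t" v] by simp
        also have "\<dots> \<le> C * 1" using v C(1) by (intro mult_left_mono) auto
        finally show ?thesis using norm_triangle_ineq[of z "cscale J (cis t) v"] z by linarith
      qed
      then show "norm ((f n (z + cscale J (cis t) v) - g (z + cscale J (cis t) v)) * cis (- t)) \<le> e"
        using e[of "z + cscale J (cis t) v"] by (simp add: norm_mult)
    qed simp
    ultimately have "norm (fd (f n) z v - g' z v) \<le> (1 / (2 * pi)) * (e * (2 * pi - 0))"
      by (simp only: norm_mult) (intro mult_mono, auto simp: norm_divide)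
    then show ?thesis by simp
  qed
  have ev: "\<forall>\<^sub>F n in sequentially. \<forall>w\<in>cball 0 (R + C). norm (f n w - g w) \<le> e" if "e > 0" for e R
    using uniform_limitD[OF lim that, of "R + C"]
    by (rule eventually_mono) (auto simp: dist_norm intro: less_imp_le)
  have ptw: "(\<lambda>n. fd (f n) z v) \<longlonglongrightarrow> g' z v" if "norm v \<le> 1" for z v
  proof (rule tendstoI)
    fix e :: real assume "e > 0"
    then have "\<forall>\<^sub>F n in sequentially. \<forall>w\<in>cball 0 (norm z + C). norm (f n w - g w) \<le> e / 2" by (intro ev) simp
    then show "\<forall>\<^sub>F n in sequentially. dist (fd (f n) z v) (g' z v) < e"
    proof (rule eventually_mono)
      fix n assume "\<forall>w\<in>cball 0 (norm z + C). norm (f n w - g w) \<le> e / 2"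
      then have "norm (fd (f n) z v - g' z v) \<le> e / 2" using that by (intro est[where R="norm z"]) auto
      then show "dist (fd (f n) z v) (g' z v) < e" using \<open>e > 0\<close> by (simp add: dist_norm)
    qed
  qed
  \<comment> \<open>The Cauchy integral \<open>g'\<close> is controlled for directions of norm at
    most 1. Extending it from unit vectors by positive homogeneity gives the estimate
    \<open>e * norm v\<close> needed to differentiate the limit.\<close>
  define h' where "h' z v = norm v *\<^sub>R g' z (v /\<^sub>R norm v)" for z v
  have lf: "linear (fd (f n) z)" for n z by (rule has_derivative_linear[OF holo_has_derivative[OF f]])
  have est': "norm (fd (f n) z v - h' z v) \<le> e * norm v"
    if e: "\<And>w. w \<in> cball 0 (R + C) \<Longrightarrow> norm (f n w - g w) \<le> e" and z: "norm z \<le> R" for n z v e R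
  proof (cases "v = 0")
    case False
    have "fd (f n) z v = norm v *\<^sub>R fd (f n) z (v /\<^sub>R norm v)"
      using False linear_scale[OF lf, of n z "norm v" "v /\<^sub>R norm v"] by simp
    then have "norm (fd (f n) z v - h' z v) = norm v * norm (fd (f n) z (v /\<^sub>R norm v) - g' z (v /\<^sub>R norm v))"
      by (simp add: h'_def flip: scaleR_diff_right)
    also have "\<dots> \<le> norm v * e" using False by (intro mult_left_mono est[OF e z]) auto
    finally show ?thesis by (simp add: mult.commute)
  qed (simp add: h'_def linear_0[OF lf])
  have ptw': "(\<lambda>n. fd (f n) z v) \<longlonglongrightarrow> h' z v" for z v
  proof (cases "v = 0")
    case False
    have "fd (f n) z v = norm v *\<^sub>R fd (f n) z (v /\<^sub>R norm v)" for n
      using False linear_scale[OF lf, of n z "norm v" "v /\<^sub>R norm v"] by simp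
    then show ?thesis unfolding h'_def using False by (auto intro!: tendsto_scaleR ptw)
  qed (simp add: h'_def linear_0[OF lf])
  show ?thesis
  proof (rule holoI)
    fix z v
    have "(\<lambda>n. \<i> * fd (f n) z v) \<longlonglongrightarrow> \<i> * h' z v" by (intro tendsto_intros ptw')
    then have "(\<lambda>n. fd (f n) z (J v)) \<longlonglongrightarrow> \<i> * h' z v" by (simp only: holo_fd_J[OF f])
    then show "h' z (J v) = \<i> * h' z v"
      by (rule LIMSEQ_unique[OF ptw'])
  next
    fix z :: 'g
    have z: "z \<in> ball 0 (norm z + 1)" by simp
    have limg: "(\<lambda>n. f n w) \<longlonglongrightarrow> g w" for w
      by (rule tendsto_uniform_limitI[OF lim[of "norm w"]]) simp
    have "\<exists>G. \<forall>w\<in>ball 0 (norm z + 1). (\<lambda>n. f n w) \<longlonglongrightarrow> G w \<and> (G has_derivative h' w) (at w within ball 0 (norm z + 1))"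
    proof (rule has_derivative_sequence[where f=f and f'="\<lambda>n. fd (f n)" and g'=h', OF _ _ _ z limg[of z]])
      show "(f n has_derivative fd (f n) w) (at w within ball 0 (norm z + 1))" for n w
        by (rule has_derivative_at_withinI[OF holo_has_derivative[OF f]])
      show "\<forall>\<^sub>F n in sequentially. \<forall>w\<in>ball 0 (norm z + 1). \<forall>h. norm (fd (f n) w h - h' w h) \<le> e * norm h" if "e > 0" for e
        using ev[OF that, of "norm z + 1"] by (rule eventually_mono) (auto intro!: est'[where R="norm z + 1"])
    qed simp
    then obtain G where G: "\<forall>w\<in>ball 0 (norm z + 1). (\<lambda>n. f n w) \<longlonglongrightarrow> G w \<and> (G has_derivative h' w) (at w within ball 0 (norm z + 1))"
      by blast
    then have "G w = g w" if "w \<in> ball 0 (norm z + 1)" for w using limg that LIMSEQ_unique by blast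
    moreover have "(G has_derivative h' z) (at z)" using G z at_within_open[OF z open_ball] by metis
    ultimately show "(g has_derivative h' z) (at z)"
      using has_derivative_transform_within_open[OF _ open_ball z] by blast
  qed
qed

end

section \<open>The maximum principle and the heat kernel\<close>

lemma second_derivative_max:
  fixes \<phi> \<psi> :: "real \<Rightarrow> real"
  assumes \<phi>: "\<And>t. (\<phi> has_real_derivative \<psi> t) (at t)" and \<psi>: "(\<psi> has_real_derivative D) (at 0)"
    and max: "\<And>t. \<phi> t \<le> \<phi> 0"
  shows "D \<le> 0"
proof (rule ccontr)
  assume "\<not> D \<le> 0"
  then have "D > 0" by simp
  have "\<psi> 0 = 0" using DERIV_local_max[OF \<phi>[of 0], of 1] max by simp
  obtain d where d: "d > 0" "\<And>h. 0 < h \<Longrightarrow> h < d \<Longrightarrow> \<psi> 0 < \<psi> (0 + h)"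
    using DERIV_pos_inc_right[OF \<psi> \<open>D > 0\<close>] by auto
  have "\<phi> 0 < \<phi> (d / 2)"
  proof (rule DERIV_pos_imp_increasing_open[of 0 "d / 2" \<phi>])
    show "0 < d / 2" using d by simp
    show "\<exists>y. (\<phi> has_real_derivative y) (at t) \<and> 0 < y" if "0 < t" "t < d / 2" for t
      using \<phi>[of t] d(2)[of t] that \<open>\<psi> 0 = 0\<close> d(1) by auto
    show "continuous_on {0..d / 2} \<phi>"
      using DERIV_isCont[OF \<phi>] by (intro continuous_at_imp_continuous_on) auto
  qed
  then show False using max[of "d / 2"] by simp
qed

locale heat_group = strat_group J br V m gmul
  for J :: "'g::euclidean_space \<Rightarrow> 'g" and br V m gmul +
  fixes x :: "nat \<Rightarrow> 'g" and n :: nat and \<rho> :: "real \<Rightarrow> 'g \<Rightarrow> real" and a :: real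
  assumes xV: "j < n \<Longrightarrow> x j \<in> V 1" and heat: "heat_kernel gmul J x n \<rho>" and a_pos: "a > 0"
begin

section \<open>The sub-Laplacian: linearity, rotations and the barrier\<close>

abbreviation Lap :: "('g \<Rightarrow> complex) \<Rightarrow> 'g \<Rightarrow> complex" where "Lap \<equiv> sublap gmul J x n"

lemma lvf2_lin:
  assumes "smooth_fun f" "smooth_fun g"
  shows "lvf gmul y (lvf gmul y (\<lambda>z. f z + c * g z)) z = lvf gmul y (lvf gmul y f) z + c * lvf gmul y (lvf gmul y g) z"
proof -
  have 1: "lvf gmul y (\<lambda>z. f z + c * g z) z = lvf gmul y f z + c * lvf gmul y g z"
    if "smooth_fun f" "smooth_fun g" for f g z
    unfolding lvf_add[OF smooth_differentiable[OF that(1)] smooth_differentiable[OF smooth_scaleC[OF that(2)]]]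
    by (simp add: lvf_cmult[OF smooth_differentiable[OF that(2)]])
  have "lvf gmul y (\<lambda>z. f z + c * g z) = (\<lambda>z. lvf gmul y f z + c * lvf gmul y g z)"
    by (rule ext) (rule 1[OF assms])
  then show ?thesis using 1[OF lvf_smooth[OF assms(1)] lvf_smooth[OF assms(2)]] by simp
qed

lemma Lap_lin:
  assumes "smooth_fun f" "smooth_fun g" shows "Lap (\<lambda>z. f z + c * g z) z = Lap f z + c * Lap g z"
  unfolding sublap_def lvf2_lin[OF assms] by (simp add: sum.distrib sum_distrib_left algebra_simps)

text \<open>A dilation of modulus one rotates the pair \<open>x j\<close>, \<open>J (x j)\<close>.
  In the sum of the two second derivatives the mixed terms enter with opposite signs, and the pure
  ones receive the factor \<open>r^2 + s^2 = 1\<close>.\<close>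

lemma Lap_dil:
  assumes f: "smooth_fun f" and l: "cmod l = 1"
  shows "Lap (\<lambda>z. f (dil J V m l z)) z = Lap f (dil J V m l z)"
  unfolding sublap_def
proof (rule sum.cong[OF refl])
  fix j assume "j \<in> {..<n}"
  then have X: "x j \<in> V 1" using xV by simp
  define r s where "r = Re l" and "s = Im l"
  have rs: "r\<^sup>2 + s\<^sup>2 = 1" using l by (simp add: r_def s_def cmod_def)
  define w where "w = dil J V m l z"
  define A B where "A = lvf gmul (x j) f" and "B = lvf gmul (J (x j)) f"
  have AB: "smooth_fun A" "smooth_fun B" unfolding A_def B_def by (rule lvf_smooth[OF f])+
  have d: "dil J V m l (x j) = r *\<^sub>R x j + s *\<^sub>R J (x j)" "dil J V m l (J (x j)) = (- s) *\<^sub>R x j + r *\<^sub>R J (x j)"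
    using dil_V1[OF X] dil_V1[OF V1_J[OF X]] by (simp_all add: cscale_def r_def s_def)
  have D2: "lvf gmul y (lvf gmul y (\<lambda>z. f (dil J V m l z))) z = lvf gmul (dil J V m l y) (lvf gmul (dil J V m l y) f) w" for y
  proof -
    have "lvf gmul y (\<lambda>z. f (dil J V m l z)) = (\<lambda>z. lvf gmul (dil J V m l y) f (dil J V m l z))"
      by (rule ext) (rule lvf_dil)
    then show ?thesis by (simp add: lvf_dil w_def)
  qed
  have dir: "lvf gmul (p *\<^sub>R x j + q *\<^sub>R J (x j)) (lvf gmul (p *\<^sub>R x j + q *\<^sub>R J (x j)) f) w
      = of_real p * (of_real p * lvf gmul (x j) A w + of_real q * lvf gmul (x j) B w)
      + of_real q * (of_real p * lvf gmul (J (x j)) A w + of_real q * lvf gmul (J (x j)) B w)" for p q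
  proof -
    have 1: "lvf gmul (p *\<^sub>R x j + q *\<^sub>R J (x j)) f = (\<lambda>z. of_real p * A z + of_real q * B z)"
      by (rule ext) (simp add: lvf_direction[OF smooth_differentiable[OF f]] A_def B_def scaleR_conv_of_real)
    have 2: "lvf gmul y (\<lambda>z. of_real p * A z + of_real q * B z) w = of_real p * lvf gmul y A w + of_real q * lvf gmul y B w" for y
      using smooth_differentiable[OF AB(1)] smooth_differentiable[OF AB(2)]
      by (simp add: lvf_add lvf_cmult differentiable_mult)
    have 3: "(\<lambda>z. of_real p * A z + of_real q * B z) differentiable (at w)"
      using smooth_differentiable[OF AB(1)] smooth_differentiable[OF AB(2)]
      by (intro differentiable_add differentiable_mult differentiable_const)
    show ?thesis unfolding 1 by (subst lvf_direction[OF 3]) (simp add: 2 scaleR_conv_of_real)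
  qed
  have "lvf gmul (x j) (lvf gmul (x j) (\<lambda>z. f (dil J V m l z))) z + lvf gmul (J (x j)) (lvf gmul (J (x j)) (\<lambda>z. f (dil J V m l z))) z
      = of_real (r\<^sup>2 + s\<^sup>2) * (lvf gmul (x j) A w + lvf gmul (J (x j)) B w)"
    unfolding D2 d dir by (simp add: power2_eq_square algebra_simps)
  then show "lvf gmul (x j) (lvf gmul (x j) (\<lambda>z. f (dil J V m l z))) z + lvf gmul (J (x j)) (lvf gmul (J (x j)) (\<lambda>z. f (dil J V m l z))) z
     = lvf gmul (x j) (lvf gmul (x j) f) (dil J V m l z) + lvf gmul (J (x j)) (lvf gmul (J (x j)) f) (dil J V m l z)"
    unfolding rs by (simp add: A_def B_def w_def)
qed

lemma Lap_max:
  assumes w: "smooth_fun w" and max: "\<And>z. Re (w z) \<le> Re (w z0)"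
  shows "Re (Lap w z0) \<le> 0"
proof -
  have "Re (lvf gmul y (lvf gmul y w) z0) \<le> 0" for y
  proof (rule second_derivative_max)
    have re: "(f has_vector_derivative D) F \<Longrightarrow> ((\<lambda>t. Re (f t)) has_real_derivative Re D) F" for f D F
      using bounded_linear.has_vector_derivative[OF bounded_linear_Re, of f D F]
      by (simp add: has_real_derivative_iff_has_vector_derivative)
    show "((\<lambda>t. Re (w (gmul z0 (t *\<^sub>R y)))) has_real_derivative Re (lvf gmul y w (gmul z0 (t *\<^sub>R y)))) (at t)" for t
      by (rule re[OF lvf_along[OF smooth_differentiable[OF w]]])
    show "((\<lambda>t. Re (lvf gmul y w (gmul z0 (t *\<^sub>R y)))) has_real_derivative Re (lvf gmul y (lvf gmul y w) z0)) (at 0)"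
      using re[OF lvf_along[OF smooth_differentiable[OF lvf_smooth[OF w, of y]], where z=z0 and t=0 and x=y]] by simp
    show "Re (w (gmul z0 (t *\<^sub>R y))) \<le> Re (w (gmul z0 (0 *\<^sub>R y)))" for t using max by simp
  qed
  then show ?thesis unfolding sublap_def Re_sum plus_complex.sel
    by (intro sum_nonpos add_nonpos_nonpos)
qed

text \<open>Two derivatives along \<open>V 1\<close> lower the degree of \<open>Psi - 1\<close> by
  two, so for expansions the result grows no faster than \<open>Psi\<close>;
  \<open>hom_bound_ex\<close> supplies the constant.\<close>

lemma Lap_Psi_bound:
  assumes q: "q \<ge> 1"
  shows "\<exists>C\<ge>0. \<forall>z. Re (Lap (\<lambda>z. of_real (Psi q z)) z) \<le> C * Psi q z"
proof -
  define N where "N = (2 * q * fact m :: nat)"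
  define P where "P z = complex_of_real (Psi q z)" for z
  have P: "smooth_fun P" unfolding P_def by (rule smooth_of_real[OF Psi_smooth])
  have "\<exists>C. \<forall>z. norm (lvf gmul y (lvf gmul y P) z) \<le> C * Psi q z" if y: "y \<in> V 1" for y
  proof (rule hom_bound_ex[OF _ q, of _ N])
    show "continuous_on UNIV (lvf gmul y (lvf gmul y P))"
      by (rule smooth_continuous[OF lvf_smooth[OF lvf_smooth[OF P]]])
    show "N \<le> 2 * q * fact m" by (simp add: N_def)
    fix r :: real and z assume r: "r \<ge> 1"
    have "P (dil J V m (of_real r) z) = of_real (1 - r ^ N) + of_real (r ^ N) * P z" for z
    proof -
      have "Psi q (dil J V m (of_real r) z) = (1 - r ^ N) + r ^ N * Psi q z"
        using Psi_dil[of r q z] r by (simp add: N_def algebra_simps)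
      then show ?thesis by (simp add: P_def)
    qed
    from lvf_scaling[OF smooth_differentiable[OF P] y _ this]
    have "lvf gmul y P (dil J V m (of_real r) z) = 0 + (of_real (r ^ N) / of_real r) * lvf gmul y P z" for z
      using r by simp
    from lvf_scaling[OF smooth_differentiable[OF lvf_smooth[OF P]] y _ this]
    have "lvf gmul y (lvf gmul y P) (dil J V m (of_real r) z)
      = (of_real (r ^ N) / of_real r / of_real r) * lvf gmul y (lvf gmul y P) z" using r by simp
    then have "norm (lvf gmul y (lvf gmul y P) (dil J V m (of_real r) z))
      = (r ^ N / r / r) * norm (lvf gmul y (lvf gmul y P) z)"
      using r by (simp add: norm_mult norm_divide norm_power)
    also have "\<dots> \<le> r ^ N * norm (lvf gmul y (lvf gmul y P) z)"
    proof (rule mult_right_mono)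
      have dv: "t / r \<le> t" if "t \<ge> 0" for t
        using r that mult_left_mono[of 1 r t] by (simp add: divide_le_eq)
      have "r ^ N / r / r \<le> r ^ N / r" using r by (intro dv) simp
      also have "\<dots> \<le> r ^ N" using r by (intro dv) simp
      finally show "r ^ N / r / r \<le> r ^ N" .
    qed simp
    finally show "norm (lvf gmul y (lvf gmul y P) (dil J V m (of_real r) z)) \<le> r ^ N * norm (lvf gmul y (lvf gmul y P) z)" .
  qed
  then obtain C where C: "\<And>y z. y \<in> V 1 \<Longrightarrow> norm (lvf gmul y (lvf gmul y P) z) \<le> C y * Psi q z" by metis
  have "Re (Lap P z) \<le> (\<Sum>j<n. \<bar>C (x j)\<bar> + \<bar>C (J (x j))\<bar>) * Psi q z" for z
  proof -
    have bd: "Re (lvf gmul y (lvf gmul y P) z) \<le> \<bar>C y\<bar> * Psi q z" if "y \<in> V 1" for y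
    proof -
      have "Re (lvf gmul y (lvf gmul y P) z) \<le> norm (lvf gmul y (lvf gmul y P) z)" by (rule complex_Re_le_cmod)
      also have "\<dots> \<le> C y * Psi q z" by (rule C[OF that])
      also have "\<dots> \<le> \<bar>C y\<bar> * Psi q z" using Psi_ge_1[of q z] by (intro mult_right_mono) auto
      finally show ?thesis .
    qed
    have "Re (Lap P z) \<le> (\<Sum>j<n. \<bar>C (x j)\<bar> * Psi q z + \<bar>C (J (x j))\<bar> * Psi q z)"
      unfolding sublap_def Re_sum plus_complex.sel
      by (intro sum_mono add_mono bd V1_J xV) simp_all
    then show ?thesis by (simp add: sum_distrib_right distrib_right)
  qed
  then show ?thesis unfolding P_def by (intro exI[of _ "\<Sum>j<n. \<bar>C (x j)\<bar> + \<bar>C (J (x j))\<bar>"]) (auto intro!: sum_nonneg)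
qed

text \<open>The class for the maximum principle: bounded and jointly continuous for positive times.
  Nothing is required at time 0; the behaviour as \<open>s\<close> tends to 0 is a separate
  hypothesis.\<close>

definition heat_sol :: "(real \<Rightarrow> 'g \<Rightarrow> complex) \<Rightarrow> bool" where
  "heat_sol w \<longleftrightarrow> (\<forall>s>0. smooth_fun (w s))
    \<and> (\<forall>s>0. \<forall>z. ((\<lambda>r. w r z) has_vector_derivative (Lap (w s) z / 4)) (at s))
    \<and> (\<exists>K. \<forall>s>0. \<forall>z. cmod (w s z) \<le> K)
    \<and> continuous_on ({0<..} \<times> UNIV) (\<lambda>(s, z). w s z)"

lemma heat_solD:
  assumes "heat_sol w"
  shows "s > 0 \<Longrightarrow> smooth_fun (w s)"
    and "s > 0 \<Longrightarrow> ((\<lambda>r. w r z) has_vector_derivative (Lap (w s) z / 4)) (at s)"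
    and "continuous_on ({0<..} \<times> UNIV) (\<lambda>(s, z). w s z)"
  using assms unfolding heat_sol_def by blast+

lemma heat_sol_bound: "heat_sol w \<Longrightarrow> \<exists>K. \<forall>s>0. \<forall>z. cmod (w s z) \<le> K"
  unfolding heat_sol_def by blast

lemma heat_sol_lin:
  assumes u: "heat_sol u" and v: "heat_sol v" shows "heat_sol (\<lambda>s z. u s z + c * v s z)"
  unfolding heat_sol_def
proof (intro conjI allI impI)
  fix s :: real and z assume s: "s > 0"
  show "smooth_fun (\<lambda>z. u s z + c * v s z)"
    by (intro smooth_add smooth_scaleC heat_solD[OF u] heat_solD[OF v] s)
  have "((\<lambda>r. u r z + c * v r z) has_vector_derivative (Lap (u s) z / 4 + c * (Lap (v s) z / 4))) (at s)"
    by (intro has_vector_derivative_add has_vector_derivative_mult_right heat_solD[OF u] heat_solD[OF v] s)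
  then show "((\<lambda>r. u r z + c * v r z) has_vector_derivative (Lap (\<lambda>z. u s z + c * v s z) z / 4)) (at s)"
    by (simp add: Lap_lin[OF heat_solD(1)[OF u s] heat_solD(1)[OF v s]] add_divide_distrib)
next
  obtain K where K: "\<And>s z. s > 0 \<Longrightarrow> cmod (u s z) \<le> K" using heat_sol_bound[OF u] by blast
  obtain L where L: "\<And>s z. s > 0 \<Longrightarrow> cmod (v s z) \<le> L" using heat_sol_bound[OF v] by blast
  have "cmod (u s z + c * v s z) \<le> K + cmod c * L" if "s > 0" for s z
    by (rule order_trans[OF norm_triangle_ineq]) (auto simp: norm_mult intro!: add_mono mult_left_mono K L that)
  then show "\<exists>K. \<forall>s>0. \<forall>z. cmod (u s z + c * v s z) \<le> K" by blast
next
  show "continuous_on ({0<..} \<times> UNIV) (\<lambda>(s, z). u s z + c * v s z)"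
    using heat_solD(3)[OF u] heat_solD(3)[OF v] unfolding split_beta by (intro continuous_intros)
qed

lemma heat_sol_dil:
  assumes u: "heat_sol u" and l: "cmod l = 1" shows "heat_sol (\<lambda>s z. u s (dil J V m l z))"
  unfolding heat_sol_def
proof (intro conjI allI impI)
  fix s :: real and z assume s: "s > 0"
  show "smooth_fun (\<lambda>z. u s (dil J V m l z))"
    by (rule smooth_linear_compose[OF heat_solD(1)[OF u s] dil_bounded_linear])
  show "((\<lambda>r. u r (dil J V m l z)) has_vector_derivative Lap (\<lambda>z. u s (dil J V m l z)) z / 4) (at s)"
    unfolding Lap_dil[OF heat_solD(1)[OF u s] l] by (rule heat_solD(2)[OF u s])
next
  show "\<exists>K. \<forall>s>0. \<forall>z. cmod (u s (dil J V m l z)) \<le> K" using heat_sol_bound[OF u] by blast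
next
  have c: "continuous_on ({0<..} \<times> UNIV) (\<lambda>p::real \<times> 'g. (fst p, dil J V m l (snd p)))"
    by (intro continuous_intros dil_continuous)
  have s: "(\<lambda>p::real \<times> 'g. (fst p, dil J V m l (snd p))) ` ({0<..} \<times> UNIV) \<subseteq> {0<..} \<times> UNIV" by auto
  show "continuous_on ({0<..} \<times> UNIV) (\<lambda>(s, z). u s (dil J V m l z))"
    using continuous_on_compose2[OF heat_solD(3)[OF u] c s] by (simp add: split_beta)
qed

text \<open>Where the excess \<open>v\<close> over the barrier is positive, boundedness of
  \<open>w\<close> confines it to a compact set, so a positive maximum over \<open>{s0..s1}\<close>
  is attained. There the sub-Laplacian of the excess has nonpositive real part, the time derivative
  is negative, and \<open>v\<close> was larger shortly before. The constant does not depend on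
  \<open>w\<close>, \<open>B\<close> or \<open>s0\<close>; this uniformity is what the bound on
  moments needs.\<close>

lemma max_principle:
  assumes q: "q \<ge> 1"
  shows "\<exists>C. \<forall>w B s0. heat_sol w \<longrightarrow> B > 0 \<longrightarrow> s0 > 0 \<longrightarrow> (\<forall>s z. 0 < s \<and> s \<le> s0 \<longrightarrow> Re (w s z) \<le> B * Psi q z)
    \<longrightarrow> (\<forall>s>0. \<forall>z. Re (w s z) \<le> B * exp (C * s) * Psi q z)"
proof -
  obtain C0 where C0: "C0 \<ge> 0" "\<And>z. Re (Lap (\<lambda>z. of_real (Psi q z)) z) \<le> C0 * Psi q z"
    using Lap_Psi_bound[OF q] by blast
  \<comment> \<open>The summand 1 makes the inequality for the time derivative strict, even when
    \<open>C0 = 0\<close>.\<close>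
  define C where "C = C0 + 1"
  have P: "smooth_fun (\<lambda>z. complex_of_real (Psi q z))" by (rule smooth_of_real[OF Psi_smooth])
  have "Re (w s1 z1) \<le> B * exp (C * s1) * Psi q z1"
    if w: "heat_sol w" and B: "B > 0" and s0: "s0 > 0"
      and init: "\<And>s z. 0 < s \<Longrightarrow> s \<le> s0 \<Longrightarrow> Re (w s z) \<le> B * Psi q z" and s1: "s1 > 0" for w B s0 s1 z1
  proof (rule ccontr)
    define v where "v s z = Re (w s z) - B * exp (C * s) * Psi q z" for s z
    assume "\<not> ?thesis"
    then have v1: "v s1 z1 > 0" by (simp add: v_def)
    have C_pos: "C > 0" using C0 by (simp add: C_def)
    have BP: "B * Psi q z \<le> B * exp (C * s) * Psi q z" if "s > 0" for s z
    proof -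
      have "1 \<le> exp (C * s)" using that C_pos by simp
      then have "B * 1 * Psi q z \<le> B * exp (C * s) * Psi q z"
        using B Psi_ge_1[of q z] by (intro mult_right_mono mult_left_mono) auto
      then show ?thesis by simp
    qed
    have init': "v s z \<le> 0" if "0 < s" "s \<le> s0" for s z
      using init[OF that, of z] BP[OF that(1), of z] by (simp add: v_def)
    have s01: "s0 < s1" using v1 init'[OF s1, of z1] by (cases "s1 \<le> s0") auto
    obtain K where K: "\<And>s z. s > 0 \<Longrightarrow> cmod (w s z) \<le> K" using heat_sol_bound[OF w] by blast
    \<comment> \<open>Beyond the level \<open>K / B\<close> the barrier exceeds the bound
      \<open>K\<close> of the solution; the other term keeps \<open>z1\<close> inside the compact
      set.\<close>
    define c where "c = max (Psi q z1) (K / B)"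
    define D where "D = {s0..s1} \<times> {z. Psi q z \<le> c}"
    have outside: "v s z \<le> 0" if "s > 0" "Psi q z > c" for s z
    proof -
      have "K / B < Psi q z" using that(2) by (simp add: c_def)
      then have "K < B * Psi q z" using B by (simp add: field_simps)
      then show ?thesis using BP[OF that(1), of z] K[OF that(1), of z] complex_Re_le_cmod[of "w s z"] by (simp add: v_def)
    qed
    have "compact D" unfolding D_def by (intro compact_Times compact_Icc Psi_compact q)
    moreover have "(s1, z1) \<in> D" using s01 by (simp add: D_def c_def)
    moreover have "continuous_on D (\<lambda>p. v (fst p) (snd p))"
    proof -
      have "continuous_on D (\<lambda>p. w (fst p) (snd p))"
      proof -
        have "D \<subseteq> {0<..} \<times> UNIV" using s0 by (auto simp: D_def)
        from continuous_on_subset[OF heat_solD(3)[OF w] this] show ?thesis by (simp add: split_beta)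
      qed
      moreover have "continuous_on D (\<lambda>p. Psi q (snd p))"
        by (intro continuous_on_compose2[OF smooth_continuous[OF Psi_smooth]] continuous_intros) auto
      ultimately show ?thesis unfolding v_def by (intro continuous_intros)
    qed
    ultimately obtain p where p: "p \<in> D" "\<And>p'. p' \<in> D \<Longrightarrow> v (fst p') (snd p') \<le> v (fst p) (snd p)"
      using continuous_attains_sup[of D "\<lambda>p. v (fst p) (snd p)"] by blast
    define s z where "s = fst p" and "z = snd p"
    have s: "s0 \<le> s" "s \<le> s1" and z: "Psi q z \<le> c" using p(1) by (auto simp: D_def s_def z_def mem_Times_iff)
    have vpos: "v s z > 0" using p(2)[OF \<open>(s1, z1) \<in> D\<close>] v1 by (simp add: s_def z_def)
    have s_pos: "s > 0" using s s0 by simp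
    have s_gt: "s > s0" using init'[OF s_pos, of z] vpos s by (cases "s = s0") auto
    have vmax: "v s z' \<le> v s z" for z'
    proof (cases "Psi q z' \<le> c")
      case True
      then show ?thesis using p(2)[of "(s, z')"] s by (simp add: D_def s_def z_def)
    next
      case False
      then show ?thesis using outside[OF s_pos, of z'] vpos by simp
    qed
    define b where "b = B * exp (C * s)"
    have b: "b > 0" using B by (simp add: b_def)
    have "Re (Lap (\<lambda>z. w s z + (- of_real b) * of_real (Psi q z)) z) \<le> 0"
    proof (rule Lap_max)
      show "smooth_fun (\<lambda>z. w s z + (- of_real b) * of_real (Psi q z))"
        by (intro smooth_add smooth_scaleC P heat_solD(1)[OF w s_pos])
      show "Re (w s z' + (- of_real b) * of_real (Psi q z')) \<le> Re (w s z + (- of_real b) * of_real (Psi q z))" for z'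
        using vmax[of z'] by (simp add: v_def b_def)
    qed
    then have "Re (Lap (w s) z) \<le> b * Re (Lap (\<lambda>z. of_real (Psi q z)) z)"
      unfolding Lap_lin[OF heat_solD(1)[OF w s_pos] P] by simp
    also have "\<dots> \<le> b * (C0 * Psi q z)" using b by (intro mult_left_mono C0(2)) auto
    finally have lap: "Re (Lap (w s) z) \<le> b * (C0 * Psi q z)" .
    have "((\<lambda>r. Re (w r z)) has_real_derivative Re (Lap (w s) z / 4)) (at s)"
      using bounded_linear.has_vector_derivative[OF bounded_linear_Re heat_solD(2)[OF w s_pos, of z]]
      by (simp add: has_real_derivative_iff_has_vector_derivative)
    then have "((\<lambda>r. v r z) has_real_derivative (Re (Lap (w s) z / 4) - b * C * Psi q z)) (at s)"
    proof -
      assume d: "((\<lambda>r. Re (w r z)) has_real_derivative Re (Lap (w s) z / 4)) (at s)"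
      have "((\<lambda>r. B * exp (C * r) * Psi q z) has_real_derivative b * C * Psi q z) (at s)"
        by (auto intro!: derivative_eq_intros simp: b_def)
      from DERIV_diff[OF d this] show ?thesis unfolding v_def .
    qed
    moreover have "Re (Lap (w s) z / 4) - b * C * Psi q z < 0"
    proof -
      have "b * Psi q z > 0" using b Psi_ge_1[of q z] by simp
      moreover have "b * C0 * Psi q z \<ge> 0" using b C0(1) Psi_ge_1[of q z] by simp
      ultimately show ?thesis using lap by (simp add: C_def algebra_simps)
    qed
    ultimately obtain d where d: "d > 0" "\<And>h. 0 < h \<Longrightarrow> h < d \<Longrightarrow> v s z < v (s - h) z"
      using DERIV_neg_dec_left by blast
    \<comment> \<open>The earlier time has to stay above \<open>s0\<close>, where maximality of
      \<open>v s z\<close> is known.\<close>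
    define h where "h = min (d / 2) (s - s0)"
    have h: "0 < h" "h < d" "h \<le> s - s0" using d(1) s_gt by (auto simp: h_def)
    have "v (s - h) z \<le> v s z" using p(2)[of "(s - h, z)"] h s z by (simp add: D_def s_def z_def)
    then show False using d(2)[OF h(1,2)] by simp
  qed
  then show ?thesis by blast
qed

text \<open>The maximum principle is applied to \<open>c * w\<close> with an arbitrarily small
  \<open>B\<close>. The unit factors 1, -1, \<open>\<i>\<close> and \<open>- \<i>\<close> together
  annihilate the real and the imaginary part.\<close>

lemma heat_sol_unique:
  assumes w: "heat_sol w" and lim: "uniform_limit UNIV w (\<lambda>z. 0) (at_right 0)" and s: "s > 0"
  shows "w s z = 0"
proof -
  obtain C where C: "\<And>w B s0. heat_sol w \<Longrightarrow> B > 0 \<Longrightarrow> s0 > 0 \<Longrightarrow> (\<And>s z. 0 < s \<Longrightarrow> s \<le> s0 \<Longrightarrow> Re (w s z) \<le> B * Psi 1 z)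
    \<Longrightarrow> (\<forall>s>0. \<forall>z. Re (w s z) \<le> B * exp (C * s) * Psi 1 z)"
  proof -
    obtain C where "\<forall>w B s0. heat_sol w \<longrightarrow> B > 0 \<longrightarrow> s0 > 0 \<longrightarrow> (\<forall>s z. 0 < s \<and> s \<le> s0 \<longrightarrow> Re (w s z) \<le> B * Psi 1 z)
      \<longrightarrow> (\<forall>s>0. \<forall>z. Re (w s z) \<le> B * exp (C * s) * Psi 1 z)"
      using max_principle[OF order_refl] by blast
    then show ?thesis by (intro that[of C]) blast
  qed
  have w0: "heat_sol (\<lambda>s z. 0)"
    unfolding heat_sol_def by (auto simp: sublap_def lvf_def smooth_funI Ck_const)
  have le: "Re (c * w s z) \<le> 0" if c: "cmod c = 1" for c
  proof (rule ccontr)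
    assume "\<not> ?thesis"
    then have pos: "Re (c * w s z) > 0" by simp
    define L where "L = exp (C * s) * Psi 1 z"
    have L: "L > 0" unfolding L_def using Psi_ge_1[of 1 z] by (intro mult_pos_pos) auto
    \<comment> \<open>With this \<open>B\<close> the barrier at the point considered is half of the
      supposed positive value.\<close>
    define B where "B = Re (c * w s z) / (2 * L)"
    have B: "B > 0" using pos L by (simp add: B_def)
    have hs: "heat_sol (\<lambda>s z. c * w s z)" using heat_sol_lin[OF w0 w, of c] by simp
    have "\<forall>\<^sub>F s in at_right 0. \<forall>z\<in>UNIV. dist (w s z) 0 < B" using uniform_limitD[OF lim B] .
    then obtain b where b: "b > 0" "\<And>s z. 0 < s \<Longrightarrow> s < b \<Longrightarrow> cmod (w s z) < B"
      unfolding eventually_at_right_field by auto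
    have "Re (c * w s' z') \<le> B * Psi 1 z'" if "0 < s'" "s' \<le> b / 2" for s' z'
    proof -
      have "Re (c * w s' z') \<le> cmod (w s' z')" using complex_Re_le_cmod[of "c * w s' z'"] c by (simp add: norm_mult)
      also have "\<dots> \<le> B * 1" using b(2)[of s' z'] that b(1) by simp
      also have "\<dots> \<le> B * Psi 1 z'" using B Psi_ge_1[of 1 z'] by (intro mult_left_mono) auto
      finally show ?thesis .
    qed
    then have "Re (c * w s z) \<le> B * exp (C * s) * Psi 1 z" using C[OF hs B, of "b / 2"] b(1) s by auto
    also have "\<dots> = B * L" by (simp add: L_def)
    also have "\<dots> = Re (c * w s z) / 2" unfolding B_def using L by (simp add: field_simps)
    finally show False using pos by simp
  qed
  show ?thesis using le[of 1] le[of "- 1"] le[of \<i>] le[of "- \<i>"] by (simp add: complex_eq_iff)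
qed

end

context heat_group
begin

section \<open>Convolution with the heat kernel\<close>

lemma rho_smooth: "s > 0 \<Longrightarrow> smooth_fun (\<rho> s)" and rho_pos: "s > 0 \<Longrightarrow> \<rho> s y > 0"
  and rho_integrable: "s > 0 \<Longrightarrow> integrable lborel (\<rho> s)" and rho_integral: "s > 0 \<Longrightarrow> integral\<^sup>L lborel (\<rho> s) = 1"
  using heat unfolding heat_kernel_def by blast+

definition hk :: "('g \<Rightarrow> complex) \<Rightarrow> real \<Rightarrow> 'g \<Rightarrow> complex" where
  "hk f s z = (\<integral>y. f (gmul z (- y)) * complex_of_real (\<rho> s y) \<partial>lborel)"

lemma hk_heat:
  assumes "test_fun f"
  shows "s > 0 \<Longrightarrow> smooth_fun (hk f s)"
    and "s > 0 \<Longrightarrow> ((\<lambda>r. hk f r z) has_vector_derivative (Lap (hk f s) z / 4)) (at s)"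
    and "uniform_limit UNIV (hk f) f (at_right 0)"
proof -
  have "\<forall>f. test_fun f \<longrightarrow> (\<forall>s>0. smooth_fun (hk f s))
    \<and> (\<forall>s>0. \<forall>z. ((\<lambda>r. hk f r z) has_vector_derivative (Lap (hk f s) z / 4)) (at s))
    \<and> uniform_limit UNIV (hk f) f (at_right 0)"
    using conjunct2[OF heat[unfolded heat_kernel_def Let_def]] unfolding hk_def[abs_def] .
  then have *: "(\<forall>s>0. smooth_fun (hk f s))
    \<and> (\<forall>s>0. \<forall>z. ((\<lambda>r. hk f r z) has_vector_derivative (Lap (hk f s) z / 4)) (at s))
    \<and> uniform_limit UNIV (hk f) f (at_right 0)" using assms by blast
  show "s > 0 \<Longrightarrow> smooth_fun (hk f s)" using * by blast
  show "s > 0 \<Longrightarrow> ((\<lambda>r. hk f r z) has_vector_derivative (Lap (hk f s) z / 4)) (at s)" using * by blast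
  show "uniform_limit UNIV (hk f) f (at_right 0)" using * by blast
qed

lemma rho_average:
  fixes g :: "'g \<Rightarrow> complex"
  assumes g: "continuous_on UNIV g" and K: "\<And>y. cmod (g y) \<le> K" and s: "s > 0"
  shows "integrable lborel (\<lambda>y. g y * complex_of_real (\<rho> s y))"
    and "cmod (\<integral>y. g y * complex_of_real (\<rho> s y) \<partial>lborel) \<le> K"
proof -
  have r: "\<And>y. \<rho> s y > 0" using rho_pos[OF s] .
  have int: "integrable lborel (\<lambda>y. K * \<rho> s y)" using rho_integrable[OF s] by simp
  have bd: "norm (g y * complex_of_real (\<rho> s y)) \<le> K * \<rho> s y" for y
    using K[of y] r[of y] by (simp add: norm_mult mult_right_mono)
  have [measurable]: "g \<in> borel_measurable borel" "\<rho> s \<in> borel_measurable borel"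
    using g smooth_continuous[OF rho_smooth[OF s]] by (auto intro: borel_measurable_continuous_onI)
  show i: "integrable lborel (\<lambda>y. g y * complex_of_real (\<rho> s y))"
  proof (rule Bochner_Integration.integrable_bound[OF int])
    show "(\<lambda>y. g y * complex_of_real (\<rho> s y)) \<in> borel_measurable lborel" by measurable
    have "norm (g y * complex_of_real (\<rho> s y)) \<le> norm (K * \<rho> s y)" for y
      using bd[of y] by (simp only: real_norm_def)
    then show "AE y in lborel. norm (g y * complex_of_real (\<rho> s y)) \<le> norm (K * \<rho> s y)" by simp
  qed
  have "cmod (\<integral>y. g y * complex_of_real (\<rho> s y) \<partial>lborel) \<le> (\<integral>y. norm (g y * complex_of_real (\<rho> s y)) \<partial>lborel)"
    by (rule integral_norm_bound)
  also have "\<dots> \<le> (\<integral>y. K * \<rho> s y \<partial>lborel)"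
    by (rule integral_mono[OF integrable_norm[OF i] int bd])
  also have "\<dots> = K" using rho_integral[OF s] by simp
  finally show "cmod (\<integral>y. g y * complex_of_real (\<rho> s y) \<partial>lborel) \<le> K" .
qed

lemma test_fun_bounded: "test_fun f \<Longrightarrow> \<exists>K. \<forall>z. cmod (f z) \<le> K"
proof -
  assume f: "test_fun f"
  then obtain K where K: "compact K" "\<And>z. z \<notin> K \<Longrightarrow> f z = 0" using test_fun_compact by blast
  have "compact (f ` K)"
    by (intro compact_continuous_image continuous_on_subset[OF smooth_continuous[OF test_fun_smooth[OF f]]] K) auto
  then obtain B where B: "\<And>z. z \<in> K \<Longrightarrow> cmod (f z) \<le> B" using compact_imp_bounded bounded_iff by (metis imageI)
  have "cmod (f z) \<le> max B 0" for z using K(2)[of z] B[of z] by (cases "z \<in> K") auto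
  then show ?thesis by blast
qed

lemma hk_arg_continuous: "continuous_on UNIV f \<Longrightarrow> continuous_on UNIV (\<lambda>y. f (gmul z (- y)))"
  by (intro continuous_on_compose2[of UNIV f UNIV "\<lambda>y. gmul z (- y)"] gmul_continuous continuous_intros) auto

text \<open>Uniform in \<open>y\<close>, although \<open>y\<close> ranges over the whole group: for
  \<open>w\<close> near \<open>z0\<close> the value at \<open>gmul w (- y)\<close> vanishes unless
  \<open>- y\<close> lies in the compact set \<open>Y\<close>, and on \<open>Y\<close> uniform
  continuity applies.\<close>

lemma hk_equicontinuous:
  assumes f: "test_fun f" and e: "e > 0"
  shows "\<exists>d>0. \<forall>z y. dist z z0 < d \<longrightarrow> cmod (f (gmul z (- y)) - f (gmul z0 (- y))) \<le> e"
proof -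
  obtain K where K: "compact K" "\<And>z. z \<notin> K \<Longrightarrow> f z = 0" using test_fun_compact[OF f] by blast
  have cf: "continuous_on UNIV f" by (rule smooth_continuous[OF test_fun_smooth[OF f]])
  define Y where "Y = (\<lambda>p. gmul (- fst p) (snd p)) ` (cball z0 1 \<times> K)"
  have "compact Y" unfolding Y_def
    by (intro compact_continuous_image gmul_continuous continuous_intros compact_Times K compact_cball)
  then have "compact (cball z0 1 \<times> Y)" by (intro compact_Times compact_cball)
  moreover have "continuous_on (cball z0 1 \<times> Y) (\<lambda>p. f (gmul (fst p) (snd p)))"
    by (intro continuous_on_compose2[OF cf] gmul_continuous continuous_intros) auto
  ultimately have "uniformly_continuous_on (cball z0 1 \<times> Y) (\<lambda>p. f (gmul (fst p) (snd p)))"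
    by (intro compact_uniformly_continuous)
  then obtain d where d: "d > 0" "\<And>p p'. p \<in> cball z0 1 \<times> Y \<Longrightarrow> p' \<in> cball z0 1 \<times> Y \<Longrightarrow> dist p' p < d \<Longrightarrow>
      dist (f (gmul (fst p') (snd p'))) (f (gmul (fst p) (snd p))) < e"
    using e unfolding uniformly_continuous_on_def by metis
  have "cmod (f (gmul z (- y)) - f (gmul z0 (- y))) \<le> e" if z: "dist z z0 < min d 1" for z y
  proof (cases "- y \<in> Y")
    case True
    have "dist (z, - y) (z0, - y) < d" using z by (simp add: dist_Pair_Pair)
    then have "dist (f (gmul z (- y))) (f (gmul z0 (- y))) < e"
      using d(2)[of "(z0, - y)" "(z, - y)"] True z by (simp add: dist_commute)
    then show ?thesis by (simp add: dist_norm)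
  next
    case False
    have "f (gmul w (- y)) = 0" if w: "w \<in> cball z0 1" for w
    proof (rule K(2), rule notI)
      assume "gmul w (- y) \<in> K"
      then have "gmul (- w) (gmul w (- y)) \<in> Y"
        unfolding Y_def by (intro image_eqI[of _ _ "(w, gmul w (- y))"]) (use w in auto)
      then show False using False by simp
    qed
    then have "f (gmul z (- y)) = 0" "f (gmul z0 (- y)) = 0" using z by (auto simp: dist_commute)
    then show ?thesis using e by simp
  qed
  then show ?thesis using d(1) by (intro exI[of _ "min d 1"]) auto
qed

text \<open>The kernel is characterised by regularity in \<open>s\<close> and in \<open>z\<close>
  separately. Joint continuity combines continuity in \<open>s\<close> at the fixed point
  \<open>z0\<close> with equicontinuity in \<open>z\<close>, which is uniform in \<open>s\<close>
  because each \<open>\<rho> s\<close> is a probability density.\<close>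

lemma hk_heat_sol:
  assumes f: "test_fun f" shows "heat_sol (hk f)"
  unfolding heat_sol_def
proof (intro conjI allI impI)
  show "s > 0 \<Longrightarrow> smooth_fun (hk f s)" for s by (rule hk_heat(1)[OF f])
  show "s > 0 \<Longrightarrow> ((\<lambda>r. hk f r z) has_vector_derivative (Lap (hk f s) z / 4)) (at s)" for s z
    by (rule hk_heat(2)[OF f])
  have cf: "continuous_on UNIV f" by (rule smooth_continuous[OF test_fun_smooth[OF f]])
  obtain K where K: "\<And>z. cmod (f z) \<le> K" using test_fun_bounded[OF f] by blast
  have "cmod (hk f s z) \<le> K" if "s > 0" for s z
    unfolding hk_def by (rule rho_average(2)[OF hk_arg_continuous[OF cf] K that])
  then show "\<exists>K. \<forall>s>0. \<forall>z. cmod (hk f s z) \<le> K" by blast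
  show "continuous_on ({0<..} \<times> UNIV) (\<lambda>(s, z). hk f s z)"
    unfolding continuous_on_iff
  proof (intro ballI allI impI)
    fix p :: "real \<times> 'g" and e :: real assume p: "p \<in> {0<..} \<times> UNIV" and e: "e > 0"
    define s0 z0 where "s0 = fst p" and "z0 = snd p"
    have s0: "s0 > 0" using p by (auto simp: s0_def)
    obtain d1 where d1: "d1 > 0" "\<And>z y. dist z z0 < d1 \<Longrightarrow> cmod (f (gmul z (- y)) - f (gmul z0 (- y))) \<le> e / 3"
      using hk_equicontinuous[OF f, of "e / 3" z0] e by auto
    have "isCont (\<lambda>r. hk f r z0) s0"
      using hk_heat(2)[OF f s0] has_vector_derivative_continuous by blast
    then obtain d2 where d2: "d2 > 0" "\<And>r. dist r s0 < d2 \<Longrightarrow> dist (hk f r z0) (hk f s0 z0) < e / 3"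
      using e unfolding continuous_at_eps_delta by (metis divide_pos_pos zero_less_numeral)
    show "\<exists>d>0. \<forall>p'\<in>{0<..} \<times> UNIV. dist p' p < d \<longrightarrow> dist (case p' of (s, z) \<Rightarrow> hk f s z) (case p of (s, z) \<Rightarrow> hk f s z) < e"
    proof (intro exI[of _ "min d1 d2"] conjI ballI impI)
      fix p' :: "real \<times> 'g" assume p': "p' \<in> {0<..} \<times> UNIV" and dd: "dist p' p < min d1 d2"
      define s z where "s = fst p'" and "z = snd p'"
      have s: "s > 0" using p' by (auto simp: s_def)
      have ds: "dist s s0 < d2" and dz: "dist z z0 < d1"
        using dd dist_fst_le[of p' p] dist_snd_le[of p' p] by (auto simp: s_def s0_def z_def z0_def)
      have "hk f s z - hk f s z0 = (\<integral>y. (f (gmul z (- y)) - f (gmul z0 (- y))) * complex_of_real (\<rho> s y) \<partial>lborel)"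
        unfolding hk_def left_diff_distrib
        by (rule Bochner_Integration.integral_diff[symmetric]; rule rho_average(1)[OF hk_arg_continuous[OF cf] K s])
      also have "cmod \<dots> \<le> e / 3"
        using dz by (intro rho_average(2) s d1 continuous_on_diff hk_arg_continuous cf)
      finally have "cmod (hk f s z - hk f s z0) \<le> e / 3" .
      moreover have "cmod (hk f s z0 - hk f s0 z0) < e / 3" using d2(2)[OF ds] by (simp add: dist_norm)
      ultimately have "cmod (hk f s z - hk f s0 z0) < e"
        using norm_triangle_ineq[of "hk f s z - hk f s z0" "hk f s z0 - hk f s0 z0"] e by simp
      then show "dist (case p' of (s, z) \<Rightarrow> hk f s z) (case p of (s, z) \<Rightarrow> hk f s z) < e"
        by (simp add: s_def z_def s0_def z0_def dist_norm split_beta)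
    qed (use d1 d2 in auto)
  qed
qed

section \<open>The weighted measure, cutoffs and moments\<close>

abbreviation M :: "'g measure" where "M \<equiv> heat_meas \<rho> a"

lemma sets_M [simp, measurable_cong]: "sets M = sets borel" and space_M [simp]: "space M = UNIV"
  by (simp_all add: heat_meas_def)

lemma rho_measurable [measurable]: "\<rho> a \<in> borel_measurable borel"
  using smooth_continuous[OF rho_smooth[OF a_pos]] by (rule borel_measurable_continuous_onI)

lemma prob_M: "prob_space M"
proof
  have "emeasure M (space M) = (\<integral>\<^sup>+ y. ennreal (\<rho> a y) \<partial>lborel)"
    by (simp add: heat_meas_def emeasure_density)
  also have "\<dots> = ennreal (\<integral>y. \<rho> a y \<partial>lborel)"
    using rho_integrable[OF a_pos] less_imp_le[OF rho_pos[OF a_pos]] by (intro nn_integral_eq_integral) auto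
  also have "\<dots> = 1" using rho_integral[OF a_pos] by simp
  finally show "emeasure M (space M) = 1" .
qed

sublocale prob_space M by (rule prob_M)

lemma integrable_M:
  fixes f :: "'g \<Rightarrow> 'b::{banach, second_countable_topology}"
  assumes "f \<in> borel_measurable borel"
  shows "integrable M f \<longleftrightarrow> integrable lborel (\<lambda>y. \<rho> a y *\<^sub>R f y)"
  unfolding heat_meas_def
  using assms less_imp_le[OF rho_pos[OF a_pos]] by (intro integrable_density) auto

lemma integral_M:
  fixes f :: "'g \<Rightarrow> 'b::{banach, second_countable_topology}"
  assumes "f \<in> borel_measurable borel"
  shows "integral\<^sup>L M f = (\<integral>y. \<rho> a y *\<^sub>R f y \<partial>lborel)"
  unfolding heat_meas_def
  using assms less_imp_le[OF rho_pos[OF a_pos]] by (intro integral_density) auto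

text \<open>Rescaling by a group dilation rather than by a scalar makes derivatives along
  \<open>V 1\<close> decay like \<open>1 / Suc k\<close>.\<close>

definition cutoff :: "nat \<Rightarrow> 'g \<Rightarrow> real" where
  "cutoff k z = bump (dil J V m (of_real (1 / real (Suc k))) z)"

lemma cutoff_smooth: "smooth_fun (cutoff k)"
  unfolding cutoff_def[abs_def] by (rule smooth_linear_compose[OF bump_smooth dil_bounded_linear])

lemma cutoff_range: "0 \<le> cutoff k z" "cutoff k z \<le> 1"
  by (simp_all add: cutoff_def bump_nonneg bump_le_1)

lemma cutoff_tendsto: "(\<lambda>k. cutoff k z) \<longlonglongrightarrow> 1"
proof -
  have "continuous_on UNIV (\<lambda>r. bump (dil J V m (of_real r) z))"
    by (intro continuous_on_compose2[OF smooth_continuous[OF bump_smooth]] dil_continuous continuous_intros) auto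
  then have "isCont (\<lambda>r. bump (dil J V m (of_real r) z)) 0" by (simp add: continuous_on_eq_continuous_at)
  moreover have "(\<lambda>k. 1 / real (Suc k)) \<longlonglongrightarrow> 0" using LIMSEQ_inverse_real_of_nat by (simp add: inverse_eq_divide)
  ultimately have "(\<lambda>k. bump (dil J V m (of_real (1 / real (Suc k))) z)) \<longlonglongrightarrow> bump (dil J V m (of_real 0) z)"
    by (rule isCont_tendsto_compose)
  then show ?thesis by (simp add: cutoff_def bump_0)
qed

lemma cutoff_support:
  "z \<notin> dil J V m (of_real (real (Suc k))) ` cball 0 1 \<Longrightarrow> cutoff k z = 0"
proof -
  assume z: "z \<notin> dil J V m (of_real (real (Suc k))) ` cball 0 1"
  define w where "w = dil J V m (of_real (1 / real (Suc k))) z"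
  have "(of_real (real (Suc k)) :: complex) * of_real (1 / real (Suc k)) = 1"
    unfolding of_real_mult[symmetric] by simp
  then have "z = dil J V m (of_real (real (Suc k))) w" unfolding w_def dil_dil by simp
  then have "w \<notin> cball 0 1" using z by blast
  then show ?thesis unfolding cutoff_def w_def[symmetric] by (rule bump_support)
qed

lemma cutoff_test:
  assumes "smooth_fun g" shows "test_fun (\<lambda>z. of_real (cutoff k z) * g z)"
proof (rule test_fun_support)
  show "smooth_fun (\<lambda>z. of_real (cutoff k z) * g z)"
    by (intro smooth_mult smooth_of_real cutoff_smooth assms)
  show "compact (dil J V m (of_real (real (Suc k))) ` cball 0 1)"
    by (intro compact_continuous_image dil_continuous continuous_intros compact_cball)
qed (simp add: cutoff_support)

lemma Psi_minus: "Psi q (- z) = Psi q z"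
  unfolding Psi_def by (simp add: linear_neg[OF comp_linear])

lemma cutoff_minus: "cutoff k (- z) = cutoff k z"
  by (simp add: cutoff_def linear_neg[OF dil_linear] bump_def)

lemma Psi_measurable [measurable]: "Psi q \<in> borel_measurable borel"
  using smooth_continuous[OF Psi_smooth] by (rule borel_measurable_continuous_onI)

lemma cutoff_measurable [measurable]: "cutoff k \<in> borel_measurable borel"
  using smooth_continuous[OF cutoff_smooth] by (rule borel_measurable_continuous_onI)

text \<open>The heat flow of the truncated \<open>Psi\<close>, evaluated at the identity at time
  \<open>a\<close>, is the truncated moment, since \<open>Psi\<close> and the cutoff are even and
  inversion is \<open>y \<mapsto> - y\<close>. The maximum principle bounds it independently of the
  truncation, and Fatou's lemma removes the cutoff.\<close>

lemma moment_integrable: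
  assumes q: "q \<ge> 1" shows "integrable M (Psi q)"
proof -
  obtain C where "\<forall>w B s0. heat_sol w \<longrightarrow> B > 0 \<longrightarrow> s0 > 0 \<longrightarrow> (\<forall>s z. 0 < s \<and> s \<le> s0 \<longrightarrow> Re (w s z) \<le> B * Psi q z)
      \<longrightarrow> (\<forall>s>0. \<forall>z. Re (w s z) \<le> B * exp (C * s) * Psi q z)"
    using max_principle[OF q] by blast
  then have C: "Re (w s z) \<le> B * exp (C * s) * Psi q z"
    if "heat_sol w" "B > 0" "t > 0" "\<forall>s z. 0 < s \<and> s \<le> t \<longrightarrow> Re (w s z) \<le> B * Psi q z" "s > 0" for w B t s z
    using that by blast
  \<comment> \<open>The factor 2: at small times the flow is within 1 of its datum, the datum is at
    most \<open>Psi\<close>, and \<open>Psi\<close> is at least 1.\<close>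
  define L where "L = 2 * exp (C * a) * Psi q 0"
  have bd: "(\<integral>\<^sup>+ y. ennreal (cutoff k y * Psi q y * \<rho> a y) \<partial>lborel) \<le> ennreal L" for k
  proof -
    define f where "f z = of_real (cutoff k z) * complex_of_real (Psi q z)" for z
    have f: "test_fun f" unfolding f_def by (intro cutoff_test smooth_of_real Psi_smooth)
    have "\<forall>\<^sub>F s in at_right 0. \<forall>z\<in>UNIV. dist (hk f s z) (f z) < 1"
      using uniform_limitD[OF hk_heat(3)[OF f]] by simp
    then obtain b where b: "b > 0" "\<And>s z. 0 < s \<Longrightarrow> s < b \<Longrightarrow> dist (hk f s z) (f z) < 1"
      unfolding eventually_at_right_field by auto
    have "Re (hk f s z) \<le> 2 * Psi q z" if "0 < s" "s \<le> b / 2" for s z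
    proof -
      have "Re (hk f s z - f z) \<le> 1"
        using b(2)[of s z] that b(1) complex_Re_le_cmod[of "hk f s z - f z"] by (simp add: dist_norm)
      moreover have "Re (f z) \<le> Psi q z"
        using mult_right_mono[OF cutoff_range(2)[of k z], of "Psi q z"] Psi_ge_1[of q z] by (simp add: f_def)
      ultimately show ?thesis using Psi_ge_1[of q z] by simp
    qed
    then have "Re (hk f a 0) \<le> L"
      unfolding L_def using b(1) a_pos hk_heat_sol[OF f] by (intro C[of "hk f" 2 "b / 2" a 0]) auto
    moreover have "hk f a 0 = of_real (\<integral>y. cutoff k y * Psi q y * \<rho> a y \<partial>lborel)"
      unfolding hk_def integral_complex_of_real[symmetric]
      by (intro Bochner_Integration.integral_cong refl) (simp add: f_def cutoff_minus Psi_minus)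
    ultimately have "(\<integral>y. cutoff k y * Psi q y * \<rho> a y \<partial>lborel) \<le> L" by simp
    moreover have "integrable lborel (\<lambda>y. cutoff k y * Psi q y * \<rho> a y)"
    proof -
      obtain K where K: "\<And>z. cmod (f z) \<le> K" using test_fun_bounded[OF f] by blast
      have "integrable lborel (\<lambda>y. complex_of_real (cutoff k y * Psi q y * \<rho> a y))"
        using rho_average(1)[OF smooth_continuous[OF test_fun_smooth[OF f]] K a_pos] by (simp add: f_def)
      then show ?thesis by (simp only: complex_of_real_integrable_eq)
    qed
    ultimately show ?thesis
    proof (subst nn_integral_eq_integral)
      show "AE y in lborel. 0 \<le> cutoff k y * Psi q y * \<rho> a y"
      proof (rule AE_I2)
        fix y show "0 \<le> cutoff k y * Psi q y * \<rho> a y"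
          using cutoff_range(1)[of k y] Psi_ge_1[of q y] rho_pos[OF a_pos, of y] by simp
      qed
    qed (auto intro: ennreal_leI)
  qed
  have "(\<integral>\<^sup>+ y. ennreal (Psi q y * \<rho> a y) \<partial>lborel) = (\<integral>\<^sup>+ y. liminf (\<lambda>k. ennreal (cutoff k y * Psi q y * \<rho> a y)) \<partial>lborel)"
  proof (rule nn_integral_cong)
    fix y
    have "(\<lambda>k. ennreal (cutoff k y * Psi q y * \<rho> a y)) \<longlonglongrightarrow> ennreal (1 * Psi q y * \<rho> a y)"
      by (intro tendsto_ennrealI tendsto_intros cutoff_tendsto)
    from lim_imp_Liminf[OF _ this] show "ennreal (Psi q y * \<rho> a y) = liminf (\<lambda>k. ennreal (cutoff k y * Psi q y * \<rho> a y))" by simp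
  qed
  also have "\<dots> \<le> liminf (\<lambda>k. \<integral>\<^sup>+ y. ennreal (cutoff k y * Psi q y * \<rho> a y) \<partial>lborel)"
    by (rule nn_integral_liminf) measurable
  also have "\<dots> \<le> ennreal L" by (intro Liminf_le) (auto simp: bd)
  finally have fin: "(\<integral>\<^sup>+ y. ennreal (Psi q y * \<rho> a y) \<partial>lborel) \<le> ennreal L" .
  have nn: "Psi q y * \<rho> a y \<ge> 0" for y using Psi_ge_1[of q y] rho_pos[OF a_pos, of y] by simp
  have "integrable lborel (\<lambda>y. \<rho> a y *\<^sub>R Psi q y)"
  proof (rule integrableI_bounded)
    have "(\<integral>\<^sup>+ y. ennreal (norm (\<rho> a y *\<^sub>R Psi q y)) \<partial>lborel) = (\<integral>\<^sup>+ y. ennreal (Psi q y * \<rho> a y) \<partial>lborel)"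
    proof (rule nn_integral_cong)
      fix y show "ennreal (norm (\<rho> a y *\<^sub>R Psi q y)) = ennreal (Psi q y * \<rho> a y)"
        using nn[of y] by (simp add: mult.commute)
    qed
    also have "\<dots> < \<infinity>" using le_less_trans[OF fin ennreal_less_top] by simp
    finally show "(\<integral>\<^sup>+ y. ennreal (norm (\<rho> a y *\<^sub>R Psi q y)) \<partial>lborel) < \<infinity>" .
  qed simp
  then show ?thesis by (simp add: integrable_M)
qed

section \<open>Invariance of the weighted measure under rotations\<close>

lemma dil_measurable [measurable]: "dil J V m l \<in> borel_measurable borel"
  using dil_continuous[OF continuous_on_const continuous_on_id] by (rule borel_measurable_continuous_onI)

text \<open>Rotating the datum and rotating the solution give two bounded solutions with the same
  initial limit. By uniqueness they agree; at the identity, a fixed point of the rotation, this is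
  equality of the two integrals.\<close>

lemma dil_invariant:
  assumes l: "cmod l = 1" shows "distr M borel (dil J V m l) = M"
proof (rule measure_eq_test_fun)
  show "finite_measure (distr M borel (dil J V m l))"
    by (rule finite_measure_distr) simp
  show "finite_measure M" by unfold_locales
  fix f :: "'g \<Rightarrow> complex" assume f: "test_fun f"
  obtain K where K: "compact K" "\<And>z. z \<notin> K \<Longrightarrow> f z = 0" using test_fun_compact[OF f] by blast
  \<comment> \<open>\<open>hk\<close> at the identity evaluates its datum at \<open>- y\<close>; the
    reflection compensates for this.\<close>
  define g where "g z = f (- z)" for z
  have g: "test_fun g"
  proof (rule test_fun_support)
    show "smooth_fun g" unfolding g_def
      by (rule smooth_linear_compose[OF test_fun_smooth[OF f] bounded_linear_minus[OF bounded_linear_ident]])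
    show "compact (uminus ` K)" using K(1) by (rule compact_negations)
    show "g z = 0" if "z \<notin> uminus ` K" for z
      unfolding g_def using that by (intro K(2)) (metis imageI minus_minus)
  qed
  define gl where "gl z = g (dil J V m l z)" for z
  have gl: "test_fun gl"
  proof -
    obtain L where L: "compact L" "\<And>z. z \<notin> L \<Longrightarrow> g z = 0" using test_fun_compact[OF g] by blast
    show ?thesis
    proof (rule test_fun_support)
      show "smooth_fun gl" unfolding gl_def
        by (rule smooth_linear_compose[OF test_fun_smooth[OF g] dil_bounded_linear])
      show "compact (dil J V m (inverse l) ` L)"
        by (intro compact_continuous_image dil_continuous continuous_intros L)
      have "l \<noteq> 0" using l by auto
      then show "gl z = 0" if "z \<notin> dil J V m (inverse l) ` L" for z
        unfolding gl_def using that by (intro L(2)) (metis dil_1 dil_dil imageI left_inverse)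
    qed
  qed
  have "heat_sol (\<lambda>s z. hk gl s z + (- 1) * hk g s (dil J V m l z))"
    by (intro heat_sol_lin heat_sol_dil hk_heat_sol gl g l)
  then have hs: "heat_sol (\<lambda>s z. hk gl s z - hk g s (dil J V m l z))" by simp
  have "uniform_limit UNIV (\<lambda>s z. hk gl s z - hk g s (dil J V m l z)) (\<lambda>z. 0) (at_right 0)"
  proof (rule uniform_limitI)
    fix e :: real assume e: "e > 0"
    have "\<forall>\<^sub>F s in at_right 0. \<forall>z\<in>UNIV. dist (hk gl s z) (gl z) < e / 2"
      "\<forall>\<^sub>F s in at_right 0. \<forall>z\<in>UNIV. dist (hk g s z) (g z) < e / 2"
      using uniform_limitD[OF hk_heat(3)[OF gl], of "e / 2"] uniform_limitD[OF hk_heat(3)[OF g], of "e / 2"] e by auto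
    then show "\<forall>\<^sub>F s in at_right 0. \<forall>z\<in>UNIV. dist (hk gl s z - hk g s (dil J V m l z)) 0 < e"
    proof eventually_elim
      case (elim s)
      show ?case
      proof
        fix z
        have "dist (hk gl s z) (gl z) < e / 2" "dist (hk g s (dil J V m l z)) (gl z) < e / 2"
          using elim by (auto simp: gl_def)
        then show "dist (hk gl s z - hk g s (dil J V m l z)) 0 < e"
          using dist_triangle2[of "hk gl s z" "hk g s (dil J V m l z)" "gl z"]
          by (simp add: dist_norm)
      qed
    qed
  qed
  from heat_sol_unique[OF hs this a_pos, of 0] have eq: "hk gl a 0 = hk g a 0" by simp
  have cf: "continuous_on UNIV f" by (rule smooth_continuous[OF test_fun_smooth[OF f]])
  have [measurable]: "f \<in> borel_measurable borel" using cf by (rule borel_measurable_continuous_onI)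
  have "hk gl a 0 = (\<integral>z. f (dil J V m l z) \<partial>M)"
    by (simp add: hk_def gl_def g_def integral_M linear_neg[OF dil_linear] scaleR_conv_of_real mult.commute)
  moreover have "hk g a 0 = (\<integral>z. f z \<partial>M)"
    by (simp add: hk_def g_def integral_M scaleR_conv_of_real mult.commute)
  moreover have "(\<integral>z. f z \<partial>distr M borel (dil J V m l)) = (\<integral>z. f (dil J V m l z) \<partial>M)"
    by (rule integral_distr) auto
  ultimately show "(\<integral>z. f z \<partial>distr M borel (dil J V m l)) = (\<integral>z. f z \<partial>M)" using eq by simp
qed auto

lemma integral_dil:
  fixes g :: "'g \<Rightarrow> 'b::{banach, second_countable_topology}"
  assumes "cmod l = 1" "g \<in> borel_measurable borel"
  shows "(\<integral>z. g (dil J V m l z) \<partial>M) = (\<integral>z. g z \<partial>M)"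
    and "integrable M (\<lambda>z. g (dil J V m l z)) \<longleftrightarrow> integrable M g"
  using integral_distr[of "dil J V m l" M borel g] integrable_distr_eq[of "dil J V m l" M borel g] assms
  by (simp_all add: dil_invariant)

lemma nn_integral_dil:
  assumes "cmod l = 1" "g \<in> borel_measurable borel"
  shows "(\<integral>\<^sup>+z. g (dil J V m l z) \<partial>M) = (\<integral>\<^sup>+z. g z \<partial>M)"
  using nn_integral_distr[of "dil J V m l" M borel g] assms by (simp add: dil_invariant)

end

section \<open>Square integrable functions\<close>

definition sq :: "'a measure \<Rightarrow> ('a \<Rightarrow> complex) \<Rightarrow> bool" where
  "sq N f \<longleftrightarrow> f \<in> borel_measurable N \<and> integrable N (\<lambda>z. (cmod (f z))\<^sup>2)"

lemma inLp_2: "inLp N 2 f \<longleftrightarrow> sq N f"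
  by (simp add: inLp_def sq_def)

lemma sq_measurable: "sq N f \<Longrightarrow> f \<in> borel_measurable N"
  by (simp add: sq_def)

lemma sq_add:
  assumes "sq N f" "sq N g" shows "sq N (\<lambda>z. f z + c * g z)"
  unfolding sq_def
proof
  have [measurable]: "f \<in> borel_measurable N" "g \<in> borel_measurable N" using assms by (auto simp: sq_def)
  show "(\<lambda>z. f z + c * g z) \<in> borel_measurable N" by measurable
  have "integrable N (\<lambda>z. 2 * (cmod (f z))\<^sup>2 + 2 * (cmod c)\<^sup>2 * (cmod (g z))\<^sup>2)"
    using assms by (auto simp: sq_def)
  then show "integrable N (\<lambda>z. (cmod (f z + c * g z))\<^sup>2)"
  proof (rule Bochner_Integration.integrable_bound)
    show "AE z in N. norm ((cmod (f z + c * g z))\<^sup>2) \<le> norm (2 * (cmod (f z))\<^sup>2 + 2 * (cmod c)\<^sup>2 * (cmod (g z))\<^sup>2)"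
    proof (rule AE_I2)
      fix z
      have "(cmod (f z + c * g z))\<^sup>2 \<le> (cmod (f z) + cmod c * cmod (g z))\<^sup>2"
        using norm_triangle_ineq[of "f z" "c * g z"] by (intro power_mono) (auto simp: norm_mult)
      also have "\<dots> \<le> 2 * (cmod (f z))\<^sup>2 + 2 * (cmod c)\<^sup>2 * (cmod (g z))\<^sup>2"
        using sum_squares_bound[of "cmod (f z)" "cmod c * cmod (g z)"] by (simp add: power2_sum power_mult_distrib algebra_simps)
      finally show "norm ((cmod (f z + c * g z))\<^sup>2) \<le> norm (2 * (cmod (f z))\<^sup>2 + 2 * (cmod c)\<^sup>2 * (cmod (g z))\<^sup>2)"
        by simp
    qed
  qed measurable
qed

lemma sq_0: "sq N (\<lambda>z. 0)" by (simp add: sq_def)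

lemma sq_cmult: "sq N f \<Longrightarrow> sq N (\<lambda>z. c * f z)"
  using sq_add[OF sq_0, of N f c] by simp

lemma sq_diff: "sq N f \<Longrightarrow> sq N g \<Longrightarrow> sq N (\<lambda>z. f z - g z)"
  using sq_add[of N f g "- 1"] by simp

lemma sq_sum: "(\<And>i. i \<in> I \<Longrightarrow> sq N (f i)) \<Longrightarrow> sq N (\<lambda>z. \<Sum>i\<in>I. f i z)"
proof (induction I rule: infinite_finite_induct)
  case (insert i I)
  then show ?case using sq_add[of N "f i" "\<lambda>z. \<Sum>i\<in>I. f i z" 1] by simp
qed (auto simp: sq_0)

lemma cnj_measurable [measurable]: "cnj \<in> borel_measurable borel"
  by (intro borel_measurable_continuous_onI continuous_intros)

lemma sq_ip_integrable:
  assumes "sq N f" "sq N g" shows "integrable N (\<lambda>z. f z * cnj (g z))"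
proof (rule Bochner_Integration.integrable_bound)
  show "integrable N (\<lambda>z. (cmod (f z))\<^sup>2 + (cmod (g z))\<^sup>2)" using assms by (auto simp: sq_def)
  have [measurable]: "f \<in> borel_measurable N" "g \<in> borel_measurable N" using assms by (auto simp: sq_def)
  show "(\<lambda>z. f z * cnj (g z)) \<in> borel_measurable N" by measurable
  show "AE z in N. norm (f z * cnj (g z)) \<le> norm ((cmod (f z))\<^sup>2 + (cmod (g z))\<^sup>2)"
  proof (rule AE_I2)
    fix z
    have "0 \<le> cmod (f z) * cmod (g z)" by simp
    then have "cmod (f z) * cmod (g z) \<le> (cmod (f z))\<^sup>2 + (cmod (g z))\<^sup>2"
      using sum_squares_bound[of "cmod (f z)" "cmod (g z)"] by linarith
    then show "norm (f z * cnj (g z)) \<le> norm ((cmod (f z))\<^sup>2 + (cmod (g z))\<^sup>2)"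
      by (simp add: norm_mult)
  qed
qed

lemma L2ip_add_left: "sq N f \<Longrightarrow> sq N g \<Longrightarrow> sq N h \<Longrightarrow> L2ip N (\<lambda>z. f z + c * g z) h = L2ip N f h + c * L2ip N g h"
  unfolding L2ip_def
  using Bochner_Integration.integral_add[OF sq_ip_integrable[of N f h] integrable_mult_right[OF sq_ip_integrable[of N g h], of c]]
  by (simp add: algebra_simps)

lemma L2ip_cnj: "cnj (L2ip N f g) = L2ip N g f"
  unfolding L2ip_def by (subst Bochner_Integration.integral_cnj[symmetric]) (simp add: mult.commute)

lemma L2ip_add_right:
  assumes "sq N f" "sq N g" "sq N h"
  shows "L2ip N h (\<lambda>z. f z + c * g z) = L2ip N h f + cnj c * L2ip N h g"
proof -
  have "L2ip N h (\<lambda>z. f z + c * g z) = cnj (L2ip N (\<lambda>z. f z + c * g z) h)" by (simp only: L2ip_cnj)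
  also have "\<dots> = L2ip N h f + cnj c * L2ip N h g"
    unfolding L2ip_add_left[OF assms] by (simp add: L2ip_cnj)
  finally show ?thesis .
qed

lemma L2ip_diff_left: "sq N f \<Longrightarrow> sq N g \<Longrightarrow> sq N h \<Longrightarrow> L2ip N (\<lambda>z. f z - g z) h = L2ip N f h - L2ip N g h"
  using L2ip_add_left[of N f g h "- 1"] by simp

lemma L2ip_diff_right: "sq N f \<Longrightarrow> sq N g \<Longrightarrow> sq N h \<Longrightarrow> L2ip N h (\<lambda>z. f z - g z) = L2ip N h f - L2ip N h g"
  using L2ip_add_right[of N f g h "- 1"] by simp

lemma L2ip_zero_left [simp]: "L2ip N (\<lambda>z. 0) f = 0" and L2ip_zero_right [simp]: "L2ip N f (\<lambda>z. 0) = 0"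
  by (simp_all add: L2ip_def)

lemma L2ip_sum_left:
  "(\<And>i. i \<in> I \<Longrightarrow> sq N (f i)) \<Longrightarrow> sq N h \<Longrightarrow> L2ip N (\<lambda>z. \<Sum>i\<in>I. f i z) h = (\<Sum>i\<in>I. L2ip N (f i) h)"
proof (induction I rule: infinite_finite_induct)
  case (insert i I)
  then show ?case using L2ip_add_left[of N "f i" "\<lambda>z. \<Sum>i\<in>I. f i z" h 1] by (simp add: sq_sum)
qed auto

lemma L2ip_sum_right:
  assumes "\<And>i. i \<in> I \<Longrightarrow> sq N (f i)" "sq N h"
  shows "L2ip N h (\<lambda>z. \<Sum>i\<in>I. f i z) = (\<Sum>i\<in>I. L2ip N h (f i))"
proof -
  have "L2ip N h (\<lambda>z. \<Sum>i\<in>I. f i z) = cnj (L2ip N (\<lambda>z. \<Sum>i\<in>I. f i z) h)" by (simp only: L2ip_cnj)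
  also have "\<dots> = (\<Sum>i\<in>I. L2ip N h (f i))"
    by (subst L2ip_sum_left[OF assms]) (auto simp: L2ip_cnj)
  finally show ?thesis .
qed

lemma L2norm_ge_0 [simp]: "0 \<le> L2norm N f" by (simp add: L2norm_def)

lemma L2norm_sq: "(L2norm N f)\<^sup>2 = (\<integral>z. (cmod (f z))\<^sup>2 \<partial>N)"
  by (simp add: L2norm_def)

lemma L2ip_self: "L2ip N f f = of_real ((L2norm N f)\<^sup>2)"
  unfolding L2ip_def L2norm_sq integral_complex_of_real[symmetric]
  by (simp only: complex_norm_square)

lemma L2norm_0 [simp]: "L2norm N (\<lambda>z. 0) = 0" by (simp add: L2norm_def)

lemma L2norm_minus_commute: "L2norm N (\<lambda>z. f z - g z) = L2norm N (\<lambda>z. g z - f z)"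
  by (simp add: L2norm_def norm_minus_commute)

lemma L2norm_expand:
  assumes "sq N f" "sq N g"
  shows "(L2norm N (\<lambda>z. f z + c * g z))\<^sup>2 = (L2norm N f)\<^sup>2 + 2 * Re (cnj c * L2ip N f g) + (cmod c)\<^sup>2 * (L2norm N g)\<^sup>2"
proof -
  define u where "u z = f z + c * g z" for z
  have u: "sq N u" unfolding u_def by (rule sq_add[OF assms])
  have "complex_of_real ((L2norm N u)\<^sup>2) = L2ip N u u" by (simp only: L2ip_self)
  also have "\<dots> = L2ip N f u + c * L2ip N g u"
    using L2ip_add_left[OF assms u, of c] by (simp add: u_def[abs_def])
  also have "L2ip N f u = L2ip N f f + cnj c * L2ip N f g"
    unfolding u_def by (rule L2ip_add_right[OF assms assms(1)])
  also have "L2ip N g u = L2ip N g f + cnj c * L2ip N g g"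
    unfolding u_def by (rule L2ip_add_right[OF assms assms(2)])
  also have "L2ip N g f = cnj (L2ip N f g)" by (simp only: L2ip_cnj)
  finally have eq: "complex_of_real ((L2norm N u)\<^sup>2) = L2ip N f f + cnj c * L2ip N f g + c * (cnj (L2ip N f g) + cnj c * L2ip N g g)" .
  have "(L2norm N u)\<^sup>2 = Re (complex_of_real ((L2norm N u)\<^sup>2))" by simp
  also have "\<dots> = (L2norm N f)\<^sup>2 + 2 * Re (cnj c * L2ip N f g) + (cmod c)\<^sup>2 * (L2norm N g)\<^sup>2"
  proof -
    have "c * (cnj (L2ip N f g) + cnj c * complex_of_real ((L2norm N g)\<^sup>2))
      = cnj (cnj c * L2ip N f g) + of_real ((cmod c)\<^sup>2 * (L2norm N g)\<^sup>2)"
      unfolding of_real_mult complex_norm_square[of c] by (simp add: algebra_simps)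
    then show ?thesis unfolding eq L2ip_self by simp
  qed
  finally show ?thesis by (simp add: u_def[abs_def])
qed

text \<open>The discriminant argument on \<open>f - t u g\<close>, with the phase \<open>u\<close>
  making the inner product real. As \<open>L2norm\<close> is a seminorm on functions,
  \<open>L2norm N g = 0\<close> has to be treated apart.\<close>

lemma L2_Cauchy_Schwarz:
  assumes "sq N f" "sq N g" shows "cmod (L2ip N f g) \<le> L2norm N f * L2norm N g"
proof (cases "L2ip N f g = 0")
  case False
  define b where "b = cmod (L2ip N f g)"
  have b: "b > 0" using False by (simp add: b_def)
  define u where "u = L2ip N f g / of_real b"
  have u: "cmod u = 1" using b by (simp add: u_def norm_divide b_def)
  have uip: "cnj u * L2ip N f g = of_real b"
  proof -
    have "cnj u * L2ip N f g = (L2ip N f g * cnj (L2ip N f g)) / of_real b" by (simp add: u_def)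
    also have "\<dots> = of_real (b\<^sup>2) / of_real b" by (simp only: b_def complex_norm_square)
    also have "\<dots> = of_real b" using b by (simp add: power2_eq_square)
    finally show ?thesis .
  qed
  define F G where "F = L2norm N f" and "G = L2norm N g"
  have pos: "0 \<le> F\<^sup>2 - 2 * t * b + t\<^sup>2 * G\<^sup>2" for t
  proof -
    have "cnj (- of_real t * u) * L2ip N f g = - of_real t * (cnj u * L2ip N f g)" by simp
    also have "\<dots> = of_real (- (t * b))" unfolding uip by simp
    finally have "Re (cnj (- of_real t * u) * L2ip N f g) = - (t * b)" by (simp only: Re_complex_of_real)
    moreover have "cmod (- of_real t * u) = \<bar>t\<bar>" using u by (simp add: norm_mult)
    ultimately have "(L2norm N (\<lambda>z. f z + (- of_real t * u) * g z))\<^sup>2 = F\<^sup>2 - 2 * t * b + t\<^sup>2 * G\<^sup>2"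
      unfolding L2norm_expand[OF assms] by (simp only: F_def G_def power2_abs)
    then show ?thesis by (metis zero_le_power2)
  qed
  have FG: "F \<ge> 0" "G \<ge> 0" by (simp_all add: F_def G_def)
  have "b \<le> F * G"
  proof (cases "G = 0")
    \<comment> \<open>For \<open>G = 0\<close> the quadratic is affine in \<open>t\<close>; this
      value of \<open>t\<close> would make it equal to -1.\<close>
    case True
    have "0 \<le> F\<^sup>2 - 2 * ((F\<^sup>2 + 1) / (2 * b)) * b" using pos[of "(F\<^sup>2 + 1) / (2 * b)"] True by simp
    also have "\<dots> = - 1" using b by (simp add: field_simps)
    finally show ?thesis by simp
  next
    case False
    then have G: "G > 0" using FG by simp
    have "0 \<le> F\<^sup>2 - 2 * (b / G\<^sup>2) * b + (b / G\<^sup>2)\<^sup>2 * G\<^sup>2" by (rule pos)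
    also have "\<dots> = F\<^sup>2 - b\<^sup>2 / G\<^sup>2" using G by (simp add: field_simps power2_eq_square)
    finally have "b\<^sup>2 \<le> (F * G)\<^sup>2" using G by (simp add: field_simps power_mult_distrib)
    then show ?thesis using FG by (intro power2_le_imp_le[of b "F * G"] mult_nonneg_nonneg)
  qed
  then show ?thesis by (simp add: b_def F_def G_def)
qed simp

lemma L2norm_triangle:
  assumes "sq N f" "sq N g" shows "L2norm N (\<lambda>z. f z + g z) \<le> L2norm N f + L2norm N g"
proof (rule power2_le_imp_le)
  have "(L2norm N (\<lambda>z. f z + g z))\<^sup>2 = (L2norm N f)\<^sup>2 + 2 * Re (L2ip N f g) + (L2norm N g)\<^sup>2"
    using L2norm_expand[OF assms, of 1] by simp
  also have "\<dots> \<le> (L2norm N f)\<^sup>2 + 2 * (L2norm N f * L2norm N g) + (L2norm N g)\<^sup>2"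
    using L2_Cauchy_Schwarz[OF assms] complex_Re_le_cmod[of "L2ip N f g"] by simp
  also have "\<dots> = (L2norm N f + L2norm N g)\<^sup>2" by (simp add: power2_sum)
  finally show "(L2norm N (\<lambda>z. f z + g z))\<^sup>2 \<le> (L2norm N f + L2norm N g)\<^sup>2" .
qed simp

lemma L2norm_triangle_diff:
  assumes "sq N f" "sq N g" "sq N h"
  shows "L2norm N (\<lambda>z. f z - h z) \<le> L2norm N (\<lambda>z. f z - g z) + L2norm N (\<lambda>z. g z - h z)"
  using L2norm_triangle[OF sq_diff[OF assms(1,2)] sq_diff[OF assms(2,3)]] by simp

lemma L2_ip_tendsto:
  assumes f: "\<And>k. sq N (f k)" "sq N F" "(\<lambda>k. L2norm N (\<lambda>z. f k z - F z)) \<longlonglongrightarrow> 0"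
    and g: "\<And>k. sq N (g k)" "sq N G" "(\<lambda>k. L2norm N (\<lambda>z. g k z - G z)) \<longlonglongrightarrow> 0"
  shows "(\<lambda>k. L2ip N (f k) (g k)) \<longlonglongrightarrow> L2ip N F G"
proof -
  have "(\<lambda>k. L2ip N (f k) (g k) - L2ip N F G) \<longlonglongrightarrow> 0"
  proof (rule Lim_null_comparison)
    show "\<forall>\<^sub>F k in sequentially. norm (L2ip N (f k) (g k) - L2ip N F G)
      \<le> L2norm N (\<lambda>z. f k z - F z) * L2norm N (\<lambda>z. g k z - G z) + L2norm N (\<lambda>z. f k z - F z) * L2norm N G
        + L2norm N F * L2norm N (\<lambda>z. g k z - G z)"
    proof (rule always_eventually, rule allI)
      fix k
      note s = sq_diff[OF f(1)[of k] f(2)] sq_diff[OF g(1)[of k] g(2)]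
      have "L2ip N (f k) (g k) - L2ip N F G = L2ip N (\<lambda>z. f k z - F z) (\<lambda>z. g k z - G z)
        + L2ip N (\<lambda>z. f k z - F z) G + L2ip N F (\<lambda>z. g k z - G z)"
        by (simp add: L2ip_diff_left[OF f(1)[of k] f(2)] L2ip_diff_right[OF g(1)[of k] g(2)] f g s)
      then show "norm (L2ip N (f k) (g k) - L2ip N F G)
        \<le> L2norm N (\<lambda>z. f k z - F z) * L2norm N (\<lambda>z. g k z - G z) + L2norm N (\<lambda>z. f k z - F z) * L2norm N G
        + L2norm N F * L2norm N (\<lambda>z. g k z - G z)"
        using norm_triangle_mono[OF norm_triangle_mono[OF L2_Cauchy_Schwarz[OF s] L2_Cauchy_Schwarz[OF s(1) g(2)]]
            L2_Cauchy_Schwarz[OF f(2) s(2)]] by simp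
    qed
    show "(\<lambda>k. L2norm N (\<lambda>z. f k z - F z) * L2norm N (\<lambda>z. g k z - G z) + L2norm N (\<lambda>z. f k z - F z) * L2norm N G
        + L2norm N F * L2norm N (\<lambda>z. g k z - G z)) \<longlonglongrightarrow> 0"
      using f(3) g(3) by (auto intro!: tendsto_eq_intros)
  qed
  then show ?thesis by (rule LIM_zero_cancel)
qed

lemma L2_Fatou:
  assumes f: "\<And>k. sq N (f k)" and F: "F \<in> borel_measurable N"
    and lim: "\<And>z. (\<lambda>k. f k z) \<longlonglongrightarrow> F z" and C: "\<forall>\<^sub>F k in sequentially. L2norm N (f k) \<le> C"
  shows "sq N F" and "L2norm N F \<le> C"
proof -
  have C0: "C \<ge> 0"
  proof -
    obtain k where "L2norm N (f k) \<le> C" using C by (auto simp: eventually_sequentially)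
    then show ?thesis using L2norm_ge_0[of N "f k"] by linarith
  qed
  have [measurable]: "\<And>k. f k \<in> borel_measurable N" "F \<in> borel_measurable N" using f F by (auto simp: sq_def)
  have "(\<integral>\<^sup>+z. ennreal ((cmod (F z))\<^sup>2) \<partial>N) = (\<integral>\<^sup>+z. liminf (\<lambda>k. ennreal ((cmod (f k z))\<^sup>2)) \<partial>N)"
  proof (rule nn_integral_cong)
    fix z
    have "(\<lambda>k. ennreal ((cmod (f k z))\<^sup>2)) \<longlonglongrightarrow> ennreal ((cmod (F z))\<^sup>2)"
      by (intro tendsto_ennrealI tendsto_intros lim)
    from lim_imp_Liminf[OF _ this] show "ennreal ((cmod (F z))\<^sup>2) = liminf (\<lambda>k. ennreal ((cmod (f k z))\<^sup>2))" by simp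
  qed
  also have "\<dots> \<le> liminf (\<lambda>k. \<integral>\<^sup>+z. ennreal ((cmod (f k z))\<^sup>2) \<partial>N)"
    by (rule nn_integral_liminf) measurable
  also have "\<dots> \<le> ennreal (C\<^sup>2)"
  proof (rule Liminf_le)
    show "\<forall>\<^sub>F k in sequentially. (\<integral>\<^sup>+z. ennreal ((cmod (f k z))\<^sup>2) \<partial>N) \<le> ennreal (C\<^sup>2)"
      using C
    proof eventually_elim
      case (elim k)
      have "(\<integral>\<^sup>+z. ennreal ((cmod (f k z))\<^sup>2) \<partial>N) = ennreal ((L2norm N (f k))\<^sup>2)"
        unfolding L2norm_sq using f[of k] by (intro nn_integral_eq_integral) (auto simp: sq_def)
      then show ?case using elim by (simp add: ennreal_leI power_mono)
    qed
  qed simp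
  finally have le: "(\<integral>\<^sup>+z. ennreal ((cmod (F z))\<^sup>2) \<partial>N) \<le> ennreal (C\<^sup>2)" .
  have int: "integrable N (\<lambda>z. (cmod (F z))\<^sup>2)"
  proof (rule integrableI_bounded)
    show "(\<integral>\<^sup>+z. ennreal (norm ((cmod (F z))\<^sup>2)) \<partial>N) < \<infinity>"
      using le_less_trans[OF le ennreal_less_top] by simp
  qed measurable
  then show "sq N F" using F by (simp add: sq_def)
  have "ennreal ((L2norm N F)\<^sup>2) = (\<integral>\<^sup>+z. ennreal ((cmod (F z))\<^sup>2) \<partial>N)"
    unfolding L2norm_sq using int by (intro nn_integral_eq_integral[symmetric]) auto
  with le have "ennreal ((L2norm N F)\<^sup>2) \<le> ennreal (C\<^sup>2)" by (simp only:)
  then have "(L2norm N F)\<^sup>2 \<le> C\<^sup>2" by (subst (asm) ennreal_le_iff) simp_all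
  then show "L2norm N F \<le> C" using C0 by (rule power2_le_imp_le)
qed

text \<open>Fatou's lemma for \<open>2^p (|g\<^sub>k|^p + |g|^p) - |g\<^sub>k - g|^p \<ge> 0\<close>.\<close>

lemma Lp_convergence:
  fixes g :: "nat \<Rightarrow> 'a \<Rightarrow> complex"
  assumes p: "p \<ge> 1" and [measurable]: "\<And>k. g k \<in> borel_measurable N" "G \<in> borel_measurable N"
    and gi: "\<And>k. integrable N (\<lambda>z. cmod (g k z) powr p)" and Gi: "integrable N (\<lambda>z. cmod (G z) powr p)"
    and le: "\<And>k. (\<integral>z. cmod (g k z) powr p \<partial>N) \<le> (\<integral>z. cmod (G z) powr p \<partial>N)"
    and lim: "\<And>z. (\<lambda>k. g k z) \<longlonglongrightarrow> G z"
  shows "(\<lambda>k. \<integral>z. cmod (g k z - G z) powr p \<partial>N) \<longlonglongrightarrow> 0"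
proof -
  define b where "b k z = 2 powr p * (cmod (g k z) powr p + cmod (G z) powr p)" for k z
  define h where "h k z = b k z - cmod (g k z - G z) powr p" for k z
  define A where "A = (\<integral>z. cmod (G z) powr p \<partial>N)"
  have dle: "cmod (g k z - G z) powr p \<le> b k z" for k z
  proof -
    define t where "t = max (cmod (g k z)) (cmod (G z))"
    have "cmod (g k z - G z) \<le> 2 * t" using norm_triangle_ineq4[of "g k z" "G z"] by (simp add: t_def)
    then have "cmod (g k z - G z) powr p \<le> (2 * t) powr p" using p by (intro powr_mono2) auto
    also have "\<dots> = 2 powr p * t powr p" by (simp add: powr_mult t_def)
    also have "\<dots> \<le> b k z" unfolding b_def by (intro mult_left_mono) (auto simp: t_def max_def)
    finally show ?thesis .
  qed
  have bi: "integrable N (b k)" for k unfolding b_def using gi Gi by auto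
  have di: "integrable N (\<lambda>z. cmod (g k z - G z) powr p)" for k
    by (rule Bochner_Integration.integrable_bound[OF bi[of k]])
       (use dle[of k] in \<open>auto intro!: AE_I2 order_trans[OF _ abs_ge_self]\<close>)
  have hi: "integrable N (h k)" for k unfolding h_def by (intro Bochner_Integration.integrable_diff bi di)
  have hpos: "0 \<le> h k z" for k z using dle[of k z] by (simp add: h_def)
  have hlim: "(\<lambda>k. h k z) \<longlonglongrightarrow> 2 powr p * (cmod (G z) powr p + cmod (G z) powr p) - 0" for z
  proof -
    have "(\<lambda>k. cmod (g k z) powr p) \<longlonglongrightarrow> cmod (G z) powr p"
      using p by (intro tendsto_powr2 tendsto_intros lim) auto
    moreover have "(\<lambda>k. cmod (g k z - G z) powr p) \<longlonglongrightarrow> 0 powr p"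
    proof (rule tendsto_powr2)
      show "(\<lambda>k. cmod (g k z - G z)) \<longlonglongrightarrow> 0" using lim[of z] by (simp add: LIM_zero tendsto_norm_zero)
    qed (use p in auto)
    then have "(\<lambda>k. cmod (g k z - G z) powr p) \<longlonglongrightarrow> 0" by simp
    ultimately show ?thesis unfolding h_def b_def by (intro tendsto_diff tendsto_mult tendsto_const tendsto_add)
  qed
  have Ih: "(\<integral>z. h k z \<partial>N) \<le> 2 powr p * (A + A) - (\<integral>z. cmod (g k z - G z) powr p \<partial>N)" for k
  proof -
    have "(\<integral>z. h k z \<partial>N) = (\<integral>z. b k z \<partial>N) - (\<integral>z. cmod (g k z - G z) powr p \<partial>N)"
      unfolding h_def by (rule Bochner_Integration.integral_diff[OF bi di])
    also have "(\<integral>z. b k z \<partial>N) = 2 powr p * ((\<integral>z. cmod (g k z) powr p \<partial>N) + A)"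
      unfolding b_def A_def using gi[of k] Gi by simp
    also have "\<dots> \<le> 2 powr p * (A + A)" using le[of k] by (simp add: A_def)
    finally show ?thesis by simp
  qed
  have "ennreal (2 powr p * (A + A)) = (\<integral>\<^sup>+z. ennreal (2 powr p * (cmod (G z) powr p + cmod (G z) powr p) - 0) \<partial>N)"
  proof -
    have "(\<integral>\<^sup>+z. ennreal (2 powr p * (cmod (G z) powr p + cmod (G z) powr p)) \<partial>N)
      = ennreal (\<integral>z. 2 powr p * (cmod (G z) powr p + cmod (G z) powr p) \<partial>N)"
      using Gi by (intro nn_integral_eq_integral) (auto intro!: AE_I2)
    then show ?thesis using Gi by (simp add: A_def)
  qed
  also have "\<dots> = (\<integral>\<^sup>+z. liminf (\<lambda>k. ennreal (h k z)) \<partial>N)"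
  proof (rule nn_integral_cong)
    fix z
    from lim_imp_Liminf[OF _ tendsto_ennrealI[OF hlim[of z]]]
    show "ennreal (2 powr p * (cmod (G z) powr p + cmod (G z) powr p) - 0) = liminf (\<lambda>k. ennreal (h k z))" by simp
  qed
  also have "\<dots> \<le> liminf (\<lambda>k. \<integral>\<^sup>+z. ennreal (h k z) \<partial>N)"
    by (rule nn_integral_liminf) (simp add: h_def b_def)
  also have "\<dots> = liminf (\<lambda>k. ennreal (\<integral>z. h k z \<partial>N))"
    using hi hpos by (simp add: nn_integral_eq_integral)
  finally have fat: "ennreal (2 powr p * (A + A)) \<le> liminf (\<lambda>k. ennreal (\<integral>z. h k z \<partial>N))" .
  show ?thesis
  proof (rule tendstoI)
    fix e :: real assume e: "e > 0"
    have D0: "0 \<le> (\<integral>z. cmod (g k z - G z) powr p \<partial>N)" for k by (intro integral_nonneg_AE) simp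
    have A0: "A \<ge> 0" unfolding A_def by (intro integral_nonneg_AE) simp
    show "\<forall>\<^sub>F k in sequentially. dist (\<integral>z. cmod (g k z - G z) powr p \<partial>N) 0 < e"
    \<comment> \<open>\<open>ennreal\<close> sends negative reals to 0, so the strict comparison
      below needs a nonnegative left side. In the other case \<open>e\<close> already exceeds the
      largest possible value of the integral.\<close>
    proof (cases "2 powr p * (A + A) - e < 0")
      case True
      have "(\<integral>z. cmod (g k z - G z) powr p \<partial>N) < e" for k
      proof -
        have "0 \<le> (\<integral>z. h k z \<partial>N)" using hpos by (intro integral_nonneg_AE) simp
        then show ?thesis using Ih[of k] True by linarith
      qed
      then show ?thesis using D0 by (simp add: dist_norm)
    next
      case False
      then have "ennreal (2 powr p * (A + A) - e) < ennreal (2 powr p * (A + A))"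
        using e by (intro ennreal_lessI) linarith+
      then have "ennreal (2 powr p * (A + A) - e) < liminf (\<lambda>k. ennreal (\<integral>z. h k z \<partial>N))" using fat by (rule less_le_trans)
      from less_LiminfD[OF this] show ?thesis
      proof eventually_elim
        case (elim k)
        then have "2 powr p * (A + A) - e < (\<integral>z. h k z \<partial>N)"
          using False by (simp add: ennreal_less_iff)
        then show ?case using Ih[of k] D0[of k] by (simp add: dist_norm)
      qed
    qed
  qed
qed

section \<open>Homogeneous components\<close>

text \<open>Normalised Haar measure of the circle, transported to the angle and carried by one
  period. Living on all reals, it can be paired directly with functions continuous on
  \<open>UNIV\<close>.\<close>

definition circ :: "real measure" where
  "circ = density lborel (\<lambda>t. ennreal (indicator {0..2 * pi} t / (2 * pi)))"

lemma sets_circ [simp, measurable_cong]: "sets circ = sets borel" and space_circ [simp]: "space circ = UNIV"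
  by (simp_all add: circ_def)

lemma prob_circ: "prob_space circ"
proof
  have "emeasure circ (space circ) = (\<integral>\<^sup>+t. ennreal (1 / (2 * pi)) * indicator {0..2 * pi} t \<partial>lborel)"
    unfolding circ_def by (subst emeasure_density) (auto intro!: nn_integral_cong simp: indicator_def)
  also have "\<dots> = ennreal (1 / (2 * pi)) * ennreal (2 * pi)"
    by (subst nn_integral_cmult) auto
  also have "\<dots> = ennreal 1" by (subst ennreal_mult[symmetric]) auto
  finally show "emeasure circ (space circ) = 1" by simp
qed

lemma circ_integral:
  fixes f :: "real \<Rightarrow> 'b::euclidean_space"
  assumes "continuous_on UNIV f"
  shows "integrable circ f" and "(\<integral>t. f t \<partial>circ) = (1 / (2 * pi)) *\<^sub>R integral {0..2 * pi} f"
proof -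
  have [measurable]: "f \<in> borel_measurable borel" using assms by (rule borel_measurable_continuous_onI)
  have "set_integrable lborel {0..2 * pi} f"
    by (rule borel_integrable_atLeastAtMost'[OF continuous_on_subset[OF assms subset_UNIV]])
  then have i: "integrable lborel (\<lambda>t. indicator {0..2 * pi} t *\<^sub>R f t)"
    and e: "(\<integral>t. indicator {0..2 * pi} t *\<^sub>R f t \<partial>lborel) = integral {0..2 * pi} f"
    using set_borel_integral_eq_integral(2)[of "{0..2 * pi}" f]
    by (auto simp: set_integrable_def set_lebesgue_integral_def)
  have eq: "(\<lambda>t. (indicator {0..2 * pi} t / (2 * pi)) *\<^sub>R f t) = (\<lambda>t. (1 / (2 * pi)) *\<^sub>R (indicator {0..2 * pi} t *\<^sub>R f t))"
    by auto
  have "integrable circ f \<longleftrightarrow> integrable lborel (\<lambda>t. (indicator {0..2 * pi} t / (2 * pi)) *\<^sub>R f t)"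
    unfolding circ_def by (rule integrable_density) auto
  then show "integrable circ f" unfolding eq using integrable_scaleR_right[OF i] by blast
  have "(\<integral>t. f t \<partial>circ) = (\<integral>t. (indicator {0..2 * pi} t / (2 * pi)) *\<^sub>R f t \<partial>lborel)"
    unfolding circ_def by (rule integral_density) auto
  also have "\<dots> = (\<integral>t. (1 / (2 * pi)) *\<^sub>R (indicator {0..2 * pi} t *\<^sub>R f t) \<partial>lborel)" by (simp only: eq)
  also have "\<dots> = (1 / (2 * pi)) *\<^sub>R (\<integral>t. indicator {0..2 * pi} t *\<^sub>R f t \<partial>lborel)" by (rule integral_scaleR_right)
  finally show "(\<integral>t. f t \<partial>circ) = (1 / (2 * pi)) *\<^sub>R integral {0..2 * pi} f" by (simp only: e)
qed

interpretation circ: prob_space circ by (rule prob_circ)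

text \<open>The tangent of a convex power at \<open>A\<close> lies below its graph. The endpoint
  \<open>y = 0\<close> is checked by hand because convexity is used on the open half-line.\<close>

lemma powr_tangent:
  fixes y A p :: real
  assumes "p \<ge> 1" "y \<ge> 0" "A > 0"
  shows "A powr p + p * A powr (p - 1) * (y - A) \<le> y powr p"
proof (cases "y = 0")
  case True
  have "A powr p = A powr (p - 1) * A" using assms(3) by (simp add: powr_diff)
  then have "A powr p + p * A powr (p - 1) * (y - A) = (1 - p) * A powr p" using True by (simp add: algebra_simps)
  also have "\<dots> \<le> 0" using assms by (intro mult_nonpos_nonneg) auto
  finally show ?thesis using True by simp
next
  case False
  have "y powr p - A powr p \<ge> (p * A powr (p - 1)) * (y - A)"
  proof (rule convex_on_imp_above_tangent)
    show "convex_on {0<..} (\<lambda>y. y powr p)" using assms(1) by (rule powr_convex)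
    show "((\<lambda>y. y powr p) has_real_derivative p * A powr (p - 1)) (at A within {0<..})"
      by (rule has_field_derivative_at_within[OF has_real_derivative_powr[OF assms(3)]])
    show "A \<in> interior {0<..}" using assms(3) by (simp add: interior_open)
  qed (use False assms in simp_all)
  then show ?thesis by simp
qed

text \<open>The tangent inequality is integrated at the mean \<open>A\<close> of
  \<open>cmod (f t)\<close>, where the linear term averages to zero.\<close>

lemma prob_Jensen_powr:
  fixes f :: "'a \<Rightarrow> complex"
  assumes "prob_space N" and p: "p \<ge> 1" and f: "integrable N f" and fp: "integrable N (\<lambda>t. cmod (f t) powr p)"
  shows "cmod (\<integral>t. f t \<partial>N) powr p \<le> (\<integral>t. cmod (f t) powr p \<partial>N)"
proof (cases "(\<integral>t. f t \<partial>N) = 0")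
  case True
  then show ?thesis by (simp add: integral_nonneg_AE)
next
  case False
  interpret prob_space N by fact
  define A where "A = (\<integral>t. cmod (f t) \<partial>N)"
  have le: "cmod (\<integral>t. f t \<partial>N) \<le> A" unfolding A_def by (rule integral_norm_bound)
  then have A: "A > 0" using False by (metis norm_le_zero_iff not_less order_trans)
  have "cmod (\<integral>t. f t \<partial>N) powr p \<le> A powr p" using le p by (intro powr_mono2) auto
  also have "\<dots> = (\<integral>t. A powr p + p * A powr (p - 1) * (cmod (f t) - A) \<partial>N)"
    using f by (simp add: A_def prob_space)
  also have "\<dots> \<le> (\<integral>t. cmod (f t) powr p \<partial>N)"
    using f by (intro integral_mono fp powr_tangent p A) auto
  finally show ?thesis .
qed

lemma Cesaro_mean:
  fixes S :: "nat \<Rightarrow> complex"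
  assumes "S \<longlonglongrightarrow> L"
  shows "(\<lambda>n. (1 / of_nat (Suc n)) * (\<Sum>k<Suc n. S k)) \<longlonglongrightarrow> L"
proof (rule LIMSEQ_I)
  fix e :: real assume e: "e > 0"
  then obtain N where N: "\<And>k. k \<ge> N \<Longrightarrow> cmod (S k - L) < e / 2"
    using LIMSEQ_D[OF assms, of "e / 2"] by auto
  define B where "B = (\<Sum>k<N. cmod (S k - L))"
  obtain N' where N': "real N' > 2 * B / e" using reals_Archimedean2 by blast
  show "\<exists>no. \<forall>n\<ge>no. norm ((1 / of_nat (Suc n)) * (\<Sum>k<Suc n. S k) - L) < e"
  proof (intro exI[of _ N'] allI impI)
    fix n assume n: "n \<ge> N'"
    have "(1 / of_nat (Suc n)) * (\<Sum>k<Suc n. S k) - L = (1 / of_nat (Suc n)) * (\<Sum>k<Suc n. S k - L)"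
    proof -
      have "(\<Sum>k<Suc n. S k - L) = (\<Sum>k<Suc n. S k) - of_nat (Suc n) * L" by (simp only: sum_subtractf) simp
      then show ?thesis by (simp add: field_simps del: sum.lessThan_Suc of_nat_Suc)
    qed
    then have "norm ((1 / of_nat (Suc n)) * (\<Sum>k<Suc n. S k) - L) = (1 / real (Suc n)) * cmod (\<Sum>k<Suc n. S k - L)"
      by (simp only: norm_mult norm_divide norm_one norm_of_nat)
    also have "\<dots> \<le> (1 / real (Suc n)) * (B + real (Suc n) * (e / 2))"
    proof (rule mult_left_mono)
      have "cmod (\<Sum>k<Suc n. S k - L) \<le> (\<Sum>k<Suc n. cmod (S k - L))" by (rule norm_sum)
      also have "\<dots> \<le> (\<Sum>k<Suc n. (if k < N then cmod (S k - L) else 0) + e / 2)"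
        using N e by (intro sum_mono) (auto simp: not_less intro: less_imp_le)
      also have "\<dots> = (\<Sum>k<Suc n. if k < N then cmod (S k - L) else 0) + real (Suc n) * (e / 2)"
        by (simp only: sum.distrib sum_constant card_lessThan)
      also have "(\<Sum>k<Suc n. if k < N then cmod (S k - L) else 0) \<le> B"
      proof -
        have "(\<Sum>k<Suc n. if k < N then cmod (S k - L) else 0) = (\<Sum>k\<in>{..<Suc n} \<inter> {..<N}. cmod (S k - L))"
          by (simp add: sum.inter_restrict del: sum.lessThan_Suc)
        also have "\<dots> \<le> B" unfolding B_def by (intro sum_mono2) auto
        finally show ?thesis .
      qed
      finally show "cmod (\<Sum>k<Suc n. S k - L) \<le> B + real (Suc n) * (e / 2)" by simp
    qed simp
    also have "\<dots> = B / real (Suc n) + e / 2" by (simp add: field_simps del: of_nat_Suc)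
    also have "\<dots> < e"
    proof -
      have "2 * B / e < real (Suc n)" using N' n by linarith
      then have "2 * B < real (Suc n) * e" using e by (simp only: pos_divide_less_eq)
      then have "B / real (Suc n) < e / 2" by (simp add: field_simps del: of_nat_Suc)
      then show ?thesis by linarith
    qed
    finally show "norm ((1 / of_nat (Suc n)) * (\<Sum>k<Suc n. S k) - L) < e" .
  qed
qed

text \<open>The Fejer kernel as a normalised square, which makes its positivity visible; multiplying
  out the square gives the frequencies \<open>j - k\<close>.\<close>

definition fejer :: "nat \<Rightarrow> real \<Rightarrow> real" where
  "fejer K t = (1 / real K) * (cmod (\<Sum>k<K. cis (real k * t)))\<^sup>2"

lemma fejer_nonneg: "0 \<le> fejer K t" by (simp add: fejer_def)

lemma fejer_expand: "complex_of_real (fejer K t) = (1 / of_nat K) * (\<Sum>k<K. \<Sum>j<K. cis (real j * t) * cis (- (real k * t)))"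
proof -
  have "complex_of_real (fejer K t) = (1 / of_nat K) * ((\<Sum>j<K. cis (real j * t)) * cnj (\<Sum>k<K. cis (real k * t)))"
    unfolding fejer_def of_real_mult complex_norm_square by simp
  also have "(\<Sum>j<K. cis (real j * t)) * cnj (\<Sum>k<K. cis (real k * t)) = (\<Sum>k<K. \<Sum>j<K. cis (real j * t) * cis (- (real k * t)))"
    by (simp add: cis_cnj sum_distrib_left sum_distrib_right)
  finally show ?thesis .
qed

lemma fejer_continuous: "continuous_on S (fejer K)"
  unfolding fejer_def by (intro continuous_intros)

context strat_group
begin

text \<open>The Fourier coefficient of the circle action, kept as an integral for use with Fubini
  and invariance. For holomorphic \<open>f\<close> it is also the Taylor coefficient of the dilation
  slice at 0.\<close>

definition tay :: "nat \<Rightarrow> ('g \<Rightarrow> complex) \<Rightarrow> 'g \<Rightarrow> complex" where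
  "tay k f z = (\<integral>t. f (dil J V m (cis t) z) * cis (- (real k * t)) \<partial>circ)"

lemma rot_continuous:
  assumes "continuous_on UNIV f" shows "continuous_on UNIV (\<lambda>t. f (dil J V m (cis t) z))"
  by (intro continuous_on_compose2[OF assms] dil_continuous continuous_intros) auto

lemma rot2_continuous:
  assumes "continuous_on UNIV f" shows "continuous_on UNIV (\<lambda>p. f (dil J V m (cis (snd p)) (fst p)))"
  by (intro continuous_on_compose2[OF assms] dil_continuous continuous_intros) auto

lemma tay_eq:
  assumes "holo J f" shows "tay k f z = (deriv ^^ k) (\<lambda>l. f (dil J V m l z)) 0 / fact k"
proof -
  have "tay k f z = (1 / (2 * pi)) *\<^sub>R integral {0..2 * pi} (\<lambda>t. f (dil J V m (cis t) z) * cis (- (real k * t)))"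
    unfolding tay_def by (intro circ_integral continuous_intros rot_continuous holo_continuous assms)
  also have "\<dots> = (deriv ^^ k) (\<lambda>l. f (dil J V m l z)) 0 / fact k"
    unfolding integral_unique[OF circle_coefficient[OF holo_dil_slice[OF assms]]]
    by (simp add: scaleR_conv_of_real)
  finally show ?thesis .
qed

lemma tay_integral:
  assumes "holo J f"
  shows "tay k f = (\<lambda>z. (1 / (2 * pi)) * integral {0..2 * pi} (\<lambda>t. cis (- (real k * t)) * f (dil J V m (cis t) z)))"
proof
  fix z
  have "tay k f z = (1 / (2 * pi)) *\<^sub>R integral {0..2 * pi} (\<lambda>t. f (dil J V m (cis t) z) * cis (- (real k * t)))"
    unfolding tay_def by (intro circ_integral continuous_intros rot_continuous holo_continuous assms)
  then show "tay k f z = (1 / (2 * pi)) * integral {0..2 * pi} (\<lambda>t. cis (- (real k * t)) * f (dil J V m (cis t) z))"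
    by (simp add: scaleR_conv_of_real mult.commute)
qed

lemma tay_param:
  assumes "holo J f"
  shows "continuous_on (UNIV \<times> {0..2 * pi}) (\<lambda>(z, t). cis (- (real k * t)) * f (dil J V m (cis t) z))"
    and "holo J (\<lambda>z. cis (- (real k * t)) * f (dil J V m (cis t) z))"
proof -
  show "continuous_on (UNIV \<times> {0..2 * pi}) (\<lambda>(z, t). cis (- (real k * t)) * f (dil J V m (cis t) z))"
    unfolding split_beta
    by (intro continuous_intros continuous_on_subset[OF rot2_continuous[OF holo_continuous[OF assms]]]) auto
  show "holo J (\<lambda>z. cis (- (real k * t)) * f (dil J V m (cis t) z))"
    by (intro holo_cmult holo_dil assms)
qed

lemma tay_holo: assumes "holo J f" shows "holo J (tay k f)"
  unfolding tay_integral[OF assms] by (intro holo_cmult[of "\<lambda>z. integral _ (F z)" for F] holo_param tay_param assms)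

text \<open>Seen as a Taylor coefficient, replacing \<open>z\<close> by its dilation rescales the
  slice variable by \<open>l\<close>. Thus homogeneity holds for every complex \<open>l\<close>, not
  only on the unit circle where the integral lives.\<close>

lemma tay_hom:
  assumes "holo J f" shows "tay k f (dil J V m l z) = l ^ k * tay k f z"
proof -
  have "(\<lambda>c. f (dil J V m c (dil J V m l z))) = (\<lambda>c. (\<lambda>c. f (dil J V m c z)) (l * c))"
    by (simp add: dil_dil mult.commute)
  moreover have "(deriv ^^ k) (\<lambda>c. (\<lambda>c. f (dil J V m c z)) (l * c)) 0 = l ^ k * (deriv ^^ k) (\<lambda>c. f (dil J V m c z)) (l * 0)"
    by (rule higher_deriv_compose_linear[OF holo_dil_slice[OF assms], of UNIV]) auto
  ultimately show ?thesis by (simp add: tay_eq[OF assms])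
qed

lemma tay_hom_poly: "holo J f \<Longrightarrow> tay k f \<in> hom_poly J V m k"
  by (simp add: hom_poly_def tay_holo tay_hom)

lemma tay_sums: assumes "holo J f" shows "(\<lambda>k. tay k f z) sums f z"
  using holomorphic_power_series[of "\<lambda>l. f (dil J V m l z)" 0 2 1] holomorphic_on_subset[OF holo_dil_slice[OF assms]]
  by (simp add: tay_eq[OF assms])

lemma tay_0: "holo J f \<Longrightarrow> tay 0 f z = f 0"
  by (simp add: tay_eq)

text \<open>Along \<open>V 1\<close> a derivative of \<open>f\<close> composed with the rotation by
  \<open>t\<close> picks up the factor \<open>cis t\<close>, which shifts the frequency by
  one.\<close>

lemma lvf_tay:
  assumes f: "holo J f" and x: "x \<in> V 1"
  shows "lvf gmul x (tay (Suc k) f) z = tay k (lvf gmul x f) z" and "lvf gmul x (tay 0 f) z = 0"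
proof -
  have d: "(\<lambda>z. integral {0..2 * pi} (\<lambda>t. cis (- (real (Suc k) * t)) * f (dil J V m (cis t) z))) differentiable (at z)"
    by (rule holo_differentiable[OF holo_param]) (intro tay_param f)+
  have "lvf gmul x (tay (Suc k) f) z
    = (1 / (2 * pi)) * integral {0..2 * pi} (\<lambda>t. lvf gmul x (\<lambda>z. cis (- (real (Suc k) * t)) * f (dil J V m (cis t) z)) z)"
    unfolding tay_integral[OF f] lvf_cmult[OF d]     by (subst lvf_param[OF tay_param(1)[OF f, of "Suc k"] tay_param(2)[OF f, of "Suc k"]]) (rule refl)
  also have "(\<lambda>t. lvf gmul x (\<lambda>z. cis (- (real (Suc k) * t)) * f (dil J V m (cis t) z)) z)
    = (\<lambda>t. cis (- (real k * t)) * lvf gmul x f (dil J V m (cis t) z))"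
  proof
    fix t
    have "lvf gmul x (\<lambda>z. cis (- (real (Suc k) * t)) * f (dil J V m (cis t) z)) z
      = cis (- (real (Suc k) * t)) * (cis t * lvf gmul x f (dil J V m (cis t) z))"
      unfolding lvf_cmult[OF holo_differentiable[OF holo_dil[OF f]]] lvf_dil_holo[OF f x] ..
    also have "\<dots> = cis (- (real k * t)) * lvf gmul x f (dil J V m (cis t) z)"
      by (simp add: cis_mult algebra_simps)
    finally show "lvf gmul x (\<lambda>z. cis (- (real (Suc k) * t)) * f (dil J V m (cis t) z)) z
      = cis (- (real k * t)) * lvf gmul x f (dil J V m (cis t) z)" .
  qed
  finally show "lvf gmul x (tay (Suc k) f) z = tay k (lvf gmul x f) z"
    unfolding tay_integral[OF holo_lvf[OF f]] .
  have "tay 0 f = (\<lambda>z. f 0)" by (rule ext) (rule tay_0[OF f])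
  then show "lvf gmul x (tay 0 f) z = 0" by (simp add: lvf_def)
qed

lemma lvf_tay_sum:
  assumes f: "holo J f" and x: "x \<in> V 1"
  shows "lvf gmul x (\<lambda>z. \<Sum>k<Suc K. tay k f z) z = (\<Sum>k<K. tay k (lvf gmul x f) z)"
proof -
  have "lvf gmul x (\<lambda>z. \<Sum>k<Suc K. tay k f z) z = (\<Sum>k<Suc K. lvf gmul x (tay k f) z)"
    by (rule lvf_sum) (rule holo_differentiable[OF tay_holo[OF f]])
  also have "\<dots> = (\<Sum>k<K. tay k (lvf gmul x f) z)"
    by (simp only: sum.lessThan_Suc_shift lvf_tay[OF f x]) simp
  finally show ?thesis .
qed

text \<open>Orbits of a holomorphic function carry only nonnegative frequencies: the integral is the
  value at 0 of a function containing the factor \<open>l ^ d\<close> with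
  \<open>d > 0\<close>.\<close>

lemma rot_positive:
  assumes "holo J f" "j > (k::nat)"
  shows "(\<integral>t. f (dil J V m (cis t) z) * (cis (real j * t) * cis (- (real k * t))) \<partial>circ) = 0"
proof -
  define d where "d = j - k"
  have d: "d > 0" "real j = real k + real d" using assms(2) by (auto simp: d_def)
  have hol: "(\<lambda>l. l ^ d * f (dil J V m l z)) holomorphic_on UNIV"
    by (intro holomorphic_intros holo_dil_slice assms)
  have "(\<integral>t. f (dil J V m (cis t) z) * (cis (real j * t) * cis (- (real k * t))) \<partial>circ)
    = (\<integral>t. cis t ^ d * f (dil J V m (cis t) z) * cis (- (real 0 * t)) \<partial>circ)"
    by (intro Bochner_Integration.integral_cong refl) (simp add: Complex.DeMoivre cis_mult d algebra_simps)
  also have "\<dots> = (1 / (2 * pi)) *\<^sub>R integral {0..2 * pi} (\<lambda>t. cis t ^ d * f (dil J V m (cis t) z) * cis (- (real 0 * t)))"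
    by (intro circ_integral continuous_intros rot_continuous holo_continuous assms)
  also have "\<dots> = 0"
    unfolding integral_unique[OF circle_coefficient[OF hol]] using d by simp
  finally show ?thesis .
qed

lemma rot_coefficient:
  assumes "holo J f"
  shows "(\<integral>t. f (dil J V m (cis t) z) * (cis (real j * t) * cis (- (real k * t))) \<partial>circ) = (if j \<le> k then tay (k - j) f z else 0)"
proof (cases "j \<le> k")
  case True
  then show ?thesis unfolding tay_def
    by (simp, intro Bochner_Integration.integral_cong refl) (simp add: cis_mult of_nat_diff algebra_simps)
next
  case False
  then show ?thesis using rot_positive[OF assms, of k j z] by simp
qed

definition fejer_mean :: "nat \<Rightarrow> ('g \<Rightarrow> complex) \<Rightarrow> 'g \<Rightarrow> complex" where
  "fejer_mean K f z = (\<integral>t. f (dil J V m (cis t) z) * of_real (fejer K t) \<partial>circ)"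

text \<open>For each \<open>k\<close>, terms with \<open>j > k\<close> vanish and the others
  contribute the components of degree \<open>k - j\<close>. One-sidedness of the spectrum thus turns
  the symmetric Fejer sum into the Cesaro mean of the partial sums.\<close>

lemma fejer_mean_eq:
  assumes f: "holo J f"
  shows "fejer_mean K f z = (1 / of_nat K) * (\<Sum>k<K. \<Sum>j<Suc k. tay j f z)"
proof -
  have ci: "integrable circ (\<lambda>t. f (dil J V m (cis t) z) * (cis (real j * t) * cis (- (real k * t))))" for j k
    by (intro circ_integral continuous_intros rot_continuous holo_continuous f)
  have "fejer_mean K f z = (\<integral>t. (1 / of_nat K) * (\<Sum>k<K. \<Sum>j<K. f (dil J V m (cis t) z) * (cis (real j * t) * cis (- (real k * t)))) \<partial>circ)"
    unfolding fejer_mean_def fejer_expand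
    by (intro Bochner_Integration.integral_cong refl) (simp add: sum_distrib_left mult.assoc mult.left_commute)
  also have "\<dots> = (1 / of_nat K) * (\<Sum>k<K. \<Sum>j<K. if j \<le> k then tay (k - j) f z else 0)"
    by (simp add: ci rot_coefficient[OF f])
  also have "(\<Sum>k<K. \<Sum>j<K. if j \<le> k then tay (k - j) f z else 0) = (\<Sum>k<K. \<Sum>j<Suc k. tay j f z)"
  proof (rule sum.cong[OF refl])
    fix k assume k: "k \<in> {..<K}"
    have "(\<Sum>j<K. if j \<le> k then tay (k - j) f z else 0) = (\<Sum>j<Suc k. tay (k - j) f z)"
      using k by (intro sum.mono_neutral_cong_right) auto
    also have "\<dots> = (\<Sum>j<Suc k. tay j f z)"
      using sum.nat_diff_reindex[of "\<lambda>j. tay j f z" "Suc k"] by simp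
    finally show "(\<Sum>j<K. if j \<le> k then tay (k - j) f z else 0) = (\<Sum>j<Suc k. tay j f z)" .
  qed
  finally show ?thesis .
qed

text \<open>The total mass is read off from the Fejer mean of the constant function 1, whose only
  component has degree 0.\<close>

lemma fejer_integral: assumes "K > 0" shows "(\<integral>t. fejer K t \<partial>circ) = 1"
proof -
  have "tay j (\<lambda>z. 1) 0 = (if j = 0 then 1 else 0)" for j
    unfolding tay_eq[OF holo_const] by (cases j) (auto simp: higher_deriv_const)
  then have "fejer_mean K (\<lambda>z. 1) 0 = 1"
    unfolding fejer_mean_eq[OF holo_const] using assms by (simp del: sum.lessThan_Suc)
  then have "complex_of_real (\<integral>t. fejer K t \<partial>circ) = 1"
    unfolding fejer_mean_def by simp
  then show ?thesis by simp
qed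

lemma fejer_mean_tendsto:
  assumes f: "holo J f" shows "(\<lambda>K. fejer_mean (Suc K) f z) \<longlonglongrightarrow> f z"
proof -
  define S where "S k = (\<Sum>j<Suc k. tay j f z)" for k
  have "S \<longlonglongrightarrow> f z"
    using LIMSEQ_Suc[OF tay_sums[OF f, of z, unfolded sums_def]] by (simp add: S_def[abs_def])
  from Cesaro_mean[OF this] show ?thesis unfolding fejer_mean_eq[OF f] S_def .
qed

end

section \<open>Homogeneous expansions in the weighted spaces\<close>

lemma inLp_add:
  assumes p: "p \<ge> 0" and f: "inLp N p f" and g: "inLp N p g" shows "inLp N p (\<lambda>z. f z + g z)"
  unfolding inLp_def
proof
  have [measurable]: "f \<in> borel_measurable N" "g \<in> borel_measurable N" using f g by (auto simp: inLp_def)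
  show "(\<lambda>z. f z + g z) \<in> borel_measurable N" by measurable
  have "integrable N (\<lambda>z. 2 powr p * (cmod (f z) powr p + cmod (g z) powr p))"
    using f g by (auto simp: inLp_def)
  then show "integrable N (\<lambda>z. cmod (f z + g z) powr p)"
  proof (rule Bochner_Integration.integrable_bound)
    show "AE z in N. norm (cmod (f z + g z) powr p) \<le> norm (2 powr p * (cmod (f z) powr p + cmod (g z) powr p))"
    proof (rule AE_I2)
      fix z
      define t where "t = max (cmod (f z)) (cmod (g z))"
      have "cmod (f z + g z) \<le> 2 * t" using norm_triangle_ineq[of "f z" "g z"] by (simp add: t_def)
      then have "cmod (f z + g z) powr p \<le> (2 * t) powr p" using p by (intro powr_mono2) auto
      also have "\<dots> = 2 powr p * t powr p" by (simp add: powr_mult t_def)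
      also have "\<dots> \<le> 2 powr p * (cmod (f z) powr p + cmod (g z) powr p)"
        by (intro mult_left_mono) (auto simp: t_def max_def)
      finally show "norm (cmod (f z + g z) powr p) \<le> norm (2 powr p * (cmod (f z) powr p + cmod (g z) powr p))" by simp
    qed
  qed measurable
qed

context strat_group
begin

lemma hom_polyD: "f \<in> hom_poly J V m k \<Longrightarrow> holo J f"
  "f \<in> hom_poly J V m k \<Longrightarrow> l \<noteq> 0 \<Longrightarrow> f (dil J V m l z) = l ^ k * f z"
  by (auto simp: hom_poly_def)

lemma hom_poly_lin:
  "f \<in> hom_poly J V m k \<Longrightarrow> g \<in> hom_poly J V m k \<Longrightarrow> (\<lambda>z. f z + c * g z) \<in> hom_poly J V m k"
  by (auto simp: hom_poly_def holo_add holo_cmult algebra_simps)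

lemma hom_poly_0: "(\<lambda>z. 0) \<in> hom_poly J V m k"
  by (simp add: hom_poly_def holo_const)

lemma poly_spanI: "\<forall>k<K. c k \<in> hom_poly J V m k \<Longrightarrow> (\<lambda>z. \<Sum>k<K. c k z) \<in> poly_span J V m"
  unfolding poly_span_def by (rule CollectI, rule exI[of _ K], rule exI[of _ c]) simp

lemma poly_spanE:
  assumes "f \<in> poly_span J V m"
  obtains K c where "\<forall>k<K. c k \<in> hom_poly J V m k" "f = (\<lambda>z. \<Sum>k<K. c k z)"
  using assms unfolding poly_span_def by auto

lemma poly_span_hom: assumes "f \<in> hom_poly J V m k" shows "f \<in> poly_span J V m"
proof -
  have "f = (\<lambda>z. \<Sum>j<Suc k. (if j = k then f else (\<lambda>z. 0)) z)" by (simp add: if_distrib[of "\<lambda>h. h _"] fun_eq_iff)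
  moreover have "\<forall>j<Suc k. (if j = k then f else (\<lambda>z. 0)) \<in> hom_poly J V m j" using assms hom_poly_0 by auto
  from poly_spanI[OF this]
  have "(\<lambda>z. \<Sum>j<Suc k. (if j = k then f else (\<lambda>z. 0)) z) \<in> poly_span J V m" .
  ultimately show ?thesis by (simp only:)
qed

lemma poly_span_lin:
  assumes "f \<in> poly_span J V m" "g \<in> poly_span J V m" shows "(\<lambda>z. f z + c * g z) \<in> poly_span J V m"
proof -
  obtain n1 a where a: "\<forall>k<n1. a k \<in> hom_poly J V m k" "f = (\<lambda>z. \<Sum>k<n1. a k z)"
    using assms(1) by (rule poly_spanE)
  obtain n2 b where b: "\<forall>k<n2. b k \<in> hom_poly J V m k" "g = (\<lambda>z. \<Sum>k<n2. b k z)"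
    using assms(2) by (rule poly_spanE)
  define a' where "a' k = (if k < n1 then a k else (\<lambda>z. 0))" for k
  define b' where "b' k = (if k < n2 then b k else (\<lambda>z. 0))" for k
  have f: "f z = (\<Sum>k<max n1 n2. a' k z)" for z
    unfolding a(2) by (intro sum.mono_neutral_cong_left) (auto simp: a'_def)
  have g: "g z = (\<Sum>k<max n1 n2. b' k z)" for z
    unfolding b(2) by (intro sum.mono_neutral_cong_left) (auto simp: b'_def)
  have "(\<lambda>z. f z + c * g z) = (\<lambda>z. \<Sum>k<max n1 n2. (\<lambda>z. a' k z + c * b' k z) z)"
    unfolding f g by (simp add: sum.distrib sum_distrib_left)
  moreover have "\<forall>k<max n1 n2. (\<lambda>z. a' k z + c * b' k z) \<in> hom_poly J V m k"
  proof (intro allI impI hom_poly_lin)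
    show "a' k \<in> hom_poly J V m k" "b' k \<in> hom_poly J V m k" for k
      using a(1) b(1) hom_poly_0 by (auto simp: a'_def b'_def)
  qed
  from poly_spanI[OF this]
  have "(\<lambda>z. \<Sum>k<max n1 n2. (\<lambda>z. a' k z + c * b' k z) z) \<in> poly_span J V m" .
  ultimately show ?thesis by (simp only:)
qed

lemma poly_span_0: "(\<lambda>z. 0) \<in> poly_span J V m" by (rule poly_span_hom[OF hom_poly_0])

lemma poly_span_sum: "(\<And>i. i \<in> I \<Longrightarrow> f i \<in> poly_span J V m) \<Longrightarrow> (\<lambda>z. \<Sum>i\<in>I. f i z) \<in> poly_span J V m"
proof (induction I rule: infinite_finite_induct)
  case (insert i I)
  then show ?case using poly_span_lin[of "f i" "\<lambda>z. \<Sum>i\<in>I. f i z" 1] by simp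
qed (auto simp: poly_span_0)

lemma poly_span_holo: "f \<in> poly_span J V m \<Longrightarrow> holo J f"
  by (erule poly_spanE) (auto intro!: holo_sum intro: hom_polyD(1))

lemma fejer_mean_poly: assumes f: "holo J f" shows "fejer_mean K f \<in> poly_span J V m"
proof -
  have "(\<lambda>z. 0 + (1 / of_nat K) * (\<Sum>k<K. \<Sum>j<Suc k. tay j f z)) \<in> poly_span J V m"
    by (intro poly_span_lin poly_span_0 poly_span_sum poly_span_hom[OF tay_hom_poly[OF f]])
  moreover have "fejer_mean K f = (\<lambda>z. 0 + (1 / of_nat K) * (\<Sum>k<K. \<Sum>j<Suc k. tay j f z))"
    by (rule ext) (simp only: fejer_mean_eq[OF f] add_0)
  ultimately show ?thesis by simp
qed

end

context heat_group
begin

section \<open>Integrability of polynomials and contraction by Fejer means\<close>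

lemma holo_measurable: "holo J f \<Longrightarrow> f \<in> borel_measurable borel"
  by (rule borel_measurable_continuous_onI[OF holo_continuous])

text \<open>Polynomial growth under expansions puts the \<open>p\<close>-th power of the modulus
  below a multiple of some \<open>Psi q\<close>, which is integrable. It is applied to homogeneous
  polynomials, to their derivatives and to \<open>Psi\<close> itself.\<close>

lemma growth_inLp:
  assumes F: "continuous_on UNIV F" and p: "p \<ge> 0"
    and hom: "\<And>r z. r \<ge> 1 \<Longrightarrow> cmod (F (dil J V m (of_real r) z)) \<le> r ^ k * cmod (F z)"
  shows "inLp M p F"
proof -
  \<comment> \<open>The degree \<open>k * p\<close> need not be an integer; rounding up is harmless
    because only \<open>r \<ge> 1\<close> occurs.\<close>
  define d where "d = nat \<lceil>real k * p\<rceil>"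
  define q where "q = Suc d"
  have q: "q \<ge> 1" by (simp add: q_def)
  have kd: "real k * p \<le> real d" unfolding d_def using p by (simp add: real_nat_ceiling_ge)
  have [measurable]: "F \<in> borel_measurable borel" using F by (rule borel_measurable_continuous_onI)
  have "\<exists>C. \<forall>z. norm (cmod (F z) powr p) \<le> C * Psi q z" if "p > 0"
  proof (rule hom_bound_ex[OF _ q, of _ d])
    show "continuous_on UNIV (\<lambda>z. cmod (F z) powr p)"
      using F that by (intro continuous_on_powr' continuous_intros) auto
    have "d * 1 \<le> 2 * q * fact m" by (intro mult_mono) (auto simp: q_def)
    then show "d \<le> 2 * q * fact m" by simp
    fix r :: real and z assume r: "r \<ge> 1"
    have "cmod (F (dil J V m (of_real r) z)) powr p \<le> (r ^ k * cmod (F z)) powr p"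
      using p by (intro powr_mono2 hom r) auto
    also have "\<dots> = r powr (real k * p) * cmod (F z) powr p"
      using r by (simp add: powr_mult powr_powr flip: powr_realpow)
    also have "\<dots> \<le> r ^ d * cmod (F z) powr p"
      using r kd by (intro mult_right_mono) (auto simp: powr_realpow[symmetric] intro!: powr_mono)
    finally show "norm (cmod (F (dil J V m (of_real r) z)) powr p) \<le> r ^ d * norm (cmod (F z) powr p)" by simp
  qed
  then have "\<exists>C. \<forall>z. norm (cmod (F z) powr p) \<le> C * Psi q z"
  proof (cases "p > 0")
    case False
    then have "p = 0" using p by simp
    then have "norm (cmod (F z) powr p) \<le> 1 * Psi q z" for z using Psi_ge_1[of q z] by simp
    then show ?thesis by blast
  qed
  then obtain C where C: "\<And>z. norm (cmod (F z) powr p) \<le> C * Psi q z" by blast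
  have "integrable M (\<lambda>z. cmod (F z) powr p)"
  proof (rule Bochner_Integration.integrable_bound)
    show "integrable M (\<lambda>z. C * Psi q z)" using moment_integrable[OF q] by simp
    show "AE z in M. norm (cmod (F z) powr p) \<le> norm (C * Psi q z)"
      using C by (auto intro!: AE_I2 order_trans[OF _ abs_ge_self])
  qed measurable
  then show ?thesis by (simp add: inLp_def)
qed

lemma hom_poly_inLp:
  assumes "f \<in> hom_poly J V m k" "p \<ge> 0" shows "inLp M p f"
proof (rule growth_inLp[OF holo_continuous[OF hom_polyD(1)[OF assms(1)]] assms(2), of k])
  fix r :: real and z assume "r \<ge> 1"
  then show "cmod (f (dil J V m (of_real r) z)) \<le> r ^ k * cmod (f z)"
    using hom_polyD(2)[OF assms(1), of "of_real r" z] by (simp add: norm_mult norm_power)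
qed

lemma poly_span_inLp:
  assumes "f \<in> poly_span J V m" and p: "p \<ge> 1" shows "inLp M p f"
proof -
  obtain K c where c: "\<forall>k<K. c k \<in> hom_poly J V m k" "f = (\<lambda>z. \<Sum>k<K. c k z)"
    using assms(1) by (rule poly_spanE)
  have "k \<le> K \<Longrightarrow> inLp M p (\<lambda>z. \<Sum>j<k. c j z)" for k
  proof (induction k)
    case 0
    then show ?case using p by (simp add: inLp_def)
  next
    case (Suc k)
    have "inLp M p (\<lambda>z. (\<Sum>j<k. c j z) + c k z)"
      using Suc c(1) p by (intro inLp_add hom_poly_inLp[of "c k" k]) auto
    then show ?case by simp
  qed
  then show ?thesis unfolding c(2) by blast
qed

lemma hom_poly_sq: "f \<in> hom_poly J V m k \<Longrightarrow> sq M f"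
  using hom_poly_inLp[of f k 2] by (simp add: inLp_2)

lemma poly_span_sq: "f \<in> poly_span J V m \<Longrightarrow> sq M f"
  using poly_span_inLp[of f 2] by (simp add: inLp_2)

sublocale rot: pair_sigma_finite circ M
  by (intro pair_sigma_finite.intro circ.sigma_finite_measure_axioms sigma_finite_measure_axioms)

lemma pair_measurable:
  assumes "continuous_on UNIV (F :: real \<times> 'g \<Rightarrow> 'b::{second_countable_topology, topological_space})"
  shows "F \<in> borel_measurable (circ \<Otimes>\<^sub>M M)"
proof -
  have "sets (circ \<Otimes>\<^sub>M M) = sets (borel \<Otimes>\<^sub>M borel)" by (intro sets_pair_measure_cong) simp_all
  then have "sets (circ \<Otimes>\<^sub>M M) = sets borel" by (simp only: borel_prod)
  from measurable_cong_sets[OF this refl] show ?thesis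
    using borel_measurable_continuous_onI[OF assms] by blast
qed

lemma rot_pair_continuous:
  assumes "continuous_on UNIV f" shows "continuous_on UNIV (\<lambda>p. f (dil J V m (cis (fst p)) (snd p)))"
  by (intro continuous_on_compose2[OF assms] dil_continuous continuous_intros) auto

text \<open>The Fejer kernel times \<open>circ\<close> is a probability measure, so Jensen's
  inequality bounds the mean pointwise by an average over rotations. After Fubini each rotated
  integral equals the unrotated one.\<close>

lemma fejer_mean_Lp:
  assumes f: "holo J f" and p: "p \<ge> 1" and fi: "inLp M p f" and K: "K > 0"
  shows "(\<integral>z. cmod (fejer_mean K f z) powr p \<partial>M) \<le> (\<integral>z. cmod (f z) powr p \<partial>M)"
proof -
  have cf: "continuous_on UNIV f" by (rule holo_continuous[OF f])
  define N where "N = density circ (\<lambda>t. ennreal (fejer K t))"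
  have fm[measurable]: "fejer K \<in> borel_measurable borel"
    by (rule borel_measurable_continuous_onI[OF fejer_continuous])
  have fint: "integrable circ (fejer K)" by (rule circ_integral[OF fejer_continuous])
  have pN: "prob_space N"
  proof
    have "emeasure N (space N) = (\<integral>\<^sup>+t. ennreal (fejer K t) \<partial>circ)" by (simp add: N_def emeasure_density)
    also have "\<dots> = ennreal (\<integral>t. fejer K t \<partial>circ)"
      using fint fejer_nonneg by (intro nn_integral_eq_integral) auto
    finally show "emeasure N (space N) = 1" using fejer_integral[OF K] by simp
  qed
  have ptw: "cmod (fejer_mean K f z) powr p \<le> (\<integral>t. fejer K t * cmod (f (dil J V m (cis t) z)) powr p \<partial>circ)"
    and ptwi: "integrable circ (\<lambda>t. fejer K t * cmod (f (dil J V m (cis t) z)) powr p)" for z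
  proof -
    have c1: "continuous_on UNIV (\<lambda>t. f (dil J V m (cis t) z))" by (rule rot_continuous[OF cf])
    have c2: "continuous_on UNIV (\<lambda>t. cmod (f (dil J V m (cis t) z)) powr p)"
      using p by (intro continuous_on_powr' continuous_intros c1) auto
    have [measurable]: "(\<lambda>t. f (dil J V m (cis t) z)) \<in> borel_measurable borel"
      using c1 by (rule borel_measurable_continuous_onI)
    show i2: "integrable circ (\<lambda>t. fejer K t * cmod (f (dil J V m (cis t) z)) powr p)"
      by (intro circ_integral continuous_intros c2 fejer_continuous)
    have i1: "integrable circ (\<lambda>t. fejer K t *\<^sub>R f (dil J V m (cis t) z))"
      by (intro circ_integral continuous_intros c1 fejer_continuous)
    have "fejer_mean K f z = (\<integral>t. f (dil J V m (cis t) z) \<partial>N)"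
      unfolding N_def fejer_mean_def using fejer_nonneg
      by (subst integral_density) (auto simp: scaleR_conv_of_real mult.commute)
    also have "cmod \<dots> powr p \<le> (\<integral>t. cmod (f (dil J V m (cis t) z)) powr p \<partial>N)"
    proof (rule prob_Jensen_powr[OF pN p])
      show "integrable N (\<lambda>t. f (dil J V m (cis t) z))"
        unfolding N_def using i1 fejer_nonneg by (subst integrable_density) auto
      show "integrable N (\<lambda>t. cmod (f (dil J V m (cis t) z)) powr p)"
        unfolding N_def using i2 fejer_nonneg by (subst integrable_density) auto
    qed
    also have "\<dots> = (\<integral>t. fejer K t * cmod (f (dil J V m (cis t) z)) powr p \<partial>circ)"
      unfolding N_def using fejer_nonneg by (subst integral_density) auto
    finally show "cmod (fejer_mean K f z) powr p \<le> (\<integral>t. fejer K t * cmod (f (dil J V m (cis t) z)) powr p \<partial>circ)" .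
  qed
  have [measurable]: "f \<in> borel_measurable borel" by (rule holo_measurable[OF f])
  have meas2: "(\<lambda>(t, z). ennreal (fejer K t * cmod (f (dil J V m (cis t) z)) powr p)) \<in> borel_measurable (circ \<Otimes>\<^sub>M M)"
  proof -
    have "(\<lambda>q. fejer K (fst q) * cmod (f (dil J V m (cis (fst q)) (snd q))) powr p) \<in> borel_measurable (circ \<Otimes>\<^sub>M M)"
      using p by (intro pair_measurable continuous_intros continuous_on_powr' rot_pair_continuous cf
        continuous_on_compose2[OF fejer_continuous[of UNIV]]) auto
    then show ?thesis unfolding split_beta by measurable
  qed
  have "(\<integral>\<^sup>+z. ennreal (cmod (fejer_mean K f z) powr p) \<partial>M)
    \<le> (\<integral>\<^sup>+z. \<integral>\<^sup>+t. ennreal (fejer K t * cmod (f (dil J V m (cis t) z)) powr p) \<partial>circ \<partial>M)"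
  proof (rule nn_integral_mono)
    fix z
    have "ennreal (cmod (fejer_mean K f z) powr p) \<le> ennreal (\<integral>t. fejer K t * cmod (f (dil J V m (cis t) z)) powr p \<partial>circ)"
      by (rule ennreal_leI[OF ptw])
    also have "\<dots> = (\<integral>\<^sup>+t. ennreal (fejer K t * cmod (f (dil J V m (cis t) z)) powr p) \<partial>circ)"
      using fejer_nonneg by (intro nn_integral_eq_integral[symmetric] ptwi) auto
    finally show "ennreal (cmod (fejer_mean K f z) powr p) \<le> (\<integral>\<^sup>+t. ennreal (fejer K t * cmod (f (dil J V m (cis t) z)) powr p) \<partial>circ)" .
  qed
  also have "\<dots> = (\<integral>\<^sup>+t. \<integral>\<^sup>+z. ennreal (fejer K t * cmod (f (dil J V m (cis t) z)) powr p) \<partial>M \<partial>circ)"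
    by (rule rot.Fubini'[OF meas2])
  also have "\<dots> = (\<integral>\<^sup>+t. ennreal (fejer K t) * (\<integral>\<^sup>+z. ennreal (cmod (f z) powr p) \<partial>M) \<partial>circ)"
  proof (rule nn_integral_cong)
    fix t
    have "(\<integral>\<^sup>+z. ennreal (fejer K t * cmod (f (dil J V m (cis t) z)) powr p) \<partial>M)
      = (\<integral>\<^sup>+z. ennreal (fejer K t) * ennreal (cmod (f (dil J V m (cis t) z)) powr p) \<partial>M)"
      using fejer_nonneg by (intro nn_integral_cong) (simp add: ennreal_mult)
    also have "\<dots> = ennreal (fejer K t) * (\<integral>\<^sup>+z. ennreal (cmod (f (dil J V m (cis t) z)) powr p) \<partial>M)"
      by (rule nn_integral_cmult) measurable
    also have "(\<integral>\<^sup>+z. ennreal (cmod (f (dil J V m (cis t) z)) powr p) \<partial>M) = (\<integral>\<^sup>+z. ennreal (cmod (f z) powr p) \<partial>M)"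
      by (rule nn_integral_dil[of "cis t" "\<lambda>z. ennreal (cmod (f z) powr p)"]) auto
    finally show "(\<integral>\<^sup>+z. ennreal (fejer K t * cmod (f (dil J V m (cis t) z)) powr p) \<partial>M)
      = ennreal (fejer K t) * (\<integral>\<^sup>+z. ennreal (cmod (f z) powr p) \<partial>M)" .
  qed
  also have "\<dots> = (\<integral>\<^sup>+t. ennreal (fejer K t) \<partial>circ) * (\<integral>\<^sup>+z. ennreal (cmod (f z) powr p) \<partial>M)"
    by (rule nn_integral_multc) measurable
  also have "(\<integral>\<^sup>+t. ennreal (fejer K t) \<partial>circ) = ennreal (\<integral>t. fejer K t \<partial>circ)"
    using fint fejer_nonneg by (intro nn_integral_eq_integral) auto
  also have "\<dots> * (\<integral>\<^sup>+z. ennreal (cmod (f z) powr p) \<partial>M) = ennreal (\<integral>z. cmod (f z) powr p \<partial>M)"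
    using fi by (simp add: fejer_integral[OF K] inLp_def nn_integral_eq_integral)
  finally have le: "(\<integral>\<^sup>+z. ennreal (cmod (fejer_mean K f z) powr p) \<partial>M) \<le> ennreal (\<integral>z. cmod (f z) powr p \<partial>M)" .
  have "inLp M p (fejer_mean K f)" by (rule poly_span_inLp[OF fejer_mean_poly[OF f] p])
  then have "(\<integral>\<^sup>+z. ennreal (cmod (fejer_mean K f z) powr p) \<partial>M) = ennreal (\<integral>z. cmod (fejer_mean K f z) powr p \<partial>M)"
    by (intro nn_integral_eq_integral) (auto simp: inLp_def)
  with le have "ennreal (\<integral>z. cmod (fejer_mean K f z) powr p \<partial>M) \<le> ennreal (\<integral>z. cmod (f z) powr p \<partial>M)" by (simp only:)
  then show ?thesis by (subst (asm) ennreal_le_iff) (auto intro!: integral_nonneg_AE)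
qed

lemma fejer_mean_converges:
  assumes f: "holo J f" and p: "p \<ge> 1" and fi: "inLp M p f"
  shows "(\<lambda>K. \<integral>z. cmod (fejer_mean (Suc K) f z - f z) powr p \<partial>M) \<longlonglongrightarrow> 0"
proof (rule Lp_convergence[OF p])
  have i: "inLp M p (fejer_mean (Suc K) f)" for K by (rule poly_span_inLp[OF fejer_mean_poly[OF f] p])
  show "fejer_mean (Suc K) f \<in> borel_measurable M" "integrable M (\<lambda>z. cmod (fejer_mean (Suc K) f z) powr p)" for K
    using i[of K] by (auto simp: inLp_def)
  show "f \<in> borel_measurable M" "integrable M (\<lambda>z. cmod (f z) powr p)" using fi by (auto simp: inLp_def)
  show "(\<integral>z. cmod (fejer_mean (Suc K) f z) powr p \<partial>M) \<le> (\<integral>z. cmod (f z) powr p \<partial>M)" for K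
    by (rule fejer_mean_Lp[OF f p fi]) simp
  show "(\<lambda>K. fejer_mean (Suc K) f z) \<longlonglongrightarrow> f z" for z by (rule fejer_mean_tendsto[OF f])
qed

text \<open>A single rotation suffices: the angle \<open>pi / (j - k)\<close> multiplies the
  integrand by -1 while the integral is preserved.\<close>

lemma rotation_orthogonal:
  assumes [measurable]: "f \<in> borel_measurable borel" "g \<in> borel_measurable borel"
    and hom: "\<And>l z. cmod l = 1 \<Longrightarrow> f (dil J V m l z) * cnj (g (dil J V m l z)) = l ^ j * cnj (l ^ k) * (f z * cnj (g z))"
    and jk: "j \<noteq> k"
  shows "L2ip M f g = 0"
proof -
  define th where "th = pi / (real j - real k)"
  have ne: "real j - real k \<noteq> 0" using jk by simp
  have "cis th ^ j * cnj (cis th ^ k) = cis (real j * th - real k * th)"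
    by (simp only: Complex.DeMoivre cis_cnj cis_mult) simp
  also have "real j * th - real k * th = (real j - real k) * th" by (simp only: left_diff_distrib)
  also have "\<dots> = pi" unfolding th_def using ne by simp
  finally have l: "cis th ^ j * cnj (cis th ^ k) = - 1" by simp
  have "L2ip M f g = (\<integral>z. f (dil J V m (cis th) z) * cnj (g (dil J V m (cis th) z)) \<partial>M)"
    unfolding L2ip_def by (rule integral_dil(1)[of "cis th" "\<lambda>z. f z * cnj (g z)", symmetric]) auto
  also have "\<dots> = (\<integral>z. (- 1) * (f z * cnj (g z)) \<partial>M)"
    by (simp only: hom[OF norm_cis] l)
  also have "\<dots> = - L2ip M f g" unfolding L2ip_def by simp
  finally show ?thesis by simp
qed

lemma hom_poly_orthogonal:
  assumes "f \<in> hom_poly J V m j" "g \<in> hom_poly J V m k" "j \<noteq> k" shows "L2ip M f g = 0"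
proof (rule rotation_orthogonal[OF _ _ _ assms(3)])
  show "f \<in> borel_measurable borel" "g \<in> borel_measurable borel"
    using holo_measurable hom_polyD(1) assms(1,2) by blast+
  fix l z assume "cmod l = 1"
  then have "l \<noteq> 0" by auto
  then show "f (dil J V m l z) * cnj (g (dil J V m l z)) = l ^ j * cnj (l ^ k) * (f z * cnj (g z))"
    by (simp add: hom_polyD(2)[OF assms(1)] hom_polyD(2)[OF assms(2)])
qed

text \<open>A rotated majorant is enough: by invariance its integral is the same for every
  \<open>t\<close>, which gives integrability on the product with the probability measure
  \<open>circ\<close>.\<close>

lemma rotation_Fubini:
  assumes F: "(\<lambda>(t, z). F t z) \<in> borel_measurable (circ \<Otimes>\<^sub>M M)" and g: "integrable M g"
    and bd: "\<And>t z. cmod (F t z) \<le> g (dil J V m (cis t) z)" and gb: "g \<in> borel_measurable borel"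
  shows "(\<integral>z. \<integral>t. F t z \<partial>circ \<partial>M) = (\<integral>t. \<integral>z. F t z \<partial>M \<partial>circ)"
proof (rule rot.Fubini_integral)
  have gt: "integrable M (\<lambda>z. g (dil J V m (cis t) z))" for t using integral_dil(2)[of "cis t" g] gb g by simp
  have Ft: "integrable M (F t)" for t
  proof (rule Bochner_Integration.integrable_bound[OF gt[of t]])
    show "F t \<in> borel_measurable M" using measurable_Pair2[OF F, of t] by simp
    show "AE z in M. norm (F t z) \<le> norm (g (dil J V m (cis t) z))"
      using bd[of t] by (auto intro!: AE_I2 order_trans[OF _ abs_ge_self])
  qed
  show "integrable (circ \<Otimes>\<^sub>M M) (\<lambda>(t, z). F t z)"
  proof (rule rot.Fubini_integrable[OF F])
    show "AE t in circ. integrable M (\<lambda>z. (\<lambda>(t, z). F t z) (t, z))" using Ft by simp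
    show "integrable circ (\<lambda>t. \<integral>z. norm ((\<lambda>(t, z). F t z) (t, z)) \<partial>M)"
    proof (rule circ.integrable_const_bound[of _ "\<integral>z. g z \<partial>M"])
      have "(\<integral>z. norm (F t z) \<partial>M) \<le> (\<integral>z. g (dil J V m (cis t) z) \<partial>M)" for t
        using bd by (intro integral_mono integrable_norm Ft gt) auto
      also have "(\<integral>z. g (dil J V m (cis t) z) \<partial>M) = (\<integral>z. g z \<partial>M)" for t
        using integral_dil(1)[of "cis t" g] gb by simp
      finally show "AE t in circ. norm (\<integral>z. norm ((\<lambda>(t, z). F t z) (t, z)) \<partial>M) \<le> (\<integral>z. g z \<partial>M)" by simp
      have "(\<lambda>(t, z). norm (F t z)) \<in> borel_measurable (circ \<Otimes>\<^sub>M M)" using F by measurable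
      then show "(\<lambda>t. \<integral>z. norm ((\<lambda>(t, z). F t z) (t, z)) \<partial>M) \<in> borel_measurable circ"
        using borel_measurable_lebesgue_integral[of "\<lambda>t z. norm (F t z)" circ] by simp
    qed
  qed
qed

text \<open>Homogeneity of \<open>g\<close> absorbs the character in the definition of
  \<open>tay\<close>, leaving an average of rotated inner products that are all equal by invariance.
  Hence \<open>tay k\<close> acts as the orthogonal projection onto degree \<open>k\<close>.\<close>

lemma tay_projection:
  assumes f: "holo J f" "sq M f" and g: "g \<in> hom_poly J V m k"
  shows "L2ip M (tay k f) g = L2ip M f g"
proof -
  have gh: "holo J g" by (rule hom_polyD(1)[OF g])
  have cf: "continuous_on UNIV f" and cg: "continuous_on UNIV g" using f gh holo_continuous by auto
  have [measurable]: "f \<in> borel_measurable borel" "g \<in> borel_measurable borel" using holo_measurable f gh by auto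
  have homg: "cnj (g (dil J V m (cis t) z)) = cis (- (real k * t)) * cnj (g z)" for t z
    by (subst hom_polyD(2)[OF g]) (auto simp: cis_cnj Complex.DeMoivre)
  have "L2ip M (tay k f) g = (\<integral>z. \<integral>t. f (dil J V m (cis t) z) * cnj (g (dil J V m (cis t) z)) \<partial>circ \<partial>M)"
    unfolding L2ip_def tay_def homg
    by (simp add: mult.assoc[symmetric] del: mult_minus_left mult_minus_right)
  also have "\<dots> = (\<integral>t. \<integral>z. f (dil J V m (cis t) z) * cnj (g (dil J V m (cis t) z)) \<partial>M \<partial>circ)"
  proof (rule rotation_Fubini[where g="\<lambda>z. cmod (f z * cnj (g z))"])
    show "(\<lambda>(t, z). f (dil J V m (cis t) z) * cnj (g (dil J V m (cis t) z))) \<in> borel_measurable (circ \<Otimes>\<^sub>M M)"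
      unfolding split_beta
      by (intro pair_measurable continuous_intros rot_pair_continuous cf cg)
    show "integrable M (\<lambda>z. cmod (f z * cnj (g z)))"
      by (intro integrable_norm sq_ip_integrable f hom_poly_sq[OF g])
  qed auto
  also have "\<dots> = (\<integral>t. L2ip M f g \<partial>circ)"
  proof (rule Bochner_Integration.integral_cong[OF refl])
    fix t
    show "(\<integral>z. f (dil J V m (cis t) z) * cnj (g (dil J V m (cis t) z)) \<partial>M) = L2ip M f g"
      unfolding L2ip_def by (rule integral_dil(1)[of "cis t" "\<lambda>z. f z * cnj (g z)"]) auto
  qed
  also have "\<dots> = L2ip M f g" using circ.prob_space by simp
  finally show ?thesis .
qed

section \<open>Partial sums in the Hilbert space\<close>

abbreviation S :: "nat \<Rightarrow> ('g \<Rightarrow> complex) \<Rightarrow> 'g \<Rightarrow> complex" where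
  "S K f \<equiv> (\<lambda>z. \<Sum>k<K. tay k f z)"

lemma tay_sq: "holo J f \<Longrightarrow> sq M (tay k f)"
  by (rule hom_poly_sq[OF tay_hom_poly])

lemma S_sq: "holo J f \<Longrightarrow> sq M (S K f)"
  by (intro sq_sum tay_sq)

lemma S_poly: "holo J f \<Longrightarrow> S K f \<in> poly_span J V m"
  by (intro poly_span_sum poly_span_hom[OF tay_hom_poly])

lemma remainder_orthogonal:
  assumes f: "holo J f" "sq M f" and g: "g \<in> hom_poly J V m j" and j: "j < K"
  shows "L2ip M (\<lambda>z. f z - S K f z) g = 0"
proof -
  have "L2ip M (S K f) g = (\<Sum>k<K. L2ip M (tay k f) g)"
    by (rule L2ip_sum_left[OF tay_sq[OF f(1)] hom_poly_sq[OF g]])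
  also have "\<dots> = (\<Sum>k<K. if k = j then L2ip M f g else 0)"
    using tay_projection[OF f g] hom_poly_orthogonal[OF tay_hom_poly[OF f(1)] g] by (intro sum.cong) auto
  also have "\<dots> = L2ip M f g" using j by simp
  finally show ?thesis using L2ip_diff_left[OF f(2) S_sq[OF f(1)] hom_poly_sq[OF g]] by simp
qed

text \<open>The remainder \<open>u\<close> is orthogonal to all components of degree below
  \<open>Suc K\<close>, and \<open>v\<close>, the partial sum minus the Fejer mean, is a combination
  of them. Pythagoras bounds \<open>u\<close> by the Fejer error, so completeness is inherited from
  the convergence of the Fejer means.\<close>

lemma L2_expansion:
  assumes f: "holo J f" "sq M f"
  shows "(\<lambda>K. L2norm M (\<lambda>z. f z - S K f z)) \<longlonglongrightarrow> 0"
proof -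
  have "(\<lambda>K. L2norm M (\<lambda>z. f z - S (Suc K) f z)) \<longlonglongrightarrow> 0"
  proof (rule tendsto_sandwich[of "\<lambda>_. 0"])
    show "\<forall>\<^sub>F K in sequentially. L2norm M (\<lambda>z. f z - S (Suc K) f z) \<le> sqrt (\<integral>z. cmod (fejer_mean (Suc K) f z - f z) powr 2 \<partial>M)"
    proof (rule always_eventually, rule allI)
      fix K
      define s where "s = fejer_mean (Suc K) f"
      define u where "u z = f z - S (Suc K) f z" for z
      define v where "v z = S (Suc K) f z - s z" for z
      have s: "sq M s" unfolding s_def by (rule poly_span_sq[OF fejer_mean_poly[OF f(1)]])
      have u: "sq M u" unfolding u_def by (intro sq_diff f S_sq)
      have v: "sq M v" unfolding v_def by (intro sq_diff s S_sq f)
      have ut: "L2ip M u (tay j f) = 0" if "j < Suc K" for j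
        unfolding u_def by (rule remainder_orthogonal[OF f tay_hom_poly[OF f(1)] that])
      have "L2ip M u (S (Suc K) f) = 0"
        unfolding L2ip_sum_right[OF tay_sq[OF f(1)] u] using ut by (intro sum.neutral) auto
      moreover have "L2ip M u s = 0"
      proof -
        have "s = (\<lambda>z. 0 + (1 / of_nat (Suc K)) * (\<Sum>k<Suc K. \<Sum>j<Suc k. tay j f z))"
          unfolding s_def by (rule ext) (simp only: fejer_mean_eq[OF f(1)] add_0)
        then have "L2ip M u s = 0 + cnj (1 / of_nat (Suc K)) * L2ip M u (\<lambda>z. \<Sum>k<Suc K. \<Sum>j<Suc k. tay j f z)"
          by (simp only: L2ip_add_right[OF sq_0 sq_sum[OF S_sq[OF f(1)]] u] L2ip_zero_right)
        moreover have "L2ip M u (\<lambda>z. \<Sum>k<Suc K. \<Sum>j<Suc k. tay j f z) = (\<Sum>k<Suc K. \<Sum>j<Suc k. L2ip M u (tay j f))"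
          by (simp only: L2ip_sum_right[OF S_sq[OF f(1)] u] L2ip_sum_right[OF tay_sq[OF f(1)] u])
        moreover have "\<dots> = 0" by (intro sum.neutral ballI ut) auto
        ultimately show ?thesis by simp
      qed
      ultimately have "L2ip M u v = 0"
        unfolding v_def by (simp add: L2ip_diff_right[OF S_sq[OF f(1)] s u] del: sum.lessThan_Suc)
      then have "(L2norm M (\<lambda>z. u z + 1 * v z))\<^sup>2 = (L2norm M u)\<^sup>2 + (L2norm M v)\<^sup>2"
        using L2norm_expand[OF u v, of 1] by simp
      then have "(L2norm M u)\<^sup>2 \<le> (L2norm M (\<lambda>z. f z - s z))\<^sup>2"
        by (simp add: u_def v_def del: sum.lessThan_Suc)
      also have "\<dots> = (\<integral>z. cmod (s z - f z) powr 2 \<partial>M)"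
        by (simp add: L2norm_sq norm_minus_commute)
      finally have "L2norm M u \<le> sqrt (\<integral>z. cmod (s z - f z) powr 2 \<partial>M)" by (rule real_le_rsqrt)
      then show "L2norm M (\<lambda>z. f z - S (Suc K) f z) \<le> sqrt (\<integral>z. cmod (fejer_mean (Suc K) f z - f z) powr 2 \<partial>M)"
        unfolding u_def s_def .
    qed
    have "(\<lambda>K. sqrt (\<integral>z. cmod (fejer_mean (Suc K) f z - f z) powr 2 \<partial>M)) \<longlonglongrightarrow> sqrt 0"
      using fejer_mean_converges[OF f(1), of 2] f(2) by (intro tendsto_real_sqrt) (auto simp: inLp_2)
    then show "(\<lambda>K. sqrt (\<integral>z. cmod (fejer_mean (Suc K) f z - f z) powr 2 \<partial>M)) \<longlonglongrightarrow> 0" by simp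
  qed (auto intro!: always_eventually)
  then show ?thesis by (rule LIMSEQ_imp_Suc)
qed

end

section \<open>Mean values, point evaluations and completeness\<close>

lemma lborel_integral_shift:
  fixes h :: "'a::euclidean_space \<Rightarrow> 'b::{banach, second_countable_topology}"
  assumes "h \<in> borel_measurable borel"
  shows "(\<integral>y. h (c + y) \<partial>lborel) = (\<integral>y. h y \<partial>lborel)" and "integrable lborel (\<lambda>y. h (c + y)) \<longleftrightarrow> integrable lborel h"
proof -
  have d: "distr lborel borel ((+) c) = lborel" by (rule lborel_distr_plus)
  have m: "(+) c \<in> measurable lborel borel" by simp
  show "(\<integral>y. h (c + y) \<partial>lborel) = (\<integral>y. h y \<partial>lborel)"
    using integral_distr[OF m assms] by (simp only: d)
  show "integrable lborel (\<lambda>y. h (c + y)) \<longleftrightarrow> integrable lborel h"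
    using integrable_distr_eq[OF m assms] by (simp only: d)
qed

context heat_group
begin

text \<open>The Euclidean inner product behind \<open>Psi\<close> is unrelated to \<open>J\<close>,
  so sublevel sets of \<open>Psi\<close> may fail to be invariant; \<open>A c\<close> asks for the
  bound on the whole circle orbit. Orbits are compact, hence the sets \<open>A k\<close> exhaust the
  space and one of them has positive measure.\<close>

lemma invariant_set:
  obtains A c where "A \<in> sets borel" "A \<subseteq> {y. Psi 1 y \<le> c}" "\<And>l y. cmod l = 1 \<Longrightarrow> dil J V m l y \<in> A \<longleftrightarrow> y \<in> A"
    "measure M A > 0"
proof -
  define A where "A c = {y. \<forall>l. cmod l = 1 \<longrightarrow> Psi 1 (dil J V m l y) \<le> c}" for c :: real
  have Psi_cont: "continuous_on UNIV (Psi 1)" by (rule smooth_continuous[OF Psi_smooth])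
  have closed: "closed (A c)" for c
  proof -
    have "A c = (\<Inter>l\<in>sphere 0 1. {y. Psi 1 (dil J V m l y) \<le> c})" by (auto simp: A_def)
    moreover have "closed (\<Inter>l\<in>sphere 0 1. {y. Psi 1 (dil J V m l y) \<le> c})"
      by (intro closed_INT ballI closed_Collect_le continuous_on_const continuous_on_compose2[OF Psi_cont] dil_continuous
          continuous_on_id) auto
    ultimately show ?thesis by simp
  qed
  have meas: "A c \<in> sets M" for c using closed by simp
  have "y \<in> (\<Union>k::nat. A (real k))" for y
  proof -
    have "compact ((\<lambda>l. Psi 1 (dil J V m l y)) ` sphere 0 1)"
      by (intro compact_continuous_image compact_sphere continuous_on_compose2[OF Psi_cont] dil_continuous
          continuous_on_id continuous_on_const) auto
    from compact_imp_bounded[OF this] obtain B where B0: "\<forall>l\<in>sphere 0 1. norm (Psi 1 (dil J V m l y)) \<le> B"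
      unfolding bounded_iff by auto
    have B: "norm (Psi 1 (dil J V m l y)) \<le> B" if l: "cmod l = 1" for l
      using B0 l by (simp del: real_norm_def)
    obtain k where "B \<le> real k" using real_arch_simple by blast
    then have "y \<in> A (real k)" unfolding A_def using B by fastforce
    then show "y \<in> (\<Union>k. A (real k))" by blast
  qed
  then have "(\<Union>k::nat. A (real k)) = UNIV" by blast
  then have "emeasure M (\<Union>k::nat. A (real k)) \<noteq> 0" using emeasure_space_1 by simp
  then obtain k :: nat where "emeasure M (A (real k)) \<noteq> 0"
    using emeasure_UN_eq_0[of M "\<lambda>k. A (real k)"] meas by blast
  then have pos: "measure M (A (real k)) > 0"
    by (simp add: emeasure_eq_measure zero_less_measure_iff)
  show ?thesis
  proof (rule that[of "A (real k)" "real k"])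
    show "A (real k) \<in> sets borel" using meas by simp
    show "A (real k) \<subseteq> {y. Psi 1 y \<le> real k}" unfolding A_def using dil_1 by (auto dest: spec[of _ 1])
    have inv: "dil J V m l y \<in> A (real k)" if "cmod l = 1" "y \<in> A (real k)" for l y
      using that by (auto simp: A_def dil_dil norm_mult)
    show "dil J V m l y \<in> A (real k) \<longleftrightarrow> y \<in> A (real k)" if l: "cmod l = 1" for l y
    proof
      assume "dil J V m l y \<in> A (real k)"
      moreover have "cmod (inverse l) = 1" using l by (simp add: norm_inverse)
      ultimately have "dil J V m (inverse l) (dil J V m l y) \<in> A (real k)" by (metis inv)
      moreover have "l \<noteq> 0" using l by auto
      ultimately show "y \<in> A (real k)" by (simp add: dil_dil)
    qed (rule inv[OF l])
    show "measure M (A (real k)) > 0" by (rule pos)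
  qed
qed

lemma compact_support_bounded:
  fixes g :: "'g \<Rightarrow> 'b::real_normed_vector"
  assumes "continuous_on UNIV g" "compact K" obtains B where "B \<ge> 0" "\<And>z. z \<in> K \<Longrightarrow> norm (g z) \<le> B"
proof -
  have "compact (g ` K)" by (intro compact_continuous_image continuous_on_subset[OF assms(1)] assms(2)) auto
  from compact_imp_bounded[OF this] obtain B where B: "\<And>z. z \<in> K \<Longrightarrow> norm (g z) \<le> B"
    unfolding bounded_iff by auto
  have "norm (g z) \<le> max B 0" if "z \<in> K" for z using B[OF that] by simp
  then show ?thesis using that[of "max B 0"] by simp
qed

text \<open>Averaging over rotations preserves the integral over the invariant set and replaces
  \<open>f\<close> by its component of degree 0, the constant \<open>f 0\<close>.\<close>

lemma mean_value:
  assumes A: "A \<in> sets borel" "A \<subseteq> {y. Psi 1 y \<le> c}" and inv: "\<And>l y. cmod l = 1 \<Longrightarrow> dil J V m l y \<in> A \<longleftrightarrow> y \<in> A"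
    and f: "holo J f"
  shows "(\<integral>y. indicator A y *\<^sub>R f y \<partial>M) = measure M A *\<^sub>R f 0"
proof -
  have cf: "continuous_on UNIV f" by (rule holo_continuous[OF f])
  have [measurable]: "f \<in> borel_measurable borel" by (rule holo_measurable[OF f])
  note [measurable] = A(1)
  obtain B where B: "B \<ge> 0" "\<And>z. z \<in> {y. Psi 1 y \<le> c} \<Longrightarrow> norm (f z) \<le> B"
    using compact_support_bounded[OF cf Psi_compact[OF order_refl]] by blast
  have gi: "integrable M (\<lambda>z. indicator A z * cmod (f z))"
  proof (rule integrable_const_bound[of _ B])
    show "AE z in M. norm (indicator A z * cmod (f z)) \<le> B"
      using A(2) B by (auto intro!: AE_I2 simp: indicator_def)
  qed measurable
  have 1: "(\<integral>z. \<integral>t. indicator A z *\<^sub>R f (dil J V m (cis t) z) \<partial>circ \<partial>M)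
    = (\<integral>t. \<integral>z. indicator A z *\<^sub>R f (dil J V m (cis t) z) \<partial>M \<partial>circ)"
  proof (rule rotation_Fubini[OF _ gi])
    have "(\<lambda>p. f (dil J V m (cis (fst p)) (snd p))) \<in> borel_measurable (circ \<Otimes>\<^sub>M M)"
      by (intro pair_measurable rot_pair_continuous cf)
    moreover have "(\<lambda>p. indicator A (snd p) :: real) \<in> borel_measurable (circ \<Otimes>\<^sub>M M)" by measurable
    ultimately show "(\<lambda>(t, z). indicator A z *\<^sub>R f (dil J V m (cis t) z)) \<in> borel_measurable (circ \<Otimes>\<^sub>M M)"
      unfolding split_beta by (rule borel_measurable_scaleR[rotated])
    show "cmod (indicator A z *\<^sub>R f (dil J V m (cis t) z)) \<le> indicator A (dil J V m (cis t) z) * cmod (f (dil J V m (cis t) z))" for t z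
      using inv[of "cis t" z] by (simp add: indicator_def)
  qed measurable
  have 2: "(\<integral>t. indicator A z *\<^sub>R f (dil J V m (cis t) z) \<partial>circ) = indicator A z *\<^sub>R f 0" for z
    using tay_0[OF f, of z] unfolding tay_def by simp
  have 3: "(\<integral>z. indicator A z *\<^sub>R f (dil J V m (cis t) z) \<partial>M) = (\<integral>z. indicator A z *\<^sub>R f z \<partial>M)" for t
  proof -
    have "(\<integral>z. indicator A z *\<^sub>R f (dil J V m (cis t) z) \<partial>M)
      = (\<integral>z. indicator A (dil J V m (cis t) z) *\<^sub>R f (dil J V m (cis t) z) \<partial>M)"
      using inv[of "cis t"] by (simp add: indicator_def)
    also have "\<dots> = (\<integral>z. indicator A z *\<^sub>R f z \<partial>M)"
      by (rule integral_dil(1)[of "cis t" "\<lambda>z. indicator A z *\<^sub>R f z"]) auto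
    finally show ?thesis .
  qed
  have "(\<integral>z. indicator A z *\<^sub>R f 0 \<partial>M) = (\<integral>t. (\<integral>z. indicator A z *\<^sub>R f z \<partial>M) \<partial>circ)"
    using 1 unfolding 2 3 .
  also have "\<dots> = (\<integral>z. indicator A z *\<^sub>R f z \<partial>M)" using circ.prob_space by simp
  also have "(\<integral>z. indicator A z *\<^sub>R f 0 \<partial>M) = (\<integral>z. indicator A z \<partial>M) *\<^sub>R f 0"
    by (rule integral_scaleR_left) (simp add: A(1) emeasure_eq_measure)
  also have "(\<integral>z. indicator A z \<partial>M) = measure M A" by simp
  finally show ?thesis by simp
qed

lemma sq_integrable: assumes "sq M f" shows "integrable M f"
proof (rule Bochner_Integration.integrable_bound)
  show "integrable M (\<lambda>z. 1 + (cmod (f z))\<^sup>2)" using assms by (auto simp: sq_def)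
  show "f \<in> borel_measurable M" by (rule sq_measurable[OF assms])
  have "cmod (f z) \<le> 1 + (cmod (f z))\<^sup>2" for z
    using sum_squares_bound[of 1 "cmod (f z)"] norm_ge_zero[of "f z"] by (simp only: power2_eq_square mult_1_right)
  then show "AE z in M. norm (f z) \<le> norm (1 + (cmod (f z))\<^sup>2)" by (auto intro!: AE_I2 order_trans[OF _ abs_ge_self])
qed

lemma L1_le_L2: assumes "sq M f" shows "(\<integral>z. cmod (f z) \<partial>M) \<le> L2norm M f"
proof -
  have i: "integrable M (\<lambda>z. complex_of_real (cmod (f z)))"
    using integrable_norm[OF sq_integrable[OF assms]] by (simp only: complex_of_real_integrable_eq)
  have "cmod (\<integral>z. complex_of_real (cmod (f z)) \<partial>M) powr 2 \<le> (\<integral>z. cmod (complex_of_real (cmod (f z))) powr 2 \<partial>M)"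
    using assms by (intro prob_Jensen_powr[OF prob_M] i) (auto simp: sq_def)
  then have "(\<integral>z. cmod (f z) \<partial>M)\<^sup>2 \<le> (L2norm M f)\<^sup>2"
    by (simp add: L2norm_sq integral_nonneg_AE)
  then show ?thesis by (rule power2_le_imp_le) simp
qed

text \<open>The mean value property is applied to the vector space translate of \<open>f\<close> by
  \<open>z\<close>. Translating back changes the density from \<open>\<rho> a (w - z)\<close> to
  \<open>\<rho> a w\<close>, at the cost of the ratio of its bound \<open>B\<close> on a sublevel
  set of \<open>Psi\<close> to its minimum \<open>b\<close> on the compact set \<open>K\<close>,
  which contains all points that occur.\<close>

lemma evaluation_bound:
  assumes R: "R \<ge> 0"
  obtains C where "C > 0" "\<And>f z. holo J f \<Longrightarrow> sq M f \<Longrightarrow> z \<in> cball 0 R \<Longrightarrow> cmod (f z) \<le> C * L2norm M f"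
proof -
  obtain A c where A: "A \<in> sets borel" "A \<subseteq> {y. Psi 1 y \<le> c}" "\<And>l y. cmod l = 1 \<Longrightarrow> dil J V m l y \<in> A \<longleftrightarrow> y \<in> A"
    "measure M A > 0" using invariant_set by blast
  note [measurable] = A(1)
  have c\<rho>: "continuous_on UNIV (\<rho> a)" by (rule smooth_continuous[OF rho_smooth[OF a_pos]])
  have r: "\<rho> a y > 0" for y by (rule rho_pos[OF a_pos])
  obtain B where B: "B \<ge> 0" "\<And>y. y \<in> {y. Psi 1 y \<le> c} \<Longrightarrow> norm (\<rho> a y) \<le> B"
    using compact_support_bounded[OF c\<rho> Psi_compact[OF order_refl]] by blast
  define K where "K = (\<lambda>p. fst p + snd p) ` (cball 0 R \<times> {y. Psi 1 y \<le> c})"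
  have "A \<noteq> {}" using A(4) by auto
  then have Kne: "K \<noteq> {}" using A(2) R by (auto simp: K_def)
  have "compact K" unfolding K_def
    by (intro compact_continuous_image compact_Times compact_cball Psi_compact order_refl continuous_intros)
  from continuous_attains_inf[OF this Kne continuous_on_subset[OF c\<rho> subset_UNIV]]
  obtain w0 where w0: "w0 \<in> K" "\<And>w. w \<in> K \<Longrightarrow> \<rho> a w0 \<le> \<rho> a w" by blast
  define b where "b = \<rho> a w0"
  have b: "b > 0" using r by (simp add: b_def)
  \<comment> \<open>The summand 1 keeps \<open>C\<close> positive even if
    \<open>B = 0\<close>.\<close>
  define C where "C = (B / b + 1) / measure M A"
  show ?thesis
  proof (rule that[of C])
    show "C > 0" using A(4) B(1) b by (auto simp: C_def intro!: divide_pos_pos add_nonneg_pos)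
    fix f z assume f: "holo J f" "sq M f" and z: "z \<in> cball (0::'g) R"
    have [measurable]: "f \<in> borel_measurable borel" by (rule holo_measurable[OF f(1)])
    have fi: "integrable lborel (\<lambda>w. \<rho> a w * cmod (f w))"
      using integrable_norm[OF sq_integrable[OF f(2)]] by (subst (asm) integrable_M) auto
    have tm: "(\<lambda>y. f (y + z)) \<in> borel_measurable borel" by measurable
    define H where "H y = indicator A y * (\<rho> a y * cmod (f (y + z)))" for y
    have Hm: "H \<in> borel_measurable borel" unfolding H_def by measurable
    have Hle: "H (- z + w) \<le> (B / b) * (\<rho> a w * cmod (f w))" for w
    proof (cases "- z + w \<in> A")
      case True
      then have P: "- z + w \<in> {y. Psi 1 y \<le> c}" using A(2) by blast
      have "w \<in> K" unfolding K_def using P z by (intro image_eqI[of _ _ "(z, - z + w)"]) auto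
      then have bw: "1 \<le> \<rho> a w / b" using w0(2) b by (simp add: b_def)
      have "H (- z + w) = \<rho> a (- z + w) * cmod (f w)" using True by (simp add: H_def)
      also have "\<dots> \<le> B * cmod (f w)" using B(2)[OF P] by (intro mult_right_mono) auto
      also have "\<dots> \<le> B * cmod (f w) * (\<rho> a w / b)" using mult_left_mono[OF bw, of "B * cmod (f w)"] B(1) by simp
      finally show ?thesis by (simp add: field_simps)
    next
      case False
      then have "H (- z + w) = 0" by (simp add: H_def)
      then show ?thesis using B(1) b less_imp_le[OF r] by simp
    qed
    have Hpos: "0 \<le> H y" for y using less_imp_le[OF r] by (simp add: H_def)
    have Hi': "integrable lborel (\<lambda>w. H (- z + w))"
    proof (rule Bochner_Integration.integrable_bound[OF integrable_mult_right[OF fi, of "B / b"]])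
      show "AE w in lborel. norm (H (- z + w)) \<le> norm (B / b * (\<rho> a w * cmod (f w)))"
      proof (rule AE_I2)
        fix w
        have "norm (H (- z + w)) = H (- z + w)" using Hpos by simp
        also have "\<dots> \<le> norm (B / b * (\<rho> a w * cmod (f w)))"
          unfolding real_norm_def by (rule order_trans[OF Hle abs_ge_self])
        finally show "norm (H (- z + w)) \<le> norm (B / b * (\<rho> a w * cmod (f w)))" .
      qed
    qed (use Hm in measurable)
    then have Hi: "integrable lborel H" using lborel_integral_shift(2)[OF Hm, of "- z"] by simp
    have "measure M A *\<^sub>R f (0 + z) = (\<integral>y. indicator A y *\<^sub>R f (y + z) \<partial>M)"
      by (rule mean_value[OF A(1-3) holo_translate[OF f(1)], symmetric])
    also have "\<dots> = (\<integral>y. \<rho> a y *\<^sub>R (indicator A y *\<^sub>R f (y + z)) \<partial>lborel)"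
      by (rule integral_M) measurable
    finally have "norm (measure M A *\<^sub>R f (0 + z)) \<le> (\<integral>y. norm (\<rho> a y *\<^sub>R (indicator A y *\<^sub>R f (y + z))) \<partial>lborel)"
      by (simp only: integral_norm_bound)
    also have "\<dots> = (\<integral>y. H y \<partial>lborel)"
      unfolding H_def using less_imp_le[OF r] by (intro Bochner_Integration.integral_cong refl) (simp add: ac_simps)
    also have "\<dots> = (\<integral>w. H (- z + w) \<partial>lborel)" by (rule lborel_integral_shift(1)[OF Hm, symmetric])
    also have "\<dots> \<le> (\<integral>w. (B / b) * (\<rho> a w * cmod (f w)) \<partial>lborel)"
      by (intro integral_mono Hi' integrable_mult_right fi Hle)
    also have "\<dots> = (B / b) * (\<integral>w. cmod (f w) \<partial>M)"
      using integral_M[of "\<lambda>w. cmod (f w)"] by simp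
    also have "\<dots> \<le> (B / b) * L2norm M f"
      using B(1) b by (intro mult_left_mono L1_le_L2 f) auto
    also have "\<dots> \<le> (B / b + 1) * L2norm M f" by (simp add: distrib_right)
    finally show "cmod (f z) \<le> C * L2norm M f" using A(4) by (simp add: C_def field_simps)
  qed
qed

text \<open>The evaluation bound turns a Cauchy sequence in the norm into a locally uniform one, so
  the limit is holomorphic and attained at every point. Fatou's lemma identifies it as the limit in
  the norm.\<close>

lemma holo_L2_complete:
  assumes F: "\<And>k. holo J (F k)" "\<And>k. sq M (F k)"
    and Cau: "\<And>e. e > 0 \<Longrightarrow> \<exists>N. \<forall>i\<ge>N. \<forall>j\<ge>N. L2norm M (\<lambda>z. F i z - F j z) < e"
  obtains G where "holo J G" "sq M G" "(\<lambda>k. L2norm M (\<lambda>z. F k z - G z)) \<longlonglongrightarrow> 0" "\<And>z. (\<lambda>k. F k z) \<longlonglongrightarrow> G z"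
proof -
  have ucau: "\<exists>N. \<forall>i\<ge>N. \<forall>j\<ge>N. \<forall>z\<in>cball 0 R. cmod (F i z - F j z) < e" if e0: "e > 0" and R0: "R \<ge> 0" for e R
  proof -
    obtain C where C: "C > 0" "\<And>f z. holo J f \<Longrightarrow> sq M f \<Longrightarrow> z \<in> cball 0 R \<Longrightarrow> cmod (f z) \<le> C * L2norm M f"
      using evaluation_bound[OF R0] by blast
    obtain N where N: "\<forall>i\<ge>N. \<forall>j\<ge>N. L2norm M (\<lambda>z. F i z - F j z) < e / C" using Cau[of "e / C"] e0 C(1) by auto
    have "cmod (F i z - F j z) < e" if ij: "i \<ge> N" "j \<ge> N" and z: "z \<in> cball 0 R" for i j z
    proof -
      have "cmod (F i z - F j z) \<le> C * L2norm M (\<lambda>z. F i z - F j z)"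
        by (rule C(2)[OF holo_diff[OF F(1) F(1)] sq_diff[OF F(2) F(2)] z])
      also have "\<dots> < C * (e / C)" using N ij C(1) by (intro mult_strict_left_mono) auto
      finally show ?thesis using C(1) by simp
    qed
    then show ?thesis by blast
  qed
  have "Cauchy (\<lambda>k. F k z)" for z
  proof (rule metric_CauchyI)
    fix e :: real assume "e > 0"
    then obtain N where N: "\<forall>i\<ge>N. \<forall>j\<ge>N. \<forall>w\<in>cball 0 (norm z). cmod (F i w - F j w) < e"
      using ucau[of e "norm z"] by auto
    have "z \<in> cball 0 (norm z)" by simp
    then show "\<exists>M. \<forall>m\<ge>M. \<forall>n\<ge>M. dist (F m z) (F n z) < e"
      using N unfolding dist_norm by blast
  qed
  then have "\<exists>l. (\<lambda>k. F k z) \<longlonglongrightarrow> l" for z using Cauchy_convergent_iff convergent_def by blast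
  then obtain G where G: "\<And>z. (\<lambda>k. F k z) \<longlonglongrightarrow> G z" by metis
  have ul: "uniform_limit (cball 0 R) F G sequentially" for R
  proof (cases "R \<ge> 0")
    case True
    show ?thesis
    proof (rule uniform_limitI)
      fix e :: real assume e: "e > 0"
      obtain N where N: "\<forall>i\<ge>N. \<forall>j\<ge>N. \<forall>z\<in>cball 0 R. cmod (F i z - F j z) < e / 2" using ucau[of "e / 2" R] e True by auto
      have "dist (F i z) (G z) < e" if iz: "i \<ge> N" "z \<in> cball 0 R" for i z
      proof -
        have "(\<lambda>j. cmod (F i z - F j z)) \<longlonglongrightarrow> cmod (F i z - G z)" by (intro tendsto_intros G)
        then have "cmod (F i z - G z) \<le> e / 2"
          by (rule LIMSEQ_le_const2) (use N iz in \<open>auto intro!: exI[of _ N] less_imp_le\<close>)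
        then show ?thesis using e by (simp add: dist_norm)
      qed
      then show "\<forall>\<^sub>F i in sequentially. \<forall>z\<in>cball 0 R. dist (F i z) (G z) < e"
        unfolding eventually_sequentially by blast
    qed
  next
    case False
    then show ?thesis by (simp add: uniform_limit_iff)
  qed
  have Gh: "holo J G" by (rule holo_uniform_limit[OF F(1) ul])
  have est: "sq M (\<lambda>z. F i z - G z) \<and> L2norm M (\<lambda>z. F i z - G z) \<le> e"
    if N: "\<forall>i\<ge>N. \<forall>j\<ge>N. L2norm M (\<lambda>z. F i z - F j z) < e" and i: "i \<ge> N" for N i e
  proof -
    have 1: "sq M (\<lambda>z. F i z - F j z)" for j by (intro sq_diff F)
    have 2: "(\<lambda>z. F i z - G z) \<in> borel_measurable M" using holo_measurable[OF holo_diff[OF F(1) Gh]] by simp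
    have 3: "(\<lambda>j. F i z - F j z) \<longlonglongrightarrow> F i z - G z" for z by (intro tendsto_intros G)
    have 4: "\<forall>\<^sub>F j in sequentially. L2norm M (\<lambda>z. F i z - F j z) \<le> e"
      using N i unfolding eventually_sequentially by (intro exI[of _ N]) (auto intro: less_imp_le)
    show ?thesis using L2_Fatou[OF 1 2 3 4] by blast
  qed
  have lim: "(\<lambda>k. L2norm M (\<lambda>z. F k z - G z)) \<longlonglongrightarrow> 0"
  proof (rule LIMSEQ_I)
    fix e :: real assume e: "e > 0"
    obtain N where N: "\<forall>i\<ge>N. \<forall>j\<ge>N. L2norm M (\<lambda>z. F i z - F j z) < e / 2" using Cau[of "e / 2"] e by auto
    have "norm (L2norm M (\<lambda>z. F k z - G z) - 0) < e" if k: "k \<ge> N" for k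
      using est[OF N k] e by simp
    then show "\<exists>N. \<forall>k\<ge>N. norm (L2norm M (\<lambda>z. F k z - G z) - 0) < e" by blast
  qed
  obtain N where N: "\<forall>i\<ge>N. \<forall>j\<ge>N. L2norm M (\<lambda>z. F i z - F j z) < 1" using Cau[of 1] by auto
  have "sq M (\<lambda>z. F N z - (F N z - G z))" by (rule sq_diff[OF F(2) conjunct1[OF est[OF N order_refl]]])
  then have "sq M G" by simp
  then show ?thesis using that Gh lim G by blast
qed

end

section \<open>The closed form on smooth functions\<close>

context strat_group
begin

section \<open>Integration by parts for Lebesgue measure\<close>

lemma fd_outside:
  assumes "closed K" "\<And>z. z \<notin> K \<Longrightarrow> F z = 0" "z \<notin> K" shows "fd F z v = 0"
proof -
  have "((\<lambda>z. 0) has_derivative (\<lambda>v. 0)) (at z)" by simp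
  then have "(F has_derivative (\<lambda>v. 0)) (at z)"
    by (rule has_derivative_transform_within_open[of _ _ _ _ "- K"]) (use assms in auto)
  from frechet_derivative_at[OF this] show ?thesis by (simp add: fun_eq_iff)
qed

lemma fd_mult:
  assumes "smooth_fun f" "smooth_fun g"
  shows "fd (\<lambda>z. f z * g z) z v = f z * fd g z v + fd f z v * g z"
  using frechet_derivative_at[OF has_derivative_mult[OF smooth_has_derivative[OF assms(1)] smooth_has_derivative[OF assms(2)], of z]]
  by (simp add: fun_eq_iff)

lemma continuous_compact_integrable:
  fixes g :: "'g \<Rightarrow> complex"
  assumes "continuous_on UNIV g" "compact K" "\<And>z. z \<notin> K \<Longrightarrow> g z = 0"
  shows "integrable lborel g"
proof -
  have "set_integrable lborel K g"
    unfolding set_integrable_def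
    using borel_integrable_compact[OF assms(2) continuous_on_subset[OF assms(1) subset_UNIV]]
    by (simp add: indicator_scaleR_eq_if)
  moreover have "(\<lambda>z. indicator K z *\<^sub>R g z) = g" using assms(3) by (auto simp: indicator_def fun_eq_iff)
  ultimately show ?thesis by (simp add: set_integrable_def)
qed

text \<open>Translation invariance of Lebesgue measure, differentiated.\<close>

lemma integral_derivative_zero:
  assumes F: "smooth_fun F" and K: "compact K" "\<And>z. z \<notin> K \<Longrightarrow> F z = 0"
  shows "(\<integral>z. fd F z v \<partial>lborel) = 0"
proof -
  have cF: "continuous_on UNIV F" by (rule smooth_continuous[OF F])
  have cD: "continuous_on UNIV (\<lambda>z. fd F z v)" by (rule smooth_continuous[OF smooth_frechet[OF F]])
  have [measurable]: "F \<in> borel_measurable borel" using cF by (rule borel_measurable_continuous_onI)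
  have mD: "(\<lambda>z. fd F z v) \<in> borel_measurable borel" using cD by (rule borel_measurable_continuous_onI)
  define r where "r k = 1 / real (Suc k)" for k
  have r: "r k > 0" "r k \<le> 1" for k by (auto simp: r_def)
  define d where "d k z = (F (z + r k *\<^sub>R v) - F z) / of_real (r k)" for k z
  have "bounded ((\<lambda>z. fd F z v) ` K)"
    by (intro compact_imp_bounded compact_continuous_image continuous_on_subset[OF cD] K) auto
  then obtain B0 where B0: "\<forall>z\<in>K. cmod (fd F z v) \<le> B0" unfolding bounded_iff by auto
  define B where "B = max B0 0"
  have dout: "fd F z v = 0" if "z \<notin> K" for z
    by (rule fd_outside[OF compact_imp_closed[OF K(1)] K(2) that])
  have B: "B \<ge> 0" "cmod (fd F z v) \<le> B" for z
    using B0 dout[of z] by (cases "z \<in> K"; auto simp: B_def)+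
  define K' where "K' = (\<lambda>p. fst p + snd p) ` (K \<times> cball 0 (norm v))"
  have cK': "compact K'" unfolding K'_def
    by (intro compact_continuous_image compact_Times K compact_cball continuous_intros)
  have line: "((\<lambda>s. F (z + s *\<^sub>R v)) has_vector_derivative fd F (z + s *\<^sub>R v) v) (at s)" for z s
  proof -
    have "((\<lambda>s. z + s *\<^sub>R v) has_derivative (\<lambda>h. h *\<^sub>R v)) (at s)" by (auto intro!: derivative_eq_intros)
    from has_derivative_compose[OF this smooth_has_derivative[OF F]]
    show ?thesis
      using linear_scale[OF has_derivative_linear[OF smooth_has_derivative[OF F]]]
      by (simp add: has_vector_derivative_def)
  qed
  have dbd: "cmod (d k z) \<le> B * indicator K' z" for k z
  proof (cases "z \<in> K'")
    case True
    have "norm (F (z + r k *\<^sub>R v) - F (z + 0 *\<^sub>R v)) \<le> B * norm (r k - 0)"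
    proof (rule differentiable_bound[of UNIV "\<lambda>s. F (z + s *\<^sub>R v)" "\<lambda>s h. h *\<^sub>R fd F (z + s *\<^sub>R v) v"])
      show "((\<lambda>s. F (z + s *\<^sub>R v)) has_derivative (\<lambda>h. h *\<^sub>R fd F (z + s *\<^sub>R v) v)) (at s)" for s
        using line by (simp add: has_vector_derivative_def)
      show "onorm (\<lambda>h. h *\<^sub>R fd F (z + s *\<^sub>R v) v) \<le> B" for s
      proof (rule onorm_le)
        fix h :: real
        show "norm (h *\<^sub>R fd F (z + s *\<^sub>R v) v) \<le> B * norm h"
          using mult_right_mono[OF B(2)[of "z + s *\<^sub>R v"], of "\<bar>h\<bar>"] by (simp add: mult.commute)
      qed
    qed auto
    then have "cmod (F (z + r k *\<^sub>R v) - F z) \<le> B * r k" using r(1)[of k] by simp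
    then show ?thesis using True r(1)[of k] by (simp add: d_def norm_divide divide_le_eq)
  next
    case False
    have "z \<notin> K" using False unfolding K'_def by (auto intro!: image_eqI[of _ _ "(z, 0)"])
    moreover have "z + r k *\<^sub>R v \<notin> K"
    proof
      assume "z + r k *\<^sub>R v \<in> K"
      moreover have "norm (- (r k *\<^sub>R v)) \<le> norm v" using r[of k] by (simp add: mult_left_le_one_le)
      ultimately have "z \<in> K'" unfolding K'_def by (intro image_eqI[of _ _ "(z + r k *\<^sub>R v, - (r k *\<^sub>R v))"]) auto
      then show False using False by simp
    qed
    ultimately show ?thesis using K(2) B(1) by (simp add: d_def)
  qed
  have "(\<lambda>k. \<integral>z. d k z \<partial>lborel) \<longlonglongrightarrow> (\<integral>z. fd F z v \<partial>lborel)"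
  proof (rule integral_dominated_convergence[where w="\<lambda>z. B * indicator K' z"])
    show "(\<lambda>z. fd F z v) \<in> borel_measurable lborel" using mD by simp
    show "d k \<in> borel_measurable lborel" for k unfolding d_def by measurable
    have "K' \<in> sets borel" using compact_imp_closed[OF cK'] by simp
    then show "integrable lborel (\<lambda>z. B * indicator K' z)"
      using emeasure_bounded_finite[OF compact_imp_bounded[OF cK']] by (intro integrable_mult_right) simp
    show "AE z in lborel. (\<lambda>k. d k z) \<longlonglongrightarrow> fd F z v"
    proof (rule AE_I2)
      fix z
      have "((\<lambda>s. (F (z + s *\<^sub>R v) - F z) /\<^sub>R s) \<longlongrightarrow> fd F z v) (at 0)"
      proof -
        let ?A = "\<lambda>s. F (z + s *\<^sub>R v) - F z"
        have "((\<lambda>s. norm (?A s - s *\<^sub>R fd F z v) / norm s) \<longlongrightarrow> 0) (at 0)"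
          using line[of z 0] by (simp add: has_vector_derivative_def has_derivative_iff_norm)
        then have "((\<lambda>s. norm (?A s /\<^sub>R s - fd F z v)) \<longlongrightarrow> 0) (at 0)"
        proof (rule Lim_transform_eventually)
          have "norm (?A s - s *\<^sub>R fd F z v) / norm s = norm (?A s /\<^sub>R s - fd F z v)" if "s \<noteq> 0" for s :: real
          proof -
            have "?A s /\<^sub>R s - fd F z v = (?A s - s *\<^sub>R fd F z v) /\<^sub>R s" using that by (simp add: scaleR_diff_right)
            then show ?thesis by (simp add: divide_inverse mult.commute)
          qed
          then show "\<forall>\<^sub>F s in at 0. norm (?A s - s *\<^sub>R fd F z v) / norm s = norm (?A s /\<^sub>R s - fd F z v)"
            by (simp add: eventually_at_filter)
        qed
        then show ?thesis by (simp only: tendsto_norm_zero_iff LIM_zero_iff)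
      qed
      moreover have "filterlim r (at 0) sequentially"
      proof (rule filterlim_atI)
        show "r \<longlonglongrightarrow> 0" unfolding r_def[abs_def] using LIMSEQ_inverse_real_of_nat by (simp add: inverse_eq_divide)
        show "\<forall>\<^sub>F k in sequentially. r k \<noteq> 0" using r(1) by (intro always_eventually) (metis less_irrefl)
      qed
      ultimately have "(\<lambda>k. (F (z + r k *\<^sub>R v) - F z) /\<^sub>R r k) \<longlonglongrightarrow> fd F z v" by (rule filterlim_compose)
      then show "(\<lambda>k. d k z) \<longlonglongrightarrow> fd F z v" by (simp add: d_def scaleR_conv_of_real divide_inverse mult.commute)
    qed
    show "AE z in lborel. norm (d k z) \<le> B * indicator K' z" for k using dbd by simp
  qed
  moreover have "(\<integral>z. d k z \<partial>lborel) = 0" for k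
  proof -
    have i: "integrable lborel F" by (rule continuous_compact_integrable[OF cF K])
    have sh: "(\<integral>z. F (z + r k *\<^sub>R v) \<partial>lborel) = (\<integral>z. F z \<partial>lborel)"
      "integrable lborel (\<lambda>z. F (z + r k *\<^sub>R v))"
      using lborel_integral_shift[of F "r k *\<^sub>R v"] i by (simp_all add: add.commute)
    have "(\<integral>z. d k z \<partial>lborel) = (\<integral>z. F (z + r k *\<^sub>R v) - F z \<partial>lborel) / of_real (r k)"
      unfolding d_def by simp
    also have "\<dots> = 0" using Bochner_Integration.integral_diff[OF sh(2) i] sh(1) by simp
    finally show ?thesis .
  qed
  ultimately have "(\<lambda>k::nat. 0) \<longlonglongrightarrow> (\<integral>z. fd F z v \<partial>lborel)" by simp
  then have "0 = (\<integral>z. fd F z v \<partial>lborel)" by (simp only: LIMSEQ_const_iff)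
  then show ?thesis by simp
qed

text \<open>The Euclidean divergence of \<open>\<psi>\<close> times the left-invariant field of
  \<open>x\<close>; its negative is the formal adjoint of the field applied to
  \<open>\<psi>\<close>.\<close>

definition adj :: "'g \<Rightarrow> ('g \<Rightarrow> complex) \<Rightarrow> 'g \<Rightarrow> complex" where
  "adj x \<psi> z = (\<Sum>b\<in>Basis. fd (\<lambda>z. of_real (E z x \<bullet> b) * \<psi> z) z b)"

lemma E_coord_smooth: "smooth_fun (\<lambda>z. complex_of_real (E z x \<bullet> b))"
  by (intro smooth_of_real smooth_funI Ck_bounded_linear[OF bounded_linear_inner_left] smooth_funD[OF E_smooth])

lemma adj_continuous: assumes "smooth_fun \<psi>" shows "continuous_on UNIV (adj x \<psi>)"
  unfolding adj_def
  by (intro continuous_on_sum smooth_continuous smooth_frechet smooth_mult E_coord_smooth assms)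

lemma adj_support:
  assumes "compact K" "\<And>z. z \<notin> K \<Longrightarrow> \<psi> z = 0" "z \<notin> K" shows "adj x \<psi> z = 0"
  unfolding adj_def using assms by (intro sum.neutral ballI fd_outside[OF compact_imp_closed]) auto

text \<open>In Euclidean coordinates the field becomes a sum of partial derivatives with smooth
  coefficients. These are absorbed into \<open>\<Psi> b\<close>, and the compact support of
  \<open>\<psi>\<close> makes each total derivative integrate to zero.\<close>

lemma integration_by_parts:
  assumes \<phi>: "smooth_fun \<phi>" and \<psi>: "smooth_fun \<psi>" and K: "compact K" "\<And>z. z \<notin> K \<Longrightarrow> \<psi> z = 0"
  shows "(\<integral>z. lvf gmul x \<phi> z * \<psi> z \<partial>lborel) = - (\<integral>z. \<phi> z * adj x \<psi> z \<partial>lborel)"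
proof -
  define \<Psi> where "\<Psi> b z = complex_of_real (E z x \<bullet> b) * \<psi> z" for b z
  have sm: "smooth_fun (\<Psi> b)" for b unfolding \<Psi>_def by (intro smooth_mult E_coord_smooth \<psi>)
  have out: "\<Psi> b z = 0" if "z \<notin> K" for b z using K(2)[OF that] by (simp add: \<Psi>_def)
  have dout: "fd (\<Psi> b) z v = 0" if "z \<notin> K" for b z v by (rule fd_outside[OF compact_imp_closed[OF K(1)] out that])
  have c1: "continuous_on UNIV (\<lambda>z. \<phi> z * fd (\<Psi> b) z b)" for b
    by (intro continuous_on_mult smooth_continuous smooth_frechet sm \<phi>)
  have c2: "continuous_on UNIV (\<lambda>z. fd \<phi> z b * \<Psi> b z)" for b
    by (intro continuous_on_mult smooth_continuous smooth_frechet sm \<phi>)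
  have i1: "integrable lborel (\<lambda>z. \<phi> z * fd (\<Psi> b) z b)" for b
    by (rule continuous_compact_integrable[OF c1 K(1)]) (simp add: dout)
  have i2: "integrable lborel (\<lambda>z. fd \<phi> z b * \<Psi> b z)" for b
    by (rule continuous_compact_integrable[OF c2 K(1)]) (simp add: out)
  have b: "(\<integral>z. fd \<phi> z b * \<Psi> b z \<partial>lborel) = - (\<integral>z. \<phi> z * fd (\<Psi> b) z b \<partial>lborel)" for b
  proof -
    have "(\<integral>z. fd (\<lambda>z. \<phi> z * \<Psi> b z) z b \<partial>lborel) = 0"
      by (rule integral_derivative_zero[OF smooth_mult[OF \<phi> sm] K(1)]) (simp add: out)
    then show ?thesis
      unfolding fd_mult[OF \<phi> sm] Bochner_Integration.integral_add[OF i1 i2] by (simp add: add_eq_0_iff)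
  qed
  have "lvf gmul x \<phi> z * \<psi> z = (\<Sum>b\<in>Basis. fd \<phi> z b * \<Psi> b z)" for z
  proof -
    have "lvf gmul x \<phi> z = (\<Sum>b\<in>Basis. (E z x \<bullet> b) *\<^sub>R fd \<phi> z b)"
      unfolding lvf_smooth_eq[OF \<phi>]
      by (rule linear_expand[OF has_derivative_linear[OF smooth_has_derivative[OF \<phi>]]])
    then show ?thesis by (simp add: \<Psi>_def sum_distrib_left scaleR_conv_of_real ac_simps)
  qed
  then have "(\<integral>z. lvf gmul x \<phi> z * \<psi> z \<partial>lborel) = (\<Sum>b\<in>Basis. \<integral>z. fd \<phi> z b * \<Psi> b z \<partial>lborel)"
    using Bochner_Integration.integral_sum[of Basis lborel "\<lambda>b z. fd \<phi> z b * \<Psi> b z"] i2 by simp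
  also have "\<dots> = - (\<Sum>b\<in>Basis. \<integral>z. \<phi> z * fd (\<Psi> b) z b \<partial>lborel)" unfolding b by (rule sum_negf)
  also have "(\<Sum>b\<in>Basis. \<integral>z. \<phi> z * fd (\<Psi> b) z b \<partial>lborel) = (\<integral>z. \<phi> z * adj x \<psi> z \<partial>lborel)"
    using Bochner_Integration.integral_sum[of Basis lborel "\<lambda>b z. \<phi> z * fd (\<Psi> b) z b"] i1
    by (simp add: adj_def \<Psi>_def[abs_def] sum_distrib_left)
  finally show ?thesis .
qed

end

context heat_group
begin

section \<open>Left-invariant derivatives as closed operators\<close>

lemma smooth_measurable: "smooth_fun f \<Longrightarrow> f \<in> borel_measurable borel" for f :: "'g \<Rightarrow> complex"
  by (rule borel_measurable_continuous_onI[OF smooth_continuous])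

lemma sq_compact_support:
  assumes g: "continuous_on UNIV g" and K: "compact K" "\<And>z. z \<notin> K \<Longrightarrow> g z = 0" shows "sq M g"
proof -
  have [measurable]: "g \<in> borel_measurable borel" using g by (rule borel_measurable_continuous_onI)
  obtain B where B: "B \<ge> 0" "\<And>z. z \<in> K \<Longrightarrow> cmod (g z) \<le> B" using compact_support_bounded[OF g K(1)] by blast
  have "cmod (g z) \<le> B" for z using B K(2)[of z] by (cases "z \<in> K") auto
  then have "integrable M (\<lambda>z. (cmod (g z))\<^sup>2)"
    by (intro integrable_const_bound[of _ "B\<^sup>2"]) (auto intro!: AE_I2 power_mono)
  then show ?thesis by (simp add: sq_def)
qed

lemma sq_test: "test_fun \<phi> \<Longrightarrow> sq M \<phi>"
  by (meson sq_compact_support smooth_continuous test_fun_compact test_fun_smooth)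

lemma lvf_support:
  assumes "smooth_fun \<phi>" "compact K" "\<And>z. z \<notin> K \<Longrightarrow> \<phi> z = 0" "z \<notin> K" shows "lvf gmul y \<phi> z = 0"
  unfolding lvf_smooth_eq[OF assms(1)] by (rule fd_outside[OF compact_imp_closed[OF assms(2)] assms(3,4)])

lemma sq_lvf_test: assumes "test_fun \<phi>" shows "sq M (lvf gmul y \<phi>)"
proof -
  obtain K where K: "compact K" "\<And>z. z \<notin> K \<Longrightarrow> \<phi> z = 0" using test_fun_compact[OF assms] by blast
  have s: "smooth_fun \<phi>" by (rule test_fun_smooth[OF assms])
  show ?thesis by (rule sq_compact_support[OF smooth_continuous[OF lvf_smooth[OF s]] K(1) lvf_support[OF s K]])
qed

text \<open>Closability, in the form of lower semicontinuity: \<open>lvf y f\<close> is tested against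
  \<open>\<chi> \<rho> cnj (lvf y f)\<close>, where \<open>\<chi>\<close> is a cutoff function.\<close>

lemma lvf_lower_semicontinuous:
  assumes f: "smooth_fun f" "sq M f" and \<phi>: "\<And>k. smooth_fun (\<phi> k)" "\<And>k. sq M (\<phi> k)" "\<And>k. sq M (lvf gmul y (\<phi> k))"
    and lim: "(\<lambda>k. L2norm M (\<lambda>z. \<phi> k z - f z)) \<longlonglongrightarrow> 0"
    and C: "\<forall>\<^sub>F k in sequentially. L2norm M (lvf gmul y (\<phi> k)) \<le> C" and C0: "C \<ge> 0"
  shows "sq M (lvf gmul y f)" and "L2norm M (lvf gmul y f) \<le> C"
proof -
  define X where "X = lvf gmul y f"
  have X: "smooth_fun X" unfolding X_def by (rule lvf_smooth[OF f(1)])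
  have [measurable]: "X \<in> borel_measurable borel" "f \<in> borel_measurable borel" using smooth_measurable X f by auto
  have r: "\<rho> a z > 0" for z by (rule rho_pos[OF a_pos])
  define cX where "cX N z = of_real (cutoff N z) * X z" for N z
  have cXs: "test_fun (cX N)" for N unfolding cX_def by (rule cutoff_test[OF X])
  have cXsq: "sq M (cX N)" for N by (rule sq_test[OF cXs])
  have bound: "L2norm M (cX N) \<le> C" for N
  proof -
    obtain K where K: "compact K" "\<And>z. z \<notin> K \<Longrightarrow> cX N z = 0" using test_fun_compact[OF cXs] by blast
    define \<psi> where "\<psi> z = complex_of_real (\<rho> a z) * cnj (cX N z)" for z
    have \<psi>: "smooth_fun \<psi>" unfolding \<psi>_def
      by (intro smooth_mult smooth_of_real rho_smooth a_pos smooth_funI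
          Ck_bounded_linear[OF bounded_linear_cnj] smooth_funD[OF test_fun_smooth[OF cXs]])
    have \<psi>0: "\<psi> z = 0" if "z \<notin> K" for z using K(2)[OF that] by (simp add: \<psi>_def)
    \<comment> \<open>Represents the functional on the weighted space: the derivative moves onto
      \<open>\<psi>\<close>, and the division by the density compensates for the weight in
      \<open>L2ip\<close>.\<close>
    define w where "w z = cnj (adj y \<psi> z) / of_real (\<rho> a z)" for z
    have w: "sq M w"
    proof (rule sq_compact_support[OF _ K(1)])
      show "continuous_on UNIV w" unfolding w_def
        using r by (intro continuous_intros adj_continuous \<psi> smooth_continuous[OF rho_smooth[OF a_pos]]) (auto simp: less_le)
      show "w z = 0" if "z \<notin> K" for z unfolding w_def using adj_support[OF K(1) \<psi>0 that] by simp
    qed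
    have wm: "w \<in> borel_measurable borel" using sq_measurable[OF w] by simp
    have parts: "(\<integral>z. lvf gmul y h z * \<psi> z \<partial>lborel) = - L2ip M h w" if h: "smooth_fun h" for h
    proof -
      have [measurable]: "h \<in> borel_measurable borel" "w \<in> borel_measurable borel" using smooth_measurable[OF h] wm by auto
      have "L2ip M h w = (\<integral>z. \<rho> a z *\<^sub>R (h z * cnj (w z)) \<partial>lborel)"
        unfolding L2ip_def by (rule integral_M) measurable
      also have "\<dots> = (\<integral>z. h z * adj y \<psi> z \<partial>lborel)"
        using r by (intro Bochner_Integration.integral_cong refl) (simp add: w_def scaleR_conv_of_real less_le)
      finally show ?thesis using integration_by_parts[OF h \<psi> K(1) \<psi>0, of y] by simp
    qed
    have ip: "L2ip M (lvf gmul y h) (cX N) = (\<integral>z. lvf gmul y h z * \<psi> z \<partial>lborel)" if h: "smooth_fun h" for h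
    proof -
      have [measurable]: "lvf gmul y h \<in> borel_measurable borel" "cX N \<in> borel_measurable borel"
        using smooth_measurable[OF lvf_smooth[OF h]] smooth_measurable[OF test_fun_smooth[OF cXs]] by auto
      have "L2ip M (lvf gmul y h) (cX N) = (\<integral>z. \<rho> a z *\<^sub>R (lvf gmul y h z * cnj (cX N z)) \<partial>lborel)"
        unfolding L2ip_def by (rule integral_M) measurable
      also have "\<dots> = (\<integral>z. lvf gmul y h z * \<psi> z \<partial>lborel)"
        by (intro Bochner_Integration.integral_cong refl) (simp add: \<psi>_def scaleR_conv_of_real ac_simps)
      finally show ?thesis .
    qed
    have "(\<lambda>k. - L2ip M (\<phi> k) w) \<longlonglongrightarrow> - L2ip M f w"
      by (intro tendsto_minus L2_ip_tendsto[OF \<phi>(2) f(2) lim, of "\<lambda>_. w" w] w) simp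
    then have "(\<lambda>k. L2ip M (lvf gmul y (\<phi> k)) (cX N)) \<longlonglongrightarrow> L2ip M X (cX N)"
      unfolding X_def ip[OF \<phi>(1)] ip[OF f(1)] parts[OF \<phi>(1)] parts[OF f(1)] .
    then have "(\<lambda>k. cmod (L2ip M (lvf gmul y (\<phi> k)) (cX N))) \<longlonglongrightarrow> cmod (L2ip M X (cX N))" by (rule tendsto_norm)
    moreover have "\<forall>\<^sub>F k in sequentially. cmod (L2ip M (lvf gmul y (\<phi> k)) (cX N)) \<le> C * L2norm M (cX N)"
      using C
    proof eventually_elim
      case (elim k)
      have "cmod (L2ip M (lvf gmul y (\<phi> k)) (cX N)) \<le> L2norm M (lvf gmul y (\<phi> k)) * L2norm M (cX N)"
        by (rule L2_Cauchy_Schwarz[OF \<phi>(3) cXsq])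
      also have "\<dots> \<le> C * L2norm M (cX N)" using elim by (intro mult_right_mono) auto
      finally show ?case .
    qed
    ultimately have le: "cmod (L2ip M X (cX N)) \<le> C * L2norm M (cX N)"
      by (intro tendsto_upperbound[where F=sequentially]) auto
    have "L2ip M X (cX N) = of_real (\<integral>z. cutoff N z * (cmod (X z))\<^sup>2 \<partial>M)"
    proof -
      have "X z * cnj (cX N z) = of_real (cutoff N z * (cmod (X z))\<^sup>2)" for z
        unfolding of_real_mult complex_norm_square by (simp add: cX_def)
      then show ?thesis unfolding L2ip_def by (simp only: integral_complex_of_real)
    qed
    moreover have "(L2norm M (cX N))\<^sup>2 \<le> (\<integral>z. cutoff N z * (cmod (X z))\<^sup>2 \<partial>M)"
      unfolding L2norm_sq
    proof (rule integral_mono)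
      show "integrable M (\<lambda>z. (cmod (cX N z))\<^sup>2)" using cXsq by (simp add: sq_def)
      have "continuous_on UNIV (\<lambda>z. complex_of_real (cutoff N z * (cmod (X z))\<^sup>2))"
        by (intro continuous_intros smooth_continuous[OF cutoff_smooth] smooth_continuous[OF X])
      moreover have "complex_of_real (cutoff N z * (cmod (X z))\<^sup>2) = 0" if "z \<notin> K" for z
        using K(2)[OF that] by (auto simp: cX_def)
      ultimately have "sq M (\<lambda>z. complex_of_real (cutoff N z * (cmod (X z))\<^sup>2))" by (intro sq_compact_support[OF _ K(1)])
      from sq_integrable[OF this] show "integrable M (\<lambda>z. cutoff N z * (cmod (X z))\<^sup>2)"
        by (simp only: complex_of_real_integrable_eq)
      show "(cmod (cX N z))\<^sup>2 \<le> cutoff N z * (cmod (X z))\<^sup>2" for z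
      proof -
        have "(cutoff N z)\<^sup>2 \<le> cutoff N z" using cutoff_range[of N z] by (simp add: power2_eq_square mult_left_le)
        then show ?thesis by (simp add: cX_def norm_mult power_mult_distrib mult_right_mono)
      qed
    qed
    \<comment> \<open>As the cutoff has values between 0 and 1, the squared norm of
      \<open>cX N\<close> is at most its pairing with \<open>X\<close>. One factor of the norm can
      be cancelled because the cutoff makes it finite beforehand.\<close>
    ultimately have "(L2norm M (cX N))\<^sup>2 \<le> C * L2norm M (cX N)" using le by simp
    then show ?thesis
      using C0 L2norm_ge_0[of M "cX N"] by (cases "L2norm M (cX N) = 0") (auto simp: power2_eq_square)
  qed
  have "(\<lambda>N. cX N z) \<longlonglongrightarrow> X z" for z
  proof -
    have "(\<lambda>N. complex_of_real (cutoff N z) * X z) \<longlonglongrightarrow> of_real 1 * X z" by (intro tendsto_intros cutoff_tendsto)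
    then show ?thesis by (simp add: cX_def)
  qed
  note lim' = this
  have Xm: "X \<in> borel_measurable M" by simp
  have ev: "\<forall>\<^sub>F N in sequentially. L2norm M (cX N) \<le> C" using bound by simp
  show "sq M (lvf gmul y f)" "L2norm M (lvf gmul y f) \<le> C"
    using L2_Fatou[OF cXsq Xm lim' ev] unfolding X_def .
qed

text \<open>Lower semicontinuity is applied with \<open>k\<close> fixed to the differences of
  \<open>\<phi> k\<close> and \<open>\<phi> i\<close> as \<open>i\<close> grows: their limit differs
  from \<open>\<phi> k\<close> by \<open>f\<close>, so the Cauchy bound for derivatives survives in
  the limit.\<close>

lemma lvf_closed:
  assumes f: "smooth_fun f" "sq M f" and \<phi>: "\<And>k. smooth_fun (\<phi> k)" "\<And>k. sq M (\<phi> k)" "\<And>k. sq M (lvf gmul y (\<phi> k))"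
    and lim: "(\<lambda>k. L2norm M (\<lambda>z. \<phi> k z - f z)) \<longlonglongrightarrow> 0"
    and cau: "\<And>e. e > 0 \<Longrightarrow> \<exists>N. \<forall>i\<ge>N. \<forall>j\<ge>N. L2norm M (lvf gmul y (\<lambda>z. \<phi> i z - \<phi> j z)) < e"
  shows "sq M (lvf gmul y f)" and "(\<lambda>k. L2norm M (\<lambda>z. lvf gmul y (\<phi> k) z - lvf gmul y f z)) \<longlonglongrightarrow> 0"
proof -
  have lv: "lvf gmul y (\<lambda>z. \<phi> k z - g z) = (\<lambda>z. lvf gmul y (\<phi> k) z - lvf gmul y g z)" if "smooth_fun g" for k g
    by (rule ext) (rule lvf_diff[OF smooth_differentiable[OF \<phi>(1)] smooth_differentiable[OF that]])
  have est: "sq M (lvf gmul y (\<lambda>z. \<phi> k z - f z)) \<and> L2norm M (lvf gmul y (\<lambda>z. \<phi> k z - f z)) \<le> e"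
    if N: "\<forall>i\<ge>N. \<forall>j\<ge>N. L2norm M (lvf gmul y (\<lambda>z. \<phi> i z - \<phi> j z)) < e" and k: "k \<ge> N" and e: "e > 0" for N k e
  proof -
    have 1: "smooth_fun (\<lambda>z. \<phi> k z - f z)" by (rule smooth_diff[OF \<phi>(1) f(1)])
    have 2: "sq M (\<lambda>z. \<phi> k z - f z)" by (rule sq_diff[OF \<phi>(2) f(2)])
    have 3: "(\<lambda>i. L2norm M (\<lambda>z. (\<phi> k z - \<phi> i z) - (\<phi> k z - f z))) \<longlonglongrightarrow> 0"
      using lim L2norm_minus_commute[of M f] by simp
    have 4: "\<forall>\<^sub>F i in sequentially. L2norm M (lvf gmul y (\<lambda>z. \<phi> k z - \<phi> i z)) \<le> e"
      unfolding eventually_sequentially using N k by (intro exI[of _ N]) (auto intro: less_imp_le)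
    have 5: "sq M (lvf gmul y (\<lambda>z. \<phi> k z - \<phi> i z))" for i
      unfolding lv[OF \<phi>(1)] by (rule sq_diff[OF \<phi>(3) \<phi>(3)])
    show ?thesis
      using lvf_lower_semicontinuous[OF 1 2 smooth_diff[OF \<phi>(1) \<phi>(1)] sq_diff[OF \<phi>(2) \<phi>(2)] 5 3 4] e by auto
  qed
  obtain N1 where N1: "\<forall>i\<ge>N1. \<forall>j\<ge>N1. L2norm M (lvf gmul y (\<lambda>z. \<phi> i z - \<phi> j z)) < 1" using cau[of 1] by auto
  have "sq M (\<lambda>z. lvf gmul y (\<phi> N1) z - (lvf gmul y (\<phi> N1) z - lvf gmul y f z))"
    by (rule sq_diff[OF \<phi>(3) conjunct1[OF est[OF N1 order_refl, unfolded lv[OF f(1)]]]]) simp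
  then show "sq M (lvf gmul y f)" by simp
  show "(\<lambda>k. L2norm M (\<lambda>z. lvf gmul y (\<phi> k) z - lvf gmul y f z)) \<longlonglongrightarrow> 0"
  proof (rule LIMSEQ_I)
    fix e :: real assume e: "e > 0"
    obtain N where N: "\<forall>i\<ge>N. \<forall>j\<ge>N. L2norm M (lvf gmul y (\<lambda>z. \<phi> i z - \<phi> j z)) < e / 2" using cau[of "e / 2"] e by auto
    have "norm (L2norm M (\<lambda>z. lvf gmul y (\<phi> k) z - lvf gmul y f z) - 0) < e" if k: "k \<ge> N" for k
      using est[OF N k] e unfolding lv[OF f(1)] by simp
    then show "\<exists>N. \<forall>k\<ge>N. norm (L2norm M (\<lambda>z. lvf gmul y (\<phi> k) z - lvf gmul y f z) - 0) < e" by blast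
  qed
qed

section \<open>The closed form and its domain on smooth functions\<close>

abbreviation q0 :: "('g \<Rightarrow> complex) \<Rightarrow> ('g \<Rightarrow> complex) \<Rightarrow> complex" where "q0 \<equiv> Q0 gmul J x n M"

lemma q0_eq:
  assumes f: "smooth_fun f" "\<And>j. j < n \<Longrightarrow> sq M (lvf gmul (x j) f)" "\<And>j. j < n \<Longrightarrow> sq M (lvf gmul (J (x j)) f)"
    and g: "smooth_fun g" "\<And>j. j < n \<Longrightarrow> sq M (lvf gmul (x j) g)" "\<And>j. j < n \<Longrightarrow> sq M (lvf gmul (J (x j)) g)"
  shows "q0 f g = (\<Sum>j<n. L2ip M (lvf gmul (x j) f) (lvf gmul (x j) g) + L2ip M (lvf gmul (J (x j)) f) (lvf gmul (J (x j)) g))"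
proof -
  have "q0 f g = (\<integral>z. (\<Sum>j<n. lvf gmul (x j) f z * cnj (lvf gmul (x j) g z)
      + lvf gmul (J (x j)) f z * cnj (lvf gmul (J (x j)) g z)) \<partial>M)"
    unfolding Q0_def by (simp only: lvf_cnj[OF smooth_differentiable[OF g(1)]])
  also have "\<dots> = (\<Sum>j<n. \<integral>z. lvf gmul (x j) f z * cnj (lvf gmul (x j) g z)
      + lvf gmul (J (x j)) f z * cnj (lvf gmul (J (x j)) g z) \<partial>M)"
    using f g by (intro Bochner_Integration.integral_sum Bochner_Integration.integrable_add sq_ip_integrable) auto
  also have "\<dots> = (\<Sum>j<n. L2ip M (lvf gmul (x j) f) (lvf gmul (x j) g) + L2ip M (lvf gmul (J (x j)) f) (lvf gmul (J (x j)) g))"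
    unfolding L2ip_def using f g
    by (intro sum.cong refl Bochner_Integration.integral_add sq_ip_integrable) auto
  finally show ?thesis .
qed

lemma q0_test:
  assumes "test_fun u"
  shows "Re (q0 u u) = (\<Sum>j<n. (L2norm M (lvf gmul (x j) u))\<^sup>2 + (L2norm M (lvf gmul (J (x j)) u))\<^sup>2)"
proof -
  have "q0 u u = (\<Sum>j<n. L2ip M (lvf gmul (x j) u) (lvf gmul (x j) u) + L2ip M (lvf gmul (J (x j)) u) (lvf gmul (J (x j)) u))"
    by (intro q0_eq test_fun_smooth sq_lvf_test assms)
  then show ?thesis by (simp add: L2ip_self)
qed

definition dirs :: "'g set" where "dirs = x ` {..<n} \<union> (\<lambda>j. J (x j)) ` {..<n}"

lemma dirs_V1: "y \<in> dirs \<Longrightarrow> y \<in> V 1"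
  unfolding dirs_def using xV V1_J by blast

lemma q0_dirs:
  assumes "test_fun u" "y \<in> dirs" shows "(L2norm M (lvf gmul y u))\<^sup>2 \<le> Re (q0 u u)"
proof -
  obtain j where j: "j < n" "y = x j \<or> y = J (x j)" using assms(2) unfolding dirs_def by auto
  have "(L2norm M (lvf gmul y u))\<^sup>2 \<le> (L2norm M (lvf gmul (x j) u))\<^sup>2 + (L2norm M (lvf gmul (J (x j)) u))\<^sup>2"
    using j(2) by auto
  also have "\<dots> \<le> Re (q0 u u)"
    unfolding q0_test[OF assms(1)]
    using member_le_sum[of j "{..<n}" "\<lambda>j. (L2norm M (lvf gmul (x j) u))\<^sup>2 + (L2norm M (lvf gmul (J (x j)) u))\<^sup>2"] j(1) by simp
  finally show ?thesis .
qed

lemma form_approx_lvf: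
  assumes f: "smooth_fun f" "sq M f" and ap: "form_approx M q0 \<phi> f" and y: "y \<in> dirs"
  shows "sq M (lvf gmul y f)" and "(\<lambda>k. L2norm M (\<lambda>z. lvf gmul y (\<phi> k) z - lvf gmul y f z)) \<longlonglongrightarrow> 0"
proof -
  have t: "\<And>k. test_fun (\<phi> k)" and lim: "(\<lambda>k. L2norm M (\<lambda>z. \<phi> k z - f z)) \<longlonglongrightarrow> 0"
    and cau: "\<And>e. e > 0 \<Longrightarrow> \<exists>N. \<forall>i\<ge>N. \<forall>j\<ge>N. Re (q0 (\<lambda>z. \<phi> i z - \<phi> j z) (\<lambda>z. \<phi> i z - \<phi> j z)) < e"
    using ap unfolding form_approx_def by blast+
  have cau': "\<exists>N. \<forall>i\<ge>N. \<forall>j\<ge>N. L2norm M (lvf gmul y (\<lambda>z. \<phi> i z - \<phi> j z)) < e" if e: "e > 0" for e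
  proof -
    obtain N where N: "\<forall>i\<ge>N. \<forall>j\<ge>N. Re (q0 (\<lambda>z. \<phi> i z - \<phi> j z) (\<lambda>z. \<phi> i z - \<phi> j z)) < e\<^sup>2"
      using cau[of "e\<^sup>2"] e by auto
    have "L2norm M (lvf gmul y (\<lambda>z. \<phi> i z - \<phi> j z)) < e" if "i \<ge> N" "j \<ge> N" for i j
    proof (rule power2_less_imp_less)
      show "(L2norm M (lvf gmul y (\<lambda>z. \<phi> i z - \<phi> j z)))\<^sup>2 < e\<^sup>2"
        using q0_dirs[OF test_fun_diff[OF t t] y, of i j] N that by (meson le_less_trans)
    qed (use e in simp)
    then show ?thesis by blast
  qed
  show "sq M (lvf gmul y f)" "(\<lambda>k. L2norm M (\<lambda>z. lvf gmul y (\<phi> k) z - lvf gmul y f z)) \<longlonglongrightarrow> 0"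
    using lvf_closed[OF f test_fun_smooth[OF t] sq_test[OF t] sq_lvf_test[OF t] lim cau'] by auto
qed

lemma form_approxI:
  assumes t: "\<And>k. test_fun (\<phi> k)" and lim: "(\<lambda>k. L2norm M (\<lambda>z. \<phi> k z - f z)) \<longlonglongrightarrow> 0"
    and G: "\<And>y. y \<in> dirs \<Longrightarrow> sq M (G y)"
    and limG: "\<And>y. y \<in> dirs \<Longrightarrow> (\<lambda>k. L2norm M (\<lambda>z. lvf gmul y (\<phi> k) z - G y z)) \<longlonglongrightarrow> 0"
  shows "form_approx M q0 \<phi> f"
  unfolding form_approx_def
proof (intro conjI allI impI t lim)
  fix e :: real assume e: "e > 0"
  \<comment> \<open>Each of the \<open>2 * n\<close> directions costs at most \<open>d^2\<close>, in
    total \<open>n * e / (n + 1) < e\<close>; the shift to \<open>n + 1\<close> makes the inequality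
    strict and covers \<open>n = 0\<close>.\<close>
  define d where "d = sqrt (e / (2 * (real n + 1)))"
  have d2: "d\<^sup>2 = e / (2 * (real n + 1))" and d: "d > 0" using e by (simp_all add: d_def)
  have "\<forall>\<^sub>F k in sequentially. \<forall>y\<in>dirs. L2norm M (\<lambda>z. lvf gmul y (\<phi> k) z - G y z) < d / 2"
  proof (rule eventually_ball_finite)
    show "finite dirs" by (simp add: dirs_def)
    show "\<forall>y\<in>dirs. \<forall>\<^sub>F k in sequentially. L2norm M (\<lambda>z. lvf gmul y (\<phi> k) z - G y z) < d / 2"
      using d by (intro ballI order_tendstoD(2)[OF limG]) simp_all
  qed
  then obtain N where N: "\<And>k y. k \<ge> N \<Longrightarrow> y \<in> dirs \<Longrightarrow> L2norm M (\<lambda>z. lvf gmul y (\<phi> k) z - G y z) < d / 2"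
    unfolding eventually_sequentially by blast
  show "\<exists>N. \<forall>i\<ge>N. \<forall>j\<ge>N. Re (q0 (\<lambda>z. \<phi> i z - \<phi> j z) (\<lambda>z. \<phi> i z - \<phi> j z)) < e"
  proof (intro exI[of _ N] allI impI)
    fix i k assume i: "i \<ge> N" and k: "k \<ge> N"
    have b: "(L2norm M (lvf gmul y (\<lambda>z. \<phi> i z - \<phi> k z)))\<^sup>2 \<le> d\<^sup>2" if y: "y \<in> dirs" for y
    proof (rule power_mono)
      have "lvf gmul y (\<lambda>z. \<phi> i z - \<phi> k z) = (\<lambda>z. lvf gmul y (\<phi> i) z - lvf gmul y (\<phi> k) z)"
        by (rule ext) (rule lvf_diff[OF smooth_differentiable smooth_differentiable]; rule test_fun_smooth[OF t])
      then have "L2norm M (lvf gmul y (\<lambda>z. \<phi> i z - \<phi> k z))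
        \<le> L2norm M (\<lambda>z. lvf gmul y (\<phi> i) z - G y z) + L2norm M (\<lambda>z. G y z - lvf gmul y (\<phi> k) z)"
        using L2norm_triangle_diff[OF sq_lvf_test[OF t[of i]] G[OF y] sq_lvf_test[OF t[of k]], of y y] by simp
      also have "\<dots> \<le> d / 2 + d / 2"
        using N[OF i y] N[OF k y] L2norm_minus_commute[of M "G y"] by (intro add_mono) auto
      finally show "L2norm M (lvf gmul y (\<lambda>z. \<phi> i z - \<phi> k z)) \<le> d" by simp
    qed simp
    have "Re (q0 (\<lambda>z. \<phi> i z - \<phi> k z) (\<lambda>z. \<phi> i z - \<phi> k z)) \<le> (\<Sum>j<n. d\<^sup>2 + d\<^sup>2)"
      unfolding q0_test[OF test_fun_diff[OF t t]]
      by (intro sum_mono add_mono b) (auto simp: dirs_def)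
    also have "\<dots> = real n * (2 * d\<^sup>2)" by simp
    also have "2 * d\<^sup>2 = e / (real n + 1)" proof -
      have "2 * (e / (2 * t)) = e / t" for t by simp
      then show ?thesis unfolding d2 .
    qed
    also have "real n * (e / (real n + 1)) < e" using e by (simp add: divide_less_eq)
    finally show "Re (q0 (\<lambda>z. \<phi> i z - \<phi> k z) (\<lambda>z. \<phi> i z - \<phi> k z)) < e" .
  qed
qed

lemma cutoff_L2:
  assumes g: "sq M g" shows "(\<lambda>k. L2norm M (\<lambda>z. of_real (cutoff k z) * g z - g z)) \<longlonglongrightarrow> 0"
proof -
  have [measurable]: "g \<in> borel_measurable M" by (rule sq_measurable[OF g])
  have "(\<lambda>k. \<integral>z. (cmod (of_real (cutoff k z) * g z - g z))\<^sup>2 \<partial>M) \<longlonglongrightarrow> (\<integral>z. 0 \<partial>M)"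
  proof (rule integral_dominated_convergence[where w="\<lambda>z. (cmod (g z))\<^sup>2"])
    show "integrable M (\<lambda>z. (cmod (g z))\<^sup>2)" using g by (simp add: sq_def)
    have eq: "cmod (of_real (cutoff k z) * g z - g z) = (1 - cutoff k z) * cmod (g z)" for k z
    proof -
      have "of_real (cutoff k z) * g z - g z = of_real (cutoff k z - 1) * g z" by (simp add: algebra_simps)
      then show ?thesis using cutoff_range(2)[of k z] by (simp only: norm_mult norm_of_real) simp
    qed
    show "AE z in M. norm ((cmod (of_real (cutoff k z) * g z - g z))\<^sup>2) \<le> (cmod (g z))\<^sup>2" for k
    proof (rule AE_I2)
      fix z
      have "(1 - cutoff k z) * cmod (g z) \<le> 1 * cmod (g z)" using cutoff_range[of k z] by (intro mult_right_mono) auto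
      then have "((1 - cutoff k z) * cmod (g z))\<^sup>2 \<le> (cmod (g z))\<^sup>2"
        using cutoff_range[of k z] by (intro power_mono) auto
      then show "norm ((cmod (of_real (cutoff k z) * g z - g z))\<^sup>2) \<le> (cmod (g z))\<^sup>2" unfolding eq by simp
    qed
    show "AE z in M. (\<lambda>k. (cmod (of_real (cutoff k z) * g z - g z))\<^sup>2) \<longlonglongrightarrow> 0"
    proof (rule AE_I2)
      fix z
      have "(\<lambda>k. ((1 - cutoff k z) * cmod (g z))\<^sup>2) \<longlonglongrightarrow> ((1 - 1) * cmod (g z))\<^sup>2"
        by (intro tendsto_intros cutoff_tendsto)
      then show "(\<lambda>k. (cmod (of_real (cutoff k z) * g z - g z))\<^sup>2) \<longlonglongrightarrow> 0" unfolding eq by simp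
    qed
  qed measurable
  then have "(\<lambda>k. sqrt (\<integral>z. (cmod (of_real (cutoff k z) * g z - g z))\<^sup>2 \<partial>M)) \<longlonglongrightarrow> sqrt 0"
    by (intro tendsto_real_sqrt) simp
  then show ?thesis by (simp add: L2norm_def)
qed

text \<open>Dilations are automorphisms, so differentiating \<open>bump\<close> composed with one
  along \<open>y\<close> amounts to differentiating \<open>bump\<close> along the dilated vector,
  which for \<open>y\<close> in \<open>V 1\<close> is \<open>y / Suc k\<close>.\<close>

lemma lvf_cutoff_bound:
  assumes y: "y \<in> V 1"
  obtains B where "B \<ge> 0" "\<And>k z. cmod (lvf gmul y (\<lambda>z. of_real (cutoff k z)) z) \<le> B / real (Suc k)"
proof -
  define b where "b z = complex_of_real (bump z)" for z :: 'g
  have b: "smooth_fun b" unfolding b_def by (rule smooth_of_real[OF bump_smooth])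
  have b0: "b z = 0" if "z \<notin> cball 0 1" for z using bump_support[OF that] by (simp add: b_def)
  obtain B where B: "B \<ge> 0" "\<And>z. z \<in> cball 0 1 \<Longrightarrow> cmod (lvf gmul y b z) \<le> B"
    using compact_support_bounded[OF smooth_continuous[OF lvf_smooth[OF b]] compact_cball] by blast
  have lo: "lvf gmul y b z = 0" if "z \<notin> cball 0 1" for z
    by (rule lvf_support[OF b compact_cball b0 that])
  have B': "cmod (lvf gmul y b z) \<le> B" for z
    using B lo[of z] by (cases "z \<in> cball 0 1") auto
  have "cmod (lvf gmul y (\<lambda>z. of_real (cutoff k z)) z) \<le> B / real (Suc k)" for k z
  proof -
    define r where "r = 1 / real (Suc k)"
    have "(\<lambda>z. complex_of_real (cutoff k z)) = (\<lambda>z. b (dil J V m (of_real r) z))"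
      by (simp add: cutoff_def b_def r_def)
    then have "lvf gmul y (\<lambda>z. of_real (cutoff k z)) z = lvf gmul (dil J V m (of_real r) y) b (dil J V m (of_real r) z)"
      by (simp only: lvf_dil)
    also have "dil J V m (of_real r) y = r *\<^sub>R y + 0 *\<^sub>R y" using dil_V1[OF y] by (simp add: cscale_of_real)
    also have "lvf gmul (r *\<^sub>R y + 0 *\<^sub>R y) b (dil J V m (of_real r) z) = r *\<^sub>R lvf gmul y b (dil J V m (of_real r) z)"
      by (simp only: lvf_direction[OF smooth_differentiable[OF b]]) simp
    finally have "cmod (lvf gmul y (\<lambda>z. of_real (cutoff k z)) z) = r * cmod (lvf gmul y b (dil J V m (of_real r) z))"
      by (simp add: r_def)
    also have "\<dots> \<le> r * B" by (intro mult_left_mono B') (simp add: r_def)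
    finally show ?thesis by (simp add: r_def)
  qed
  then show ?thesis using that B(1) by blast
qed

text \<open>The approximants are the truncations of \<open>f\<close>. In the Leibniz rule the term
  with the differentiated cutoff has norm at most \<open>B / Suc k\<close> times that of
  \<open>f\<close>, so the derivatives converge as well.\<close>

lemma smooth_form_dom:
  assumes f: "smooth_fun f" "sq M f" and lf: "\<And>y. y \<in> dirs \<Longrightarrow> sq M (lvf gmul y f)"
  shows "f \<in> Qdom gmul J x n \<rho> a"
proof -
  define \<phi> where "\<phi> k z = complex_of_real (cutoff k z) * f z" for k z
  have "form_approx M q0 \<phi> f"
  proof (rule form_approxI)
    show "test_fun (\<phi> k)" for k unfolding \<phi>_def by (rule cutoff_test[OF f(1)])
    show "(\<lambda>k. L2norm M (\<lambda>z. \<phi> k z - f z)) \<longlonglongrightarrow> 0" unfolding \<phi>_def by (rule cutoff_L2[OF f(2)])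
    fix y assume y: "y \<in> dirs"
    show "sq M (lvf gmul y f)" by (rule lf[OF y])
    obtain B where B: "B \<ge> 0" "\<And>k z. cmod (lvf gmul y (\<lambda>z. of_real (cutoff k z)) z) \<le> B / real (Suc k)"
      using lvf_cutoff_bound[OF dirs_V1[OF y]] by blast
    have sc: "smooth_fun (\<lambda>z. complex_of_real (cutoff k z))" for k by (rule smooth_of_real[OF cutoff_smooth])
    define D where "D k z = lvf gmul y (\<lambda>z. of_real (cutoff k z)) z * f z" for k z
    have lv: "lvf gmul y (\<phi> k) z = of_real (cutoff k z) * lvf gmul y f z + D k z" for k z
      unfolding \<phi>_def D_def by (rule lvf_mult[OF smooth_differentiable[OF sc] smooth_differentiable[OF f(1)]])
    have Dsq: "sq M (D k)" and Dn: "L2norm M (D k) \<le> (B / real (Suc k)) * L2norm M f" for k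
    proof -
      have bd: "(cmod (D k z))\<^sup>2 \<le> (B / real (Suc k))\<^sup>2 * (cmod (f z))\<^sup>2" for z
      proof -
        have "cmod (D k z) \<le> (B / real (Suc k)) * cmod (f z)"
          unfolding D_def norm_mult by (intro mult_right_mono B) simp
        then have "(cmod (D k z))\<^sup>2 \<le> ((B / real (Suc k)) * cmod (f z))\<^sup>2" by (intro power_mono) auto
        then show ?thesis by (simp only: power_mult_distrib)
      qed
      have fi: "integrable M (\<lambda>z. (B / real (Suc k))\<^sup>2 * (cmod (f z))\<^sup>2)"
        using f(2) unfolding sq_def by (intro integrable_mult_right) blast
      have [measurable]: "D k \<in> borel_measurable borel"
        unfolding D_def by (intro smooth_measurable smooth_mult lvf_smooth sc f)
      have Di: "integrable M (\<lambda>z. (cmod (D k z))\<^sup>2)"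
      proof (rule Bochner_Integration.integrable_bound[OF fi])
        show "AE z in M. norm ((cmod (D k z))\<^sup>2) \<le> norm ((B / real (Suc k))\<^sup>2 * (cmod (f z))\<^sup>2)"
        proof (rule AE_I2)
          fix z show "norm ((cmod (D k z))\<^sup>2) \<le> norm ((B / real (Suc k))\<^sup>2 * (cmod (f z))\<^sup>2)"
            using bd[of z] by (simp only: real_norm_def abs_mult abs_power2)
        qed
      qed measurable
      then show "sq M (D k)" by (simp add: sq_def)
      have "(L2norm M (D k))\<^sup>2 \<le> (B / real (Suc k))\<^sup>2 * (L2norm M f)\<^sup>2"
        unfolding L2norm_sq using integral_mono[OF Di fi bd] by simp
      then have "(L2norm M (D k))\<^sup>2 \<le> ((B / real (Suc k)) * L2norm M f)\<^sup>2" by (simp only: power_mult_distrib)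
      then show "L2norm M (D k) \<le> (B / real (Suc k)) * L2norm M f"
        by (rule power2_le_imp_le) (use B(1) in simp)
    qed
    show "(\<lambda>k. L2norm M (\<lambda>z. lvf gmul y (\<phi> k) z - lvf gmul y f z)) \<longlonglongrightarrow> 0"
    proof (rule tendsto_sandwich[of "\<lambda>_. 0"])
      have csq: "sq M (\<lambda>z. of_real (cutoff k z) * lvf gmul y f z)" for k
        by (rule sq_test[OF cutoff_test[OF lvf_smooth[OF f(1)]]])
      have "L2norm M (\<lambda>z. lvf gmul y (\<phi> k) z - lvf gmul y f z)
        \<le> L2norm M (\<lambda>z. of_real (cutoff k z) * lvf gmul y f z - lvf gmul y f z) + (B / real (Suc k)) * L2norm M f" for k
      proof -
        have "(\<lambda>z. lvf gmul y (\<phi> k) z - lvf gmul y f z)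
          = (\<lambda>z. (of_real (cutoff k z) * lvf gmul y f z - lvf gmul y f z) + D k z)"
          by (rule ext) (simp add: lv)
        then show ?thesis
          using L2norm_triangle[OF sq_diff[OF csq[of k] lf[OF y]] Dsq[of k]] Dn[of k] by simp
      qed
      then show "\<forall>\<^sub>F k in sequentially. L2norm M (\<lambda>z. lvf gmul y (\<phi> k) z - lvf gmul y f z)
        \<le> L2norm M (\<lambda>z. of_real (cutoff k z) * lvf gmul y f z - lvf gmul y f z) + (B / real (Suc k)) * L2norm M f" by simp
      have "(\<lambda>k. B / real (Suc k)) \<longlonglongrightarrow> 0" by real_asymp
      then have "(\<lambda>k. L2norm M (\<lambda>z. of_real (cutoff k z) * lvf gmul y f z - lvf gmul y f z) + (B / real (Suc k)) * L2norm M f) \<longlonglongrightarrow> 0 + 0 * L2norm M f"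
        by (intro tendsto_intros cutoff_L2 lf y)
      then show "(\<lambda>k. L2norm M (\<lambda>z. of_real (cutoff k z) * lvf gmul y f z - lvf gmul y f z) + (B / real (Suc k)) * L2norm M f) \<longlonglongrightarrow> 0" by simp
    qed auto
  qed
  then show ?thesis unfolding Qdom_def form_dom_def using f(2) by (auto simp: inLp_2)
qed

lemma form_domD:
  assumes "f \<in> Qdom gmul J x n \<rho> a"
  shows "sq M f" and "form_approx M q0 (SOME \<phi>. form_approx M q0 \<phi> f) f"
  using assms someI_ex[of "\<lambda>\<phi>. form_approx M q0 \<phi> f"] unfolding Qdom_def form_dom_def by (auto simp: inLp_2)

text \<open>\<open>form_closure\<close> evaluates along sequences picked by \<open>SOME\<close>.
  Whatever is picked, the derivatives converge in the norm to those of \<open>f\<close> and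
  \<open>g\<close>, so the limit exists and does not depend on the choice.\<close>

lemma Qform_smooth:
  assumes f: "f \<in> Qdom gmul J x n \<rho> a" "smooth_fun f" and g: "g \<in> Qdom gmul J x n \<rho> a" "smooth_fun g"
  shows "Qform gmul J x n \<rho> a f g
    = (\<Sum>j<n. L2ip M (lvf gmul (x j) f) (lvf gmul (x j) g) + L2ip M (lvf gmul (J (x j)) f) (lvf gmul (J (x j)) g))"
proof -
  define \<phi> where "\<phi> = (SOME \<phi>. form_approx M q0 \<phi> f)"
  define \<psi> where "\<psi> = (SOME \<phi>. form_approx M q0 \<phi> g)"
  have ap: "form_approx M q0 \<phi> f" "form_approx M q0 \<psi> g" unfolding \<phi>_def \<psi>_def using form_domD(2) f g by auto
  have t: "test_fun (\<phi> k)" "test_fun (\<psi> k)" for k using ap unfolding form_approx_def by auto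
  have "(\<lambda>k. q0 (\<phi> k) (\<psi> k)) \<longlonglongrightarrow>
    (\<Sum>j<n. L2ip M (lvf gmul (x j) f) (lvf gmul (x j) g) + L2ip M (lvf gmul (J (x j)) f) (lvf gmul (J (x j)) g))"
  proof -
    have eq: "q0 (\<phi> k) (\<psi> k) = (\<Sum>j<n. L2ip M (lvf gmul (x j) (\<phi> k)) (lvf gmul (x j) (\<psi> k))
        + L2ip M (lvf gmul (J (x j)) (\<phi> k)) (lvf gmul (J (x j)) (\<psi> k)))" for k
      by (intro q0_eq test_fun_smooth sq_lvf_test t)
    have conv: "(\<lambda>k. L2ip M (lvf gmul y (\<phi> k)) (lvf gmul y (\<psi> k))) \<longlonglongrightarrow> L2ip M (lvf gmul y f) (lvf gmul y g)"
      if y: "y \<in> dirs" for y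
      by (rule L2_ip_tendsto[OF sq_lvf_test[OF t(1)] form_approx_lvf[OF f(2) form_domD(1)[OF f(1)] ap(1) y]
          sq_lvf_test[OF t(2)] form_approx_lvf[OF g(2) form_domD(1)[OF g(1)] ap(2) y]])
    show ?thesis unfolding eq by (intro tendsto_sum tendsto_add conv) (auto simp: dirs_def)
  qed
  then show ?thesis unfolding Qform_def form_closure_def \<phi>_def[symmetric] \<psi>_def[symmetric] by (rule limI)
qed

lemma smooth_form_dom_iff:
  assumes "smooth_fun f"
  shows "f \<in> Qdom gmul J x n \<rho> a \<longleftrightarrow> sq M f \<and> (\<forall>y\<in>dirs. sq M (lvf gmul y f))"
  using smooth_form_dom[OF assms] form_domD[of f] form_approx_lvf(1)[OF assms] by blast

end

section \<open>Riesz representation on a complete subspace\<close>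

lemma L2_Pythagoras:
  assumes "finite I" "\<And>i. i \<in> I \<Longrightarrow> sq N (u i)" "\<And>i j. i \<in> I \<Longrightarrow> j \<in> I \<Longrightarrow> i \<noteq> j \<Longrightarrow> L2ip N (u i) (u j) = 0"
  shows "(L2norm N (\<lambda>z. \<Sum>i\<in>I. u i z))\<^sup>2 = (\<Sum>i\<in>I. (L2norm N (u i))\<^sup>2)"
proof -
  have "complex_of_real ((L2norm N (\<lambda>z. \<Sum>i\<in>I. u i z))\<^sup>2) = L2ip N (\<lambda>z. \<Sum>i\<in>I. u i z) (\<lambda>z. \<Sum>i\<in>I. u i z)"
    by (simp only: L2ip_self)
  also have "\<dots> = (\<Sum>i\<in>I. L2ip N (u i) (\<lambda>z. \<Sum>i\<in>I. u i z))"
    by (rule L2ip_sum_left[OF assms(2) sq_sum[OF assms(2)]])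
  also have "\<dots> = (\<Sum>i\<in>I. L2ip N (u i) (u i))"
  proof (rule sum.cong[OF refl])
    fix i assume i: "i \<in> I"
    have "L2ip N (u i) (\<lambda>z. \<Sum>i\<in>I. u i z) = (\<Sum>j\<in>I. L2ip N (u i) (u j))"
      by (rule L2ip_sum_right[OF assms(2) assms(2)[OF i]])
    also have "\<dots> = (\<Sum>j\<in>I. if j = i then L2ip N (u i) (u i) else 0)"
      using assms(3)[OF i] by (intro sum.cong) auto
    also have "\<dots> = L2ip N (u i) (u i)" using assms(1) i by simp
    finally show "L2ip N (u i) (\<lambda>z. \<Sum>i\<in>I. u i z) = L2ip N (u i) (u i)" .
  qed
  also have "\<dots> = complex_of_real (\<Sum>i\<in>I. (L2norm N (u i))\<^sup>2)" by (simp add: L2ip_self)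
  finally show ?thesis by (simp only: of_real_eq_iff)
qed

lemma L2_Cauchy_orthogonal:
  assumes sq: "\<And>i. sq N (u i)" and orth: "\<And>i j. i \<noteq> j \<Longrightarrow> L2ip N (u i) (u j) = 0"
    and sm: "summable (\<lambda>k. (L2norm N (u k))\<^sup>2)" and e: "e > 0"
  shows "\<exists>K. \<forall>i\<ge>K. \<forall>j\<ge>K. L2norm N (\<lambda>z. (\<Sum>k<i. u k z) - (\<Sum>k<j. u k z)) < e"
proof -
  obtain K where K: "\<And>m n. m \<ge> K \<Longrightarrow> norm (\<Sum>k\<in>{m..<n}. (L2norm N (u k))\<^sup>2) < e\<^sup>2"
    using sm e unfolding summable_Cauchy by (metis zero_less_power)
  have le: "L2norm N (\<lambda>z. (\<Sum>k<i. u k z) - (\<Sum>k<j. u k z)) < e" if "j \<ge> K" "j \<le> i" for i j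
  proof (rule power2_less_imp_less)
    have "(\<lambda>z. (\<Sum>k<i. u k z) - (\<Sum>k<j. u k z)) = (\<lambda>z. \<Sum>k\<in>{j..<i}. u k z)"
      using that(2) by (auto simp: fun_eq_iff lessThan_atLeast0 sum_diff_nat_ivl)
    then have "(L2norm N (\<lambda>z. (\<Sum>k<i. u k z) - (\<Sum>k<j. u k z)))\<^sup>2 = (\<Sum>k\<in>{j..<i}. (L2norm N (u k))\<^sup>2)"
      using L2_Pythagoras[of "{j..<i}" N u] sq orth by simp
    also have "\<dots> < e\<^sup>2" using K[OF that(1), of i] by (simp add: sum_nonneg)
    finally show "(L2norm N (\<lambda>z. (\<Sum>k<i. u k z) - (\<Sum>k<j. u k z)))\<^sup>2 < e\<^sup>2" .
  qed (use e in simp)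
  show ?thesis
  proof (intro exI[of _ K] allI impI)
    fix i j assume "i \<ge> K" "j \<ge> K"
    then show "L2norm N (\<lambda>z. (\<Sum>k<i. u k z) - (\<Sum>k<j. u k z)) < e"
      using le[of i j] le[of j i] L2norm_minus_commute[of N "\<lambda>z. \<Sum>k<i. u k z" "\<lambda>z. \<Sum>k<j. u k z"]
      by (cases "j \<le> i") auto
  qed
qed

text \<open>The representing element is the limit of a minimising sequence of \<open>\<parallel>h\<parallel>\<^sup>2 - 2 Re (\<ell> h)\<close>,
  which is Cauchy by the parallelogram law.\<close>

lemma Riesz_subspace:
  assumes E_sq: "\<And>h. h \<in> E \<Longrightarrow> sq N h" and E_0: "(\<lambda>z. 0) \<in> E"
    and E_lin: "\<And>f g c. f \<in> E \<Longrightarrow> g \<in> E \<Longrightarrow> (\<lambda>z. f z + c * g z) \<in> E"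
    and complete: "\<And>F. (\<And>k. F k \<in> E) \<Longrightarrow> (\<And>e. e > 0 \<Longrightarrow> \<exists>K. \<forall>i\<ge>K. \<forall>j\<ge>K. L2norm N (\<lambda>z. F i z - F j z) < e)
      \<Longrightarrow> \<exists>G\<in>E. (\<lambda>k. L2norm N (\<lambda>z. F k z - G z)) \<longlonglongrightarrow> 0"
    and l_lin: "\<And>f g c. f \<in> E \<Longrightarrow> g \<in> E \<Longrightarrow> l (\<lambda>z. f z + c * g z) = l f + cnj c * l g"
    and l_bd: "\<And>h. h \<in> E \<Longrightarrow> cmod (l h) \<le> C * L2norm N h"
  shows "\<exists>g\<in>E. \<forall>h\<in>E. l h = L2ip N g h"
proof -
  define I where "I h = (L2norm N h)\<^sup>2 - 2 * Re (l h)" for h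
  have I_add: "I (\<lambda>z. f z + c * g z) = I f + 2 * Re (cnj c * (L2ip N f g - l g)) + (cmod c)\<^sup>2 * (L2norm N g)\<^sup>2"
    if "f \<in> E" "g \<in> E" for f g c
    unfolding I_def L2norm_expand[OF E_sq[OF that(1)] E_sq[OF that(2)]] l_lin[OF that]
    by (simp add: right_diff_distrib)
  have I_ge: "- (C\<^sup>2) \<le> I h" if "h \<in> E" for h
  proof -
    have "Re (l h) \<le> C * L2norm N h" using l_bd[OF that] complex_Re_le_cmod[of "l h"] by linarith
    then show ?thesis unfolding I_def using zero_le_power2[of "L2norm N h - C"] by (simp add: power2_diff algebra_simps)
  qed
  define \<mu> where "\<mu> = Inf (I ` E)"
  have bdd: "bdd_below (I ` E)" using I_ge by (intro bdd_belowI[of _ "- (C\<^sup>2)"]) auto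
  have \<mu>_le: "\<mu> \<le> I h" if "h \<in> E" for h unfolding \<mu>_def using bdd that by (intro cInf_lower) auto
  have "\<exists>h\<in>E. I h < \<mu> + 1 / real (Suc i)" for i
  proof -
    have "Inf (I ` E) < \<mu> + 1 / real (Suc i)" by (simp add: \<mu>_def)
    then show ?thesis using cInf_lessD[of "I ` E"] E_0 by blast
  qed
  then obtain h where h: "\<And>i. h i \<in> E" "\<And>i. I (h i) < \<mu> + 1 / real (Suc i)" by metis
  have par: "(L2norm N (\<lambda>z. h i z - h j z))\<^sup>2 \<le> 2 / real (Suc i) + 2 / real (Suc j)" for i j
  proof -
    \<comment> \<open>With \<open>w\<close> the difference of \<open>h i\<close> and
      \<open>h j\<close>, the functional is expanded at the midpoint and at \<open>h i\<close>.
      Eliminating the linear term \<open>p\<close> leaves a multiple of the squared norm of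
      \<open>w\<close>, while the midpoint value is at least \<open>\<mu>\<close>.\<close>
    define w where "w z = h i z + (- 1) * h j z" for z
    have w: "w \<in> E" unfolding w_def by (rule E_lin[OF h(1) h(1)])
    define p where "p = 2 * Re (cnj (1 / 2) * (L2ip N (h j) w - l w))"
    have "I (\<lambda>z. h j z + (1 / 2) * w z) = I (h j) + p + (1 / 4) * (L2norm N w)\<^sup>2"
      unfolding I_add[OF h(1) w] p_def by (simp add: power2_eq_square norm_divide)
    moreover have "I (h i) = I (h j) + 2 * p + (L2norm N w)\<^sup>2"
    proof -
      have "h i = (\<lambda>z. h j z + 1 * w z)" by (simp add: w_def)
      then have "I (h i) = I (\<lambda>z. h j z + 1 * w z)" by simp
      also have "\<dots> = I (h j) + 2 * p + (L2norm N w)\<^sup>2" unfolding I_add[OF h(1) w] p_def by simp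
      finally show ?thesis .
    qed
    moreover have "\<mu> \<le> I (\<lambda>z. h j z + (1 / 2) * w z)" by (rule \<mu>_le[OF E_lin[OF h(1) w]])
    ultimately have "(L2norm N w)\<^sup>2 \<le> 2 / real (Suc i) + 2 / real (Suc j)" using h(2)[of i] h(2)[of j] by linarith
    moreover have "w = (\<lambda>z. h i z - h j z)" by (simp add: w_def fun_eq_iff)
    ultimately show ?thesis by (simp only:)
  qed
  obtain g where g: "g \<in> E" "(\<lambda>k. L2norm N (\<lambda>z. h k z - g z)) \<longlonglongrightarrow> 0"
  proof -
    have "\<exists>K. \<forall>i\<ge>K. \<forall>j\<ge>K. L2norm N (\<lambda>z. h i z - h j z) < e" if e: "e > 0" for e :: real
    proof -
      obtain K where K: "4 / e\<^sup>2 < real K" using reals_Archimedean2 by blast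
      have "L2norm N (\<lambda>z. h i z - h j z) < e" if ij: "i \<ge> K" "j \<ge> K" for i j
      proof (rule power2_less_imp_less)
        have inv: "2 / real (Suc k) < e\<^sup>2 / 2" if "k \<ge> K" for k
        proof -
          have "4 / e\<^sup>2 < real (Suc k)" using K that by linarith
          then have "4 < real (Suc k) * e\<^sup>2" using e by (simp only: pos_divide_less_eq zero_less_power)
          then show ?thesis by (simp add: field_simps del: of_nat_Suc)
        qed
        show "(L2norm N (\<lambda>z. h i z - h j z))\<^sup>2 < e\<^sup>2"
          using par[of i j] inv[OF ij(1)] inv[OF ij(2)] by linarith
      qed (use e in simp)
      then show ?thesis by blast
    qed
    then show ?thesis using complete[of h] h(1) that by blast
  qed
  have "l f = L2ip N g f" if f: "f \<in> E" for f
  proof -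
    define d where "d = L2ip N g f - l f"
    have pos: "0 \<le> 2 * Re (cnj \<tau> * d) + (cmod \<tau>)\<^sup>2 * (L2norm N f)\<^sup>2" for \<tau>
    proof -
      have lim: "(\<lambda>i. L2ip N (h i) f) \<longlonglongrightarrow> L2ip N g f"
        by (rule L2_ip_tendsto[OF E_sq[OF h(1)] E_sq[OF g(1)] g(2) E_sq[OF f] E_sq[OF f]]) simp
      have 1: "- (1 / real (Suc i)) \<le> 2 * Re (cnj \<tau> * (L2ip N (h i) f - l f)) + (cmod \<tau>)\<^sup>2 * (L2norm N f)\<^sup>2" for i
        using \<mu>_le[OF E_lin[OF h(1)[of i] f, of \<tau>]] h(2)[of i] unfolding I_add[OF h(1) f] by linarith
      have 2: "(\<lambda>i. - (1 / real (Suc i))) \<longlonglongrightarrow> 0" by real_asymp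
      have 3: "(\<lambda>i. 2 * Re (cnj \<tau> * (L2ip N (h i) f - l f)) + (cmod \<tau>)\<^sup>2 * (L2norm N f)\<^sup>2)
        \<longlonglongrightarrow> 2 * Re (cnj \<tau> * (L2ip N g f - l f)) + (cmod \<tau>)\<^sup>2 * (L2norm N f)\<^sup>2"
        by (intro tendsto_intros lim)
      show ?thesis unfolding d_def by (rule LIMSEQ_le[OF 2 3]) (use 1 in blast)
    qed
    \<comment> \<open>Testing with \<open>\<tau> = - s d\<close>, this size keeps the quadratic term
      at most half of the linear one; the summand 1 avoids division by zero.\<close>
    define s where "s = 1 / ((L2norm N f)\<^sup>2 + 1)"
    have s: "s > 0" "s * (L2norm N f)\<^sup>2 \<le> 1" by (auto simp: s_def add_nonneg_pos divide_le_eq)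
    have "cnj (- of_real s * d) * d = of_real (- (s * (cmod d)\<^sup>2))"
      unfolding of_real_minus of_real_mult complex_norm_square by simp
    then have "Re (cnj (- of_real s * d) * d) = - (s * (cmod d)\<^sup>2)" by (simp only: Re_complex_of_real)
    moreover have "cmod (- of_real s * d) = s * cmod d" using s(1) by (simp add: norm_mult)
    ultimately have "0 \<le> - 2 * (s * (cmod d)\<^sup>2) + (s * cmod d)\<^sup>2 * (L2norm N f)\<^sup>2" using pos[of "- of_real s * d"] by simp
    also have "(s * cmod d)\<^sup>2 * (L2norm N f)\<^sup>2 = (s * (cmod d)\<^sup>2) * (s * (L2norm N f)\<^sup>2)" by (simp add: power2_eq_square)
    also have "\<dots> \<le> (s * (cmod d)\<^sup>2) * 1" using s by (intro mult_left_mono) auto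
    finally have "s * (cmod d)\<^sup>2 \<le> 0" by simp
    then have "d = 0" using s(1) by (simp add: mult_le_0_iff)
    then show ?thesis by (simp add: d_def)
  qed
  then show ?thesis using g(1) by blast
qed

section \<open>The restricted form and its operator\<close>

context strat_group
begin

text \<open>The derivative has degree \<open>k - 1\<close>; keeping the factor \<open>l\<close> on
  the left covers \<open>k = 0\<close> without truncated subtraction.\<close>

lemma hom_poly_lvf:
  assumes f: "f \<in> hom_poly J V m k" and y: "y \<in> V 1" and l: "l \<noteq> 0"
  shows "l * lvf gmul y f (dil J V m l z) = l ^ k * lvf gmul y f z"
proof -
  have fh: "holo J f" by (rule hom_polyD(1)[OF f])
  have "l * lvf gmul y f (dil J V m l z) = lvf gmul y (\<lambda>z. f (dil J V m l z)) z"
    by (rule lvf_dil_holo[OF fh y, symmetric])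
  also have "\<dots> = lvf gmul y (\<lambda>z. l ^ k * f z) z" by (simp only: hom_polyD(2)[OF f l])
  also have "\<dots> = l ^ k * lvf gmul y f z" by (rule lvf_cmult[OF holo_differentiable[OF fh]])
  finally show ?thesis .
qed

lemma hom_poly_lvf_Suc:
  assumes f: "f \<in> hom_poly J V m (Suc k)" and y: "y \<in> V 1" shows "lvf gmul y f \<in> hom_poly J V m k"
  using hom_poly_lvf[OF f y] holo_lvf[OF hom_polyD(1)[OF f], of y] by (auto simp: hom_poly_def)

lemma hom_poly_0_const:
  assumes f: "f \<in> hom_poly J V m 0" shows "f z = f 0"
proof -
  have "tay 0 f z = (\<integral>t. f z \<partial>circ)"
    unfolding tay_def by (intro Bochner_Integration.integral_cong refl) (simp add: hom_polyD(2)[OF f])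
  then show ?thesis using tay_0[OF hom_polyD(1)[OF f], of z] circ.prob_space by simp
qed

lemma hom_poly_lvf_0: assumes "f \<in> hom_poly J V m 0" shows "lvf gmul y f = (\<lambda>z. 0)"
proof -
  have "f = (\<lambda>z. f 0)" by (rule ext) (rule hom_poly_0_const[OF assms])
  then obtain c where "f = (\<lambda>z. c)" by blast
  then show ?thesis by (simp add: lvf_def fun_eq_iff)
qed

end

context heat_group
begin

section \<open>The form on holomorphic functions\<close>

abbreviation X :: "nat \<Rightarrow> ('g \<Rightarrow> complex) \<Rightarrow> 'g \<Rightarrow> complex" where "X j \<equiv> lvf gmul (x j)"

text \<open>The form domain within the holomorphic functions in concrete terms; the directions
  \<open>J (x j)\<close> are left out because there the derivative is \<open>\<i>\<close> times that
  along \<open>x j\<close>.\<close>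

definition HD :: "('g \<Rightarrow> complex) set" where
  "HD = {f. holo J f \<and> sq M f \<and> (\<forall>j<n. sq M (X j f))}"

text \<open>The factor 2 accounts for the directions \<open>J (x j)\<close>, which contribute the
  same as the \<open>x j\<close>.\<close>

definition Qh :: "('g \<Rightarrow> complex) \<Rightarrow> ('g \<Rightarrow> complex) \<Rightarrow> complex" where
  "Qh f g = 2 * (\<Sum>j<n. L2ip M (X j f) (X j g))"

lemma HDD: "f \<in> HD \<Longrightarrow> holo J f" "f \<in> HD \<Longrightarrow> sq M f" "f \<in> HD \<Longrightarrow> j < n \<Longrightarrow> sq M (X j f)"
  by (auto simp: HD_def)

lemma lvf_J_fun: "holo J f \<Longrightarrow> lvf gmul (J y) f = (\<lambda>z. \<i> * lvf gmul y f z)"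
  by (rule ext) (rule lvf_J)

lemma HD_eq: "HD = Qdom gmul J x n \<rho> a \<inter> {f. holo J f}"
proof -
  have "(\<forall>y\<in>dirs. sq M (lvf gmul y f)) \<longleftrightarrow> (\<forall>j<n. sq M (X j f))" if "holo J f" for f
    unfolding dirs_def by (auto simp: lvf_J_fun[OF that] intro!: sq_cmult)
  then show ?thesis
    unfolding HD_def by (auto simp: smooth_form_dom_iff[OF holo_smooth])
qed

lemma Qform_HD: assumes f: "f \<in> HD" and g: "g \<in> HD" shows "Qform gmul J x n \<rho> a f g = Qh f g"
proof -
  have "Qform gmul J x n \<rho> a f g
    = (\<Sum>j<n. L2ip M (X j f) (X j g) + L2ip M (lvf gmul (J (x j)) f) (lvf gmul (J (x j)) g))"
    using f g by (intro Qform_smooth) (auto simp: HD_eq holo_smooth)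
  also have "\<dots> = (\<Sum>j<n. 2 * L2ip M (X j f) (X j g))"
  proof (rule sum.cong[OF refl])
    fix j
    have "L2ip M (lvf gmul (J (x j)) f) (lvf gmul (J (x j)) g) = L2ip M (X j f) (X j g)"
      unfolding lvf_J_fun[OF HDD(1)[OF f]] lvf_J_fun[OF HDD(1)[OF g]] L2ip_def
      by (intro Bochner_Integration.integral_cong refl) (simp add: complex_eq_iff)
    then show "L2ip M (X j f) (X j g) + L2ip M (lvf gmul (J (x j)) f) (lvf gmul (J (x j)) g) = 2 * L2ip M (X j f) (X j g)"
      by simp
  qed
  finally show ?thesis by (simp add: Qh_def sum_distrib_left)
qed

lemma X_lin:
  assumes "holo J f" "holo J g" shows "X j (\<lambda>z. f z + c * g z) = (\<lambda>z. X j f z + c * X j g z)"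
proof
  fix z
  show "X j (\<lambda>z. f z + c * g z) z = X j f z + c * X j g z"
    using lvf_add[OF holo_differentiable[OF assms(1)] holo_differentiable[OF holo_cmult[OF assms(2)]]]
    by (simp add: lvf_cmult[OF holo_differentiable[OF assms(2)]])
qed

lemma X_diff:
  assumes "holo J f" "holo J g" shows "X j (\<lambda>z. f z - g z) = (\<lambda>z. X j f z - X j g z)"
  using X_lin[OF assms, of j "- 1"] by simp

lemma X_sum:
  assumes "\<And>i. i \<in> I \<Longrightarrow> holo J (f i)" shows "X j (\<lambda>z. \<Sum>i\<in>I. f i z) = (\<lambda>z. \<Sum>i\<in>I. X j (f i) z)"
  by (rule ext) (rule lvf_sum[OF holo_differentiable[OF assms]])

lemma HD_lin: assumes "f \<in> HD" "g \<in> HD" shows "(\<lambda>z. f z + c * g z) \<in> HD"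
  using assms unfolding HD_def
  by (auto simp: X_lin holo_add holo_cmult sq_add)

lemma HD_diff: "f \<in> HD \<Longrightarrow> g \<in> HD \<Longrightarrow> (\<lambda>z. f z - g z) \<in> HD"
  using HD_lin[of f g "- 1"] by simp

lemma Qh_lin_left:
  assumes "f \<in> HD" "g \<in> HD" "h \<in> HD" shows "Qh (\<lambda>z. f z + c * g z) h = Qh f h + c * Qh g h"
proof -
  have "L2ip M (X j (\<lambda>z. f z + c * g z)) (X j h) = L2ip M (X j f) (X j h) + c * L2ip M (X j g) (X j h)" if "j < n" for j
    unfolding X_lin[OF HDD(1)[OF assms(1)] HDD(1)[OF assms(2)]] by (intro L2ip_add_left HDD(3) assms that)
  then show ?thesis unfolding Qh_def by (simp add: sum.distrib sum_distrib_left algebra_simps)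
qed

lemma Qh_cnj: "cnj (Qh f g) = Qh g f"
  by (simp add: Qh_def L2ip_cnj)

lemma Qh_lin_right:
  assumes "f \<in> HD" "g \<in> HD" "h \<in> HD" shows "Qh h (\<lambda>z. f z + c * g z) = Qh h f + cnj c * Qh h g"
proof -
  have "Qh h (\<lambda>z. f z + c * g z) = cnj (Qh (\<lambda>z. f z + c * g z) h)" by (simp only: Qh_cnj)
  also have "\<dots> = Qh h f + cnj c * Qh h g" unfolding Qh_lin_left[OF assms] by (simp add: Qh_cnj)
  finally show ?thesis .
qed

lemma Qh_self: "Re (Qh f f) = 2 * (\<Sum>j<n. (L2norm M (X j f))\<^sup>2)"
  by (simp add: Qh_def L2ip_self)

lemma energy_sq:
  assumes "f \<in> HD"
  shows "(energy_norm M (Qform gmul J x n \<rho> a) f)\<^sup>2 = (L2norm M f)\<^sup>2 + 2 * (\<Sum>j<n. (L2norm M (X j f))\<^sup>2)"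
  unfolding energy_norm_def Qform_HD[OF assms assms] Qh_self by (simp add: sum_nonneg)

lemma energy_tendsto:
  assumes "\<And>k. F k \<in> HD" "(\<lambda>k. L2norm M (F k)) \<longlonglongrightarrow> 0" "\<And>j. j < n \<Longrightarrow> (\<lambda>k. L2norm M (X j (F k))) \<longlonglongrightarrow> 0"
  shows "(\<lambda>k. energy_norm M (Qform gmul J x n \<rho> a) (F k)) \<longlonglongrightarrow> 0"
proof -
  have "energy_norm M (Qform gmul J x n \<rho> a) (F k) = sqrt ((L2norm M (F k))\<^sup>2 + 2 * (\<Sum>j<n. (L2norm M (X j (F k)))\<^sup>2))" for k
    unfolding energy_norm_def Qform_HD[OF assms(1) assms(1)] Qh_self ..
  moreover have "(\<lambda>k. sqrt ((L2norm M (F k))\<^sup>2 + 2 * (\<Sum>j<n. (L2norm M (X j (F k)))\<^sup>2))) \<longlonglongrightarrow> sqrt (0\<^sup>2 + 2 * (\<Sum>j<n. 0\<^sup>2))"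
    by (intro tendsto_intros assms) auto
  ultimately show ?thesis by simp
qed

lemma hom_poly_X_sq: assumes f: "f \<in> hom_poly J V m k" and j: "j < n" shows "sq M (X j f)"
proof -
  have "inLp M 2 (X j f)"
  proof (rule growth_inLp[of _ _ k])
    show "continuous_on UNIV (X j f)" by (rule holo_continuous[OF holo_lvf[OF hom_polyD(1)[OF f]]])
    fix r :: real and z assume r: "r \<ge> 1"
    have "cmod (of_real r * X j f (dil J V m (of_real r) z)) = cmod (of_real r ^ k * X j f z)"
      using r by (subst hom_poly_lvf[OF f xV[OF j]]) auto
    then have "r * cmod (X j f (dil J V m (of_real r) z)) = r ^ k * cmod (X j f z)" using r by (simp add: norm_mult norm_power)
    moreover have "1 * cmod (X j f (dil J V m (of_real r) z)) \<le> r * cmod (X j f (dil J V m (of_real r) z))"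
      using r by (intro mult_right_mono) auto
    ultimately show "cmod (X j f (dil J V m (of_real r) z)) \<le> r ^ k * cmod (X j f z)" by simp
  qed simp
  then show ?thesis by (simp add: inLp_2)
qed

lemma hom_poly_HD: "f \<in> hom_poly J V m k \<Longrightarrow> f \<in> HD"
  unfolding HD_def using hom_polyD(1) hom_poly_sq hom_poly_X_sq by blast

lemma HD_0: "(\<lambda>z. 0) \<in> HD" by (rule hom_poly_HD[OF hom_poly_0])

lemma HD_sum: "(\<And>i. i \<in> I \<Longrightarrow> f i \<in> HD) \<Longrightarrow> (\<lambda>z. \<Sum>i\<in>I. f i z) \<in> HD"
proof (induction I rule: infinite_finite_induct)
  case (insert i I)
  then show ?case using HD_lin[of "f i" "\<lambda>z. \<Sum>i\<in>I. f i z" 1] by simp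
qed (auto simp: HD_0)

lemma poly_span_HD: "f \<in> poly_span J V m \<Longrightarrow> f \<in> HD"
  by (erule poly_spanE) (auto intro!: HD_sum intro: hom_poly_HD)

text \<open>Both derivatives lose one degree, and the two lost factors combine to
  \<open>l * cnj l = 1\<close>. The product therefore transforms by the same character as for
  \<open>f\<close> and \<open>g\<close> themselves, including degree 0.\<close>

lemma Qh_orthogonal:
  assumes f: "f \<in> hom_poly J V m i" and g: "g \<in> hom_poly J V m k" and ik: "i \<noteq> k" and j: "j < n"
  shows "L2ip M (X j f) (X j g) = 0"
proof (rule rotation_orthogonal[OF _ _ _ ik])
  show "X j f \<in> borel_measurable borel" "X j g \<in> borel_measurable borel"
    using f g by (auto intro!: holo_measurable holo_lvf dest: hom_polyD(1))
  fix l z assume l: "cmod l = 1"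
  then have l0: "l \<noteq> 0" by auto
  have "l * cnj l = 1" using l by (simp only: complex_norm_square[symmetric]) simp
  then have "X j f (dil J V m l z) * cnj (X j g (dil J V m l z))
    = (l * X j f (dil J V m l z)) * cnj (l * X j g (dil J V m l z))"
    by (simp add: mult.assoc mult.left_commute)
  also have "\<dots> = l ^ i * cnj (l ^ k) * (X j f z * cnj (X j g z))"
    unfolding hom_poly_lvf[OF f xV[OF j] l0] hom_poly_lvf[OF g xV[OF j] l0] by simp
  finally show "X j f (dil J V m l z) * cnj (X j g (dil J V m l z)) = l ^ i * cnj (l ^ k) * (X j f z * cnj (X j g z))" .
qed

lemma S_HD: "holo J f \<Longrightarrow> S K f \<in> HD"
  by (rule poly_span_HD[OF S_poly])

lemma energy_expansion:
  assumes f: "f \<in> HD"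
  shows "(\<lambda>K. energy_norm M (Qform gmul J x n \<rho> a) (\<lambda>z. f z - S K f z)) \<longlonglongrightarrow> 0"
proof (rule LIMSEQ_imp_Suc, rule energy_tendsto)
  have fh: "holo J f" by (rule HDD(1)[OF f])
  show "(\<lambda>z. f z - S (Suc K) f z) \<in> HD" for K by (rule HD_diff[OF f S_HD[OF fh]])
  show "(\<lambda>K. L2norm M (\<lambda>z. f z - S (Suc K) f z)) \<longlonglongrightarrow> 0"
    using L2_expansion[OF fh HDD(2)[OF f]] by (rule LIMSEQ_Suc)
  fix j assume j: "j < n"
  \<comment> \<open>The index drops by one because the constant component has derivative zero and
    all other degrees are lowered.\<close>
  have "X j (\<lambda>z. f z - S (Suc K) f z) = (\<lambda>z. X j f z - S K (X j f) z)" for K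
    unfolding X_diff[OF fh poly_span_holo[OF S_poly[OF fh]]] lvf_tay_sum[OF fh xV[OF j]] ..
  then show "(\<lambda>K. L2norm M (X j (\<lambda>z. f z - S (Suc K) f z))) \<longlonglongrightarrow> 0"
    using L2_expansion[OF holo_lvf[OF fh] HDD(3)[OF f j]] by simp
qed

lemma L2_sum_complete:
  assumes c: "\<And>k. c k \<in> hom_poly J V m k" and sm: "summable (\<lambda>k. (L2norm M (c k))\<^sup>2)"
  obtains f where "holo J f" "sq M f" "(\<lambda>K. L2norm M (\<lambda>z. (\<Sum>k<K. c k z) - f z)) \<longlonglongrightarrow> 0"
proof -
  have ph: "holo J (\<lambda>z. \<Sum>k<K. c k z)" for K by (intro holo_sum hom_polyD(1)[OF c])
  have ps: "sq M (\<lambda>z. \<Sum>k<K. c k z)" for K by (intro sq_sum hom_poly_sq[OF c])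
  have cau: "\<exists>K. \<forall>i\<ge>K. \<forall>j\<ge>K. L2norm M (\<lambda>z. (\<Sum>k<i. c k z) - (\<Sum>k<j. c k z)) < e" if "e > 0" for e
    by (rule L2_Cauchy_orthogonal[OF hom_poly_sq[OF c] hom_poly_orthogonal[OF c c] sm that])
  show ?thesis
    using holo_L2_complete[of "\<lambda>K z. \<Sum>k<K. c k z", OF ph ps cau] that by blast
qed

text \<open>Summable energies give orthogonal series that converge in the norm, both for the
  components and for each of their derivatives. Closedness of \<open>X j\<close> identifies the
  limits of the latter as derivatives of the sum.\<close>

lemma energy_sum_complete:
  assumes c: "\<And>k. c k \<in> hom_poly J V m k" and sm: "summable (\<lambda>k. (energy_norm M (Qform gmul J x n \<rho> a) (c k))\<^sup>2)"
  shows "\<exists>f\<in>HD. (\<lambda>K. energy_norm M (Qform gmul J x n \<rho> a) (\<lambda>z. f z - (\<Sum>k<K. c k z))) \<longlonglongrightarrow> 0"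
proof -
  have esq: "(energy_norm M (Qform gmul J x n \<rho> a) (c k))\<^sup>2 = (L2norm M (c k))\<^sup>2 + 2 * (\<Sum>j<n. (L2norm M (X j (c k)))\<^sup>2)" for k
    by (rule energy_sq[OF hom_poly_HD[OF c]])
  have sm0: "summable (\<lambda>k. (L2norm M (c k))\<^sup>2)"
    by (rule summable_comparison_test'[OF sm, of 0]) (auto simp: esq sum_nonneg)
  have smj: "summable (\<lambda>k. (L2norm M (X j (c k)))\<^sup>2)" if j: "j < n" for j
  proof (rule summable_comparison_test'[OF sm, of 0])
    fix k
    have "(L2norm M (X j (c k)))\<^sup>2 \<le> (\<Sum>j<n. (L2norm M (X j (c k)))\<^sup>2)"
      using j by (intro member_le_sum) auto
    moreover have "(\<Sum>j<n. (L2norm M (X j (c k)))\<^sup>2) \<ge> 0" by (intro sum_nonneg) simp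
    ultimately have "(L2norm M (X j (c k)))\<^sup>2 \<le> (energy_norm M (Qform gmul J x n \<rho> a) (c k))\<^sup>2"
      unfolding esq using zero_le_power2[of "L2norm M (c k)"] by linarith
    then show "norm ((L2norm M (X j (c k)))\<^sup>2) \<le> (energy_norm M (Qform gmul J x n \<rho> a) (c k))\<^sup>2" by simp
  qed
  obtain f where f: "holo J f" "sq M f" "(\<lambda>K. L2norm M (\<lambda>z. (\<Sum>k<K. c k z) - f z)) \<longlonglongrightarrow> 0"
    using L2_sum_complete[OF c sm0] by blast
  have pHD: "(\<lambda>z. \<Sum>k<K. c k z) \<in> HD" for K by (intro HD_sum hom_poly_HD[OF c])
  have Xs: "X j (\<lambda>z. \<Sum>k<K. c k z) = (\<lambda>z. \<Sum>k<K. X j (c k) z)" for j K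
    by (rule X_sum[OF hom_polyD(1)[OF c]])
  have Xf: "sq M (X j f) \<and> (\<lambda>K. L2norm M (\<lambda>z. X j (\<lambda>z. \<Sum>k<K. c k z) z - X j f z)) \<longlonglongrightarrow> 0" if j: "j < n" for j
  proof -
    have "\<exists>N. \<forall>i\<ge>N. \<forall>i'\<ge>N. L2norm M (X j (\<lambda>z. (\<Sum>k<i. c k z) - (\<Sum>k<i'. c k z))) < e" if e: "e > 0" for e
      unfolding X_diff[OF HDD(1)[OF pHD] HDD(1)[OF pHD]] Xs
      by (rule L2_Cauchy_orthogonal[OF hom_poly_X_sq[OF c j] Qh_orthogonal[OF c c _ j] smj[OF j] e])
    from lvf_closed[of f "\<lambda>K z. \<Sum>k<K. c k z" "x j", OF holo_smooth[OF f(1)] f(2) holo_smooth[OF HDD(1)[OF pHD]]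
        HDD(2)[OF pHD] HDD(3)[OF pHD j] f(3) this]
    show ?thesis by blast
  qed
  have fHD: "f \<in> HD" using f Xf by (auto simp: HD_def)
  have "(\<lambda>K. energy_norm M (Qform gmul J x n \<rho> a) (\<lambda>z. f z - (\<Sum>k<K. c k z))) \<longlonglongrightarrow> 0"
  proof (rule energy_tendsto)
    show "(\<lambda>z. f z - (\<Sum>k<K. c k z)) \<in> HD" for K by (rule HD_diff[OF fHD pHD])
    show "(\<lambda>K. L2norm M (\<lambda>z. f z - (\<Sum>k<K. c k z))) \<longlonglongrightarrow> 0"
      using f(3) by (simp only: L2norm_minus_commute[of M f])
    show "(\<lambda>K. L2norm M (X j (\<lambda>z. f z - (\<Sum>k<K. c k z)))) \<longlonglongrightarrow> 0" if "j < n" for j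
      unfolding X_diff[OF f(1) HDD(1)[OF pHD]] using Xf[OF that] by (simp only: L2norm_minus_commute[of M "X j f"])
  qed
  then show ?thesis using fHD by blast
qed

section \<open>Representation of the form on a fixed degree\<close>

lemma hom_poly_complete:
  assumes F: "\<And>i. F i \<in> hom_poly J V m k"
    and cau: "\<And>e. e > 0 \<Longrightarrow> \<exists>K. \<forall>i\<ge>K. \<forall>j\<ge>K. L2norm M (\<lambda>z. F i z - F j z) < e"
  shows "\<exists>G\<in>hom_poly J V m k. (\<lambda>i. L2norm M (\<lambda>z. F i z - G z)) \<longlonglongrightarrow> 0"
proof -
  obtain G where G: "holo J G" "(\<lambda>k. L2norm M (\<lambda>z. F k z - G z)) \<longlonglongrightarrow> 0" "\<And>z. (\<lambda>k. F k z) \<longlonglongrightarrow> G z"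
    using holo_L2_complete[of F, OF hom_polyD(1)[OF F] hom_poly_sq[OF F] cau] by blast
  have "G (dil J V m l z) = l ^ k * G z" if l: "l \<noteq> 0" for l z
  proof -
    have "(\<lambda>i. l ^ k * F i z) \<longlonglongrightarrow> l ^ k * G z" by (intro tendsto_intros G)
    then have "(\<lambda>i. F i (dil J V m l z)) \<longlonglongrightarrow> l ^ k * G z" by (simp only: hom_polyD(2)[OF F l])
    then show ?thesis by (rule LIMSEQ_unique[OF G(3)])
  qed
  then show ?thesis using G by (auto simp: hom_poly_def intro!: bexI[of _ G])
qed

text \<open>Cauchy's formula bounds \<open>X j h\<close> on the set where
  \<open>Psi q z \<le> 2\<close> by values of \<open>h\<close> on a compact set, and the evaluation
  bound controls these by the norm of \<open>h\<close>. Homogeneity carries the estimate to all of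
  the group with the factor \<open>Psi q\<close>, whose square is integrable.\<close>

lemma hom_poly_X_bounded:
  assumes j: "j < n" shows "\<exists>C. \<forall>h\<in>hom_poly J V m k. L2norm M (X j h) \<le> C * L2norm M h"
proof -
  define q where "q = Suc k"
  have q: "q \<ge> 1" by (simp add: q_def)
  have kq: "k \<le> 2 * q * fact m"
  proof -
    have "k * 1 \<le> 2 * q * fact m" by (intro mult_mono) (auto simp: q_def)
    then show ?thesis by simp
  qed
  \<comment> \<open>The set of all points at which Cauchy's formula samples
    \<open>h\<close>.\<close>
  define D where "D = (\<lambda>p. gmul (fst p) (cscale J (snd p) (x j))) ` ({z. Psi q z \<le> 2} \<times> sphere 0 1)"
  have "compact D" unfolding D_def
    by (intro compact_continuous_image compact_Times Psi_compact q compact_sphere gmul_continuous cscale_continuous continuous_intros)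
  from compact_imp_bounded[OF this] obtain R0 where R0: "\<forall>z\<in>D. norm z \<le> R0" unfolding bounded_iff by blast
  define R where "R = max R0 0"
  have R: "R \<ge> 0" "D \<subseteq> cball 0 R" using R0 by (auto simp: R_def)
  obtain C where C: "C > 0" "\<And>f z. holo J f \<Longrightarrow> sq M f \<Longrightarrow> z \<in> cball 0 R \<Longrightarrow> cmod (f z) \<le> C * L2norm M f"
    using evaluation_bound[OF R(1)] by blast
  have P2: "sq M (\<lambda>z. complex_of_real (Psi q z))"
  proof -
    have "inLp M 2 (\<lambda>z. complex_of_real (Psi q z))"
    proof (rule growth_inLp[of _ _ "2 * q * fact m"])
      show "continuous_on UNIV (\<lambda>z. complex_of_real (Psi q z))"
        by (intro continuous_intros smooth_continuous[OF Psi_smooth])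
      fix r :: real and z assume r: "r \<ge> 1"
      have "Psi q (dil J V m (of_real r) z) = 1 + r ^ (2 * q * fact m) * (Psi q z - 1)"
        using Psi_dil[of r q z] r by simp
      also have "\<dots> \<le> r ^ (2 * q * fact m) * Psi q z" using one_le_power[OF r, of "2 * q * fact m"] by (simp add: algebra_simps)
      finally show "cmod (complex_of_real (Psi q (dil J V m (of_real r) z))) \<le> r ^ (2 * q * fact m) * cmod (complex_of_real (Psi q z))"
        using Psi_ge_1[of q z] Psi_ge_1[of q "dil J V m (of_real r) z"] by simp
    qed simp
    then show ?thesis by (simp add: inLp_2)
  qed
  have "L2norm M (X j h) \<le> (C * L2norm M (\<lambda>z. complex_of_real (Psi q z))) * L2norm M h" if h: "h \<in> hom_poly J V m k" for h
  proof -
    have hh: "holo J h" by (rule hom_polyD(1)[OF h])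
    define B where "B = C * L2norm M h"
    have B0: "B \<ge> 0" using C(1) by (simp add: B_def)
    have loc: "cmod (X j h z) \<le> B" if z: "Psi q z \<le> 2" for z
    proof -
      have "cmod (2 * pi * X j h z) \<le> B * (2 * pi - 0)"
        unfolding integral_unique[OF Cauchy_lvf[OF hh], symmetric]
      proof (rule integral_bound)
        show "continuous_on {0..2 * pi} (\<lambda>t. h (gmul z (cscale J (cis t) (x j))) * cis (- t))"
          by (intro continuous_intros continuous_on_compose2[OF holo_continuous[OF hh]] gmul_continuous cscale_continuous) auto
        fix t
        have "gmul z (cscale J (cis t) (x j)) \<in> D"
          unfolding D_def using z by (intro image_eqI[of _ _ "(z, cis t)"]) auto
        then have "cmod (h (gmul z (cscale J (cis t) (x j)))) \<le> B"
          unfolding B_def using R(2) by (intro C(2)[OF hh hom_poly_sq[OF h]]) blast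
        then show "cmod (h (gmul z (cscale J (cis t) (x j))) * cis (- t)) \<le> B" by (simp add: norm_mult)
      qed simp
      then show ?thesis by (simp add: norm_mult)
    qed
    have "cmod (X j h z) \<le> B * Psi q z" for z
    proof (rule hom_bound[OF holo_continuous[OF holo_lvf[OF hh]] q kq _ loc])
      fix r :: real and z assume r: "r \<ge> 1"
      have "cmod (of_real r * X j h (dil J V m (of_real r) z)) = cmod (of_real r ^ k * X j h z)"
        using r by (subst hom_poly_lvf[OF h xV[OF j]]) auto
      then have "r * cmod (X j h (dil J V m (of_real r) z)) = r ^ k * cmod (X j h z)" using r by (simp add: norm_mult norm_power)
      moreover have "1 * cmod (X j h (dil J V m (of_real r) z)) \<le> r * cmod (X j h (dil J V m (of_real r) z))"
        using r by (intro mult_right_mono) auto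
      ultimately show "cmod (X j h (dil J V m (of_real r) z)) \<le> r ^ k * cmod (X j h z)" by simp
    qed
    then have bd: "(cmod (X j h z))\<^sup>2 \<le> B\<^sup>2 * (cmod (complex_of_real (Psi q z)))\<^sup>2" for z
      unfolding power_mult_distrib[symmetric] using Psi_ge_1[of q z] by (intro power_mono) auto
    have "(L2norm M (X j h))\<^sup>2 \<le> (\<integral>z. B\<^sup>2 * (cmod (complex_of_real (Psi q z)))\<^sup>2 \<partial>M)"
      unfolding L2norm_sq using hom_poly_X_sq[OF h j] P2
      by (intro integral_mono bd integrable_mult_right) (auto simp: sq_def)
    also have "\<dots> = (B * L2norm M (\<lambda>z. complex_of_real (Psi q z)))\<^sup>2"
      by (simp only: power_mult_distrib L2norm_sq integral_mult_right_zero)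
    finally have "L2norm M (X j h) \<le> B * L2norm M (\<lambda>z. complex_of_real (Psi q z))"
      using B0 by (rule power2_le_imp_le[OF _ mult_nonneg_nonneg]) simp
    then show ?thesis by (simp add: B_def ac_simps)
  qed
  then show ?thesis by blast
qed

text \<open>For fixed \<open>f\<close> the form is a bounded antilinear functional of the second
  argument on the complete space of polynomials of degree \<open>k\<close>.\<close>

lemma hom_poly_Riesz:
  assumes f: "f \<in> hom_poly J V m k"
  shows "\<exists>g\<in>hom_poly J V m k. \<forall>h\<in>hom_poly J V m k. Qh f h = L2ip M g h"
proof -
  have "\<exists>C. \<forall>j<n. \<forall>h\<in>hom_poly J V m k. L2norm M (X j h) \<le> C j * L2norm M h"
  proof -
    have "\<forall>j. \<exists>C. j < n \<longrightarrow> (\<forall>h\<in>hom_poly J V m k. L2norm M (X j h) \<le> C * L2norm M h)"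
      using hom_poly_X_bounded by blast
    from choice[OF this] show ?thesis by blast
  qed
  then obtain C where C: "\<And>j h. j < n \<Longrightarrow> h \<in> hom_poly J V m k \<Longrightarrow> L2norm M (X j h) \<le> C j * L2norm M h" by blast
  show ?thesis
  proof (rule Riesz_subspace[where C="2 * (\<Sum>j<n. L2norm M (X j f) * C j)"])
    show "sq M h" if "h \<in> hom_poly J V m k" for h by (rule hom_poly_sq[OF that])
    show "(\<lambda>z. 0) \<in> hom_poly J V m k" by (rule hom_poly_0)
    show "(\<lambda>z. f z + c * g z) \<in> hom_poly J V m k" if "f \<in> hom_poly J V m k" "g \<in> hom_poly J V m k" for f g c
      by (rule hom_poly_lin[OF that])
    show "\<exists>G\<in>hom_poly J V m k. (\<lambda>i. L2norm M (\<lambda>z. F i z - G z)) \<longlonglongrightarrow> 0"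
      if "\<And>i. F i \<in> hom_poly J V m k" "\<And>e. e > 0 \<Longrightarrow> \<exists>K. \<forall>i\<ge>K. \<forall>j\<ge>K. L2norm M (\<lambda>z. F i z - F j z) < e" for F
      by (rule hom_poly_complete[OF that])
    show "Qh f (\<lambda>z. u z + c * v z) = Qh f u + cnj c * Qh f v" if "u \<in> hom_poly J V m k" "v \<in> hom_poly J V m k" for u v c
      by (rule Qh_lin_right[OF hom_poly_HD[OF that(1)] hom_poly_HD[OF that(2)] hom_poly_HD[OF f]])
    fix h assume h: "h \<in> hom_poly J V m k"
    have "cmod (Qh f h) \<le> 2 * (\<Sum>j<n. cmod (L2ip M (X j f) (X j h)))"
      unfolding Qh_def norm_mult using norm_sum[of "\<lambda>j. L2ip M (X j f) (X j h)" "{..<n}"] by simp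
    also have "\<dots> \<le> 2 * (\<Sum>j<n. L2norm M (X j f) * (C j * L2norm M h))"
    proof (intro mult_left_mono sum_mono)
      fix j assume "j \<in> {..<n}"
      then have j: "j < n" by simp
      have "cmod (L2ip M (X j f) (X j h)) \<le> L2norm M (X j f) * L2norm M (X j h)"
        by (rule L2_Cauchy_Schwarz[OF hom_poly_X_sq[OF f j] hom_poly_X_sq[OF h j]])
      also have "\<dots> \<le> L2norm M (X j f) * (C j * L2norm M h)" by (intro mult_left_mono C j h) simp
      finally show "cmod (L2ip M (X j f) (X j h)) \<le> L2norm M (X j f) * (C j * L2norm M h)" .
    qed simp
    also have "\<dots> = 2 * (\<Sum>j<n. L2norm M (X j f) * C j) * L2norm M h" by (simp add: sum_distrib_right mult.assoc)
    finally show "cmod (Qh f h) \<le> 2 * (\<Sum>j<n. L2norm M (X j f) * C j) * L2norm M h" .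
  qed
qed

text \<open>Each \<open>X j f\<close> is homogeneous of one degree less and pairs only with the
  component of that degree in \<open>X j h\<close>, which is the derivative of
  \<open>tay k h\<close>. For \<open>k = 0\<close> all terms vanish since \<open>f\<close> is
  constant.\<close>

lemma Qh_projection:
  assumes f: "f \<in> hom_poly J V m k" and h: "h \<in> HD" shows "Qh f h = Qh f (tay k h)"
proof -
  have hh: "holo J h" by (rule HDD(1)[OF h])
  have "L2ip M (X j f) (X j h) = L2ip M (X j f) (X j (tay k h))" if j: "j < n" for j
  proof (cases k)
    case 0
    then show ?thesis using hom_poly_lvf_0[of f "x j"] f by simp
  next
    case (Suc i)
    have Xf: "X j f \<in> hom_poly J V m i" by (rule hom_poly_lvf_Suc[OF f[unfolded Suc] xV[OF j]])
    have "X j (tay k h) = tay i (X j h)" unfolding Suc by (rule ext) (rule lvf_tay(1)[OF hh xV[OF j]])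
    then have "L2ip M (X j (tay k h)) (X j f) = L2ip M (X j h) (X j f)"
      using tay_projection[OF holo_lvf[OF hh] HDD(3)[OF h j] Xf] by simp
    then have "cnj (L2ip M (X j (tay k h)) (X j f)) = cnj (L2ip M (X j h) (X j f))" by simp
    then show ?thesis by (simp only: L2ip_cnj)
  qed
  then show ?thesis by (simp add: Qh_def)
qed

lemma L2ip_projection:
  assumes g: "g \<in> hom_poly J V m k" and h: "holo J h" "sq M h" shows "L2ip M g h = L2ip M g (tay k h)"
proof -
  have "cnj (L2ip M (tay k h) g) = cnj (L2ip M h g)" using tay_projection[OF h g] by simp
  then show ?thesis by (simp only: L2ip_cnj)
qed

text \<open>The graph of \<open>B\<close> as a relation. Linearity and compatibility with components
  are shown for it, before a value is selected by \<open>SOME\<close>.\<close>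

definition rep :: "('g \<Rightarrow> complex) \<Rightarrow> ('g \<Rightarrow> complex) \<Rightarrow> bool" where
  "rep f g \<longleftrightarrow> holo J g \<and> sq M g \<and> (\<forall>h\<in>HD. Qh f h = L2ip M g h)"

text \<open>Both sides of the defining identity see only the component of degree \<open>k\<close> of
  the test function, so a representation on that degree holds on the whole form domain.\<close>

lemma rep_hom_poly: assumes f: "f \<in> hom_poly J V m k" shows "\<exists>g. rep f g"
proof -
  obtain g where g: "g \<in> hom_poly J V m k" "\<And>h. h \<in> hom_poly J V m k \<Longrightarrow> Qh f h = L2ip M g h"
    using hom_poly_Riesz[OF f] by blast
  have "Qh f h = L2ip M g h" if h: "h \<in> HD" for h
    using Qh_projection[OF f h] g(2)[OF tay_hom_poly[OF HDD(1)[OF h]]] L2ip_projection[OF g(1) HDD(1,2)[OF h]] by simp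
  then show ?thesis unfolding rep_def using hom_polyD(1)[OF g(1)] hom_poly_sq[OF g(1)] by blast
qed

lemma rep_lin:
  assumes "rep f u" "rep g v" "f \<in> HD" "g \<in> HD" shows "rep (\<lambda>z. f z + c * g z) (\<lambda>z. u z + c * v z)"
  using assms unfolding rep_def
  by (auto simp: Qh_lin_left L2ip_add_left HDD holo_add holo_cmult sq_add)

lemma rep_sum:
  assumes "\<And>i. i \<in> I \<Longrightarrow> rep (f i) (g i)" "\<And>i. i \<in> I \<Longrightarrow> f i \<in> HD"
  shows "rep (\<lambda>z. \<Sum>i\<in>I. f i z) (\<lambda>z. \<Sum>i\<in>I. g i z)"
proof -
  have rep0: "rep (\<lambda>z. 0) (\<lambda>z. 0)"
    by (simp add: rep_def holo_const sq_0 Qh_def lvf_def L2ip_def)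
  show ?thesis using assms
  proof (induction I rule: infinite_finite_induct)
    case (insert i I)
    then show ?case
      using rep_lin[of "f i" "g i" "\<lambda>z. \<Sum>i\<in>I. f i z" "\<lambda>z. \<Sum>i\<in>I. g i z" 1] by (simp add: HD_sum)
  qed (auto simp: rep0)
qed

lemma rep_poly_span: assumes "f \<in> poly_span J V m" shows "\<exists>g. rep f g"
proof -
  obtain K c where c: "\<forall>k<K. c k \<in> hom_poly J V m k" "f = (\<lambda>z. \<Sum>k<K. c k z)"
    using assms by (rule poly_spanE)
  have "\<forall>k. \<exists>g. k < K \<longrightarrow> rep (c k) g" using rep_hom_poly c(1) by blast
  from choice[OF this] obtain g where g: "\<And>k. k < K \<Longrightarrow> rep (c k) (g k)" by blast
  have "rep f (\<lambda>z. \<Sum>k<K. g k z)"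
    unfolding c(2) using g c(1) hom_poly_HD by (intro rep_sum) auto
  then show ?thesis by blast
qed

text \<open>The difference of two representatives is orthogonal to its own partial sums and so has
  norm zero. The evaluation bound makes it vanish at every point, as needed for equality of
  functions.\<close>

lemma rep_unique:
  assumes "rep f g" "rep f g'" shows "g z = g' z"
proof -
  define u where "u z = g z - g' z" for z
  have g: "holo J g" "sq M g" "holo J g'" "sq M g'" using assms by (auto simp: rep_def)
  have u: "holo J u" "sq M u" unfolding u_def by (auto intro: holo_diff sq_diff g)
  have orth: "L2ip M u h = 0" if h: "h \<in> HD" for h
    unfolding u_def L2ip_diff_left[OF g(2,4) HDD(2)[OF h]] using assms h by (simp add: rep_def)
  have "(\<lambda>K. L2norm M (\<lambda>z. S K u z - u z)) \<longlonglongrightarrow> 0"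
    using L2_expansion[OF u] by (simp only: L2norm_minus_commute[of M u])
  then have "(\<lambda>K. L2ip M u (S K u)) \<longlonglongrightarrow> L2ip M u u"
    by (intro L2_ip_tendsto u S_sq) simp_all
  then have "(\<lambda>K::nat. 0) \<longlonglongrightarrow> L2ip M u u" by (simp only: orth[OF S_HD[OF u(1)]])
  then have "0 = L2ip M u u" by (simp only: LIMSEQ_const_iff)
  then have "L2norm M u = 0" by (simp add: L2ip_self)
  moreover obtain C where "C > 0" "\<And>f w. holo J f \<Longrightarrow> sq M f \<Longrightarrow> w \<in> cball 0 (norm z) \<Longrightarrow> cmod (f w) \<le> C * L2norm M f"
    using evaluation_bound[of "norm z"] by auto
  ultimately have "cmod (u z) \<le> 0" using u by fastforce
  then show ?thesis by (simp add: u_def)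
qed

text \<open>\<open>B\<close> commutes with taking components: the projection is moved to the test
  function, across the form by its symmetry, and back again on the side of the inner
  product.\<close>

lemma rep_tay:
  assumes f: "f \<in> HD" and r: "rep f g" shows "rep (tay k f) (tay k g)"
  unfolding rep_def
proof (intro conjI ballI)
  have g: "holo J g" "sq M g" using r by (auto simp: rep_def)
  show "holo J (tay k g)" "sq M (tay k g)" using tay_holo[OF g(1)] tay_sq[OF g(1)] by auto
  fix h assume h: "h \<in> HD"
  have hh: "holo J h" "sq M h" using HDD h by auto
  have tf: "tay k f \<in> hom_poly J V m k" and th: "tay k h \<in> hom_poly J V m k" and tg: "tay k g \<in> hom_poly J V m k"
    using tay_hom_poly HDD(1)[OF f] hh g by auto
  have "Qh (tay k f) h = Qh (tay k f) (tay k h)" by (rule Qh_projection[OF tf h])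
  also have "\<dots> = cnj (Qh (tay k h) (tay k f))" by (simp only: Qh_cnj)
  also have "Qh (tay k h) (tay k f) = Qh (tay k h) f" by (rule Qh_projection[OF th f, symmetric])
  also have "cnj (Qh (tay k h) f) = Qh f (tay k h)" by (simp only: Qh_cnj)
  also have "\<dots> = L2ip M g (tay k h)" using r hom_poly_HD[OF th] by (simp add: rep_def)
  also have "\<dots> = L2ip M (tay k g) (tay k h)" by (rule tay_projection[OF g th, symmetric])
  also have "\<dots> = L2ip M (tay k g) h" by (rule L2ip_projection[OF tg hh, symmetric])
  finally show "Qh (tay k f) h = L2ip M (tay k g) h" .
qed

section \<open>The domain and a core of the operator\<close>

abbreviation DB :: "('g \<Rightarrow> complex) set" where
  "DB \<equiv> assoc_dom M (Qform gmul J x n \<rho> a) (HDQ gmul J x n \<rho> a) (HL2 J \<rho> a)"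

abbreviation B :: "('g \<Rightarrow> complex) \<Rightarrow> 'g \<Rightarrow> complex" where
  "B \<equiv> assoc_op M (Qform gmul J x n \<rho> a) (HDQ gmul J x n \<rho> a) (HL2 J \<rho> a)"

lemma rep_iff: assumes "f \<in> HD"
  shows "rep f g \<longleftrightarrow> g \<in> HL2 J \<rho> a \<and> (\<forall>h\<in>HDQ gmul J x n \<rho> a. Qform gmul J x n \<rho> a f h = L2ip M g h)"
proof -
  have "HDQ gmul J x n \<rho> a = HD" by (simp add: HDQ_def HD_eq)
  then show ?thesis unfolding rep_def HL2_def using Qform_HD[OF assms] by (auto simp: inLp_2)
qed

lemma DB_iff: "f \<in> DB \<longleftrightarrow> f \<in> HD \<and> (\<exists>g. rep f g)"
proof -
  have "HDQ gmul J x n \<rho> a = HD" by (simp add: HDQ_def HD_eq)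
  then show ?thesis unfolding assoc_dom_def using rep_iff by auto
qed

lemma rep_B: assumes "f \<in> DB" shows "rep f (B f)"
proof -
  have f: "f \<in> HD" and ex: "\<exists>g. rep f g" using assms by (auto simp: DB_iff)
  have "\<exists>g. g \<in> HL2 J \<rho> a \<and> (\<forall>h\<in>HDQ gmul J x n \<rho> a. Qform gmul J x n \<rho> a f h = L2ip M g h)"
    using ex unfolding rep_iff[OF f] .
  from someI_ex[OF this] show ?thesis unfolding rep_iff[OF f] assoc_op_def .
qed

text \<open>As \<open>B\<close> maps the partial sum of \<open>f\<close> to the partial sum of
  \<open>B f\<close>, both terms of the graph norm are remainders of expansions in the Hilbert
  space.\<close>

lemma B_core:
  assumes f: "f \<in> DB" and e: "e > 0"
  shows "\<exists>q\<in>poly_span J V m. L2norm M (\<lambda>z. f z - q z) + L2norm M (\<lambda>z. B f z - B q z) < e"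
proof -
  have fHD: "f \<in> HD" using f by (simp add: DB_iff)
  have r: "rep f (B f)" by (rule rep_B[OF f])
  have g: "holo J (B f)" "sq M (B f)" using r by (auto simp: rep_def)
  have fh: "holo J f" "sq M f" using HDD fHD by auto
  have "(\<lambda>K. L2norm M (\<lambda>z. f z - S K f z) + L2norm M (\<lambda>z. B f z - S K (B f) z)) \<longlonglongrightarrow> 0 + 0"
    by (intro tendsto_add L2_expansion fh g)
  then have "\<forall>\<^sub>F K in sequentially. L2norm M (\<lambda>z. f z - S K f z) + L2norm M (\<lambda>z. B f z - S K (B f) z) < e"
    using e by (intro order_tendstoD(2)) auto
  then obtain K where K: "L2norm M (\<lambda>z. f z - S K f z) + L2norm M (\<lambda>z. B f z - S K (B f) z) < e"
    unfolding eventually_sequentially by blast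
  have S1: "rep (S K f) (S K (B f))"
    by (intro rep_sum rep_tay fHD r hom_poly_HD[OF tay_hom_poly[OF fh(1)]])
  then have "S K f \<in> DB" using S_HD[OF fh(1)] by (auto simp: DB_iff)
  from rep_B[OF this] have "B (S K f) = S K (B f)" using rep_unique[OF _ S1] by (intro ext) blast
  then show ?thesis using K S_poly[OF fh(1)] by (intro bexI[of _ "S K f"]) auto
qed

lemma poly_span_DB: "poly_span J V m \<subseteq> DB"
  using rep_poly_span poly_span_HD by (auto simp: DB_iff)

lemma Lp_dense:
  assumes p: "1 \<le> p" and f: "holo J f" "inLp M p f" and e: "e > 0"
  shows "\<exists>q\<in>poly_span J V m. Lp_dist M p f q < e"
proof -
  have "\<forall>\<^sub>F K in sequentially. (\<integral>z. cmod (fejer_mean (Suc K) f z - f z) powr p \<partial>M) < e powr p"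
    using fejer_mean_converges[OF f(1) p f(2)] e by (intro order_tendstoD(2)) auto
  then obtain K where K: "(\<integral>z. cmod (fejer_mean (Suc K) f z - f z) powr p \<partial>M) < e powr p"
    unfolding eventually_sequentially by blast
  have "Lp_dist M p f (fejer_mean (Suc K) f) = (\<integral>z. cmod (fejer_mean (Suc K) f z - f z) powr p \<partial>M) powr (1 / p)"
    by (simp add: Lp_dist_def norm_minus_commute)
  also have "\<dots> < (e powr p) powr (1 / p)"
    using K p by (intro powr_less_mono2) (auto intro!: integral_nonneg_AE)
  also have "\<dots> = e" using p e by (simp add: powr_powr)
  finally show ?thesis using fejer_mean_poly[OF f(1)] by blast
qed

end

theorem theorem4p2:
  fixes J :: "'g::euclidean_space \<Rightarrow> 'g"
    and br :: "'g \<Rightarrow> 'g \<Rightarrow> 'g"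
    and V :: "nat \<Rightarrow> 'g set"
    and m :: nat
    and gmul :: "'g \<Rightarrow> 'g \<Rightarrow> 'g"
    and h :: "('g \<Rightarrow> real) \<Rightarrow> ('g \<Rightarrow> real) \<Rightarrow> real"
    and x :: "nat \<Rightarrow> 'g"
    and n :: nat
    and \<rho> :: "real \<Rightarrow> 'g \<Rightarrow> real"
    and a :: real
  assumes strat: "stratified J br V m"
    and grp: "exp_identified_group br gmul"
    and cometr: "cometric J (V 1) h"
    and onb: "horizontal_onb J (V 1) h x n"
    and heat: "heat_kernel gmul J x n \<rho>"
    and apos: "a > 0"
  defines "M \<equiv> heat_meas \<rho> a"
    and "Hol \<equiv> {f. holo J f}"
    and "Pk \<equiv> hom_poly J V m"
    and "P \<equiv> poly_span J V m"
    and "L2 \<equiv> {f. inLp (heat_meas \<rho> a) 2 f}"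
    and "DQ \<equiv> Qdom gmul J x n \<rho> a"
    and "Q \<equiv> Qform gmul J x n \<rho> a"
    and "DB \<equiv> assoc_dom (heat_meas \<rho> a) (Qform gmul J x n \<rho> a) (HDQ gmul J x n \<rho> a) (HL2 J \<rho> a)"
    and "B \<equiv> assoc_op (heat_meas \<rho> a) (Qform gmul J x n \<rho> a) (HDQ gmul J x n \<rho> a) (HL2 J \<rho> a)"
  shows
    \<comment> \<open>(a) P is dense in H \<inter> L^p(rho_a), 1 <= p < infinity\<close>
    "(\<forall>p::real. 1 \<le> p \<longrightarrow>
        P \<subseteq> {f. inLp M p f}
        \<and> (\<forall>f\<in>Hol. inLp M p f \<longrightarrow> (\<forall>e>0. \<exists>q\<in>P. Lp_dist M p f q < e)))
     \<comment> \<open>(b) P \<subseteq> D(Q), P is a core for Q restricted to H, Q|H densely defined\<close>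
     \<and> P \<subseteq> DQ
     \<and> (\<forall>f\<in>DQ \<inter> Hol. \<forall>e>0. \<exists>q\<in>P. energy_norm M Q (\<lambda>z. f z - q z) < e)
     \<and> (\<forall>f\<in>Hol \<inter> L2. \<forall>e>0. \<exists>g\<in>DQ \<inter> Hol. L2norm M (\<lambda>z. f z - g z) < e)
     \<comment> \<open>(c) P_j orthogonal to P_k (j \<noteq> k) in L^2(rho_a) and in the energy inner product\<close>
     \<and> (\<forall>j k f g. j \<noteq> k \<longrightarrow> f \<in> Pk j \<longrightarrow> g \<in> Pk k \<longrightarrow>
           L2ip M f g = 0 \<and> L2ip M f g + Q f g = 0)
     \<comment> \<open>(d) H \<inter> L^2(rho_a) is the Hilbert direct sum of the P_k (in L^2)\<close>
     \<and> (\<forall>k. Pk k \<subseteq> Hol \<inter> L2)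
     \<and> (\<forall>f\<in>Hol \<inter> L2. \<exists>c. (\<forall>k. c k \<in> Pk k)
           \<and> (\<lambda>N. L2norm M (\<lambda>z. f z - (\<Sum>k<N. c k z))) \<longlonglongrightarrow> 0)
     \<and> (\<forall>c. (\<forall>k. c k \<in> Pk k) \<longrightarrow> summable (\<lambda>k. (L2norm M (c k))\<^sup>2) \<longrightarrow>
           (\<exists>f\<in>Hol \<inter> L2. (\<lambda>N. L2norm M (\<lambda>z. f z - (\<Sum>k<N. c k z))) \<longlonglongrightarrow> 0))
     \<comment> \<open>(e) H \<inter> D(Q) is the Hilbert direct sum of the P_k (in energy norm)\<close>
     \<and> (\<forall>k. Pk k \<subseteq> Hol \<inter> DQ)
     \<and> (\<forall>f\<in>Hol \<inter> DQ. \<exists>c. (\<forall>k. c k \<in> Pk k)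
           \<and> (\<lambda>N. energy_norm M Q (\<lambda>z. f z - (\<Sum>k<N. c k z))) \<longlonglongrightarrow> 0)
     \<and> (\<forall>c. (\<forall>k. c k \<in> Pk k) \<longrightarrow> summable (\<lambda>k. (energy_norm M Q (c k))\<^sup>2) \<longrightarrow>
           (\<exists>f\<in>Hol \<inter> DQ. (\<lambda>N. energy_norm M Q (\<lambda>z. f z - (\<Sum>k<N. c k z))) \<longlonglongrightarrow> 0))
     \<comment> \<open>(f) P \<subseteq> D(B) and P is a core for B\<close>
     \<and> P \<subseteq> DB
     \<and> (\<forall>f\<in>DB. \<forall>e>0. \<exists>q\<in>P.
           L2norm M (\<lambda>z. f z - q z) + L2norm M (\<lambda>z. B f z - B q z) < e)"
proof -
  interpret heat_group J br V m gmul x n \<rho> a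
    using strat grp heat apos onb by unfold_locales (auto simp: horizontal_onb_def)
  have HD: "DQ \<inter> Hol = HD" "Hol \<inter> DQ = HD" unfolding DQ_def Hol_def HD_eq by auto
  have L2: "L2 = {f. sq M f}" unfolding L2_def M_def by (simp add: inLp_2)
  have HL2: "f \<in> Hol \<inter> L2 \<longleftrightarrow> holo J f \<and> sq M f" for f unfolding L2 by (simp add: Hol_def)
  have a: "\<forall>p::real. 1 \<le> p \<longrightarrow> P \<subseteq> {f. inLp M p f} \<and> (\<forall>f\<in>Hol. inLp M p f \<longrightarrow> (\<forall>e>0. \<exists>q\<in>P. Lp_dist M p f q < e))"
    unfolding P_def Hol_def M_def using poly_span_inLp Lp_dense by auto
  have P_HD: "P \<subseteq> HD" unfolding P_def using poly_span_HD by auto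
  have b1: "P \<subseteq> DQ" using P_HD HD(1) by blast
  have en: "(\<lambda>K. energy_norm M Q (\<lambda>z. f z - S K f z)) \<longlonglongrightarrow> 0" if "f \<in> HD" for f
    unfolding Q_def M_def by (rule energy_expansion[OF that])
  have SP: "S K f \<in> P" if "holo J f" for K f unfolding P_def by (rule S_poly[OF that])
  have b2: "\<exists>q\<in>P. energy_norm M Q (\<lambda>z. f z - q z) < e" if f: "f \<in> HD" and e: "e > 0" for f e
  proof -
    have "\<forall>\<^sub>F K in sequentially. energy_norm M Q (\<lambda>z. f z - S K f z) < e"
      by (rule order_tendstoD(2)[OF en[OF f] e])
    then obtain K where "energy_norm M Q (\<lambda>z. f z - S K f z) < e" unfolding eventually_sequentially by blast
    then show ?thesis by (rule bexI[of _ "S K f"]) (rule SP[OF HDD(1)[OF f]])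
  qed
  have le: "(\<lambda>K. L2norm M (\<lambda>z. f z - S K f z)) \<longlonglongrightarrow> 0" if "f \<in> Hol \<inter> L2" for f
    using that unfolding HL2 M_def by (intro L2_expansion) auto
  have b3: "\<exists>g\<in>HD. L2norm M (\<lambda>z. f z - g z) < e" if f: "f \<in> Hol \<inter> L2" and e: "e > 0" for f e
  proof -
    have "\<forall>\<^sub>F K in sequentially. L2norm M (\<lambda>z. f z - S K f z) < e" by (rule order_tendstoD(2)[OF le[OF f] e])
    then obtain K where "L2norm M (\<lambda>z. f z - S K f z) < e" unfolding eventually_sequentially by blast
    moreover have "S K f \<in> HD" using f S_HD by (auto simp: Hol_def)
    ultimately show ?thesis by (rule bexI[of _ "S K f"])
  qed
  have c: "L2ip M f g = 0 \<and> L2ip M f g + Q f g = 0" if jk: "j \<noteq> k" and f: "f \<in> Pk j" and g: "g \<in> Pk k" for j k f g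
  proof -
    have f': "f \<in> hom_poly J V m j" and g': "g \<in> hom_poly J V m k" using f g by (auto simp: Pk_def)
    have "Q f g = 0"
      unfolding Q_def Qform_HD[OF hom_poly_HD[OF f'] hom_poly_HD[OF g']] Qh_def
      using Qh_orthogonal[OF f' g' jk] by simp
    then show ?thesis using hom_poly_orthogonal[OF f' g' jk] by (simp add: M_def)
  qed
  have d1: "Pk k \<subseteq> Hol \<inter> L2" for k
  proof
    fix f assume "f \<in> Pk k"
    then show "f \<in> Hol \<inter> L2"
      unfolding HL2 M_def using hom_polyD(1)[of f k] hom_poly_sq[of f k] by (simp add: Pk_def)
  qed
  have d2: "\<exists>c. (\<forall>k. c k \<in> Pk k) \<and> (\<lambda>N. L2norm M (\<lambda>z. f z - (\<Sum>k<N. c k z))) \<longlonglongrightarrow> 0" if f: "f \<in> Hol \<inter> L2" for f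
    using le[OF f] f tay_hom_poly by (intro exI[of _ "\<lambda>k. tay k f"]) (auto simp: Pk_def Hol_def)
  have d3: "\<exists>f\<in>Hol \<inter> L2. (\<lambda>N. L2norm M (\<lambda>z. f z - (\<Sum>k<N. c k z))) \<longlonglongrightarrow> 0"
    if ck: "\<forall>k. c k \<in> Pk k" and sm: "summable (\<lambda>k. (L2norm M (c k))\<^sup>2)" for c
  proof -
    have ck': "c k \<in> hom_poly J V m k" for k using ck by (simp add: Pk_def)
    obtain f where f: "holo J f" "sq M f" "(\<lambda>K. L2norm M (\<lambda>z. (\<Sum>k<K. c k z) - f z)) \<longlonglongrightarrow> 0"
      using L2_sum_complete[OF ck' sm[unfolded M_def]] unfolding M_def .
    show ?thesis
    proof (rule bexI[of _ f])
      show "(\<lambda>N. L2norm M (\<lambda>z. f z - (\<Sum>k<N. c k z))) \<longlonglongrightarrow> 0"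
        using f(3) by (simp only: L2norm_minus_commute[of M f])
      show "f \<in> Hol \<inter> L2" using f by (simp only: HL2 simp_thms)
    qed
  qed
  have e1: "Pk k \<subseteq> HD" for k unfolding Pk_def by (intro subsetI hom_poly_HD)
  have e2: "\<exists>c. (\<forall>k. c k \<in> Pk k) \<and> (\<lambda>N. energy_norm M Q (\<lambda>z. f z - (\<Sum>k<N. c k z))) \<longlonglongrightarrow> 0" if f: "f \<in> HD" for f
    using en[OF f] tay_hom_poly[OF HDD(1)[OF f]] by (intro exI[of _ "\<lambda>k. tay k f"]) (auto simp: Pk_def)
  have e3: "\<exists>f\<in>HD. (\<lambda>N. energy_norm M Q (\<lambda>z. f z - (\<Sum>k<N. c k z))) \<longlonglongrightarrow> 0"
    if ck: "\<forall>k. c k \<in> Pk k" and sm: "summable (\<lambda>k. (energy_norm M Q (c k))\<^sup>2)" for c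
  proof -
    have ck': "c k \<in> hom_poly J V m k" for k using ck by (simp add: Pk_def)
    show ?thesis using energy_sum_complete[OF ck' sm[unfolded M_def Q_def]] unfolding M_def Q_def .
  qed
  have f1: "P \<subseteq> DB" unfolding P_def DB_def by (rule poly_span_DB)
  have f2: "\<exists>q\<in>P. L2norm M (\<lambda>z. f z - q z) + L2norm M (\<lambda>z. B f z - B q z) < e" if "f \<in> DB" "e > 0" for f e
    using B_core[OF that(1)[unfolded DB_def] that(2)] unfolding P_def B_def M_def .
  show ?thesis unfolding HD
    by (rule conjI[OF a], rule conjI[OF b1], rule conjI, intro ballI allI impI, erule b2, assumption,
        rule conjI, intro ballI allI impI, erule b3, assumption,
        rule conjI, intro allI impI, rule c, assumption, assumption, assumption,
        rule conjI, rule allI, rule d1, rule conjI, rule ballI, erule d2,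
        rule conjI, intro allI impI, erule d3, assumption,
        rule conjI, rule allI, rule e1, rule conjI, rule ballI, erule e2,
        rule conjI, intro allI impI, erule e3, assumption,
        rule conjI[OF f1], intro ballI allI impI, erule f2, assumption)
qed

end
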